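(* Let $(R,{}^-)$ be a unital associative $\Bbbk$-superalgebra with superinvolution. Then, as $\Bbbk$-modules, $$\mathrm H_2(\mathfrak{osp}_{1|2}(R,{}^-),\Bbbk)\cong{}_{-}\widetilde{\mathrm{HD}}_1(R,{}^-)\oplus R/\mathcal I_3\oplus R/\mathcal I_3.$$
   Context: **Base conventions.** $\Bbbk$ is a unital commutative associative ring in which $2$ is invertible; all modules and (super)algebras are over $\Bbbk$. Superalgebras are $\mathbb{Z}/2\mathbb{Z}$-graded, $|x|$ is the degree of a homogeneous $x$, and formulas involving degrees are for homogeneous elements, extended linearly. A Lie superalgebra is a $\mathbb Z/2\mathbb Z$-graded module with an even bilinear bracket satisfying (only) $[x,y]=-(-1)^{|x||y|}[y,x]$ and $(-1)^{|x||z|}[[x,y],z]+(-1)^{|y||x|}[[y,z],x]+(-1)^{|z||y|}[[z,x],y]=0$; in particular $[[x,x],x]=0$ for odd $x$ is not an extra axiom. A superinvolution on $R$ is a degree-preserving $\Bbbk$-linear map $a\mapsto\bar a$ with $\overline{ab}=(-1)^{|a||b|}\bar b\bar a$, $\bar{\bar a}=a$. In $R$, $[a,b]=ab-(-1)^{|a||b|}ba$. Put $\rho(a)=(-1)^{|a|}a$, $a_+=a+\bar a$. **$\mathfrak{osp}_{1|2}(R,{}^-)$.** Give the algebra of $3\times3$ matrices over $R$ the grading $|e_{ij}(a)|=|i|+|j|+|a|$, $|1|=0$, $|2|=|3|=1$, and the superinvolution $$\begin{pmatrix}a&b_1&c_2\\ c_1&d_{11}&d_{12}\\ b_2&d_{21}&d_{22}\end{pmatrix}^{\mathrm{osp}}=\begin{pmatrix}\overline{a}&-\overline{\rho(b_2)}&\overline{\rho(c_1)}\\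 \overline{\rho(c_2)}&\overline{d_{22}}&-\overline{d_{12}}\\ -\overline{\rho(b_1)}&-\overline{d_{21}}&\overline{d_{11}}\end{pmatrix}.$$ $\mathfrak{osp}_{1|2}(R,{}^-)$ is the derived Lie superalgebra (for the supercommutator) of $\{X: X^{\mathrm{osp}}=-X\}$; it is perfect. **Second homology.** For a Lie superalgebra $L$, $\mathrm H_2(L,\Bbbk)$ is the kernel of the map $(L\otimes_\Bbbk L)/B\to L$, $x\otimes y\mapsto[x,y]$, where $B$ is spanned by $x\otimes y+(-1)^{|x||y|}y\otimes x$ and $(-1)^{|x||z|}[x,y]\otimes z+(-1)^{|y||x|}[y,z]\otimes x+(-1)^{|z||y|}[z,x]\otimes y$ for homogeneous $x,y,z\in L$; for perfect $L$ this is the kernel of the universal central extension of $L$. **Modified skew-dihedral homology.** In $R\otimes_\Bbbk R$ put $J(a,b,c)=(-1)^{|a||c|}ab\otimes c+(-1)^{|b||a|}bc\otimes a+(-1)^{|c||b|}ca\otimes b$. Let $\tilde I_{\mathsf d}^-$ be the $\Bbbk$-submodule of $R\otimes_\Bbbk R$ spanned by (i) $a\otimes1$; (ii) $a\otimes b+(-1)^{|a||b|}b\otimes a$; (iii) $a\otimes b-\bar a\otimes\bar b$; (iv) $J(b,a,c)-(-1)^{|a||b|+|b||c|+|c||a|}J(a,b,c-\bar c)$; (v) $J(a,b,[c,d])+(-1)^{|a||c|+|b||d|}J(c,d,[a,b])$; (vi) $J([a_1,a_2],[b_1,b_2],[c_1,c_2])$, for all homogeneous elements of $R$. Write $\langle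 a,b\rangle_{\tilde{\mathsf d}}^-$ for the class of $a\otimes b$ in $\langle R,R\rangle_{\tilde{\mathsf d}}^-=(R\otimes_\Bbbk R)/\tilde I_{\mathsf d}^-$, and ${}_{-}\widetilde{\mathrm{HD}}_1(R,{}^-)=\{\sum_i\langle a_i,b_i\rangle_{\tilde{\mathsf d}}^-:\ \sum_i[a_i,b_i]=\sum_i\overline{[a_i,b_i]}\}$. **$\mathcal I_3$.** The $\Bbbk$-submodule of $R$ spanned by $3a$, $a-\bar a$, $([a,b]-\overline{[a,b]})c$, $a_+b_+c-(-1)^{|a||b|}b_+a_+c$, and $(-1)^{|a||c|}(a\bar bc+\bar ab\bar c)+(-1)^{|b||a|}(b\bar ca+\bar bc\bar a)+(-1)^{|c||b|}(c\bar ab+\bar ca\bar b)$ for homogeneous $a,b,c\in R$. *)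

theory Defs
  imports "HOL-Analysis.Cartesian_Space" "HOL-Library.Poly_Mapping" "HOL-Library.Z2"
begin

section \<open>Modules with explicit carrier\<close>

text \<open>
  The base ring is a type of class \<open>comm_ring_1\<close>. Tensor products and quotients do not live on a
  whole type, so modules are also represented by a carrier together with their operations.
\<close>

record ('k, 'm) kmod =
  carr :: "'m set"
  madd :: "'m \<Rightarrow> 'm \<Rightarrow> 'm" (infixl \<open>\<oplus>\<index>\<close> 65)
  mzero :: "'m" (\<open>\<zero>\<index>\<close>)
  msmult :: "'k \<Rightarrow> 'm \<Rightarrow> 'm" (infixr \<open>\<odot>\<index>\<close> 75)

definition kmod_of :: "('k \<Rightarrow> 'm \<Rightarrow> 'm) \<Rightarrow> 'm set \<Rightarrow> ('k, 'm::ab_group_add) kmod" where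
  "kmod_of smul A = \<lparr>carr = A, madd = (+), mzero = 0, msmult = smul\<rparr>"

definition submod :: "('k, 'm) kmod \<Rightarrow> 'm set \<Rightarrow> bool" where
  "submod M N \<longleftrightarrow> N \<subseteq> carr M \<and> \<zero>\<^bsub>M\<^esub> \<in> N \<and>
     (\<forall>x\<in>N. \<forall>y\<in>N. x \<oplus>\<^bsub>M\<^esub> y \<in> N) \<and> (\<forall>c. \<forall>x\<in>N. c \<odot>\<^bsub>M\<^esub> x \<in> N)"

definition mspan :: "('k, 'm) kmod \<Rightarrow> 'm set \<Rightarrow> 'm set" where
  "mspan M S = \<Inter>{N. submod M N \<and> S \<subseteq> N}"

definition mcoset :: "('k, 'm) kmod \<Rightarrow> 'm set \<Rightarrow> 'm \<Rightarrow> 'm set" where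
  "mcoset M N x = {x \<oplus>\<^bsub>M\<^esub> n | n. n \<in> N}"

definition quot :: "('k, 'm) kmod \<Rightarrow> 'm set \<Rightarrow> ('k, 'm set) kmod" where
  "quot M N = \<lparr>carr = mcoset M N ` carr M,
     madd = (\<lambda>A B. {a \<oplus>\<^bsub>M\<^esub> b | a b. a \<in> A \<and> b \<in> B}),
     mzero = N,
     msmult = (\<lambda>c A. {(c \<odot>\<^bsub>M\<^esub> a) \<oplus>\<^bsub>M\<^esub> n | a n. a \<in> A \<and> n \<in> N})\<rparr>"

definition mlinear :: "('k, 'm) kmod \<Rightarrow> ('k, 'n) kmod \<Rightarrow> ('m \<Rightarrow> 'n) \<Rightarrow> bool" where
  "mlinear M N f \<longleftrightarrow> f ` carr M \<subseteq> carr N \<and>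
     (\<forall>x\<in>carr M. \<forall>y\<in>carr M. f (x \<oplus>\<^bsub>M\<^esub> y) = f x \<oplus>\<^bsub>N\<^esub> f y) \<and>
     (\<forall>c. \<forall>x\<in>carr M. f (c \<odot>\<^bsub>M\<^esub> x) = c \<odot>\<^bsub>N\<^esub> f x)"

definition mker :: "('k, 'm) kmod \<Rightarrow> ('k, 'n) kmod \<Rightarrow> ('m \<Rightarrow> 'n) \<Rightarrow> ('k, 'm) kmod" where
  "mker M N f = M\<lparr>carr := {x \<in> carr M. f x = \<zero>\<^bsub>N\<^esub>}\<rparr>"

definition miso :: "('k, 'm) kmod \<Rightarrow> ('k, 'n) kmod \<Rightarrow> bool" where
  "miso M N \<longleftrightarrow> (\<exists>f. mlinear M N f \<and> bij_betw f (carr M) (carr N))"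

definition direct_sum :: "('k, 'm) kmod \<Rightarrow> ('k, 'n) kmod \<Rightarrow> ('k, 'm \<times> 'n) kmod" where
  "direct_sum M N = \<lparr>carr = carr M \<times> carr N,
     madd = (\<lambda>(x, y) (x', y'). (x \<oplus>\<^bsub>M\<^esub> x', y \<oplus>\<^bsub>N\<^esub> y')),
     mzero = (\<zero>\<^bsub>M\<^esub>, \<zero>\<^bsub>N\<^esub>),
     msmult = (\<lambda>c (x, y). (c \<odot>\<^bsub>M\<^esub> x, c \<odot>\<^bsub>N\<^esub> y))\<rparr>"

text \<open>The free module on a set of generators; the generator \<open>x\<close> is \<open>Poly_Mapping.single x 1\<close>.\<close>

definition free_mod :: "'x set \<Rightarrow> ('k::comm_ring_1, 'x \<Rightarrow>\<^sub>0 'k) kmod" where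
  "free_mod X = kmod_of (\<lambda>c. Poly_Mapping.map ((*) c)) {f. Poly_Mapping.keys f \<subseteq> X}"

definition bilinear_rels ::
  "('k::comm_ring_1, 'm) kmod \<Rightarrow> ('k, 'n) kmod \<Rightarrow> ('m \<times> 'n \<Rightarrow>\<^sub>0 'k) set" where
  "bilinear_rels M N = mspan (free_mod (carr M \<times> carr N))
     ({Poly_Mapping.single (x \<oplus>\<^bsub>M\<^esub> x', y) 1 - Poly_Mapping.single (x, y) 1
         - Poly_Mapping.single (x', y) 1 | x x' y. x \<in> carr M \<and> x' \<in> carr M \<and> y \<in> carr N} \<union>
      {Poly_Mapping.single (x, y \<oplus>\<^bsub>N\<^esub> y') 1 - Poly_Mapping.single (x, y) 1
         - Poly_Mapping.single (x, y') 1 | x y y'. x \<in> carr M \<and> y \<in> carr N \<and> y' \<in> carr N} \<union>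
      {Poly_Mapping.single (c \<odot>\<^bsub>M\<^esub> x, y) 1 - Poly_Mapping.single (x, y) c
         | c x y. x \<in> carr M \<and> y \<in> carr N} \<union>
      {Poly_Mapping.single (x, c \<odot>\<^bsub>N\<^esub> y) 1 - Poly_Mapping.single (x, y) c
         | c x y. x \<in> carr M \<and> y \<in> carr N})"

definition tensor ::
  "('k::comm_ring_1, 'm) kmod \<Rightarrow> ('k, 'n) kmod \<Rightarrow> ('k, ('m \<times> 'n \<Rightarrow>\<^sub>0 'k) set) kmod" where
  "tensor M N = quot (free_mod (carr M \<times> carr N)) (bilinear_rels M N)"

definition tens ::
  "('k::comm_ring_1, 'm) kmod \<Rightarrow> ('k, 'n) kmod \<Rightarrow> 'm \<Rightarrow> 'n \<Rightarrow> ('m \<times> 'n \<Rightarrow>\<^sub>0 'k) set" where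
  "tens M N x y = mcoset (free_mod (carr M \<times> carr N)) (bilinear_rels M N)
     (Poly_Mapping.single (x, y) 1)"


section \<open>Gradings and superalgebras\<close>

text \<open>
  Degrees are elements of the two-element field \<open>bit\<close>, so that the exponent \<open>|a||b|\<close> of a sign
  is the product \<open>i * j\<close> of the degrees. A grading is a family \<open>G :: bit \<Rightarrow> _ set\<close> of submodules.
\<close>

definition ksign :: "bit \<Rightarrow> 'k::comm_ring_1" where
  "ksign p = (if p = 0 then 1 else - 1)"

text \<open>The degree-\<open>i\<close> component, for a grading with \<open>G 0\<close> and \<open>G 1\<close> complementary.\<close>

definition hcomp :: "(bit \<Rightarrow> 'a set) \<Rightarrow> bit \<Rightarrow> 'a \<Rightarrow> 'a::ab_group_add" where
  "hcomp G i x = (THE y. y \<in> G i \<and> x - y \<in> G (i + 1))"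

definition supercommutator :: "('k::comm_ring_1 \<Rightarrow> 'a \<Rightarrow> 'a) \<Rightarrow> (bit \<Rightarrow> 'a set) \<Rightarrow>
    ('a \<Rightarrow> 'a \<Rightarrow> 'a) \<Rightarrow> 'a \<Rightarrow> 'a \<Rightarrow> 'a::ab_group_add" where
  "supercommutator smul G mult a b = (\<Sum>i\<in>{0, 1}. \<Sum>j\<in>{0, 1}.
     mult (hcomp G i a) (hcomp G j b) - smul (ksign (i * j)) (mult (hcomp G j b) (hcomp G i a)))"

text \<open>
  The sort \<open>{ring, monoid_mult}\<close> is that of unital associative rings; unlike \<open>ring_1\<close> it admits
  the zero ring.
\<close>

locale superalgebra = module scale
  for scale :: "'k::comm_ring_1 \<Rightarrow> 'r::{ring, monoid_mult} \<Rightarrow> 'r" +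
  fixes G :: "bit \<Rightarrow> 'r set"
  assumes scale_mult_left: "scale c (a * b) = scale c a * b"
    and scale_mult_right: "scale c (a * b) = a * scale c b"
    and subspace_G: "subspace (G i)"
    and G_sum: "\<exists>x\<in>G 0. \<exists>y\<in>G 1. a = x + y"
    and G_Int: "G 0 \<inter> G 1 = {0}"
    and G_mult: "a \<in> G i \<Longrightarrow> b \<in> G j \<Longrightarrow> a * b \<in> G (i + j)"

locale superalgebra_with_superinvolution = superalgebra scale G
  for scale :: "'k::comm_ring_1 \<Rightarrow> 'r::{ring, monoid_mult} \<Rightarrow> 'r" and G +
  fixes bar :: "'r \<Rightarrow> 'r"
  assumes bar_linear: "module_hom scale scale bar"
    and bar_G: "a \<in> G i \<Longrightarrow> bar a \<in> G i"
    and bar_mult: "a \<in> G i \<Longrightarrow> b \<in> G j \<Longrightarrow>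
          bar (a * b) = scale (ksign (i * j)) (bar b * bar a)"
    and bar_bar: "bar (bar a) = a"


section \<open>Second homology of a Lie superalgebra\<close>

text \<open>
  A Lie superalgebra is given by its underlying module \<open>L\<close>, the bracket \<open>br\<close> and a grading \<open>G\<close>,
  possibly of a larger module: the homogeneous elements of \<open>L\<close> are those of \<open>G i \<inter> carr L\<close>.
\<close>

definition H2_rels :: "('k::comm_ring_1, 'l) kmod \<Rightarrow> (bit \<Rightarrow> 'l set) \<Rightarrow> ('l \<Rightarrow> 'l \<Rightarrow> 'l) \<Rightarrow>
    ('l \<times> 'l \<Rightarrow>\<^sub>0 'k) set set" where
  "H2_rels L G br =
    (let T = tensor L L; t = tens L L in mspan T
      ({t x y \<oplus>\<^bsub>T\<^esub> ksign (i * j) \<odot>\<^bsub>T\<^esub> t y x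
          | i j x y. x \<in> G i \<inter> carr L \<and> y \<in> G j \<inter> carr L} \<union>
       {ksign (i * k) \<odot>\<^bsub>T\<^esub> t (br x y) z
          \<oplus>\<^bsub>T\<^esub> ksign (j * i) \<odot>\<^bsub>T\<^esub> t (br y z) x
          \<oplus>\<^bsub>T\<^esub> ksign (k * j) \<odot>\<^bsub>T\<^esub> t (br z x) y
          | i j k x y z. x \<in> G i \<inter> carr L \<and> y \<in> G j \<inter> carr L \<and> z \<in> G k \<inter> carr L}))"

definition H2_quot :: "('k::comm_ring_1, 'l) kmod \<Rightarrow> (bit \<Rightarrow> 'l set) \<Rightarrow> ('l \<Rightarrow> 'l \<Rightarrow> 'l) \<Rightarrow>
    ('k, ('l \<times> 'l \<Rightarrow>\<^sub>0 'k) set set) kmod" where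
  "H2_quot L G br = quot (tensor L L) (H2_rels L G br)"

text \<open>
  The linear map with \<open>x \<otimes> y \<mapsto> br x y\<close>. It exists for a Lie superalgebra, and its values on
  the carrier are unique because the classes of the \<open>x \<otimes> y\<close> span it.
\<close>

definition H2_map :: "('k::comm_ring_1, 'l) kmod \<Rightarrow> (bit \<Rightarrow> 'l set) \<Rightarrow> ('l \<Rightarrow> 'l \<Rightarrow> 'l) \<Rightarrow>
    ('l \<times> 'l \<Rightarrow>\<^sub>0 'k) set set \<Rightarrow> 'l" where
  "H2_map L G br = (SOME f. mlinear (H2_quot L G br) L f \<and>
     (\<forall>x\<in>carr L. \<forall>y\<in>carr L. f (mcoset (tensor L L) (H2_rels L G br) (tens L L x y)) = br x y))"

definition H2 :: "('k::comm_ring_1, 'l) kmod \<Rightarrow> (bit \<Rightarrow> 'l set) \<Rightarrow> ('l \<Rightarrow> 'l \<Rightarrow> 'l) \<Rightarrow>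
    ('k, ('l \<times> 'l \<Rightarrow>\<^sub>0 'k) set set) kmod" where
  "H2 L G br = mker (H2_quot L G br) L (H2_map L G br)"


section \<open>The objects attached to \<open>(R, bar)\<close>\<close>

context
  fixes scale :: "'k::comm_ring_1 \<Rightarrow> 'r::{ring, monoid_mult} \<Rightarrow> 'r" (infixr \<open>*s\<close> 75)
    and G :: "bit \<Rightarrow> 'r set"
    and bar :: "'r \<Rightarrow> 'r"
begin

definition rcom :: "'r \<Rightarrow> 'r \<Rightarrow> 'r" where
  "rcom = supercommutator (*s) G (*)"

subsection \<open>\<open>osp\<close>\<close>

text \<open>
  Multiplication on \<open>'r^3^3\<close> is componentwise, and the library's matrix product requires
  \<open>semiring_1\<close>, which excludes the zero ring.
\<close>

definition mat_mult :: "'r^3^3 \<Rightarrow> 'r^3^3 \<Rightarrow> 'r^3^3" where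
  "mat_mult X Y = (\<chi> p q. \<Sum>r\<in>UNIV. X $ p $ r * Y $ r $ q)"

definition mat_scale :: "'k \<Rightarrow> 'r^3^3 \<Rightarrow> 'r^3^3" where
  "mat_scale c X = (\<chi> p q. c *s X $ p $ q)"

definition index_deg :: "3 \<Rightarrow> bit" where
  "index_deg p = (if p = 1 then 0 else 1)"

definition mat_grading :: "bit \<Rightarrow> ('r^3^3) set" where
  "mat_grading i = {X. \<forall>p q. X $ p $ q \<in> G (index_deg p + index_deg q + i)}"

definition mat_com :: "'r^3^3 \<Rightarrow> 'r^3^3 \<Rightarrow> 'r^3^3" where
  "mat_com = supercommutator mat_scale mat_grading mat_mult"

definition rho :: "'r \<Rightarrow> 'r" where
  "rho a = hcomp G 0 a - hcomp G 1 a"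

definition osp_invol :: "'r^3^3 \<Rightarrow> 'r^3^3" where
  "osp_invol X =
    (let a = X$1$1; b1 = X$1$2; c2 = X$1$3;
         c1 = X$2$1; d11 = X$2$2; d12 = X$2$3;
         b2 = X$3$1; d21 = X$3$2; d22 = X$3$3
     in vector [vector [bar a, - bar (rho b2), bar (rho c1)],
                vector [bar (rho c2), bar d22, - bar d12],
                vector [- bar (rho b1), - bar d21, bar d11]])"

definition osp :: "('k, 'r^3^3) kmod" where
  "osp = kmod_of mat_scale (module.span mat_scale
     {mat_com X Y | X Y. osp_invol X = - X \<and> osp_invol Y = - Y})"

definition osp_H2 :: "('k, (('r^3^3) \<times> ('r^3^3) \<Rightarrow>\<^sub>0 'k) set set) kmod" where
  "osp_H2 = H2 osp mat_grading mat_com"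

subsection \<open>Modified skew-dihedral homology\<close>

definition R_kmod :: "('k, 'r) kmod" where
  "R_kmod = kmod_of (*s) UNIV"

definition RR :: "('k, ('r \<times> 'r \<Rightarrow>\<^sub>0 'k) set) kmod" where
  "RR = tensor R_kmod R_kmod"

definition rtens :: "'r \<Rightarrow> 'r \<Rightarrow> ('r \<times> 'r \<Rightarrow>\<^sub>0 'k) set" (infix \<open>\<otimes>\<close> 77) where
  "a \<otimes> b = tens R_kmod R_kmod a b"

text \<open>\<open>J i j k a b c\<close> is \<open>J(a, b, c)\<close> for \<open>a\<close>, \<open>b\<close>, \<open>c\<close> of degrees \<open>i\<close>, \<open>j\<close>, \<open>k\<close>.\<close>

definition J :: "bit \<Rightarrow> bit \<Rightarrow> bit \<Rightarrow> 'r \<Rightarrow> 'r \<Rightarrow> 'r \<Rightarrow> ('r \<times> 'r \<Rightarrow>\<^sub>0 'k) set" where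
  "J i j k a b c =
     ksign (i * k) \<odot>\<^bsub>RR\<^esub> (a * b) \<otimes> c
     \<oplus>\<^bsub>RR\<^esub> ksign (j * i) \<odot>\<^bsub>RR\<^esub> (b * c) \<otimes> a
     \<oplus>\<^bsub>RR\<^esub> ksign (k * j) \<odot>\<^bsub>RR\<^esub> (c * a) \<otimes> b"

definition HD_rels :: "('r \<times> 'r \<Rightarrow>\<^sub>0 'k) set set" where
  "HD_rels = mspan RR
    ({a \<otimes> 1 | i a. a \<in> G i} \<union>
     {a \<otimes> b \<oplus>\<^bsub>RR\<^esub> ksign (i * j) \<odot>\<^bsub>RR\<^esub> b \<otimes> a | i j a b. a \<in> G i \<and> b \<in> G j} \<union>
     {a \<otimes> b \<oplus>\<^bsub>RR\<^esub> (- 1) \<odot>\<^bsub>RR\<^esub> bar a \<otimes> bar b | i j a b. a \<in> G i \<and> b \<in> G j} \<union>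
     {J j i k b a c \<oplus>\<^bsub>RR\<^esub> (- ksign (i * j + j * k + k * i)) \<odot>\<^bsub>RR\<^esub> J i j k a b (c - bar c)
        | i j k a b c. a \<in> G i \<and> b \<in> G j \<and> c \<in> G k} \<union>
     {J i j (k + l) a b (rcom c d)
        \<oplus>\<^bsub>RR\<^esub> ksign (i * k + j * l) \<odot>\<^bsub>RR\<^esub> J k l (i + j) c d (rcom a b)
        | i j k l a b c d. a \<in> G i \<and> b \<in> G j \<and> c \<in> G k \<and> d \<in> G l} \<union>
     {J (i1 + i2) (j1 + j2) (k1 + k2) (rcom a1 a2) (rcom b1 b2) (rcom c1 c2)
        | i1 i2 j1 j2 k1 k2 a1 a2 b1 b2 c1 c2.
          a1 \<in> G i1 \<and> a2 \<in> G i2 \<and> b1 \<in> G j1 \<and> b2 \<in> G j2 \<and> c1 \<in> G k1 \<and> c2 \<in> G k2})"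

definition HD_quot :: "('k, ('r \<times> 'r \<Rightarrow>\<^sub>0 'k) set set) kmod" where
  "HD_quot = quot RR HD_rels"

definition HD_class :: "'r \<Rightarrow> 'r \<Rightarrow> ('r \<times> 'r \<Rightarrow>\<^sub>0 'k) set set" where
  "HD_class a b = mcoset RR HD_rels (a \<otimes> b)"

definition HD :: "('k, ('r \<times> 'r \<Rightarrow>\<^sub>0 'k) set set) kmod" where
  "HD = HD_quot\<lparr>carr :=
     {foldr (madd HD_quot) (map (\<lambda>(a, b). HD_class a b) ps) (mzero HD_quot) | ps.
        (\<Sum>(a, b)\<leftarrow>ps. rcom a b) = (\<Sum>(a, b)\<leftarrow>ps. bar (rcom a b))}\<rparr>"

subsection \<open>The module \<open>R / I3\<close>\<close>

abbreviation plus_bar :: "'r \<Rightarrow> 'r" where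
  "plus_bar a \<equiv> a + bar a"

definition I3 :: "'r set" where
  "I3 = module.span (*s)
    ({3 *s a | i a. a \<in> G i} \<union>
     {a - bar a | i a. a \<in> G i} \<union>
     {(rcom a b - bar (rcom a b)) * c | i j k a b c. a \<in> G i \<and> b \<in> G j \<and> c \<in> G k} \<union>
     {plus_bar a * plus_bar b * c - ksign (i * j) *s (plus_bar b * plus_bar a * c)
        | i j k a b c. a \<in> G i \<and> b \<in> G j \<and> c \<in> G k} \<union>
     {ksign (i * k) *s (a * bar b * c + bar a * b * bar c)
        + ksign (j * i) *s (b * bar c * a + bar b * c * bar a)
        + ksign (k * j) *s (c * bar a * b + bar c * a * bar b)
        | i j k a b c. a \<in> G i \<and> b \<in> G j \<and> c \<in> G k})"

definition R_quot_I3 :: "('k, 'r set) kmod" where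
  "R_quot_I3 = quot R_kmod I3"

end

end

theory Submission
  imports Defs
begin

text \<open>Up to coboundaries, a two-cocycle \<open>\<beta>\<close> on \<open>osp\<close> is determined by three functions on \<open>R\<close>: its values
  \<open>T(b, c)\<close> on odd root vectors of opposite weights, normalised by a coboundary so that \<open>T(b, 1) = 0\<close>,
  and its values \<open>r(b)\<close> on pairs of root vectors of weights \<open>(1, 2)\<close>, respectively \<open>(-1, -2)\<close>. The
  cocycle identities say that \<open>T\<close> satisfies the relations defining the symbols \<open>\<langle>a, b\<rangle>\<close>
  and that the two functions \<open>r\<close> vanish on \<open>I3\<close>; conversely, every such triple comes from an explicit
  cocycle. For the universal cocycle, with values in \<open>(L \<otimes> L) / B\<close>, this gives linear maps between
  \<open>(L \<otimes> L) / B\<close> and \<open>\<langle>R, R\<rangle> \<oplus> R/I3 \<oplus> R/I3\<close> in both directions. On the kernel of the bracket they are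
  mutually inverse, because a cocycle without invariants factors through the bracket, and this kernel
  corresponds to the kernel of \<open>\<langle>a, b\<rangle> \<mapsto> [a, b] - bar [a, b]\<close>.\<close>

section \<open>Signs and gradings\<close>

text \<open>Under the adjoint action of \<open>hm 0 1\<close> the algebra has the weights 0, 1, -1,
  2 and -2. The cocycle identity with \<open>hm 0 1\<close> multiplies the value on a pair of
  weights n and m by n + m and turns it into a value on \<open>hm 0 1\<close> and the bracket, hence
  into a coboundary as soon as n + m is invertible. Up to sign the sums are 0, 1, 2, 3, 4. As 2 is
  invertible, only the sums 0, 3 and -3 can carry cohomology: sum 0 leaves the pairing
  \<open>T\<close>, and each of 3 and -3 leaves a copy of \<open>R / I3\<close>, which 3
  annihilates. The automorphism \<open>theta\<close> exchanges the two signs, so that one of them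
  has to be treated. The harder construction is that of a cocycle with prescribed \<open>T\<close>.
  Its values on vectors of even weight are forced by writing them as sums of brackets of vectors of
  odd weight, and the relations on \<open>T\<close> make the result independent of the chosen sum.
  Calculations with cocycles use groups that are whole types, whereas tensor products and quotients
  live on carriers; the type \<open>univ\<close> receives each of these quotients injectively and
  carries the results over.\<close>

declare add_bit_eq_xor [simp del] mult_bit_eq_and [simp del]

text \<open>A sign acting on a bare additive group: sign identities need no scalars, and after a
  case distinction on the degrees they are plain group identities.\<close>

definition sg :: "bit \<Rightarrow> 'a::ab_group_add \<Rightarrow> 'a" where
  "sg p x = (if p = 0 then x else - x)"

lemma sg_0 [simp]: "sg 0 x = x" and sg_1 [simp]: "sg 1 x = - x"
  by (simp_all add: sg_def)

lemma sg_add: "sg p (x + y) = sg p x + sg p y"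
  and sg_diff: "sg p (x - y) = sg p x - sg p y"
  and sg_minus: "sg p (- x) = - sg p x"
  and sg_zero [simp]: "sg p 0 = 0"
  and sg_sg: "sg p (sg q x) = sg (p + q) x"
  and sg_eq_0_iff [simp]: "sg p x = 0 \<longleftrightarrow> x = 0"
  by (cases p; cases q; simp)+

lemma sg_self [simp]: "sg p (sg p x) = x"
  by (cases p) simp_all

lemma sg_mult_left: "sg p x * y = sg p (x * y)"
  and sg_mult_right: "x * sg p y = sg p (x * y)" for x y :: "'a::ring"
  by (cases p; simp)+

lemma bit_double [simp]: "(p::bit) + p = 0" "p + (p + q) = q" "p * p = p" "p * (p * q) = p * q"
  by (cases p; cases q; simp add: add.assoc[symmetric])+

lemma (in module) scale_ksign: "scale (ksign p) x = sg p x"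
  by (cases p) (simp_all add: ksign_def)

lemma (in module) scale_sg: "scale c (sg p x) = sg p (scale c x)"
  by (cases p) simp_all

section \<open>Gradings by two degrees and homogeneous components\<close>

locale graded_module = module scale
  for scale :: "'k::comm_ring_1 \<Rightarrow> 'v::ab_group_add \<Rightarrow> 'v" +
  fixes G :: "bit \<Rightarrow> 'v set"
  assumes subspace_G: "subspace (G i)"
    and G_sum: "\<exists>x\<in>G 0. \<exists>y\<in>G 1. a = x + y"
    and G_Int: "G 0 \<inter> G 1 = {0}"
begin

lemma G_closed [simp]: "0 \<in> G i" "x \<in> G i \<Longrightarrow> y \<in> G i \<Longrightarrow> x + y \<in> G i"
  "x \<in> G i \<Longrightarrow> y \<in> G i \<Longrightarrow> x - y \<in> G i" "x \<in> G i \<Longrightarrow> - x \<in> G i"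
  "x \<in> G i \<Longrightarrow> scale c x \<in> G i" "x \<in> G i \<Longrightarrow> sg p x \<in> G i"
  using subspace_G[of i]
  by (auto simp: subspace_0 subspace_add subspace_diff subspace_neg subspace_scale sg_def)

text \<open>Two candidates differ by an element of \<open>G i\<close> that, as a difference of two
  complements, lies in \<open>G (i + 1)\<close> as well and is therefore 0.\<close>

lemma hcomp_unique:
  assumes "y \<in> G i" "x - y \<in> G (i + 1)" shows "hcomp G i x = y"
  unfolding hcomp_def
proof (rule the_equality)
  show "y \<in> G i \<and> x - y \<in> G (i + 1)" using assms by simp
  fix z assume z: "z \<in> G i \<and> x - z \<in> G (i + 1)"
  have "y - z \<in> G i" using z assms by simp
  moreover have "(x - z) - (x - y) \<in> G (i + 1)" using z assms G_closed(3) by blast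
  ultimately have "y - z \<in> G 0 \<inter> G 1" by (cases i) simp_all
  then show "z = y" using G_Int by simp
qed

lemma hcomp_same [simp]: "x \<in> G i \<Longrightarrow> hcomp G i x = x"
  by (rule hcomp_unique) simp_all

lemma hcomp_other: "x \<in> G i \<Longrightarrow> j \<noteq> i \<Longrightarrow> hcomp G j x = 0"
  by (rule hcomp_unique; cases i; cases j; simp)

lemma hcomp_mem [simp]: "hcomp G i x \<in> G i"
  and hcomp_compl: "x - hcomp G i x \<in> G (i + 1)"
proof -
  obtain u v where uv: "u \<in> G 0" "v \<in> G 1" "x = u + v" using G_sum by blast
  have *: "hcomp G 0 x = u" "hcomp G 1 x = v"
    using uv by (auto intro!: hcomp_unique)
  show "hcomp G i x \<in> G i" "x - hcomp G i x \<in> G (i + 1)"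
    using uv * by (cases i; simp)+
qed

lemma hcomp_sum: "hcomp G 0 x + hcomp G 1 x = x"
proof -
  obtain u v where uv: "u \<in> G 0" "v \<in> G 1" "x = u + v" using G_sum by blast
  have *: "hcomp G 0 x = u" "hcomp G 1 x = v"
    using uv by (auto intro!: hcomp_unique)
  then show ?thesis using uv by simp
qed

lemma hcomp_add: "hcomp G i (x + y) = hcomp G i x + hcomp G i y"
proof (rule hcomp_unique)
  have "(x - hcomp G i x) + (y - hcomp G i y) \<in> G (i + 1)"
    using hcomp_compl[of x i] hcomp_compl[of y i] by (intro G_closed(2))
  then show "x + y - (hcomp G i x + hcomp G i y) \<in> G (i + 1)" by (simp add: algebra_simps)
qed simp

lemma hcomp_scale: "hcomp G i (scale c x) = scale c (hcomp G i x)"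
proof (rule hcomp_unique)
  have "scale c (x - hcomp G i x) \<in> G (i + 1)"
    using hcomp_compl by (intro G_closed(5))
  then show "scale c x - scale c (hcomp G i x) \<in> G (i + 1)" by (simp add: scale_right_diff_distrib)
qed simp

lemma hcomp_zero [simp]: "hcomp G i 0 = 0" by simp

lemma homogeneous_induct:
  assumes "\<And>i x. x \<in> G i \<Longrightarrow> P x" "\<And>x y. P x \<Longrightarrow> P y \<Longrightarrow> P (x + y)"
  shows "P x"
  using assms(2)[OF assms(1)[OF hcomp_mem] assms(1)[OF hcomp_mem], of 0 x 1 x]
  by (simp add: hcomp_sum)

definition par :: "'v \<Rightarrow> 'v" where "par x = hcomp G 0 x - hcomp G 1 x"

lemma par_hom: "x \<in> G i \<Longrightarrow> par x = sg i x"
  by (cases i) (simp_all add: par_def hcomp_other)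

lemma par_add: "par (x + y) = par x + par y"
  by (simp add: par_def hcomp_add)

lemma par_scale: "par (scale c x) = scale c (par x)"
  by (simp add: par_def hcomp_scale scale_right_diff_distrib)

lemma par_zero [simp]: "par 0 = 0" by (simp add: par_def)

lemma par_minus: "par (- x) = - par x"
  using par_add[of x "- x"] by (simp add: eq_neg_iff_add_eq_0 add.commute)

lemma par_diff: "par (x - y) = par x - par y"
  using par_add[of x "- y"] by (simp add: par_minus)

lemma par_par [simp]: "par (par x) = x"
  by (rule homogeneous_induct[where P="\<lambda>x. par (par x) = x"])
     (auto simp add: par_add par_hom[OF G_closed(6)] par_hom)

end

text \<open>The product is a parameter because the same facts serve \<open>R\<close> and its 3 by 3
  matrices, whose product \<open>*\<close> is the componentwise one.\<close>

locale graded_algebra = graded_module +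
  fixes m :: "'b \<Rightarrow> 'b \<Rightarrow> 'b"
  assumes m_add_left: "m (x + y) z = m x z + m y z"
    and m_add_right: "m x (y + z) = m x y + m x z"
    and m_scale_left: "m (scale c x) y = scale c (m x y)"
    and m_scale_right: "m x (scale c y) = scale c (m x y)"
    and m_assoc: "m (m x y) z = m x (m y z)"
    and m_G: "x \<in> G i \<Longrightarrow> y \<in> G j \<Longrightarrow> m x y \<in> G (i + j)"
begin

lemma m_zero [simp]: "m 0 y = 0" "m x 0 = 0"
  using m_add_left[of 0 0 y] m_add_right[of x 0 0] by simp_all

lemma m_minus: "m (- x) y = - m x y" "m x (- y) = - m x y"
  using m_add_left[of x "- x" y] m_add_right[of x y "- y"]
  by (simp_all add: eq_neg_iff_add_eq_0 add.commute)

lemma m_diff: "m (x - z) y = m x y - m z y" "m x (y - z) = m x y - m x z"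
  using m_add_left[of x "- z" y] m_add_right[of x y "- z"] by (simp_all add: m_minus)

abbreviation br where "br \<equiv> supercommutator scale G m"

lemma br_hom:
  assumes "x \<in> G i" "y \<in> G j" shows "br x y = m x y - sg (i * j) (m y x)"
  using assms
  by (cases i; cases j; simp add: supercommutator_def hcomp_other scale_ksign[unfolded] ksign_def m_minus)

lemma br_add_left: "br (x + y) z = br x z + br y z"
  and br_add_right: "br x (y + z) = br x y + br x z"
  by (simp_all add: supercommutator_def hcomp_add m_add_left m_add_right scale_right_distrib algebra_simps)

lemma br_scale_left: "br (scale c x) z = scale c (br x z)"
  and br_scale_right: "br x (scale c z) = scale c (br x z)"
  by (simp_all add: supercommutator_def hcomp_scale m_scale_left m_scale_right scale_right_distrib
      scale_right_diff_distrib algebra_simps)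

lemma br_zero [simp]: "br 0 y = 0" "br x 0 = 0"
  using br_add_left[of 0 0 y] br_add_right[of x 0 0] by simp_all

lemma br_minus: "br (- x) y = - br x y" "br x (- y) = - br x y"
  using br_add_left[of x "- x" y] br_add_right[of x y "- y"]
  by (simp_all add: eq_neg_iff_add_eq_0 add.commute)

lemma br_sg: "br (sg p x) y = sg p (br x y)" "br x (sg p y) = sg p (br x y)"
  by (cases p; simp add: br_minus)+

lemma br_G [simp]: "x \<in> G i \<Longrightarrow> y \<in> G j \<Longrightarrow> br x y \<in> G (i + j)"
  using m_G[of x i y j] m_G[of y j x i] by (simp add: br_hom add.commute)

lemma br_anti:
  assumes "x \<in> G i" "y \<in> G j" shows "br y x = - sg (i * j) (br x y)"
  using assms by (simp add: br_hom mult.commute sg_diff)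

lemma br_leibniz:
  assumes "x \<in> G i" "y \<in> G j" "z \<in> G k"
  shows "br x (br y z) = br (br x y) z + sg (i * j) (br y (br x z))"
proof -
  note yz = br_hom[OF assms(2,3)] and xy = br_hom[OF assms(1,2)] and xz = br_hom[OF assms(1,3)]
  note 1 = br_hom[OF assms(1) br_G[OF assms(2,3)]] br_hom[OF br_G[OF assms(1,2)] assms(3)]
    br_hom[OF assms(2) br_G[OF assms(1,3)]]
  show ?thesis
    unfolding 1[unfolded yz xy xz] yz xy xz
    by (cases i; cases j; cases k; simp add: m_diff m_minus m_add_left m_add_right m_assoc algebra_simps)
qed

end

sublocale superalgebra \<subseteq> graded_algebra scale G "(*)"
  by (unfold_locales)
    (auto simp: subspace_G G_Int G_mult algebra_simps scale_mult_left scale_mult_right[symmetric] intro: G_sum)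

text \<open>The odd component \<open>v\<close> of \<open>1\<close> satisfies
  \<open>v * x = x - u * x\<close>, which has the degree of \<open>x\<close> and the opposite degree
  at once. So \<open>v\<close> annihilates everything, in particular \<open>1\<close>.\<close>

lemma (in superalgebra) one_G [simp]: "1 \<in> G 0"
proof -
  obtain u v where uv: "u \<in> G 0" "v \<in> G 1" "1 = u + v" using G_sum by blast
  have *: "v * x = 0" if "x \<in> G i" for i x
  proof -
    have "x - u * x = v * x" using uv(3) by (metis add_diff_cancel_left' distrib_right mult_1_left)
    moreover have "x - u * x \<in> G i" "v * x \<in> G (1 + i)"
      using that G_mult[OF uv(1) that] G_mult[OF uv(2) that] by simp_all
    ultimately have "v * x \<in> G 0 \<inter> G 1" by (cases i) simp_all
    then show ?thesis using G_Int by simp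
  qed
  have "v * x = 0" for x
    by (rule homogeneous_induct[where P="\<lambda>x. v * x = 0"]) (auto simp: * distrib_left)
  from this[of 1] uv show ?thesis by simp
qed

section \<open>Rules for the superinvolution\<close>

context superalgebra_with_superinvolution
begin

interpretation bar: module_hom scale scale bar by (rule bar_linear)

lemmas bar_add = bar.add and bar_diff = bar.diff and bar_minus = bar.neg and bar_scale = bar.scale
  and bar_zero [simp] = bar.zero

declare bar_bar [simp] bar_G [simp]

lemma bar_sg: "bar (sg p a) = sg p (bar a)"
  by (cases p) (simp_all add: bar_minus)

lemma bar_mult': "a \<in> G i \<Longrightarrow> b \<in> G j \<Longrightarrow> bar (a * b) = sg (i * j) (bar b * bar a)"
  by (simp add: bar_mult scale_ksign)

lemma bar_one [simp]: "bar 1 = 1"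
proof -
  have "a * bar 1 = a" if "a \<in> G i" for a i
    using bar_mult'[OF one_G bar_G[OF that]] by simp
  from this[OF one_G] show ?thesis by simp
qed

lemma G_mult' [simp]: "a \<in> G i \<Longrightarrow> b \<in> G j \<Longrightarrow> a * b \<in> G (i + j)"
  by (rule G_mult)

lemma G_op_mult [simp]: "a \<in> G i \<Longrightarrow> b \<in> G j \<Longrightarrow> sg p (b * a) \<in> G (i + j)"
  using G_mult[of b j a i] by (simp add: add.commute)

lemma rcom_eq: "rcom scale G = br"
  by (simp add: rcom_def fun_eq_iff)

lemma rho_eq: "rho G = par"
  by (simp add: rho_def par_def fun_eq_iff)

lemma bar_par: "bar (par x) = par (bar x)"
  by (rule homogeneous_induct[where P="\<lambda>x. bar (par x) = par (bar x)"])
     (auto simp: par_hom par_hom[OF bar_G] par_add bar_add bar_sg)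

lemma bar_br:
  assumes "a \<in> G i" "b \<in> G j" shows "bar (br a b) = - br (bar a) (bar b)"
  unfolding br_hom[OF assms] br_hom[OF bar_G[OF assms(1)] bar_G[OF assms(2)]]
  by (simp add: bar_diff bar_sg bar_mult'[OF assms] bar_mult'[OF assms(2,1)] mult.commute sg_sg sg_diff)

lemma br_one [simp]: "br a 1 = 0" "br 1 a = 0"
  by (rule homogeneous_induct[where P="\<lambda>a. br a 1 = 0"], simp add: br_hom[OF _ one_G],
      simp add: br_add_left, rule homogeneous_induct[where P="\<lambda>a. br 1 a = 0"],
      simp add: br_hom[OF one_G], simp add: br_add_right)

lemma skew_bar [simp]: "bar (x - bar x) = - (x - bar x)" "bar (x + bar x) = x + bar x"
  by (simp_all add: bar_diff bar_add)

lemma par_mem [simp]: "x \<in> G i \<Longrightarrow> par x \<in> G i"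
  by (simp add: par_hom)

lemma par_mult: "par (a * b) = par a * par b"
proof (induction a rule: homogeneous_induct)
  case (1 i a)
  show ?case
    by (induction b rule: homogeneous_induct)
       (auto simp: par_hom[OF 1] par_hom[OF G_mult'[OF 1]] par_hom sg_mult_left sg_mult_right sg_sg
         distrib_left par_add add.commute)
qed (simp add: par_add distrib_right)

end

section \<open>Bilinear maps on \<open>R\<close>\<close>

text \<open>The alternating sum of four instances of one relation between two pairs, where each pair
  is either kept or replaced by a standard one; the common terms \<open>a\<close>, \<open>c\<close>,
  \<open>a'\<close>, \<open>c'\<close> cancel. It serves \<open>J_br\<close>.\<close>

lemma four_term:
  fixes a :: "'w::ab_group_add"
  assumes "a + b + sg e (c + d) = 0" "a' + b' + sg e c = 0" "a + sg e (c' + d') = 0" "a' + sg e c' = 0"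
  shows "b - b' + sg e (d - d') = 0"
proof -
  have "b - b' + sg e (d - d')
    = (a + b + sg e (c + d)) - (a' + b' + sg e c) - (a + sg e (c' + d')) + (a' + sg e c')"
    by (simp add: sg_add sg_diff algebra_simps)
  then show ?thesis using assms by simp
qed

text \<open>The element J(a, b, c) with \<open>T\<close> in place of the tensor symbol.\<close>

definition Jt :: "('r::ring \<Rightarrow> 'r \<Rightarrow> 'w::ab_group_add) \<Rightarrow> bit \<Rightarrow> bit \<Rightarrow> bit \<Rightarrow> 'r \<Rightarrow> 'r \<Rightarrow> 'r \<Rightarrow> 'w" where
  "Jt T i j k a b c = sg (i * k) (T (a * b) c) + sg (j * i) (T (b * c) a) + sg (k * j) (T (c * a) b)"

lemma Jt_cyc: "Jt T i j k a b c = Jt T j k i b c a"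
  by (simp add: Jt_def)

locale biadditive =
  fixes T :: "'r::{ring, monoid_mult} \<Rightarrow> 'r \<Rightarrow> 'w::ab_group_add"
  assumes T_add_left: "T (a + b) c = T a c + T b c"
    and T_add_right: "T a (b + c) = T a b + T a c"
begin

lemma T_zero [simp]: "T 0 b = 0" "T a 0 = 0"
  using T_add_left[of 0 0 b] T_add_right[of a 0 0] by simp_all

lemma T_minus: "T (- a) b = - T a b" "T a (- b) = - T a b"
  using T_add_left[of a "- a" b] T_add_right[of a b "- b"]
  by (simp_all add: eq_neg_iff_add_eq_0 add.commute)

lemma T_diff: "T (a - c) b = T a b - T c b" "T a (b - c) = T a b - T a c"
  using T_add_left[of a "- c" b] T_add_right[of a b "- c"] by (simp_all add: T_minus)

lemma T_sg: "T (sg p a) b = sg p (T a b)" "T a (sg p b) = sg p (T a b)"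
  by (cases p; simp add: T_minus)+

lemmas T_simps = T_add_left T_add_right T_minus T_diff T_sg

lemma Jt_add: "Jt T i j k (a + a') b c = Jt T i j k a b c + Jt T i j k a' b c"
  "Jt T i j k a (b + b') c = Jt T i j k a b c + Jt T i j k a b' c"
  "Jt T i j k a b (c + c') = Jt T i j k a b c + Jt T i j k a b c'"
  by (simp_all add: Jt_def T_simps sg_add algebra_simps)

lemma Jt_minus: "Jt T i j k (- a) b c = - Jt T i j k a b c"
  "Jt T i j k a (- b) c = - Jt T i j k a b c"
  "Jt T i j k a b (- c) = - Jt T i j k a b c"
  by (simp_all add: Jt_def T_simps sg_minus algebra_simps)

lemma Jt_sg: "Jt T i j k (sg p a) b c = sg p (Jt T i j k a b c)"
  "Jt T i j k a (sg p b) c = sg p (Jt T i j k a b c)"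
  "Jt T i j k a b (sg p c) = sg p (Jt T i j k a b c)"
  by (cases p; simp add: Jt_minus)+

lemma Jt_diff: "Jt T i j k (a - a') b c = Jt T i j k a b c - Jt T i j k a' b c"
  "Jt T i j k a (b - b') c = Jt T i j k a b c - Jt T i j k a b' c"
  "Jt T i j k a b (c - c') = Jt T i j k a b c - Jt T i j k a b c'"
  using Jt_add(1)[of i j k a "- a'" b c] Jt_add(2)[of i j k a b "- b'" c] Jt_add(3)[of i j k a b c "- c'"]
  by (simp_all add: Jt_minus)

text \<open>The action of \<open>diag(a, \<rho>(d), -bar(\<rho>(d)))\<close>, of degree \<open>k\<close>, on \<open>T\<close>, viewed as a pairing of the root
  spaces of weights \<open>1\<close> and \<open>-1\<close>.\<close>

definition QT :: "bit \<Rightarrow> 'r \<Rightarrow> 'r \<Rightarrow> bit \<Rightarrow> bit \<Rightarrow> 'r \<Rightarrow> 'r \<Rightarrow> 'w" where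
  "QT k a d i j b c = T (a * b - sg (k * i) (b * d)) c + sg (k * i) (T b (d * c - sg (k * j) (c * a)))"

lemma QT_add: "QT k (a + a') (d + d') i j b c = QT k a d i j b c + QT k a' d' i j b c"
  by (simp add: QT_def T_simps sg_add sg_diff algebra_simps)

end

text \<open>Relations (i) to (iii), common to the symbols and to the pairings that come from
  cocycles. The identities \<open>K2\<close> and \<open>K3\<close> below serve both for deriving the
  other relations from a cocycle and for building a cocycle from them.\<close>

locale dihedral_pairing = superalgebra_with_superinvolution scale G bar + biadditive T
  for scale :: "'k::comm_ring_1 \<Rightarrow> 'r::{ring, monoid_mult} \<Rightarrow> 'r" and G bar
    and T :: "'r \<Rightarrow> 'r \<Rightarrow> 'w::ab_group_add" +
  assumes T_one: "T a 1 = 0"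
    and T_anti: "a \<in> G i \<Longrightarrow> b \<in> G j \<Longrightarrow> T a b = - sg (i * j) (T b a)"
    and T_bar: "T (bar a) (bar b) = T a b"
begin

lemma T_one' [simp]: "T a 1 = 0" "T 1 a = 0"
proof -
  show *: "T a 1 = 0" for a by (rule T_one)
  show "T 1 a = 0"
    by (rule homogeneous_induct[where P="\<lambda>a. T 1 a = 0"]) (auto simp: T_add_right * T_anti[OF one_G])
qed

lemma T_bar_left: "T (bar a) b = T a (bar b)"
  using T_bar[of a "bar b"] by simp

lemma Jt_bar:
  assumes a: "a \<in> G i" and b: "b \<in> G j" and c: "c \<in> G k"
  shows "Jt T i j k (bar a) (bar b) (bar c) = sg (i * j + j * k + k * i) (Jt T j i k b a c)"
proof -
  have "T (bar a * bar b) (bar c) = sg (i * j) (T (b * a) c)"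
    unfolding T_bar[of "b * a" c, symmetric] bar_mult'[OF b a] by (simp add: T_sg mult.commute)
  moreover have "T (bar b * bar c) (bar a) = sg (j * k) (T (c * b) a)"
    unfolding T_bar[of "c * b" a, symmetric] bar_mult'[OF c b] by (simp add: T_sg mult.commute)
  moreover have "T (bar c * bar a) (bar b) = sg (k * i) (T (a * c) b)"
    unfolding T_bar[of "a * c" b, symmetric] bar_mult'[OF a c] by (simp add: T_sg mult.commute)
  ultimately show ?thesis
    unfolding Jt_def by (cases i; cases j; cases k; simp)
qed

lemma QT_skew:
  assumes s: "s \<in> G k" and b: "b \<in> G i" and c: "c \<in> G j"
  shows "QT k s 0 i j b c = sg (k * j) (Jt T k i j s b c) + T s (b * c)"
  unfolding QT_def Jt_def
  using T_anti[OF b G_mult'[OF c s]] T_anti[OF s G_mult'[OF b c]]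
  by (cases i; cases j; cases k; simp add: T_simps)

lemma QT_one:
  assumes "d \<in> G k" "b \<in> G i"
  shows "QT k (d - bar d) d i 0 b 1 = sg (k * i) (T b (bar d))"
  by (simp add: QT_def)

text \<open>By \<open>hm_skbr\<close> the pair \<open>(b, c)\<close> minus the pair
  \<open>(sg (i * j) (c * b), 1)\<close> represents \<open>hm (sk (br b c)) 0\<close>, because both
  brackets have the same (2,2) entry. The left side is the action of a diagonal element on this
  difference.\<close>

lemma K3:
  assumes d: "d \<in> G k" and b: "b \<in> G i" and c: "c \<in> G j"
  shows "QT k (d - bar d) d i j b c - QT k (d - bar d) d (i + j) 0 (sg (i * j) (c * b)) 1
    = sg (k * j) (Jt T k i j (d - bar d) b c) - sg (i * j + k * i) (Jt T k j i d c b)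
      - sg (k * (i + j)) (T (br b c - bar (br b c)) d)"
proof -
  have d': "bar d \<in> G k" using d by simp
  note 1 = T_anti[OF b G_mult'[OF d c]] T_anti[OF b G_mult'[OF c d]] T_anti[OF b G_mult'[OF c d']]
    T_bar_left[of "c * b" d] T_bar_left[of "b * c" d]
  show ?thesis
    unfolding QT_def Jt_def br_hom[OF b c]
    by (cases i; cases j; cases k; simp add: T_simps 1 bar_diff bar_add algebra_simps)
qed


text \<open>Up to sign the left side is what the Leibniz rule prescribes for \<open>fm q\<close> on
  the bracket of \<open>xm b\<close> and \<open>xm b'\<close>. Without the J term it depends on
  \<open>bar b * b'\<close> only, as the bracket does. \<open>K2\<close> is the analogue for
  \<open>em p\<close> and two vectors \<open>ym\<close>.\<close>

lemma K1:
  assumes q: "q \<in> G n" "bar q = q" and b: "b \<in> G i" and b': "b' \<in> G j"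
  shows "sg (i * (j + n)) (T b' (q * bar b)) + sg (j * n) (T b (q * bar b'))
    = T (bar b * b') q - sg (i * n) (Jt T n i j q (bar b) b')"
proof -
  have "T b (q * bar b') = sg (n * j) (T (bar b) (b' * q))"
    using T_bar[of b "q * bar b'"] bar_mult'[OF q(1) bar_G[OF b']] q(2) by (simp add: T_sg)
  note 1 = this T_anti[OF b' G_mult'[OF q(1) bar_G[OF b]]] T_anti[OF bar_G[OF b] G_mult'[OF b' q(1)]]
  show ?thesis unfolding Jt_def 1 by (cases i; cases j; cases n; simp add: algebra_simps)
qed

lemma K2:
  assumes p: "p \<in> G m" "bar p = p" and c: "c \<in> G k" and c': "c' \<in> G l"
  shows "T (bar c * p) c' + sg (k * l + m * k + m * l) (T (bar c' * p) c)
    = sg (m * k) (T p (c * bar c')) + sg (m * k + m * l) (Jt T m k l p c (bar c'))"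
proof -
  have "T (bar c * p) c' = sg (m * k) (T (p * c) (bar c'))"
    using T_bar[of "bar c * p" c'] bar_mult'[OF bar_G[OF c] p(1)] p(2) by (simp add: T_sg mult.commute)
  note 1 = this T_anti[OF p(1) G_mult'[OF c bar_G[OF c']]]
  show ?thesis unfolding Jt_def 1 by (cases m; cases k; cases l; simp add: algebra_simps)
qed

end

context superalgebra_with_superinvolution
begin

definition sk :: "'r \<Rightarrow> 'r" where "sk a = a - bar a"

lemma sk_G [simp]: "a \<in> G i \<Longrightarrow> sk a \<in> G i"
  by (simp add: sk_def)

lemma sk_add: "sk (a + b) = sk a + sk b"
  and sk_diff: "sk (a - b) = sk a - sk b"
  and sk_sg: "sk (sg p a) = sg p (sk a)"
  and sk_minus: "sk (- a) = - sk a"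
  and sk_scale: "sk (scale c a) = scale c (sk a)"
  and bar_sk: "bar (sk a) = - sk a"
  by (simp_all add: sk_def bar_add bar_diff bar_sg bar_minus bar_scale sg_diff scale_right_diff_distrib)

text \<open>By \<open>hm_skbr_Lie\<close> these are (1,1) entries of elements \<open>hm s 0\<close>
  of the derived algebra.\<close>

definition skbr :: "bit \<Rightarrow> 'r set" where
  "skbr k = {sk (br a b) | i j a b. a \<in> G i \<and> b \<in> G j \<and> k = i + j}"

lemma skbr_D: "s \<in> skbr k \<Longrightarrow> s \<in> G k \<and> bar s = - s"
  by (auto simp: skbr_def bar_sk)

lemma sk_mult: "a \<in> G i \<Longrightarrow> b \<in> G j \<Longrightarrow> sk (a * b) = sk (sg (i * j) (b * a)) + sk (br a b)"
  by (simp add: br_hom sk_diff)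

end

text \<open>What the cocycle identities say about \<open>T\<close> before any simplification:
  \<open>R0\<close> and \<open>R2\<close> come from the Leibniz rule for \<open>em\<close> and
  \<open>fm\<close>, and \<open>R3\<close> is antisymmetry on two diagonal elements, each a bracket
  of \<open>xm\<close> with \<open>ym\<close>.\<close>

locale lie_pairing = superalgebra_with_superinvolution scale G bar + biadditive T
  for scale :: "'k::comm_ring_1 \<Rightarrow> 'r::{ring, monoid_mult} \<Rightarrow> 'r" and G bar
    and T :: "'r \<Rightarrow> 'r \<Rightarrow> 'w::ab_group_add" +
  assumes two_torsion_free: "w + w = 0 \<Longrightarrow> w = (0 :: 'w)"
    and T_right_one: "T a 1 = 0"
    and R0: "p \<in> G m \<Longrightarrow> bar p = p \<Longrightarrow> T 1 p = 0"
    and R2: "p \<in> G m \<Longrightarrow> bar p = p \<Longrightarrow> c \<in> G k \<Longrightarrow> c' \<in> G l \<Longrightarrow>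
      T (bar c * p) c' + sg (k * l + m * k + m * l) (T (bar c' * p) c) = sg (m * k) (T p (c * bar c'))"
    and R3: "b \<in> G i \<Longrightarrow> c \<in> G j \<Longrightarrow> b' \<in> G k \<Longrightarrow> c' \<in> G l \<Longrightarrow>
      QT (k + l) (sk (b' * c')) (sg (k * l) (c' * b')) i j b c
      + sg ((k + l) * (i + j)) (QT (i + j) (sk (b * c)) (sg (i * j) (c * b)) k l b' c') = 0"

locale hd_symbol = dihedral_pairing +
  assumes J_skew: "a \<in> G i \<Longrightarrow> b \<in> G j \<Longrightarrow> c \<in> G k \<Longrightarrow>
      Jt T j i k b a c = sg (i * j + j * k + k * i) (Jt T i j k a b (sk c))"
    and J_br: "a \<in> G i \<Longrightarrow> b \<in> G j \<Longrightarrow> c \<in> G k \<Longrightarrow> d \<in> G l \<Longrightarrow>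
      Jt T i j (k + l) a b (br c d) + sg (i * k + j * l) (Jt T k l (i + j) c d (br a b)) = 0"
begin

text \<open>Relation (iv) with the symmetric element in the place where \<open>sk\<close>
  acts.\<close>

lemma J_sym:
  assumes "p \<in> G m" "bar p = p" "a \<in> G i" "b \<in> G j"
  shows "Jt T m i j p a b = 0"
  using J_skew[OF assms(4,3,1)] assms(2) by (simp add: sk_def Jt_def[of T j i m b a 0] Jt_cyc[of T m i j])

text \<open>Relation (iv) cancels the two J terms of \<open>K3\<close>.\<close>

lemma QT_D:
  assumes d: "d \<in> G k" and b: "b \<in> G i" and c: "c \<in> G j"
  shows "QT k (sk d) d i j b c
    = sg (k * (i + j)) (T (sg (i * j) (c * b)) (bar d) - T (sk (br b c)) d)"
proof -
  have "Jt T k j i d c b = Jt T j i k c b d" by (simp add: Jt_cyc)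
  also have "\<dots> = sg (i * j + j * k + k * i) (Jt T i j k b c (sk d))" by (rule J_skew[OF b c d])
  also have "Jt T i j k b c (sk d) = Jt T k i j (sk d) b c" by (simp add: Jt_cyc)
  finally have J: "Jt T k j i d c b = sg (i * j + j * k + k * i) (Jt T k i j (sk d) b c)" .
  have u: "sg (i * j) (c * b) \<in> G (i + j)" using b c by simp
  show ?thesis
    using K3[OF d b c] QT_one[OF d u] unfolding sk_def[symmetric] J
    by (cases i; cases j; cases k; simp add: algebra_simps)
qed

text \<open>This recovers \<open>R3\<close> from the relations of the symbols. Each diagonal element
  splits into a part with parameters \<open>(sk u, u)\<close>, governed by \<open>QT_D\<close>, and
  a part \<open>(sk w, 0)\<close>, governed by \<open>QT_skew\<close>. The \<open>T\<close> terms
  cancel by antisymmetry, the J terms by (iv) and (v).\<close>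

lemma xyxy:
  assumes b: "b \<in> G i" and c: "c \<in> G j" and b': "b' \<in> G k" and c': "c' \<in> G l"
  shows "QT (k + l) (sk (b' * c')) (sg (k * l) (c' * b')) i j b c
      + sg ((k + l) * (i + j)) (QT (i + j) (sk (b * c)) (sg (i * j) (c * b)) k l b' c') = 0"
proof -
  define u u' w w' where "u = sg (i * j) (c * b)" and "u' = sg (k * l) (c' * b')"
    and "w = br b c" and "w' = br b' c'"
  have G: "u \<in> G (i + j)" "u' \<in> G (k + l)" "w \<in> G (i + j)" "w' \<in> G (k + l)"
    using assms by (simp_all add: u_def u'_def w_def w'_def)
  have e: "b * c = u + w" "b' * c' = u' + w'"
    using b c b' c' by (simp_all add: u_def u'_def w_def w'_def br_hom)
  have s: "sk (b * c) = sk u + sk w" "sk (b' * c') = sk u' + sk w'" by (simp_all add: e sk_add)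
  have Q: "QT (k + l) (sk (b' * c')) u' i j b c
     = sg ((k + l) * (i + j)) (T u (bar u') - T (sk w) u')
       + (sg ((k + l) * j) (Jt T (k + l) i j (sk w') b c) + T (sk w') (u + w))"
    using QT_add[of "k + l" "sk u'" "sk w'" u' 0 i j b c] QT_D[OF G(2) b c] QT_skew[OF sk_G[OF G(4)] b c]
    unfolding s(2) by (simp add: u_def w_def e)
  have Q': "QT (i + j) (sk (b * c)) u k l b' c'
     = sg ((i + j) * (k + l)) (T u' (bar u) - T (sk w') u)
       + (sg ((i + j) * l) (Jt T (i + j) k l (sk w) b' c') + T (sk w) (u' + w'))"
    using QT_add[of "i + j" "sk u" "sk w" u 0 k l b' c'] QT_D[OF G(1) b' c'] QT_skew[OF sk_G[OF G(3)] b' c']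
    unfolding s(1) by (simp add: u'_def w'_def e)
  have t1: "T u' (bar u) = - sg ((i + j) * (k + l)) (T u (bar u'))"
    using T_anti[OF G(2) bar_G[OF G(1)]] T_bar_left[of u u'] by (simp add: mult.commute)
  have t2: "T (sk w) w' = - sg ((i + j) * (k + l)) (T (sk w') w)"
    using T_anti[OF G(3) sk_G[OF G(4)]] T_bar_left[of w w'] by (simp add: sk_def T_diff)
  have wanti: "br c b = - sg (i * j) w" "br c' b' = - sg (k * l) w'"
    unfolding w_def w'_def using br_anti[OF b c] br_anti[OF b' c'] by simp_all
  \<comment> \<open>Relation (iv) trades \<open>sk\<close> for a swap of \<open>a\<close> and
    \<open>d\<close>; relation (v) then moves the commutator to the other pair.\<close>
  have skew: "Jt T (p + q) m n (sk (br x y)) a d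
     = sg (m * n + n * (p + q) + (p + q) * m + n * p + m * q + m * n) (Jt T p q (m + n) x y (br a d))"
    if G: "a \<in> G m" "d \<in> G n" "x \<in> G p" "y \<in> G q" for a d x y m n p q
  proof -
    have "Jt T n m (p + q) d a (br x y) + sg (n * p + m * q) (Jt T p q (n + m) x y (- sg (m * n) (br a d))) = 0"
      using J_br[OF G(2,1,3,4)] br_anti[OF G(1,2)] by simp
    then have "Jt T n m (p + q) d a (br x y) = sg (n * p + m * q + m * n) (Jt T p q (m + n) x y (br a d))"
      by (simp add: Jt_minus Jt_sg sg_minus sg_sg add.commute)
    moreover have "Jt T m n (p + q) a d (sk (br x y)) = sg (m * n + n * (p + q) + (p + q) * m) (Jt T n m (p + q) d a (br x y))"
      using J_skew[OF G(1,2) br_G[OF G(3,4)]] by simp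
    ultimately show ?thesis by (simp add: Jt_cyc[of T "p + q"] sg_sg add.assoc)
  qed
  note j1 = skew[OF b c b' c', folded w_def w'_def] and j2 = skew[OF b' c' b c, folded w_def w'_def]
  have j3: "Jt T k l (i + j) b' c' w = - sg (i * k + j * l) (Jt T i j (k + l) b c w')"
    using J_br[OF b' c' b c] unfolding w_def[symmetric] w'_def[symmetric]
    by (simp add: eq_neg_iff_add_eq_0 mult.commute)
  show ?thesis
    unfolding u_def[symmetric] u'_def[symmetric] Q Q' j1 j2 j3 T_add_right t1 t2
    by (cases i; cases j; cases k; cases l; simp add: algebra_simps)
qed

end


section \<open>Relations of the symbols for a pairing that comes from a cocycle\<close>

context lie_pairing
begin

text \<open>\<open>R2\<close> at \<open>p = c = 1\<close> makes \<open>T 1\<close> invariant under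
  \<open>bar\<close>, so \<open>T 1 (a + bar a)\<close>, which \<open>R0\<close> kills, is twice
  \<open>T 1 a\<close>.\<close>

lemma T_one_left: "T 1 a = 0"
proof -
  have 1: "T 1 (bar a) = T 1 a" if a: "a \<in> G i" for a i
    using R2[OF one_G bar_one one_G a] by (simp add: T_right_one)
  have 2: "T 1 a = 0" if a: "a \<in> G i" for a i
  proof (rule two_torsion_free)
    have "T 1 (a + bar a) = 0" by (rule R0[of _ i]) (simp_all add: a)
    then show "T 1 a + T 1 a = 0" by (simp add: T_add_right 1[OF a])
  qed
  show ?thesis
    by (rule homogeneous_induct[where P="\<lambda>a. T 1 a = 0"]) (auto simp: 2 T_add_right)
qed

lemma T_bar_anti:
  assumes c: "c \<in> G k" and c': "c' \<in> G l"
  shows "T (bar c) c' = - sg (k * l) (T (bar c') c)"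
  using R2[OF one_G bar_one c c'] T_one_left by (simp add: eq_neg_iff_add_eq_0)

lemma T_sym_bar:
  assumes p: "p \<in> G m" "bar p = p" and c: "c \<in> G l"
  shows "T p (bar c) = T p c"
  using R2[OF p one_G c] by (simp add: T_right_one)

lemma T_sym_bar': 
  assumes p: "p \<in> G m" "bar p = p" and c: "c \<in> G l"
  shows "T (bar c) p = T c p"
  using T_bar_anti[OF c p(1)] T_bar_anti[OF bar_G[OF c] p(1)] T_sym_bar[OF p c] p(2) by simp

text \<open>The symmetric elements \<open>a + bar a\<close> and \<open>b + bar b\<close> give two
  linear equations between four values of \<open>T\<close>; their sum is twice the claim.\<close>

lemma T_bar_hom:
  assumes a: "a \<in> G i" and b: "b \<in> G j"
  shows "T (bar a) (bar b) = T a b"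
proof -
  let ?p = "a + bar a" and ?q = "b + bar b"
  have p: "?p \<in> G i" "bar ?p = ?p" and q: "?q \<in> G j" "bar ?q = ?q" using a b by simp_all
  have 1: "T a (bar b) + T (bar a) (bar b) = T a b + T (bar a) b"
    using T_sym_bar[OF p b] by (simp add: T_add_left)
  have 2: "T (bar a) b + T (bar a) (bar b) = T a b + T a (bar b)"
    using T_sym_bar'[OF q a] by (simp add: T_add_right)
  have "(T (bar a) (bar b) - T a b) + (T (bar a) (bar b) - T a b) = 0"
  proof -
    have "(T (bar a) (bar b) - T a b) + (T (bar a) (bar b) - T a b)
      = (T a (bar b) + T (bar a) (bar b) - (T a b + T (bar a) b))
        + (T (bar a) b + T (bar a) (bar b) - (T a b + T a (bar b)))"
      by (simp add: algebra_simps)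
    then show ?thesis unfolding 1 2 by simp
  qed
  then have "T (bar a) (bar b) - T a b = 0" by (rule two_torsion_free)
  then show ?thesis by simp
qed

lemma T_bar_all: "T (bar a) (bar b) = T a b"
proof (induction a rule: homogeneous_induct)
  case (1 i a)
  show ?case
    by (induction b rule: homogeneous_induct) (auto simp: T_bar_hom[OF 1] T_add_right bar_add)
qed (simp add: T_add_left bar_add)

lemma T_anti_hom:
  assumes a: "a \<in> G i" and b: "b \<in> G j" shows "T a b = - sg (i * j) (T b a)"
  using T_bar_anti[OF bar_G[OF a] b] T_bar_all[of b a] by simp

end

sublocale lie_pairing \<subseteq> dihedral_pairing
  by unfold_locales (use T_right_one T_anti_hom T_bar_all in blast)+

context lie_pairing
begin

text \<open>\<open>R2\<close> is \<open>K2\<close> without its J term.\<close>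

lemma J_sym0:
  assumes p: "p \<in> G m" "bar p = p" and c: "c \<in> G k" and d: "d \<in> G l"
  shows "Jt T m k l p c d = 0"
  using K2[OF p c bar_G[OF d]] R2[OF p c bar_G[OF d]] by simp

lemma QT_skbr:
  assumes s: "s \<in> G k" and b: "b \<in> G i" and c: "c \<in> G j"
  shows "QT k s 0 i j b c - QT k s 0 (i + j) 0 (sg (i * j) (c * b)) 1
    = sg (k * j) (Jt T k i j s b c) + T s (br b c)"
proof -
  have u: "sg (i * j) (c * b) \<in> G (i + j)" using b c by simp
  have "Jt T k (i + j) 0 s (sg (i * j) (c * b)) 1 = 0"
    using T_anti[OF s u] by (simp add: Jt_def add.commute mult.commute)
  then show ?thesis
    using QT_skew[OF s b c] QT_skew[OF s u one_G] by (simp add: br_hom[OF b c] T_simps)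
qed

lemma QT_skbr_D:
  assumes "s \<in> G m" "d \<in> G k"
  shows "QT m s 0 k 0 d 1 = T s d"
  using QT_skew[OF assms one_G] T_anti[OF assms] by (simp add: Jt_def add.commute mult.commute)

text \<open>Compare \<open>R3\<close> for the pairs \<open>(a, b)\<close>, \<open>(c, 1)\<close>
  with \<open>R3\<close> for \<open>(?u, 1)\<close>, \<open>(c, 1)\<close>. The difference is the
  left side of \<open>K3\<close>, whose last \<open>T\<close> term cancels; relation (iv)
  remains.\<close>

lemma J_skew:
  assumes a: "a \<in> G i" and b: "b \<in> G j" and c: "c \<in> G k"
  shows "Jt T j i k b a c = sg (i * j + j * k + k * i) (Jt T i j k a b (sk c))"
proof -
  let ?u = "sg (i * j) (b * a)"
  have u: "?u \<in> G (i + j)" using a b by simp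
  have "QT (i + j) (sk (a * b)) ?u k 0 c 1 - QT (i + j) (sk ?u) ?u k 0 c 1 = QT (i + j) (sk (br a b)) 0 k 0 c 1"
    using QT_add[of "i + j" "sk ?u" "sk (br a b)" ?u 0 k 0 c 1] by (simp add: sk_mult[OF a b])
  also have "\<dots> = T (sk (br a b)) c" by (rule QT_skbr_D) (use a b c in simp_all)
  finally have 1: "QT (i + j) (sk (a * b)) ?u k 0 c 1 - QT (i + j) (sk ?u) ?u k 0 c 1 = T (sk (br a b)) c" .
  have "QT k (sk c) c i j a b - QT k (sk c) c (i + j) 0 ?u 1 = - sg (k * (i + j)) (T (sk (br a b)) c)"
    using R3[OF a b c one_G] R3[OF u one_G c one_G] unfolding 1[symmetric]
    by (simp add: sg_diff eq_neg_iff_add_eq_0[symmetric])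
  then have "sg (k * j) (Jt T k i j (sk c) a b) = sg (i * j + k * i) (Jt T k j i c b a)"
    using K3[OF c a b] by (simp add: sk_def)
  then have "Jt T j i k b a c = sg (i * j + k * i) (sg (k * j) (Jt T i j k a b (sk c)))"
    by (metis Jt_cyc sg_self)
  then show ?thesis by (simp add: sg_sg mult.commute add.commute add.left_commute)
qed

text \<open>\<open>four_term\<close> tests \<open>R3\<close> on \<open>(a, b)\<close> minus
  \<open>(u, 1)\<close> against \<open>(c, d)\<close> minus \<open>(u', 1)\<close>, so that only the
  diagonal elements with entries \<open>sk (br a b)\<close> and \<open>sk (br c d)\<close> are
  left.\<close>

lemma J_br:
  assumes a: "a \<in> G i" and b: "b \<in> G j" and c: "c \<in> G k" and d: "d \<in> G l"
  shows "Jt T i j (k + l) a b (br c d) + sg (i * k + j * l) (Jt T k l (i + j) c d (br a b)) = 0"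
proof -
  have main: "sg ((k + l) * j) (Jt T (k + l) i j (sk (br c d)) a b) + T (sk (br c d)) (br a b)
     + sg ((k + l) * (i + j)) (sg ((i + j) * l) (Jt T (i + j) k l (sk (br a b)) c d) + T (sk (br a b)) (br c d)) = 0"
    if a: "a \<in> G i" and b: "b \<in> G j" and c: "c \<in> G k" and d: "d \<in> G l" for a b c d i j k l
  proof -
    define u u' w w' where "u = sg (i * j) (b * a)" and "u' = sg (k * l) (d * c)"
      and "w = br a b" and "w' = br c d"
    have G: "u \<in> G (i + j)" "u' \<in> G (k + l)" "w \<in> G (i + j)" "w' \<in> G (k + l)"
      using that by (simp_all add: u_def u'_def w_def w'_def)
    have s: "sk (a * b) = sk u + sk w" "sk (c * d) = sk u' + sk w'"
      using sk_mult[OF a b] sk_mult[OF c d] by (simp_all add: u_def u'_def w_def w'_def)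
    have e: "QT (k + l) (sk (c * d)) u' p q x y = QT (k + l) (sk u') u' p q x y + QT (k + l) (sk w') 0 p q x y"
      "QT (i + j) (sk (a * b)) u p q x y = QT (i + j) (sk u) u p q x y + QT (i + j) (sk w) 0 p q x y" for p q x y
      using QT_add[of "k + l" "sk u'" "sk w'" u' 0 p q x y] QT_add[of "i + j" "sk u" "sk w" u 0 p q x y]
      by (simp_all add: s)
    have r: "QT (k + l) (sk (c * d)) u' i j a b + sg ((k + l) * (i + j)) (QT (i + j) (sk (a * b)) u k l c d) = 0"
      "QT (k + l) (sk (c * d)) u' (i + j) 0 u 1 + sg ((k + l) * (i + j)) (QT (i + j) (sk u) u k l c d) = 0"
      "QT (k + l) (sk u') u' i j a b + sg ((k + l) * (i + j)) (QT (i + j) (sk (a * b)) u (k + l) 0 u' 1) = 0"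
      "QT (k + l) (sk u') u' (i + j) 0 u 1 + sg ((k + l) * (i + j)) (QT (i + j) (sk u) u (k + l) 0 u' 1) = 0"
      using R3[OF a b c d] R3[OF G(1) one_G c d] R3[OF a b G(2) one_G] R3[OF G(1) one_G G(2) one_G]
      by (simp_all add: u_def u'_def)
    have "QT (k + l) (sk w') 0 i j a b - QT (k + l) (sk w') 0 (i + j) 0 u 1
       + sg ((k + l) * (i + j)) (QT (i + j) (sk w) 0 k l c d - QT (i + j) (sk w) 0 (k + l) 0 u' 1) = 0"
      by (rule four_term[OF r[unfolded e]])
    then show ?thesis
      unfolding u_def u'_def QT_skbr[OF sk_G[OF G(4)] a b] QT_skbr[OF sk_G[OF G(3)] c d]
      unfolding w_def w'_def .
  qed
  \<comment> \<open>\<open>T_bar_left\<close> moves \<open>sk\<close> from one argument of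
    \<open>T\<close> to the other.\<close>
  have t2: "T (sk (br a b)) (br c d) = - sg ((i + j) * (k + l)) (T (sk (br c d)) (br a b))"
    if a: "a \<in> G i" and b: "b \<in> G j" and c: "c \<in> G k" and d: "d \<in> G l" for a b c d i j k l
    using T_anti[OF br_G[OF a b] sk_G[OF br_G[OF c d]]] T_bar_left[of "br a b" "br c d"]
    by (simp add: sk_def T_diff)
  have wanti: "br b a = - sg (i * j) (br a b)" using br_anti[OF a b] .
  \<comment> \<open>Both pairs are reversed here because relation (iv), which removes
    \<open>sk\<close> in \<open>z\<close>, swaps them back.\<close>
  have j1: "sg ((k + l) * i) (Jt T (k + l) j i (sk (br d c)) b a)
     + sg ((k + l) * (i + j)) (sg ((i + j) * k) (Jt T (i + j) l k (sk (br b a)) d c)) = 0"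
    using main[OF b a d c] t2[OF b a d c]
    by (cases "(k + l) * (i + j)") (simp_all add: add.commute mult.commute algebra_simps)
  have z: "Jt T (p + q) i j (sk (br d' c')) b' a' = - sg (p * q + i * j + j * (p + q) + (p + q) * i) (Jt T j i (p + q) a' b' (br c' d'))"
    if "a' \<in> G j" "b' \<in> G i" "c' \<in> G p" "d' \<in> G q" for a' b' c' d' i j p q
  proof -
    have "Jt T (p + q) i j (sk (br d' c')) b' a' = - sg (p * q) (Jt T i j (p + q) b' a' (sk (br c' d')))"
      by (simp add: br_anti[OF that(3,4)] Jt_cyc[of T "p + q"] sk_minus sk_sg Jt_minus Jt_sg)
    also have "Jt T i j (p + q) b' a' (sk (br c' d')) = sg (i * j + j * (p + q) + (p + q) * i) (Jt T j i (p + q) a' b' (br c' d'))"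
      using J_skew[OF that(2,1) br_G[OF that(3,4)]] by simp
    finally show ?thesis by (simp add: sg_sg add.assoc)
  qed
  show ?thesis
    using j1 z[OF a b c d] z[OF c d a b]
    by (cases i; cases j; cases k; cases l) (simp_all add: add_eq_0_iff)
qed

text \<open>On skew elements \<open>Jt_bar\<close> gives J(b, a, c) as minus the signed J(a, b, c),
  whereas (iv) with \<open>sk c = c + c\<close> gives twice the signed value. Hence three times J is
  0.\<close>

lemma J_alt:
  assumes a: "a \<in> G i" "bar a = - a" and b: "b \<in> G j" and c: "c \<in> G k" "bar c = - c" and bb: "bar b = - b"
  shows "Jt T j i k b a c = - sg (i * j + j * k + k * i) (Jt T i j k a b c)"
    and "Jt T i j k a b c + Jt T i j k a b c + Jt T i j k a b c = 0"
proof -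
  have skc: "sk c = c + c" by (simp add: sk_def c)
  show 1: "Jt T j i k b a c = - sg (i * j + j * k + k * i) (Jt T i j k a b c)"
    using Jt_bar[OF a(1) b c(1)] a bb c by (simp add: Jt_minus sg_minus) (metis (no_types) minus_minus sg_minus sg_self)
  show "Jt T i j k a b c + Jt T i j k a b c + Jt T i j k a b c = 0"
    using J_skew[OF a(1) b c(1)] unfolding 1 skc Jt_add
    by (cases "i * j + j * k + k * i") (simp_all add: algebra_simps eq_neg_iff_add_eq_0 neg_eq_iff_add_eq_0)
qed

end

sublocale lie_pairing \<subseteq> hd_symbol
  by unfold_locales (use J_skew J_br in blast)+

text \<open>\<open>R6\<close> is, up to sign, twice the Jacobi identity for \<open>hm a 0\<close>,
  \<open>hm b 0\<close>, \<open>hm c 0\<close>. It is the source of relation (vi).\<close>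

locale lie_pairing_jacobi = lie_pairing +
  assumes R6: "a \<in> skbr i \<Longrightarrow> b \<in> skbr j \<Longrightarrow> c \<in> skbr k \<Longrightarrow>
      sg (k * j) (sg (k * j) (Jt T k i j c a b) + T c (br a b))
      + sg (i * k) (sg (i * k) (Jt T i j k a b c) + T a (br b c))
      + sg (j * i) (sg (j * i) (Jt T j k i b c a) + T b (br c a)) = 0"
begin

text \<open>The J terms of \<open>R6\<close> add up to three times J. The commutator terms combine
  to J(a, b, c) minus the signed J(b, a, c), which is twice J by \<open>J_alt\<close>. What remains
  is J itself.\<close>

lemma J_skbr:
  assumes "a \<in> skbr i" "b \<in> skbr j" "c \<in> skbr k"
  shows "Jt T i j k a b c = 0"
proof -
  note a = skbr_D[OF assms(1)] and b = skbr_D[OF assms(2)] and c = skbr_D[OF assms(3)]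
  let ?X = "Jt T i j k a b c"
  have alt: "Jt T j i k b a c = - sg (i * j + j * k + k * i) ?X"
    using J_alt a b c by blast
  have t: "T c (br a b) = - sg (k * (i + j)) (T (br a b) c)"
    "T a (br b c) = - sg (i * (j + k)) (T (br b c) a)"
    "T b (br c a) = - sg (j * (k + i)) (T (br c a) b)"
    using a b c T_anti[OF _ br_G] by blast+
  have x: "sg (i * k) (T (br a b) c) + sg (j * i) (T (br b c) a) + sg (k * j) (T (br c a) b)
     = ?X - sg (i * j + j * k + k * i) (Jt T j i k b a c)"
    using a b c by (cases i; cases j; cases k) (simp_all add: Jt_def br_hom T_simps algebra_simps)
  have cyc: "Jt T k i j c a b = ?X" "Jt T j k i b c a = ?X"
    by (rule Jt_cyc, rule Jt_cyc[symmetric])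
  have "?X + ?X + ?X - (sg (i * k) (T (br a b) c) + sg (j * i) (T (br b c) a) + sg (k * j) (T (br c a) b)) = 0"
    using R6[OF assms] unfolding cyc t by (cases i; cases j; cases k) (simp_all add: algebra_simps)
  then show ?thesis unfolding x alt by (simp add: sg_minus algebra_simps)
qed

text \<open>Since J vanishes at symmetric entries, \<open>sk\<close> in an entry doubles it.
  Starting from \<open>J_skbr\<close>, the three factors 2 are cancelled one at a time, each entry
  being rotated to the front.\<close>

lemma J_comm:
  assumes a: "a1 \<in> G i1" "a2 \<in> G i2" and b: "b1 \<in> G j1" "b2 \<in> G j2" and c: "c1 \<in> G k1" "c2 \<in> G k2"
  shows "Jt T (i1 + i2) (j1 + j2) (k1 + k2) (br a1 a2) (br b1 b2) (br c1 c2) = 0"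
proof -
  have dbl: "Jt T m k l (sk p) c d = Jt T m k l p c d + Jt T m k l p c d"
    if "p \<in> G m" "c \<in> G k" "d \<in> G l" for m k l p c d
  proof -
    have "Jt T m k l (p + bar p) c d = 0" by (rule J_sym0) (simp_all add: that)
    then have "Jt T m k l (bar p) c d = - Jt T m k l p c d"
      by (simp add: Jt_add eq_neg_iff_add_eq_0 add.commute)
    then show ?thesis by (simp add: sk_def Jt_diff)
  qed
  let ?a = "br a1 a2" and ?b = "br b1 b2" and ?c = "br c1 c2"
  let ?i = "i1 + i2" and ?j = "j1 + j2" and ?k = "k1 + k2"
  have G: "?a \<in> G ?i" "?b \<in> G ?j" "?c \<in> G ?k" using a b c by simp_all
  have S: "sk ?a \<in> skbr ?i" "sk ?b \<in> skbr ?j" "sk ?c \<in> skbr ?k"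
    using a b c unfolding skbr_def by blast+
  have "Jt T ?i ?j ?k (sk ?a) (sk ?b) (sk ?c) = 0" by (rule J_skbr[OF S])
  then have "Jt T ?i ?j ?k ?a (sk ?b) (sk ?c) = 0"
    using dbl[OF G(1) sk_G[OF G(2)] sk_G[OF G(3)]] by - (rule two_torsion_free, simp)
  then have "Jt T ?j ?k ?i (sk ?b) (sk ?c) ?a = 0" by (simp only: Jt_cyc[of T ?i ?j ?k])
  then have "Jt T ?j ?k ?i ?b (sk ?c) ?a = 0"
    using dbl[OF G(2) sk_G[OF G(3)] G(1)] by - (rule two_torsion_free, simp)
  then have "Jt T ?k ?i ?j (sk ?c) ?a ?b = 0" by (simp only: Jt_cyc[of T ?j ?k ?i])
  then have "Jt T ?k ?i ?j ?c ?a ?b = 0"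
    using dbl[OF G(3) G(1) G(2)] by - (rule two_torsion_free, simp)
  then show ?thesis by (simp only: Jt_cyc[of T ?k ?i ?j])
qed

end

section \<open>Maps vanishing on \<open>I3\<close>\<close>

lemma eq_of_double_eq_minus: "y + y = - x \<Longrightarrow> y + y + y = 0 \<Longrightarrow> x = y" for x y :: "'a::ab_group_add"
  by (simp add: neg_eq_iff_add_eq_0)

text \<open>Additive maps that kill the generators of \<open>I3\<close>. The fourth generator is
  stated for symmetric \<open>p\<close> and \<open>q\<close>, which are the elements
  \<open>a + bar a\<close> once 2 is invertible.\<close>

locale I3_map = superalgebra_with_superinvolution scale G bar + r: additive r
  for scale :: "'k::comm_ring_1 \<Rightarrow> 'r::{ring, monoid_mult} \<Rightarrow> 'r" and G bar
    and r :: "'r \<Rightarrow> 'w::ab_group_add" +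
  assumes r_three: "a \<in> G i \<Longrightarrow> r a + r a + r a = 0"
    and r_bar: "a \<in> G i \<Longrightarrow> r (bar a) = r a"
    and r_sk: "a \<in> G i \<Longrightarrow> b \<in> G j \<Longrightarrow> c \<in> G k \<Longrightarrow> r (sk (br a b) * c) = 0"
    and r_sym: "p \<in> G i \<Longrightarrow> q \<in> G j \<Longrightarrow> c \<in> G k \<Longrightarrow> bar p = p \<Longrightarrow> bar q = q \<Longrightarrow>
      r (p * q * c) = sg (i * j) (r (q * p * c))"
    and r_cyc: "a \<in> G i \<Longrightarrow> b \<in> G j \<Longrightarrow> c \<in> G k \<Longrightarrow>
      sg (i * k) (r (a * bar b * c + bar a * b * bar c))
      + sg (j * i) (r (b * bar c * a + bar b * c * bar a))
      + sg (k * j) (r (c * bar a * b + bar c * a * bar b)) = 0"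
begin

lemma r_sg: "r (sg p a) = sg p (r a)"
  by (cases p) (simp_all add: r.minus)

lemmas r_simps = r.add r.minus r.diff r_sg

lemma r_bar2:
  assumes "a \<in> G i" "b \<in> G j"
  shows "r (bar b * bar a) = sg (i * j) (r (a * b))"
  using r_bar[OF G_mult'[OF assms]] unfolding bar_mult'[OF assms] r_sg by (metis sg_self)

lemma r_bar3:
  assumes "a \<in> G i" "b \<in> G j" "c \<in> G k"
  shows "r (bar c * bar b * bar a) = sg (i * j + j * k + k * i) (r (a * b * c))"
  using r_bar2[OF G_mult'[OF assms(1,2)] assms(3)] bar_mult'[OF assms(1,2)]
  by (cases i; cases j; cases k; simp add: r_simps mult.assoc)
     (simp_all add: equation_minus_iff)

lemma r_sym':
  assumes c: "c \<in> G k" and p: "p \<in> G i" "bar p = p" and q: "q \<in> G j" "bar q = q"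
  shows "r (c * p * q) = sg (i * j) (r (c * q * p))"
  using r_bar3[OF bar_G[OF p(1)] bar_G[OF q(1)] c] r_bar3[OF q(1) p(1) bar_G[OF c]] r_bar3[OF p(1) q(1) bar_G[OF c]]
    r_sym[OF q(1) p(1) bar_G[OF c] q(2) p(2)]
  by (cases i; cases j; cases k; simp add: p(2) q(2))

text \<open>\<open>r_cyc\<close> at \<open>(d, b, 1)\<close>, with \<open>bar b\<close> removed by
  \<open>r_bar2\<close>.\<close>

lemma r_anticomm:
  assumes d: "d \<in> G k" "bar d = - d" and b: "b \<in> G i"
  shows "r (d * b) = - sg (k * i) (r (b * d))"
proof -
  have 1: "r (bar b * d) = - sg (k * i) (r (d * b))"
    using r_bar2[OF d(1) b] d(2) by (simp add: r_simps neg_eq_iff_add_eq_0 eq_neg_iff_add_eq_0 add.commute)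
  have 2: "r (d * bar b) = - sg (k * i) (r (b * d))"
    using r_bar2[OF b d(1)] d(2)
    by (simp add: r_simps mult.commute neg_eq_iff_add_eq_0 eq_neg_iff_add_eq_0 add.commute)
  have 3: "r (bar b * bar d) = sg (k * i) (r (d * b))"
    by (rule r_bar2[OF d(1) b])
  show ?thesis
    using r_cyc[OF d(1) b one_G] r_three[OF G_mult'[OF d(1) b]] r_three[OF G_mult'[OF b d(1)]]
    by (cases i; cases k; simp add: d(2) r_simps 1 2 3 algebra_simps)
qed

text \<open>Needed for the Jacobi identity of three vectors \<open>xm\<close>. \<open>r_bar3\<close>
  turns the terms of \<open>r_cyc\<close> with two bars into terms with one.\<close>

lemma r_height_one:
  assumes b: "b1 \<in> G (i + 1)" "b2 \<in> G (j + 1)" "b3 \<in> G (k + 1)"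
  shows "sg (i * k + (i + j) * k) (r (b3 * (bar (par b1) * b2 - sg (i * j) (bar (par b2) * b1))))
    + sg (j * i + (j + k) * i) (r (b1 * (bar (par b2) * b3 - sg (j * k) (bar (par b3) * b2))))
    + sg (k * j + (k + i) * j) (r (b2 * (bar (par b3) * b1 - sg (k * i) (bar (par b1) * b3)))) = 0"
proof -
  note b1 = b(1) and b2 = b(2) and b3 = b(3)
  have 1: "r (bar x * y * bar z) = sg (p * q + q * s + s * p) (r (z * bar y * x))"
    if "x \<in> G p" "y \<in> G q" "z \<in> G s" for x y z p q s
    using r_bar3[OF that(3) bar_G[OF that(2)] that(1)] by (simp add: mult.commute add.commute add.left_commute)
  show ?thesis
    using r_cyc[OF b1 b2 b3] 1[OF b1 b2 b3] 1[OF b2 b3 b1] 1[OF b3 b1 b2]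
    by (cases i; cases j; cases k)
       (simp_all add: par_hom[OF b1] par_hom[OF b2] par_hom[OF b3] bar_minus r_simps mult.assoc algebra_simps neg_eq_iff_add_eq_0)
qed

text \<open>Needed for the Jacobi identity of a diagonal element, an \<open>xm\<close> and an
  \<open>em\<close>. Under \<open>r\<close> the entry \<open>a\<close> may be replaced by
  \<open>sk d\<close>; \<open>sk d\<close> anticommutes, \<open>d + bar d\<close> may be swapped
  with \<open>p\<close>, and \<open>d + d\<close> is the sum of these two. This gives
  \<open>?y + ?y = - ?x\<close>, while three times \<open>?y\<close> is 0.\<close>

lemma r_height_two:
  assumes a: "a \<in> G i" and d: "d \<in> G i" and b: "b \<in> G j" and p: "p \<in> G k" "bar p = p"
    and s: "\<And>l z. z \<in> G l \<Longrightarrow> r ((a - sk d) * z) = 0"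
  shows "r (a * b * p) - sg (i * j) (r (b * d * p))
    = sg (i * j) (r (b * (bar d * p + sg (i * k) (p * d))))"
proof -
  let ?x = "r (sk d * b * p)" and ?y = "sg (i * j) (r (b * (d + bar d) * p) + sg (i * k) (r (b * p * d)))"
  have *: "b * p \<in> G (j + k)" using b p by simp
  have abp: "r (a * b * p) = r (sk d * b * p)"
    using s[OF *] by (simp add: algebra_simps r_simps)
  have 1: "r (b * p * (d + bar d)) = sg (k * i) (r (b * (d + bar d) * p))"
    by (rule r_sym'[OF b p]) (use d in simp_all)
  have 2: "r (sk d * b * p) = - sg (i * (j + k)) (r (b * p * sk d))"
    using r_anticomm[OF sk_G[OF d] bar_sk *] by (simp add: mult.assoc)
  have 3: "r (b * p * d) + r (b * p * d) = r (b * p * (d + bar d)) + r (b * p * sk d)"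
    by (simp add: sk_def r_simps[symmetric] algebra_simps)
  have "?y + ?y = sg (i * j) (r (b * (d + bar d) * p) + r (b * (d + bar d) * p))
      + sg (i * j + i * k) (r (b * p * d) + r (b * p * d))"
    by (simp add: sg_add sg_sg algebra_simps)
  also have "sg (i * j + i * k) (r (b * p * d) + r (b * p * d))
     = sg (i * j) (r (b * (d + bar d) * p)) - ?x"
    unfolding 3 1 2 by (cases i; cases j; cases k; simp)
  also have "sg (i * j) (r (b * (d + bar d) * p) + r (b * (d + bar d) * p)) + (sg (i * j) (r (b * (d + bar d) * p)) - ?x) = - ?x"
  proof -
    have "b * (d + bar d) * p \<in> G (j + i + k)" using b d p by simp
    from r_three[OF this] show ?thesis
      by (cases i; cases j; simp add: algebra_simps neg_eq_iff_add_eq_0)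
  qed
  finally have y: "?y + ?y = - ?x" .
  have y3: "?y + ?y + ?y = 0"
  proof -
    have "b * (d + bar d) * p + sg (i * k) (b * p * d) \<in> G (i + j + k)"
      using G_mult'[OF G_mult'[OF b, of "d + bar d" i] p(1)] G_mult'[OF G_mult'[OF b p(1)] d] d
      by (simp add: add_ac)
    from r_three[OF this] show ?thesis
      by (cases i; cases j; simp add: r_simps sg_add algebra_simps neg_eq_iff_add_eq_0)
  qed
  have "?x = ?y" by (rule eq_of_double_eq_minus[OF y y3])
  then show ?thesis unfolding abp
    by (cases i; cases j; cases k; simp add: algebra_simps r_simps neg_eq_iff_add_eq_0 eq_neg_iff_add_eq_0)
qed

text \<open>Needed for the Jacobi identity of a \<open>ym\<close> and two vectors
  \<open>em\<close>.\<close>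

lemma r_height_four:
  assumes "c \<in> G i" "p \<in> G j" "bar p = p" "q \<in> G k" "bar q = q"
  shows "r (c * p * q) - sg (j * k) (r (c * q * p)) = 0"
  using r_sym'[OF assms(1-5)] by simp

end

text \<open>\<open>E b p\<close> stands for the value of a cocycle on \<open>xm b\<close> and
  \<open>em p\<close>, of total weight -3. \<open>F1\<close> and \<open>F2\<close> are the Leibniz
  rule for diagonal elements, \<open>F3\<close> is the Jacobi identity for three vectors
  \<open>xm\<close>. The outcome is that \<open>E\<close> is determined by \<open>E b 1\<close>, and
  that this kills \<open>I3\<close>.\<close>

locale height_three = superalgebra_with_superinvolution scale G bar + E: biadditive E
  for scale :: "'k::comm_ring_1 \<Rightarrow> 'r::{ring, monoid_mult} \<Rightarrow> 'r" and G bar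
    and E :: "'r \<Rightarrow> 'r \<Rightarrow> 'w::ab_group_add" +
  assumes two_torsion_free: "w + w = 0 \<Longrightarrow> w = (0 :: 'w)"
    and F1: "d \<in> G k \<Longrightarrow> b \<in> G i \<Longrightarrow> p \<in> G m \<Longrightarrow> bar p = p \<Longrightarrow>
      E (sk d * b - sg (k * i) (b * d)) p = sg (k * i) (E b (bar d * p + sg (k * m) (p * d)))"
    and F2: "x \<in> G i \<Longrightarrow> y \<in> G j \<Longrightarrow> b \<in> G k \<Longrightarrow> E (sk (br x y) * b) 1 = 0"
    and F3: "a \<in> G i \<Longrightarrow> b \<in> G j \<Longrightarrow> c \<in> G k \<Longrightarrow>
      sg (j * k) (E c (bar a * b + sg (i * j) (bar b * a)))
      + sg (k * i) (E a (bar b * c + sg (j * k) (bar c * b)))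
      + sg (i * j) (E b (bar c * a + sg (k * i) (bar a * c))) = 0"
begin

text \<open>\<open>F1\<close> with \<open>p\<close> as the diagonal parameter and \<open>1\<close>
  as the last argument; \<open>sk p\<close> is 0.\<close>

lemma E_sym2: "p \<in> G k \<Longrightarrow> bar p = p \<Longrightarrow> b \<in> G i \<Longrightarrow> E b p + E b p = - E (b * p) 1"
  using F1[OF _ _ one_G bar_one, of p k b i]
  by (cases k; cases i; simp add: sk_def E.T_simps eq_neg_iff_add_eq_0 neg_eq_iff_add_eq_0 algebra_simps)

text \<open>This is the origin of the generator \<open>3 *s a\<close> of \<open>I3\<close>: at
  \<open>p = 1\<close> both sides of \<open>E_sym2\<close> are multiples of
  \<open>E b 1\<close>.\<close>

lemma E_three: "b \<in> G i \<Longrightarrow> E b 1 + E b 1 + E b 1 = 0"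
  using E_sym2[OF one_G bar_one, of b i] by simp

lemma E_sym:
  assumes p: "p \<in> G k" "bar p = p" and b: "b \<in> G i"
  shows "E b p = E (b * p) 1"
proof -
  have 2: "E b p + E b p = - E (b * p) 1" by (rule E_sym2[OF assms])
  have 3: "E (b * p) 1 + E (b * p) 1 + E (b * p) 1 = 0" by (rule E_three[OF G_mult'[OF b p(1)]])
  have "(E b p - E (b * p) 1) + (E b p - E (b * p) 1) = (E b p + E b p) - (E (b * p) 1 + E (b * p) 1)"
    by (simp add: algebra_simps)
  also have "\<dots> = 0" unfolding 2 using 3 by (simp add: algebra_simps neg_eq_iff_add_eq_0)
  finally have "E b p - E (b * p) 1 = 0" by (rule two_torsion_free)
  then show ?thesis by simp
qed

text \<open>\<open>F1\<close> at \<open>b = p = 1\<close> says that \<open>E d 1\<close> plus twice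
  \<open>E (bar d) 1\<close> is 0, and 2 acts as -1 by \<open>E_three\<close>.\<close>

lemma E_bar: assumes d: "d \<in> G k" shows "E (bar d) 1 = E d 1"
proof -
  have "E 1 (d + bar d) = E (d + bar d) 1" using E_sym[of "d + bar d" k 1 0] d by simp
  then have "E (d - bar d) 1 - E d 1 = E (d + bar d) 1"
    using F1[OF d one_G one_G bar_one] by (simp add: sk_def E.T_simps algebra_simps)
  then have "E d 1 + (E (bar d) 1 + E (bar d) 1) = 0"
    by (simp add: E.T_simps algebra_simps neg_eq_iff_add_eq_0)
  then show ?thesis using E_three[OF bar_G[OF d]] by (metis add.assoc add.commute add_left_cancel)
qed

lemma E_bar2:
  assumes "a \<in> G i" "b \<in> G j"
  shows "E (bar b * bar a) 1 = sg (i * j) (E (a * b) 1)"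
  using E_bar[OF G_mult'[OF assms]] unfolding bar_mult'[OF assms] E.T_sg by (metis sg_self)

lemma E_bar3:
  assumes "a \<in> G i" "b \<in> G j" "c \<in> G k"
  shows "E (bar c * bar b * bar a) 1 = sg (i * j + j * k + k * i) (E (a * b * c) 1)"
  using E_bar2[OF G_mult'[OF assms(1,2)] assms(3)] bar_mult'[OF assms(1,2)]
  by (cases i; cases j; cases k; simp add: E.T_simps mult.assoc)
     (simp_all add: equation_minus_iff)

text \<open>\<open>F1\<close> with \<open>d = p\<close> expresses \<open>E (b * p) q\<close> through
  the symmetric element \<open>p * q + sg (k * m) (q * p)\<close>. By \<open>E_sym\<close> this
  reads \<open>?x + ?x + ?y = 0\<close>, and three times \<open>?x\<close> is 0.\<close>

lemma E_swap:
  assumes p: "p \<in> G k" "bar p = p" and q: "q \<in> G m" "bar q = q" and b: "b \<in> G i"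
  shows "E (b * p * q) 1 = sg (k * m) (E (b * q * p) 1)"
proof -
  let ?x = "E (b * p * q) 1" and ?y = "sg (k * m) (E (b * q * p) 1)"
  have s: "p * q + sg (k * m) (q * p) \<in> G (k + m)" "bar (p * q + sg (k * m) (q * p)) = p * q + sg (k * m) (q * p)"
    using p q G_mult'[OF q(1) p(1)]
    by (simp_all add: bar_add bar_sg bar_mult'[OF p(1) q(1)] bar_mult'[OF q(1) p(1)] mult.commute)
  have "E b (p * q + sg (k * m) (q * p)) = ?x + ?y"
    using E_sym[OF s b] by (simp add: distrib_left sg_mult_right E.T_simps mult.assoc)
  moreover have "- E (b * p) q = E b (p * q + sg (k * m) (q * p))"
    using F1[OF p(1) b q] p(2) by (cases k; cases i; simp add: sk_def E.T_simps)
  moreover have "E (b * p) q = ?x" by (rule E_sym[OF q G_mult'[OF b p(1)]])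
  ultimately have 1: "?x + ?x + ?y = 0" by (simp add: neg_eq_iff_add_eq_0 algebra_simps)
  have "?x + ?x + ?x = 0" by (rule E_three[of _ "i + k + m"]) (use b p q in simp)
  with 1 show ?thesis by (metis add_left_cancel)
qed

lemma I3_map_E: "I3_map scale G bar (\<lambda>b. E b 1)"
proof (unfold_locales, goal_cases)
  case 1 show ?case by (simp add: E.T_simps)
next
  case 2 then show ?case by (rule E_three)
next
  case 3 then show ?case by (rule E_bar)
next
  case 4 then show ?case by (rule F2)
next
  case (5 p i q j c k)
  show ?case
    using E_swap[OF 5(2,5,1,4) bar_G[OF 5(3)]] E_bar3[OF 5(1,2,3)] E_bar3[OF 5(2,1,3)] 5(4,5)
    by (cases i; cases j; cases k; simp)
next
  case (6 a i b j c k)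
  have s: "E z (bar x * y + sg (p * q) (bar y * x)) = E (z * bar x * y) 1 + sg (p * q) (E (z * bar y * x) 1)"
    if "x \<in> G p" "y \<in> G q" "z \<in> G n" for x y z p q n
  proof -
    have "bar x * y + sg (p * q) (bar y * x) \<in> G (p + q)"
      using that G_mult'[OF bar_G[OF that(2)] that(1)] by (simp add: add.commute)
    moreover have "bar (bar x * y + sg (p * q) (bar y * x)) = bar x * y + sg (p * q) (bar y * x)"
      using that by (simp add: bar_add bar_sg bar_mult'[of _ p _ q] bar_mult'[of _ q _ p] mult.commute)
    ultimately have "E z (bar x * y + sg (p * q) (bar y * x)) = E (z * (bar x * y + sg (p * q) (bar y * x))) 1"
      using E_sym that(3) by blast
    then show ?thesis by (simp add: distrib_left sg_mult_right E.T_simps mult.assoc)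
  qed
  have 1: "E (bar x * y * bar z) 1 = sg (p * q + q * n + n * p) (E (z * bar y * x) 1)"
    if "x \<in> G p" "y \<in> G q" "z \<in> G n" for x y z p q n
    using E_bar3[OF that(3) bar_G[OF that(2)] that(1)] by (simp add: mult.commute add.commute add.left_commute)
  show ?case
    using F3[OF 6] unfolding s[OF 6] s[OF 6(2,3,1)] s[OF 6(3,1,2)] E.T_add_left 1[OF 6] 1[OF 6(2,3,1)] 1[OF 6(3,1,2)]
    by (cases i; cases j; cases k; simp add: algebra_simps)
qed

end

section \<open>The Lie superalgebra\<close>

lemma vec3_eq_iff: "(X :: 'a^3^3) = Y \<longleftrightarrow>
   X$1$1 = Y$1$1 \<and> X$1$2 = Y$1$2 \<and> X$1$3 = Y$1$3 \<and>
   X$2$1 = Y$2$1 \<and> X$2$2 = Y$2$2 \<and> X$2$3 = Y$2$3 \<and>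
   X$3$1 = Y$3$1 \<and> X$3$2 = Y$3$2 \<and> X$3$3 = Y$3$3"
  by (auto simp: vec_eq_iff forall_3)

lemma index_deg_simps [simp]: "index_deg 1 = 0" "index_deg 2 = 1" "index_deg 3 = 1"
  by (simp_all add: index_deg_def)

lemma mat_scale_nth [simp]: "mat_scale s c X $ i $ j = s c (X $ i $ j)"
  by (simp add: mat_scale_def)

lemma mat_mult_nth: "mat_mult X Y $ i $ j = X $ i $ 1 * Y $ 1 $ j + X $ i $ 2 * Y $ 2 $ j + X $ i $ 3 * Y $ 3 $ j"
  by (simp add: mat_mult_def sum_3)

lemma sg_nth [simp]: "sg p X $ i = sg p (X $ i)"
  by (cases p) simp_all

sublocale superalgebra \<subseteq> mat: graded_algebra "mat_scale scale" "mat_grading G" mat_mult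
proof
  fix X Y Z :: "'r^3^3" and c d :: 'k and i j
  show "mat_scale scale c (X + Y) = mat_scale scale c X + mat_scale scale c Y"
    "mat_scale scale (c + d) X = mat_scale scale c X + mat_scale scale d X"
    "mat_scale scale c (mat_scale scale d X) = mat_scale scale (c * d) X"
    "mat_scale scale 1 X = X"
    by (simp_all add: vec_eq_iff scale_right_distrib scale_left_distrib)
  show "module.subspace (mat_scale scale) (mat_grading G i)"
    by (subst module.subspace_def, unfold_locales)
       (auto simp: mat_grading_def vec_eq_iff scale_right_distrib scale_left_distrib)
  show "\<exists>U\<in>mat_grading G 0. \<exists>V\<in>mat_grading G 1. X = U + V"
  proof (intro bexI)
    show "X = (\<chi> p q. hcomp G (index_deg p + index_deg q + 0) (X $ p $ q))
      + (\<chi> p q. hcomp G (index_deg p + index_deg q + 1) (X $ p $ q))"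
      using hcomp_sum hcomp_sum[unfolded add.commute[of "hcomp G 0 _"]] by (auto simp: vec3_eq_iff)
  qed (auto simp: mat_grading_def)
  show "mat_grading G 0 \<inter> mat_grading G 1 = {0}"
  proof -
    have "x = 0" if "x \<in> G (i + 0)" "x \<in> G (i + 1)" for x i
      using that G_Int by (cases i) auto
    then have "X = 0" if "X \<in> mat_grading G 0" "X \<in> mat_grading G 1" for X :: "'r^3^3"
      using that unfolding mat_grading_def vec_eq_iff zero_index by blast
    then show ?thesis by (auto simp: mat_grading_def)
  qed
  show "mat_mult (X + Y) Z = mat_mult X Z + mat_mult Y Z" "mat_mult X (Y + Z) = mat_mult X Y + mat_mult X Z"
    by (simp_all add: vec_eq_iff mat_mult_nth algebra_simps)
  show "mat_mult (mat_scale scale c X) Y = mat_scale scale c (mat_mult X Y)"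
    "mat_mult X (mat_scale scale c Y) = mat_scale scale c (mat_mult X Y)"
    by (simp_all add: vec_eq_iff mat_mult_nth scale_right_distrib m_scale_left m_scale_right)
  show "mat_mult (mat_mult X Y) Z = mat_mult X (mat_mult Y Z)"
    by (simp add: vec_eq_iff mat_mult_nth algebra_simps)
  show "mat_mult X Y \<in> mat_grading G (i + j)" if X: "X \<in> mat_grading G i" and Y: "Y \<in> mat_grading G j"
  proof -
    have "X $ p $ r * Y $ r $ q \<in> G (index_deg p + index_deg q + (i + j))" for p q r
    proof -
      have "X $ p $ r \<in> G (index_deg p + index_deg r + i)" "Y $ r $ q \<in> G (index_deg r + index_deg q + j)"
        using X Y by (auto simp: mat_grading_def)
      from G_mult[OF this] show ?thesis
        by (cases "index_deg r") (simp_all add: add_ac)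
    qed
    then show ?thesis by (auto simp: mat_grading_def mat_mult_nth)
  qed
qed

section \<open>Coordinates and root vectors\<close>

context superalgebra_with_superinvolution
begin

text \<open>With \<open>a\<close> skew and \<open>p\<close>, \<open>q\<close> symmetric this is the
  general solution of \<open>osp_invol X = - X\<close>, see \<open>osp_invol_iff\<close>.\<close>

definition omat :: "'r \<Rightarrow> 'r \<Rightarrow> 'r \<Rightarrow> 'r \<Rightarrow> 'r \<Rightarrow> 'r \<Rightarrow> 'r^3^3" where
  "omat b c p q a d = vector [vector [a, b, - bar (par c)], vector [c, d, q], vector [bar (par b), p, - bar d]]"

lemma omat_nth [simp]:
  "omat b c p q a d $ 1 $ 1 = a" "omat b c p q a d $ 1 $ 2 = b" "omat b c p q a d $ 1 $ 3 = - bar (par c)"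
  "omat b c p q a d $ 2 $ 1 = c" "omat b c p q a d $ 2 $ 2 = d" "omat b c p q a d $ 2 $ 3 = q"
  "omat b c p q a d $ 3 $ 1 = bar (par b)" "omat b c p q a d $ 3 $ 2 = p" "omat b c p q a d $ 3 $ 3 = - bar d"
  by (simp_all add: omat_def)

text \<open>Root vectors for \<open>hm 0 1\<close>: \<open>xm\<close>, \<open>ym\<close>,
  \<open>em\<close>, \<open>fm\<close>, \<open>hm\<close> have the weights -1, 1, -2, 2, 0.\<close>

abbreviation xm where "xm b \<equiv> omat b 0 0 0 0 0"
abbreviation ym where "ym c \<equiv> omat 0 c 0 0 0 0"
abbreviation em where "em p \<equiv> omat 0 0 p 0 0 0"
abbreviation fm where "fm q \<equiv> omat 0 0 0 q 0 0"
abbreviation hm where "hm a d \<equiv> omat 0 0 0 0 a d"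

lemma omat_add: "omat b c p q a d + omat b' c' p' q' a' d' = omat (b + b') (c + c') (p + p') (q + q') (a + a') (d + d')"
  by (simp add: vec3_eq_iff bar_add par_add)

lemma omat_minus: "- omat b c p q a d = omat (- b) (- c) (- p) (- q) (- a) (- d)"
  by (simp add: vec3_eq_iff bar_minus par_minus)

lemma omat_diff: "omat b c p q a d - omat b' c' p' q' a' d' = omat (b - b') (c - c') (p - p') (q - q') (a - a') (d - d')"
  by (simp add: vec3_eq_iff bar_diff par_diff)

lemma omat_scale: "mat_scale scale k (omat b c p q a d) = omat (scale k b) (scale k c) (scale k p) (scale k q) (scale k a) (scale k d)"
  by (simp add: vec3_eq_iff bar_scale par_scale)

lemma omat_sg: "sg k (omat b c p q a d) = omat (sg k b) (sg k c) (sg k p) (sg k q) (sg k a) (sg k d)"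
  by (cases k) (simp_all add: omat_minus)

lemma omat_0 [simp]: "omat 0 0 0 0 0 0 = 0"
  by (simp add: vec3_eq_iff)

lemma omat_split: "omat b c p q a d = xm b + ym c + em p + fm q + hm a d"
  by (simp add: omat_add)

lemma omat_G:
  assumes "b \<in> G (i + 1)" "c \<in> G (i + 1)" "p \<in> G i" "q \<in> G i" "a \<in> G i" "d \<in> G i"
  shows "omat b c p q a d \<in> mat_grading G i"
  using assms by (simp add: mat_grading_def forall_3 add.commute)

lemma xm_G [simp]: "b \<in> G i \<Longrightarrow> xm b \<in> mat_grading G (i + 1)"
  and ym_G [simp]: "b \<in> G i \<Longrightarrow> ym b \<in> mat_grading G (i + 1)"
  and em_G [simp]: "b \<in> G i \<Longrightarrow> em b \<in> mat_grading G i"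
  and fm_G [simp]: "b \<in> G i \<Longrightarrow> fm b \<in> mat_grading G i"
  and hm_G [simp]: "b \<in> G i \<Longrightarrow> d \<in> G i \<Longrightarrow> hm b d \<in> mat_grading G i"
  by (rule omat_G; simp add: add.assoc)+

lemma osp_invol_iff:
  "osp_invol G bar X = - X \<longleftrightarrow> (\<exists>b c p q a d. X = omat b c p q a d \<and> bar a = - a \<and> bar p = p \<and> bar q = q)"
proof
  assume "osp_invol G bar X = - X"
  then have *: "bar (X$1$1) = - X$1$1" "- bar (par (X$3$1)) = - X$1$2" "bar (par (X$2$1)) = - X$1$3"
     "bar (par (X$1$3)) = - X$2$1" "bar (X$3$3) = - X$2$2" "- bar (X$2$3) = - X$2$3"
     "- bar (par (X$1$2)) = - X$3$1" "- bar (X$3$2) = - X$3$2" "bar (X$2$2) = - X$3$3"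
    by (simp_all add: vec3_eq_iff osp_invol_def rho_eq Let_def)
  have "X = omat (X$1$2) (X$2$1) (X$3$2) (X$2$3) (X$1$1) (X$2$2)"
    using * by (simp add: vec3_eq_iff)
  then show "\<exists>b c p q a d. X = omat b c p q a d \<and> bar a = - a \<and> bar p = p \<and> bar q = q"
    using * by (metis neg_equal_iff_equal)
next
  assume "\<exists>b c p q a d. X = omat b c p q a d \<and> bar a = - a \<and> bar p = p \<and> bar q = q"
  then show "osp_invol G bar X = - X"
    by (auto simp: vec3_eq_iff osp_invol_def rho_eq Let_def bar_par[symmetric] bar_minus par_minus)
qed

text \<open>The master formula: the brackets of root vectors below are its specialisations.\<close>

lemma omat_br:
  assumes b: "b \<in> G (i + 1)" and c: "c \<in> G (i + 1)" and p: "p \<in> G i" "bar p = p" and q: "q \<in> G i" "bar q = q"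
    and a: "a \<in> G i" "bar a = - a" and d: "d \<in> G i"
    and b': "b' \<in> G (j + 1)" and c': "c' \<in> G (j + 1)" and p': "p' \<in> G j" "bar p' = p'" and q': "q' \<in> G j" "bar q' = q'"
    and a': "a' \<in> G j" "bar a' = - a'" and d': "d' \<in> G j"
  shows "mat.br (omat b c p q a d) (omat b' c' p' q' a' d') = omat
     (a * b' + b * d' - bar (par c) * p' - sg (i * j) (a' * b + b' * d - bar (par c') * p))
     (c * a' + d * c' + q * bar (par b') - sg (i * j) (c' * a + d' * c + q' * bar (par b)))
     (bar (par b) * b' + p * d' - bar d * p' - sg (i * j) (bar (par b') * b + p' * d - bar d' * p))
     (d * q' - c * bar (par c') - q * bar d' - sg (i * j) (d' * q - c' * bar (par c) - q' * bar d))
     (a * a' + b * c' - bar (par c) * bar (par b') - sg (i * j) (a' * a + b' * c - bar (par c') * bar (par b)))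
     (c * b' + d * d' + q * p' - sg (i * j) (c' * b + d' * d + q' * p))"
proof -
  note G = mat.br_hom[OF omat_G[OF b c p(1) q(1) a(1) d] omat_G[OF b' c' p'(1) q'(1) a'(1) d']]
  note P = par_hom[OF b] par_hom[OF c] par_hom[OF p(1)] par_hom[OF q(1)] par_hom[OF a(1)] par_hom[OF d]
    par_hom[OF b'] par_hom[OF c'] par_hom[OF p'(1)] par_hom[OF q'(1)] par_hom[OF a'(1)] par_hom[OF d']
  note B = bar_mult'[OF c a'(1)] bar_mult'[OF d c'] bar_mult'[OF q(1) bar_G[OF b']]
    bar_mult'[OF c' a(1)] bar_mult'[OF d' c] bar_mult'[OF q'(1) bar_G[OF b]]
    bar_mult'[OF a(1) b'] bar_mult'[OF b d'] bar_mult'[OF bar_G[OF c] p'(1)]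
    bar_mult'[OF a'(1) b] bar_mult'[OF b' d] bar_mult'[OF bar_G[OF c'] p(1)]
    bar_mult'[OF c b'] bar_mult'[OF d d'] bar_mult'[OF q(1) p'(1)]
    bar_mult'[OF c' b] bar_mult'[OF d' d] bar_mult'[OF q'(1) p(1)]
  note S = p(2) q(2) a(2) p'(2) q'(2) a'(2)
  show ?thesis
    unfolding G
    by (cases i; cases j;
        simp add: vec3_eq_iff mat_mult_nth P B S par_mult par_add par_diff par_minus bar_par[symmetric]
          bar_add bar_diff bar_minus algebra_simps)
qed

lemma br_hx:
  assumes "a \<in> G k" "bar a = - a" "d \<in> G k" "b \<in> G i"
  shows "mat.br (hm a d) (xm b) = xm (a * b - sg (k * (i + 1)) (b * d))"
  using omat_br[of 0 k 0 0 0 a d b "i + 1" 0 0 0 0 0] assms by (simp add: add.assoc)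

lemma br_hy:
  assumes "a \<in> G k" "bar a = - a" "d \<in> G k" "c \<in> G j"
  shows "mat.br (hm a d) (ym c) = ym (d * c - sg (k * (j + 1)) (c * a))"
  using omat_br[of 0 k 0 0 0 a d 0 "j + 1" c 0 0 0 0] assms by (simp add: add.assoc)

lemma br_he:
  assumes "a \<in> G k" "bar a = - a" "d \<in> G k" "p \<in> G m" "bar p = p"
  shows "mat.br (hm a d) (em p) = em (- (bar d * p) - sg (k * m) (p * d))"
  using omat_br[of 0 k 0 0 0 a d 0 m 0 p 0 0 0] assms by simp

lemma br_xx:
  assumes "b \<in> G i" "b' \<in> G j"
  shows "mat.br (xm b) (xm b') = em (sg i (bar b * b' + sg (i * j) (bar b' * b)))"
  using omat_br[of b "i + 1" 0 0 0 0 0 b' "j + 1" 0 0 0 0 0] assms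
  by (cases i; cases j; simp add: par_hom bar_minus)

text \<open>The (2,2) entry sees \<open>b\<close> and \<open>c\<close> only through the product
  \<open>c * b\<close>, the (1,1) entry through \<open>sk (b * c)\<close>. Pairs with the same (2,2)
  entry may thus differ by \<open>sk\<close> of a commutator.\<close>

lemma br_xy:
  assumes "b \<in> G i" "c \<in> G j"
  shows "mat.br (xm b) (ym c) = hm (sk (b * c)) (sg (i * j + i + j) (c * b))"
  using omat_br[of b "i + 1" 0 0 0 0 0 0 "j + 1" c 0 0 0 0] assms
  by (cases i; cases j; simp add: par_hom bar_minus sk_def bar_mult')

lemma br_yy:
  assumes "c \<in> G k" "c' \<in> G l"
  shows "mat.br (ym c) (ym c') = fm (- sg l (c * bar c' + sg (k * l) (c' * bar c)))"
  using omat_br[of 0 "k + 1" c 0 0 0 0 0 "l + 1" c' 0 0 0 0] assms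
  by (cases k; cases l; simp add: par_hom bar_minus add.commute)

lemma br_ey:
  assumes "p \<in> G m" "bar p = p" "c \<in> G k"
  shows "mat.br (em p) (ym c) = xm (sg (m * k + m + k) (bar c * p))"
  using omat_br[of 0 m 0 p 0 0 0 0 "k + 1" c 0 0 0 0] assms
  by (cases m; cases k; simp add: par_hom bar_minus)

lemma br_fx:
  assumes "q \<in> G m" "bar q = q" "b \<in> G i"
  shows "mat.br (fm q) (xm b) = ym (sg i (q * bar b))"
  using omat_br[of 0 m 0 0 q 0 0 b "i + 1" 0 0 0 0 0] assms
  by (cases m; cases i; simp add: par_hom bar_minus)

lemma br_ex: "p \<in> G m \<Longrightarrow> bar p = p \<Longrightarrow> b \<in> G i \<Longrightarrow> mat.br (em p) (xm b) = 0"
  using omat_br[of 0 m 0 p 0 0 0 b "i + 1" 0 0 0 0 0] by simp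

lemma br_fy: "q \<in> G m \<Longrightarrow> bar q = q \<Longrightarrow> c \<in> G i \<Longrightarrow> mat.br (fm q) (ym c) = 0"
  using omat_br[of 0 m 0 0 q 0 0 0 "i + 1" c 0 0 0 0] by simp

lemma br_ef:
  assumes "p \<in> G m" "bar p = p" "q \<in> G n" "bar q = q"
  shows "mat.br (em p) (fm q) = hm 0 (- sg (m * n) (q * p))"
  using omat_br[of 0 m 0 p 0 0 0 0 n 0 0 q 0 0] assms by simp

lemma br_ee: "p \<in> G m \<Longrightarrow> bar p = p \<Longrightarrow> p' \<in> G n \<Longrightarrow> bar p' = p' \<Longrightarrow> mat.br (em p) (em p') = 0"
  using omat_br[of 0 m 0 p 0 0 0 0 n 0 p' 0 0 0] by simp

lemma br_ff: "p \<in> G m \<Longrightarrow> bar p = p \<Longrightarrow> p' \<in> G n \<Longrightarrow> bar p' = p' \<Longrightarrow> mat.br (fm p) (fm p') = 0"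
  using omat_br[of 0 m 0 0 p 0 0 0 n 0 0 p' 0 0] by simp

definition Lie :: "('r^3^3) set" where
  "Lie = mat.span {mat.br X Y | X Y. osp_invol G bar X = - X \<and> osp_invol G bar Y = - Y}"

lemma osp_eq: "osp scale G bar = kmod_of (mat_scale scale) Lie"
  by (simp add: osp_def Lie_def mat_com_def)

lemma Lie_closed [simp]: "0 \<in> Lie" "X \<in> Lie \<Longrightarrow> Y \<in> Lie \<Longrightarrow> X + Y \<in> Lie"
  "X \<in> Lie \<Longrightarrow> Y \<in> Lie \<Longrightarrow> X - Y \<in> Lie" "X \<in> Lie \<Longrightarrow> - X \<in> Lie"
  "X \<in> Lie \<Longrightarrow> mat_scale scale c X \<in> Lie" "X \<in> Lie \<Longrightarrow> sg p X \<in> Lie"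
  unfolding Lie_def
  by (simp_all add: mat.span_zero mat.span_add mat.span_diff mat.span_neg mat.span_scale sg_def)

end

section \<open>The derived algebra when 2 is invertible\<close>

locale osp_setting = superalgebra_with_superinvolution scale G bar
  for scale :: "'k::comm_ring_1 \<Rightarrow> 'r::{ring, monoid_mult} \<Rightarrow> 'r" and G bar +
  assumes two_dvd: "(2::'k) dvd 1"
begin

definition hlf :: 'k where "hlf = (SOME h. h * 2 = 1)"

lemma hlf: "hlf + hlf = 1"
proof -
  have "\<exists>h::'k. h * 2 = 1" using two_dvd by (metis dvdE mult.commute)
  then have "hlf * 2 = 1" unfolding hlf_def by (rule someI_ex)
  then show ?thesis by (simp add: mult.commute)
qed

lemma scale_hlf: "scale hlf a + scale hlf a = a"
  by (metis hlf scale_left_distrib scale_one)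

lemma osp_omat: "bar a = - a \<Longrightarrow> bar p = p \<Longrightarrow> bar q = q \<Longrightarrow> osp_invol G bar (omat b c p q a d) = - omat b c p q a d"
  using osp_invol_iff by blast

lemma Lie_br: "osp_invol G bar X = - X \<Longrightarrow> osp_invol G bar Y = - Y \<Longrightarrow> mat.br X Y \<in> Lie"
  unfolding Lie_def by (rule mat.span_base) blast

lemma br_D1: "b \<in> G i \<Longrightarrow> mat.br (hm 0 1) (xm b) = - xm b"
  "c \<in> G i \<Longrightarrow> mat.br (hm 0 1) (ym c) = ym c"
  by (simp_all add: br_hx[of 0 0 1] br_hy[of 0 0 1] omat_minus)

text \<open>\<open>xm b\<close> is an eigenvector of \<open>hm 0 1\<close>, which satisfies
  \<open>osp_invol X = - X\<close>, with an invertible eigenvalue.\<close>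

lemma xm_Lie [simp]: "xm b \<in> Lie"
proof (induction b rule: homogeneous_induct)
  case (1 i b)
  have "- mat.br (hm 0 1) (xm b) \<in> Lie" by (intro Lie_closed Lie_br osp_omat) simp_all
  then show ?case by (simp add: br_D1[OF 1])
next
  case (2 b b') then show ?case using Lie_closed(2)[of "xm b" "xm b'"] by (simp add: omat_add)
qed

lemma ym_Lie [simp]: "ym c \<in> Lie"
proof (induction c rule: homogeneous_induct)
  case (1 i b)
  have "mat.br (hm 0 1) (ym b) \<in> Lie" by (intro Lie_closed Lie_br osp_omat) simp_all
  then show ?case by (simp add: br_D1[OF 1])
next
  case (2 b b') then show ?case using Lie_closed(2)[of "ym b" "ym b'"] by (simp add: omat_add)
qed

lemma bar_hcomp: "bar (hcomp G i a) = hcomp G i (bar a)"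
proof -
  have "hcomp G i (bar a) = bar (hcomp G i a)"
    using hcomp_compl[of a i] by (intro hcomp_unique) (simp_all add: bar_diff[symmetric])
  then show ?thesis by simp
qed

text \<open>The homogeneous components of a symmetric element are symmetric, since
  \<open>bar\<close> preserves degrees.\<close>

lemma sym_induct [consumes 1, case_names hom add]:
  assumes p: "bar p = p" and P: "\<And>i p. p \<in> G i \<Longrightarrow> bar p = p \<Longrightarrow> P p" "\<And>p q. P p \<Longrightarrow> P q \<Longrightarrow> P (p + q)"
  shows "P p"
  using P(2)[OF P(1)[OF hcomp_mem] P(1)[OF hcomp_mem], of 0 p 1 p] by (simp add: hcomp_sum bar_hcomp p)

text \<open>\<open>hlf\<close> makes up for the symmetrisation in \<open>br_xx\<close>, and
  \<open>sg i\<close> for the sign there.\<close>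

lemma em_br: "p \<in> G i \<Longrightarrow> bar p = p \<Longrightarrow> em p = mat.br (xm (sg i (scale hlf p))) (xm 1)"
  using br_xx[OF G_closed(6)[OF G_closed(5)] one_G, of p i i hlf] scale_hlf[of p]
  by (cases i) (simp_all add: bar_scale bar_minus omat_minus mat.br_minus)

lemma fm_br: "q \<in> G i \<Longrightarrow> bar q = q \<Longrightarrow> fm q = mat.br (ym (- scale hlf q)) (ym 1)"
  using br_yy[OF G_closed(4)[OF G_closed(5)] one_G, of q i hlf] scale_hlf[of q]
  by (simp_all add: bar_scale bar_minus)

lemma em_Lie: "bar p = p \<Longrightarrow> em p \<in> Lie"
proof (induction p rule: sym_induct)
  case (hom i p)
  show ?case unfolding em_br[OF hom] by (intro Lie_br osp_omat) simp_all
next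
  case (add p q) then show ?case using Lie_closed(2)[of "em p" "em q"] by (simp add: omat_add)
qed

lemma fm_Lie: "bar p = p \<Longrightarrow> fm p \<in> Lie"
proof (induction p rule: sym_induct)
  case (hom i p)
  show ?case unfolding fm_br[OF hom] by (intro Lie_br osp_omat) simp_all
next
  case (add p q) then show ?case using Lie_closed(2)[of "fm p" "fm q"] by (simp add: omat_add)
qed

lemma xy_Lie: "mat.br (xm b) (ym c) \<in> Lie"
  by (intro Lie_br osp_omat) simp_all

text \<open>The diagonal elements of the derived algebra: \<open>d\<close> is arbitrary, and \<open>a\<close> is determined by \<open>d\<close> up
  to the span of the \<open>sk [x, y]\<close>.\<close>

definition S :: "'r set" where "S = span {sk (br x y) | x y. \<exists>i j. x \<in> G i \<and> y \<in> G j}"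

lemma S_closed [simp]: "0 \<in> S" "X \<in> S \<Longrightarrow> Y \<in> S \<Longrightarrow> X + Y \<in> S"
  "X \<in> S \<Longrightarrow> Y \<in> S \<Longrightarrow> X - Y \<in> S" "X \<in> S \<Longrightarrow> - X \<in> S"
  "X \<in> S \<Longrightarrow> scale c X \<in> S" "X \<in> S \<Longrightarrow> sg p X \<in> S"
  unfolding S_def by (simp_all add: span_zero span_add span_diff span_neg span_scale sg_def)

lemma S_base: "x \<in> G i \<Longrightarrow> y \<in> G j \<Longrightarrow> sk (br x y) \<in> S"
  unfolding S_def by (rule span_base) blast

lemma S_br: "x \<in> G i \<Longrightarrow> y \<in> G j \<Longrightarrow> bar (br x y) = - br x y \<Longrightarrow> br x y \<in> S"
  using S_closed(5)[OF S_base, of x i y j hlf] scale_hlf[of "br x y"]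
  by (simp add: sk_def scale_right_distrib)

text \<open>Normal form of the derived algebra: the conditions of \<open>osp_invol_iff\<close>, and
  on the diagonal \<open>a\<close> is \<open>sk (par d)\<close> modulo \<open>S\<close>. The twist
  by \<open>par\<close> is the sign of the (2,2) entry in \<open>br_xy\<close>.\<close>

definition Lrep :: "'r^3^3 \<Rightarrow> bool" where
  "Lrep X \<longleftrightarrow> (\<exists>b c p q a d. X = omat b c p q a d \<and> bar a = - a \<and> bar p = p \<and> bar q = q \<and> a - sk (par d) \<in> S)"

lemma Lrep_omat: "bar a = - a \<Longrightarrow> bar p = p \<Longrightarrow> bar q = q \<Longrightarrow> a - sk (par d) \<in> S \<Longrightarrow> Lrep (omat b c p q a d)"
  unfolding Lrep_def by blast

lemma Lrep_add: "Lrep X \<Longrightarrow> Lrep Y \<Longrightarrow> Lrep (X + Y)"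
proof -
  assume "Lrep X" "Lrep Y"
  then obtain b c p q a d b' c' p' q' a' d' where
    1: "X = omat b c p q a d" "bar a = - a" "bar p = p" "bar q = q" "a - sk (par d) \<in> S" and
    2: "Y = omat b' c' p' q' a' d'" "bar a' = - a'" "bar p' = p'" "bar q' = q'" "a' - sk (par d') \<in> S"
    unfolding Lrep_def by blast
  have "a + a' - sk (par (d + d')) \<in> S" using S_closed(2)[OF 1(5) 2(5)] by (simp add: par_add sk_add algebra_simps)
  then show ?thesis unfolding 1(1) 2(1) omat_add using 1 2 by (intro Lrep_omat) (simp_all add: bar_add)
qed

lemma Lrep_scale: "Lrep X \<Longrightarrow> Lrep (mat_scale scale k X)"
proof -
  assume "Lrep X"
  then obtain b c p q a d where
    1: "X = omat b c p q a d" "bar a = - a" "bar p = p" "bar q = q" "a - sk (par d) \<in> S"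
    unfolding Lrep_def by blast
  have "scale k a - sk (par (scale k d)) \<in> S"
    using S_closed(5)[OF 1(5)] by (simp add: par_scale sk_scale scale_right_diff_distrib)
  then show ?thesis unfolding 1(1) omat_scale using 1 by (intro Lrep_omat) (simp_all add: bar_scale)
qed

text \<open>Each contribution to the diagonal lies in \<open>S\<close> by itself: \<open>S1\<close>
  and \<open>S2\<close> are commutators, \<open>S3\<close> and \<open>S4\<close> compare
  \<open>b * c'\<close> and \<open>b' * c\<close> with the opposite products, and in
  \<open>S5\<close> and \<open>S6\<close> the element \<open>sk (q * p')\<close> of two symmetric
  factors is their commutator.\<close>

lemma Lrep_br_hom:
  assumes b: "b \<in> G (i + 1)" and c: "c \<in> G (i + 1)" and p: "p \<in> G i" "bar p = p" and q: "q \<in> G i" "bar q = q"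
    and a: "a \<in> G i" "bar a = - a" and d: "d \<in> G i"
    and b': "b' \<in> G (j + 1)" and c': "c' \<in> G (j + 1)" and p': "p' \<in> G j" "bar p' = p'" and q': "q' \<in> G j" "bar q' = q'"
    and a': "a' \<in> G j" "bar a' = - a'" and d': "d' \<in> G j"
  shows "Lrep (mat.br (omat b c p q a d) (omat b' c' p' q' a' d'))"
proof -
  have e1: "b * c' + sg (i * j) (bar (par c') * bar (par b)) = sk (b * c')"
    using bar_mult'[OF b c'] by (cases i; cases j; simp add: par_hom[OF b] par_hom[OF c'] sk_def bar_minus)
  have e2: "b' * c + sg (i * j) (bar (par c) * bar (par b')) = sk (b' * c)"
    using bar_mult'[OF b' c] by (cases i; cases j; simp add: par_hom[OF b'] par_hom[OF c] sk_def bar_minus)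
  have eq11: "a * a' + b * c' - bar (par c) * bar (par b') - sg (i * j) (a' * a + b' * c - bar (par c') * bar (par b))
    = br a a' + sk (b * c') - sg (i * j) (sk (b' * c))"
    unfolding e1[symmetric] e2[symmetric] br_hom[OF a(1) a'(1)]
    by (cases i; cases j; simp add: algebra_simps)
  have brs: "bar (br a a') = - br a a'" "bar (br q p') = - br q p'" "bar (br q' p) = - br q' p"
    using bar_br[OF a(1) a'(1)] bar_br[OF q(1) p'(1)] bar_br[OF q'(1) p(1)] a a' q q' p p' by (simp_all add: br_minus)
  have S1: "br a a' \<in> S" by (rule S_br[OF a(1) a'(1) brs(1)])
  have S2: "sk (par (d * d' - sg (i * j) (d' * d))) \<in> S"
    using S_closed(6)[OF S_base[OF d d'], of "i + j"] par_hom[OF br_G[OF d d']] by (simp add: br_hom[OF d d'] sk_sg)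
  have S3: "sk (b * c') + sg (i * j) (sk (par (c' * b))) \<in> S"
    using S_base[OF b c'] by (cases i; cases j; simp add: br_hom[OF b c'] par_mult par_hom[OF b] par_hom[OF c'] sk_diff sk_add sk_minus)
  have S4: "sk (b' * c) + sg (i * j) (sk (par (c * b'))) \<in> S"
    using S_base[OF b' c] by (cases i; cases j; simp add: br_hom[OF b' c] par_mult par_hom[OF b'] par_hom[OF c] sk_diff sk_add sk_minus)
  have S5: "sk (par (q * p')) \<in> S"
    using S_closed(6)[OF S_br[OF q(1) p'(1) brs(2)], of "i + j"] bar_mult'[OF q(1) p'(1)]
    by (simp add: par_hom[OF G_mult'[OF q(1) p'(1)]] sk_sg) (simp add: sk_def br_hom[OF q(1) p'(1)] p' q)
  have S6: "sk (par (q' * p)) \<in> S"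
    using S_closed(6)[OF S_br[OF q'(1) p(1) brs(3)], of "j + i"] bar_mult'[OF q'(1) p(1)]
    by (simp add: par_hom[OF G_mult'[OF q'(1) p(1)]] sk_sg) (simp add: sk_def br_hom[OF q'(1) p(1)] p q')
  have "br a a' + sk (b * c') - sg (i * j) (sk (b' * c)) - sk (par (c * b' + d * d' + q * p' - sg (i * j) (c' * b + d' * d + q' * p)))
    = br a a' - sk (par (d * d' - sg (i * j) (d' * d))) + (sk (b * c') + sg (i * j) (sk (par (c' * b))))
      - sg (i * j) (sk (b' * c) + sg (i * j) (sk (par (c * b')))) - sk (par (q * p')) + sg (i * j) (sk (par (q' * p)))"
    by (cases i; cases j; simp add: par_add par_diff par_minus sk_add sk_diff sk_minus algebra_simps)
  also have "\<dots> \<in> S" by (intro S_closed S1 S2 S3 S4 S5 S6)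
  finally have *: "br a a' + sk (b * c') - sg (i * j) (sk (b' * c)) - sk (par (c * b' + d * d' + q * p' - sg (i * j) (c' * b + d' * d + q' * p))) \<in> S" .
  have s32: "bar (bar (par b) * b' + p * d' - bar d * p' - sg (i * j) (bar (par b') * b + p' * d - bar d' * p))
     = bar (par b) * b' + p * d' - bar d * p' - sg (i * j) (bar (par b') * b + p' * d - bar d' * p)"
    using bar_mult'[OF bar_G[OF b] b'] bar_mult'[OF bar_G[OF b'] b] bar_mult'[OF p(1) d'] bar_mult'[OF p'(1) d]
      bar_mult'[OF bar_G[OF d] p'(1)] bar_mult'[OF bar_G[OF d'] p(1)]
    by (cases i; cases j; simp add: par_hom[OF b] par_hom[OF b'] bar_add bar_diff bar_minus p p')
  have s23: "bar (d * q' - c * bar (par c') - q * bar d' - sg (i * j) (d' * q - c' * bar (par c) - q' * bar d))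
     = d * q' - c * bar (par c') - q * bar d' - sg (i * j) (d' * q - c' * bar (par c) - q' * bar d)"
    using bar_mult'[OF c bar_G[OF c']] bar_mult'[OF c' bar_G[OF c]] bar_mult'[OF d q'(1)] bar_mult'[OF d' q(1)]
      bar_mult'[OF q(1) bar_G[OF d']] bar_mult'[OF q'(1) bar_G[OF d]]
    by (cases i; cases j; simp add: par_hom[OF c] par_hom[OF c'] bar_add bar_diff bar_minus q q' algebra_simps)
  show ?thesis
    unfolding omat_br[OF assms] eq11
    by (rule Lrep_omat[OF _ s32 s23 *]) (simp add: bar_add bar_diff bar_sg brs bar_sk sg_minus)
qed

definition osp_hom :: "bit \<Rightarrow> 'r^3^3 \<Rightarrow> bool" where
  "osp_hom i X \<longleftrightarrow> (\<exists>b c p q a d. X = omat b c p q a d \<and> b \<in> G (i + 1) \<and> c \<in> G (i + 1) \<and> p \<in> G i \<and> q \<in> G i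
     \<and> a \<in> G i \<and> d \<in> G i \<and> bar a = - a \<and> bar p = p \<and> bar q = q)"

lemma osp_decomp:
  assumes "osp_invol G bar X = - X"
  shows "\<exists>X0 X1. X = X0 + X1 \<and> osp_hom 0 X0 \<and> osp_hom 1 X1"
proof -
  obtain b c p q a d where X: "X = omat b c p q a d" "bar a = - a" "bar p = p" "bar q = q"
    using assms osp_invol_iff by blast
  have 1: "hcomp G 1 x + hcomp G 0 x = x" for x using hcomp_sum[of x] by (simp add: add.commute)
  have 2: "hcomp G i (- a) = - hcomp G i a" for i
    using hcomp_add[of i a "- a"] by (simp add: eq_neg_iff_add_eq_0 add.commute)
  have 3: "bar (hcomp G i a) = - hcomp G i a" "bar (hcomp G i p) = hcomp G i p" "bar (hcomp G i q) = hcomp G i q" for i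
    using X by (simp_all add: bar_hcomp 2)
  have 4: "osp_hom i (omat (hcomp G (i + 1) b) (hcomp G (i + 1) c) (hcomp G i p) (hcomp G i q) (hcomp G i a) (hcomp G i d))" for i
    unfolding osp_hom_def by (intro exI conjI, rule refl) (simp_all add: 3)
  have "X = omat (hcomp G 1 b) (hcomp G 1 c) (hcomp G 0 p) (hcomp G 0 q) (hcomp G 0 a) (hcomp G 0 d)
      + omat (hcomp G 0 b) (hcomp G 0 c) (hcomp G 1 p) (hcomp G 1 q) (hcomp G 1 a) (hcomp G 1 d)"
    by (simp add: X omat_add 1 hcomp_sum)
  then show ?thesis using 4[of 0] 4[of 1] by auto
qed

lemma Lrep_br_osp_hom: "osp_hom i X \<Longrightarrow> osp_hom j Y \<Longrightarrow> Lrep (mat.br X Y)"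
  unfolding osp_hom_def by (elim exE conjE) (hypsubst, rule Lrep_br_hom)

lemma Lrep_br:
  assumes "osp_invol G bar X = - X" "osp_invol G bar Y = - Y" shows "Lrep (mat.br X Y)"
proof -
  obtain X0 X1 Y0 Y1 where X: "X = X0 + X1" "osp_hom 0 X0" "osp_hom 1 X1"
    and Y: "Y = Y0 + Y1" "osp_hom 0 Y0" "osp_hom 1 Y1"
    using osp_decomp[OF assms(1)] osp_decomp[OF assms(2)] by blast
  show ?thesis unfolding X(1) Y(1) mat.br_add_left mat.br_add_right
    using Lrep_br_osp_hom X Y by (blast intro: Lrep_add)
qed

lemma Lie_Lrep: "X \<in> Lie \<Longrightarrow> Lrep X"
  unfolding Lie_def
proof (induction rule: mat.span_induct_alt)
  case base
  have "omat 0 0 0 0 0 0 = 0" by simp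
  moreover have "Lrep (omat 0 0 0 0 0 0)" by (rule Lrep_omat) (simp_all add: sk_def)
  ultimately show ?case by simp
next
  case (step c x y)
  then show ?case using Lrep_br by (auto intro!: Lrep_add Lrep_scale)
qed

text \<open>Brackets of \<open>xm\<close> with \<open>ym\<close> take the place of diagonal
  generators, since \<open>hm a d\<close> need not lie in \<open>Lie\<close>. They suffice:
  \<open>hm (sk (par d)) d\<close> is one such bracket with \<open>ym 1\<close>, and
  \<open>hm s 0\<close> for \<open>s\<close> in \<open>S\<close> is built from differences of
  two.\<close>

lemma Lie_induct [consumes 1, case_names x y e f xy add scale]:
  assumes X: "X \<in> Lie"
    and x: "\<And>i b. b \<in> G i \<Longrightarrow> P (xm b)" and y: "\<And>i c. c \<in> G i \<Longrightarrow> P (ym c)"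
    and e: "\<And>i p. p \<in> G i \<Longrightarrow> bar p = p \<Longrightarrow> P (em p)" and f: "\<And>i q. q \<in> G i \<Longrightarrow> bar q = q \<Longrightarrow> P (fm q)"
    and xy: "\<And>i j b c. b \<in> G i \<Longrightarrow> c \<in> G j \<Longrightarrow> P (mat.br (xm b) (ym c))"
    and add: "\<And>X Y. X \<in> Lie \<Longrightarrow> Y \<in> Lie \<Longrightarrow> P X \<Longrightarrow> P Y \<Longrightarrow> P (X + Y)"
    and scale: "\<And>c X. X \<in> Lie \<Longrightarrow> P X \<Longrightarrow> P (mat_scale scale c X)"
  shows "P X"
proof -
  obtain b c p q a d where X: "X = omat b c p q a d" "bar a = - a" "bar p = p" "bar q = q" "a - sk (par d) \<in> S"
    using Lie_Lrep[OF X] unfolding Lrep_def by blast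
  have minus: "P (- X)" if "X \<in> Lie" "P X" for X using scale[OF that, of "- 1"] by (simp del: vector_uminus_component)
  have sg: "P (sg p X)" if "X \<in> Lie" "P X" for X p using minus[OF that] that by (cases p) simp_all
  have D: "hm (sk (par d)) d \<in> Lie \<and> P (hm (sk (par d)) d)" for d
  proof (induction d rule: homogeneous_induct)
    case (1 i d)
    have "hm (sk (par d)) d = mat.br (xm (sg i d)) (ym 1)"
      using br_xy[OF G_closed(6)[OF 1] one_G, of i] by (simp add: par_hom[OF 1])
    then show ?case using xy[OF G_closed(6)[OF 1] one_G, of i] xy_Lie by simp
  next
    case (2 d d')
    then show ?case using Lie_closed(2)[of "hm (sk (par d)) d" "hm (sk (par d')) d'"] add[of "hm (sk (par d)) d" "hm (sk (par d')) d'"]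
      by (simp add: omat_add par_add sk_add)
  qed
  have s: "hm s 0 \<in> Lie \<and> P (hm s 0)" if "s \<in> S" for s
    using that unfolding S_def
  proof (induction rule: span_induct_alt)
    case base
    show ?case using x[of 0 0] by simp
  next
    case (step k z w)
    then obtain x y i j where z: "z = sk (br x y)" "x \<in> G i" "y \<in> G j" by blast
    let ?u = "sg (i * j + i + j) (y * x)"
    have "hm z 0 = mat.br (xm x) (ym y) - hm (sk (par ?u)) ?u"
      unfolding br_xy[OF z(2,3)] omat_diff z(1)
      by (cases i; cases j; simp add: br_hom[OF z(2,3)] par_hom[OF G_mult'[OF z(3,2)]] par_minus sk_diff sk_add sk_minus)
    then have "hm z 0 \<in> Lie \<and> P (hm z 0)"
      using D[of ?u] xy[OF z(2,3)] xy_Lie[of x y] add[OF xy_Lie Lie_closed(4)] minus by (metis Lie_closed(3) diff_conv_add_uminus Lie_closed(4))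
    then have "mat_scale scale k (hm z 0) \<in> Lie \<and> P (mat_scale scale k (hm z 0))" using scale by auto
    then show ?case using step add[of "hm (scale k z) 0" "hm w 0"] Lie_closed(2)[of "hm (scale k z) 0" "hm w 0"]
      by (simp add: omat_scale omat_add)
  qed
  have "hm a d = hm (a - sk (par d)) 0 + hm (sk (par d)) d" by (simp add: omat_add)
  then have H: "hm a d \<in> Lie \<and> P (hm a d)" using D[of d] s[OF X(5)] add by simp
  have xb: "P (xm b)" for b
    by (induction b rule: homogeneous_induct) (use x add[OF xm_Lie xm_Lie] in \<open>auto simp: omat_add\<close>)
  have yc: "P (ym b)" for b
    by (induction b rule: homogeneous_induct) (use y add[OF ym_Lie ym_Lie] in \<open>auto simp: omat_add\<close>)
  have ep: "em p \<in> Lie \<and> P (em p)" using X(3)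
    by (induction p rule: sym_induct) (use e add em_Lie in \<open>auto simp flip: omat_add[of 0 0 _ 0 0 0 0 0 _ 0 0 0, simplified]\<close>)
  have fq: "fm q \<in> Lie \<and> P (fm q)" using X(4)
    by (induction q rule: sym_induct) (use f add fm_Lie in \<open>auto simp flip: omat_add[of 0 0 0 _ 0 0 0 0 0 _ 0 0, simplified]\<close>)
  show ?thesis unfolding X(1) omat_split[of b c]
    using xb yc ep fq H by (intro add conjI Lie_closed) auto
qed

end

section \<open>Cocycles\<close>

context osp_setting
begin

lemma Lie_osp: "X \<in> Lie \<Longrightarrow> osp_invol G bar X = - X"
  using Lie_Lrep unfolding Lrep_def osp_invol_iff by blast

lemma br_Lie [simp]: "X \<in> Lie \<Longrightarrow> Y \<in> Lie \<Longrightarrow> mat.br X Y \<in> Lie"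
  by (intro Lie_br Lie_osp)

text \<open>The two brackets have the same (2,2) entry, and \<open>sk_mult\<close> gives the
  difference of their (1,1) entries.\<close>

lemma hm_skbr:
  assumes "b \<in> G i" "c \<in> G j"
  shows "hm (sk (br b c)) 0 = mat.br (xm b) (ym c) - mat.br (xm (sg (i * j) (c * b))) (ym 1)"
proof -
  have 1: "mat.br (xm (sg (i * j) (c * b))) (ym 1) = hm (sk (sg (i * j) (c * b))) (sg (i + j) (sg (i * j) (c * b)))"
    using br_xy[OF G_op_mult[OF assms] one_G, of "i * j"] by simp
  show ?thesis unfolding 1 br_xy[OF assms] omat_diff sk_mult[OF assms]
    by (simp add: sg_sg add_ac)
qed

lemma hm_skbr_Lie: "s \<in> skbr k \<Longrightarrow> hm s 0 \<in> Lie"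
proof -
  assume "s \<in> skbr k"
  then obtain i j b c where s: "s = sk (br b c)" "b \<in> G i" "c \<in> G j" unfolding skbr_def by blast
  show "hm s 0 \<in> Lie" unfolding s(1) hm_skbr[OF s(2,3)] by (intro Lie_closed br_Lie xm_Lie ym_Lie)
qed

lemma hm_D: "d \<in> G k \<Longrightarrow> hm (sk d) (sg k d) = mat.br (xm d) (ym 1)"
  using br_xy[OF _ one_G, of d k] by simp

lemma hm_D_Lie: "d \<in> G k \<Longrightarrow> hm (sk d) (sg k d) \<in> Lie"
  by (simp add: hm_D)

lemma D1_Lie [simp]: "hm 0 1 \<in> Lie"
  using hm_D_Lie[OF one_G] by (simp add: sk_def)

text \<open>Conjugation by the matrix with rows (1, 0, 0), (0, 0, 1), (0, -1, 0), a lift of the Weyl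
  reflection: it negates \<open>hm 0 1\<close> and with it all weights.\<close>

definition theta :: "'r^3^3 \<Rightarrow> 'r^3^3" where
  "theta X = vector [vector [X$1$1, X$1$3, - X$1$2], vector [X$3$1, X$3$3, - X$3$2], vector [- X$2$1, - X$2$3, X$2$2]]"

lemma theta_nth [simp]:
  "theta X $ 1 $ 1 = X$1$1" "theta X $ 1 $ 2 = X$1$3" "theta X $ 1 $ 3 = - X$1$2"
  "theta X $ 2 $ 1 = X$3$1" "theta X $ 2 $ 2 = X$3$3" "theta X $ 2 $ 3 = - X$3$2"
  "theta X $ 3 $ 1 = - X$2$1" "theta X $ 3 $ 2 = - X$2$3" "theta X $ 3 $ 3 = X$2$2"
  by (simp_all add: theta_def)

lemma theta_add: "theta (X + Y) = theta X + theta Y"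
  and theta_diff: "theta (X - Y) = theta X - theta Y"
  and theta_minus: "theta (- X) = - theta X"
  and theta_scale: "theta (mat_scale scale k X) = mat_scale scale k (theta X)"
  and theta_mult: "theta (mat_mult X Y) = mat_mult (theta X) (theta Y)"
  by (simp_all add: vec3_eq_iff mat_mult_nth algebra_simps)

lemma theta_sg: "theta (sg p X) = sg p (theta X)"
  by (cases p) (simp_all add: theta_minus)

lemma theta_zero [simp]: "theta 0 = 0" by (simp add: vec3_eq_iff)

lemma theta_omat: "theta (omat b c p q a d) = omat (- bar (par c)) (bar (par b)) (- q) (- p) a (- bar d)"
  by (simp add: vec3_eq_iff bar_minus par_minus bar_par)

lemma theta_G: "X \<in> mat_grading G i \<Longrightarrow> theta X \<in> mat_grading G i"
  by (simp add: mat_grading_def forall_3)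

lemma theta_br: "theta (mat.br X Y) = mat.br (theta X) (theta Y)"
proof (induction X rule: mat.homogeneous_induct)
  case (1 i X)
  show ?case
  proof (induction Y rule: mat.homogeneous_induct)
    case (1 j Y)
    show ?case
      by (simp add: mat.br_hom[OF \<open>X \<in> _\<close> 1] mat.br_hom[OF theta_G[OF \<open>X \<in> _\<close>] theta_G[OF 1]]
          theta_diff theta_sg theta_mult)
  qed (simp add: mat.br_add_right theta_add)
qed (simp add: mat.br_add_left theta_add)

lemma theta_Lie [simp]: "X \<in> Lie \<Longrightarrow> theta X \<in> Lie"
proof -
  have osp: "osp_invol G bar X = - X \<Longrightarrow> osp_invol G bar (theta X) = - theta X" for X
    unfolding osp_invol_iff by (elim exE conjE) (hypsubst, simp only: theta_omat, intro exI conjI, rule refl, simp_all add: bar_minus)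
  assume "X \<in> Lie"
  then show ?thesis unfolding Lie_def
  proof (induction rule: mat.span_induct_alt)
    case base show ?case using Lie_closed(1) by (simp add: Lie_def)
  next
    case (step c x y)
    then have "theta x \<in> Lie" using Lie_br osp by (auto simp: theta_br)
    then show ?case using step Lie_closed(2,5) unfolding theta_add theta_scale Lie_def by blast
  qed
qed

end

text \<open>Linearity is asked for on \<open>Lie\<close> only, because the universal cocycle
  consists of classes in a tensor product over that carrier.\<close>

locale cocycle = osp_setting scale G bar + W: module sw
  for scale :: "'k::comm_ring_1 \<Rightarrow> 'r::{ring, monoid_mult} \<Rightarrow> 'r" and G bar
    and sw :: "'k \<Rightarrow> 'w::ab_group_add \<Rightarrow> 'w" +
  fixes \<beta> :: "'r^3^3 \<Rightarrow> 'r^3^3 \<Rightarrow> 'w"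
  assumes add_left: "X \<in> Lie \<Longrightarrow> Y \<in> Lie \<Longrightarrow> Z \<in> Lie \<Longrightarrow> \<beta> (X + Y) Z = \<beta> X Z + \<beta> Y Z"
    and add_right: "X \<in> Lie \<Longrightarrow> Y \<in> Lie \<Longrightarrow> Z \<in> Lie \<Longrightarrow> \<beta> Z (X + Y) = \<beta> Z X + \<beta> Z Y"
    and scale_left: "X \<in> Lie \<Longrightarrow> Y \<in> Lie \<Longrightarrow> \<beta> (mat_scale scale r X) Y = sw r (\<beta> X Y)"
    and scale_right: "X \<in> Lie \<Longrightarrow> Y \<in> Lie \<Longrightarrow> \<beta> X (mat_scale scale r Y) = sw r (\<beta> X Y)"
    and anti: "X \<in> mat_grading G i \<inter> Lie \<Longrightarrow> Y \<in> mat_grading G j \<inter> Lie \<Longrightarrow> \<beta> X Y + sg (i * j) (\<beta> Y X) = 0"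
    and jac: "X \<in> mat_grading G i \<inter> Lie \<Longrightarrow> Y \<in> mat_grading G j \<inter> Lie \<Longrightarrow> Z \<in> mat_grading G k \<inter> Lie \<Longrightarrow>
      sg (i * k) (\<beta> (mat.br X Y) Z) + sg (j * i) (\<beta> (mat.br Y Z) X) + sg (k * j) (\<beta> (mat.br Z X) Y) = 0"
begin

lemma torsion_free: "w + w = 0 \<Longrightarrow> w = (0::'w)"
  by (metis hlf W.scale_left_distrib W.scale_one W.scale_right_distrib W.scale_zero_right)

lemma zero_left [simp]: "Y \<in> Lie \<Longrightarrow> \<beta> 0 Y = 0"
  and zero_right [simp]: "Y \<in> Lie \<Longrightarrow> \<beta> Y 0 = 0"
  using add_left[of 0 0 Y] add_right[of 0 0 Y] by simp_all

lemma minus_left: "X \<in> Lie \<Longrightarrow> Y \<in> Lie \<Longrightarrow> \<beta> (- X) Y = - \<beta> X Y"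
  and minus_right: "X \<in> Lie \<Longrightarrow> Y \<in> Lie \<Longrightarrow> \<beta> X (- Y) = - \<beta> X Y"
  using add_left[of X "- X" Y] add_right[of Y "- Y" X] by (simp_all add: eq_neg_iff_add_eq_0 add.commute)

lemma diff_right: "X \<in> Lie \<Longrightarrow> Z \<in> Lie \<Longrightarrow> Y \<in> Lie \<Longrightarrow> \<beta> Y (X - Z) = \<beta> Y X - \<beta> Y Z"
  using add_right[of X "- Z" Y] by (simp add: minus_right)

lemma sg_left: "X \<in> Lie \<Longrightarrow> Y \<in> Lie \<Longrightarrow> \<beta> (sg p X) Y = sg p (\<beta> X Y)"
  and sg_right: "X \<in> Lie \<Longrightarrow> Y \<in> Lie \<Longrightarrow> \<beta> X (sg p Y) = sg p (\<beta> X Y)"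
  by (cases p; simp add: minus_left minus_right)+

lemma anti': "X \<in> mat_grading G i \<Longrightarrow> X \<in> Lie \<Longrightarrow> Y \<in> mat_grading G j \<Longrightarrow> Y \<in> Lie \<Longrightarrow> \<beta> Y X = - sg (i * j) (\<beta> X Y)"
  using anti[of Y j X i] by (simp add: eq_neg_iff_add_eq_0 mult.commute)

lemma leib:
  assumes X: "X \<in> mat_grading G i" "X \<in> Lie" and Y: "Y \<in> mat_grading G j" "Y \<in> Lie"
    and Z: "Z \<in> mat_grading G k" "Z \<in> Lie"
  shows "\<beta> X (mat.br Y Z) = \<beta> (mat.br X Y) Z + sg (i * j) (\<beta> Y (mat.br X Z))"
proof -
  have 1: "\<beta> (mat.br Y Z) X = - sg (i * (j + k)) (\<beta> X (mat.br Y Z))"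
    by (rule anti') (use X Y Z in simp_all)
  have 2: "\<beta> (mat.br Z X) Y = sg (i * k + j * (i + k)) (\<beta> Y (mat.br X Z))"
    unfolding mat.br_anti[OF X(1) Z(1)] using anti'[OF Y mat.br_G[OF X(1) Z(1)]] X Y Z
    by (simp add: minus_left sg_left sg_minus sg_sg)
  show ?thesis
    using jac[of X i Y j Z k] X Y Z unfolding 1 2
    by (cases i; cases j; cases k; simp add: algebra_simps neg_eq_iff_add_eq_0 eq_neg_iff_add_eq_0)
qed

text \<open>Turns each fact about the weights -1 and -2 into one about 1 and 2.\<close>

lemma cocycle_theta: "cocycle scale G bar sw (\<lambda>X Y. \<beta> (theta X) (theta Y))"
  using anti jac theta_G
  by unfold_locales
    (auto simp: theta_add theta_scale add_left add_right scale_left scale_right theta_br)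

lemma br_D1_e: "p \<in> G m \<Longrightarrow> bar p = p \<Longrightarrow> mat.br (hm 0 1) (em p) = - (em p + em p)"
  and br_D1_f: "p \<in> G m \<Longrightarrow> bar p = p \<Longrightarrow> mat.br (hm 0 1) (fm p) = fm p + fm p"
  and br_D1_h: "a \<in> G m \<Longrightarrow> bar a = - a \<Longrightarrow> d \<in> G m \<Longrightarrow> mat.br (hm 0 1) (hm a d) = 0"
  using omat_br[of 0 0 0 0 0 0 1 0 m 0 p 0 0 0] omat_br[of 0 0 0 0 0 0 1 0 m 0 0 p 0 0]
    omat_br[of 0 0 0 0 0 0 1 0 m 0 0 0 a d]
  by (simp_all add: omat_add omat_minus)

text \<open>The part of the cocycle in weight three. The second argument is symmetrised so that \<open>Ew\<close> is
  additive on all of \<open>R\<close>.\<close>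

definition Ew :: "'r \<Rightarrow> 'r \<Rightarrow> 'w" where
  "Ew b p = \<beta> (xm b) (em (scale hlf (p + bar p)))"

lemma scale_hlf_sym: "bar p = p \<Longrightarrow> scale hlf (p + bar p) = p"
  using scale_hlf[of p] by (simp add: scale_right_distrib)

lemma Ew_sym: assumes "bar p = p" shows "Ew b p = \<beta> (xm b) (em p)"
  unfolding Ew_def scale_hlf_sym[OF assms] ..

text \<open>\<open>F1\<close> is the Leibniz rule for \<open>hm (sk d) (sg k d)\<close>, which lies
  in \<open>Lie\<close>, on \<open>xm b\<close> and \<open>em p\<close>, whose bracket is 0;
  \<open>F2\<close> is the same for \<open>hm (sk (br x y)) 0\<close>; \<open>F3\<close> is the
  Jacobi identity for three vectors \<open>xm\<close>.\<close>

lemma height_three_Ew: "height_three scale G bar Ew"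
proof (unfold_locales, goal_cases)
  case (1 a b c)
  show ?case using add_left[of "xm a" "xm b" "em (scale hlf (c + bar c))"] em_Lie[of "scale hlf (c + bar c)"]
    by (simp add: Ew_def omat_add bar_scale)
next
  case (2 a b c)
  have *: "scale hlf (b + c + bar (b + c)) = scale hlf (b + bar b) + scale hlf (c + bar c)"
    by (simp add: bar_add scale_right_distrib)
  show ?case using add_right[of "em (scale hlf (b + bar b))" "em (scale hlf (c + bar c))" "xm a"]
     em_Lie[of "scale hlf (b + bar b)"] em_Lie[of "scale hlf (c + bar c)"]
    by (simp add: Ew_def omat_add bar_scale *)
next
  case 3 then show ?case by (rule torsion_free)
next
  case (4 d k b i p m)
  have sym: "bar (bar d * p + sg (k * m) (p * d)) = bar d * p + sg (k * m) (p * d)"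
    using bar_mult'[OF bar_G[OF 4(1)] 4(3)] bar_mult'[OF 4(3,1)] 4(4) by (simp add: bar_add bar_sg mult.commute)
  have xe: "mat.br (xm b) (em p) = 0"
    using mat.br_anti[OF em_G[OF 4(3)] xm_G[OF 4(2)]] br_ex[OF 4(3,4,2)] by simp
  have hx: "mat.br (hm (sk d) (sg k d)) (xm b) = xm (sk d * b - sg (k * i) (b * d))"
    using br_hx[OF sk_G[OF 4(1)] bar_sk G_closed(6)[OF 4(1)] 4(2)] by (simp add: sg_mult_right sg_sg distrib_left add.assoc)
  have he: "mat.br (hm (sk d) (sg k d)) (em p) = em (- sg k (bar d * p + sg (k * m) (p * d)))"
    using br_he[OF sk_G[OF 4(1)] bar_sk G_closed(6)[OF 4(1)] 4(3,4)]
    by (simp add: sg_mult_right sg_mult_left bar_sg sg_sg sg_add add.commute)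
  have 0: "0 = \<beta> (xm (sk d * b - sg (k * i) (b * d))) (em p)
     + sg (k * (i + 1)) (\<beta> (xm b) (em (- sg k (bar d * p + sg (k * m) (p * d)))))"
    using leib[OF hm_G[OF sk_G[OF 4(1)] G_closed(6)[OF 4(1)]] hm_D_Lie[OF 4(1)] xm_G[OF 4(2)] xm_Lie em_G[OF 4(3)] em_Lie[OF 4(4)]]
      hm_D_Lie[OF 4(1)]
    unfolding xe hx he by simp
  have *: "\<beta> (xm b) (em (- sg k (bar d * p + sg (k * m) (p * d)))) = - sg k (\<beta> (xm b) (em (bar d * p + sg (k * m) (p * d))))"
    using minus_right[OF xm_Lie em_Lie] sg_right[OF xm_Lie em_Lie[OF sym], of b k] em_Lie[OF sym]
      minus_right[OF xm_Lie Lie_closed(6)[OF em_Lie[OF sym]], of b k]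
    by (simp add: omat_minus omat_sg)
  show ?case
    using 0[unfolded *] unfolding Ew_sym[OF 4(4)] Ew_sym[OF sym]
    by (cases i; cases k; simp add: eq_neg_iff_add_eq_0 neg_eq_iff_add_eq_0)
next
  case (5 x i y j b k)
  have s: "sk (br x y) \<in> skbr (i + j)" using 5 unfolding skbr_def by blast
  have s': "sk (br x y) \<in> G (i + j)" using 5 by simp
  have xe: "mat.br (xm b) (em 1) = 0"
    using mat.br_anti[OF em_G[OF one_G] xm_G[OF 5(3)]] br_ex[OF one_G bar_one 5(3)] by simp
  show ?case
    using leib[OF hm_G[OF s'] hm_skbr_Lie[OF s] xm_G[OF 5(3)] xm_Lie em_G[OF one_G] em_Lie[OF bar_one]]
      hm_skbr_Lie[OF s]
    unfolding xe br_hx[OF s' bar_sk G_closed(1) 5(3)] br_he[OF s' bar_sk G_closed(1) one_G bar_one]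
    by (simp add: Ew_sym)
next
  case (6 a i b j c k)
  have L: "\<beta> (mat.br (xm x) (xm y)) (xm z) = - sg ((p + q) * (n + 1) + p) (Ew z (bar x * y + sg (p * q) (bar y * x)))"
    if "x \<in> G p" "y \<in> G q" "z \<in> G n" for x y z p q n
  proof -
    let ?u = "bar x * y + sg (p * q) (bar y * x)"
    have u: "?u \<in> G (p + q)" "bar ?u = ?u"
      using that by (simp_all add: bar_add bar_sg bar_mult'[of _ p _ q] bar_mult'[of _ q _ p] mult.commute)
    have "\<beta> (em (sg p ?u)) (xm z) = sg p (\<beta> (em ?u) (xm z))"
      using sg_left[OF em_Lie[OF u(2)] xm_Lie, of p z] by (simp add: omat_sg)
    moreover have "\<beta> (em ?u) (xm z) = - sg ((n + 1) * (p + q)) (\<beta> (xm z) (em ?u))"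
      by (rule anti') (use that u em_Lie[OF u(2)] in simp_all)
    ultimately show ?thesis
      unfolding br_xx[OF that(1,2)] Ew_sym[OF u(2)] by (simp add: sg_minus sg_sg mult.commute add.commute)
  qed
  show ?case
    using jac[OF IntI[OF xm_G[OF 6(1)] xm_Lie] IntI[OF xm_G[OF 6(2)] xm_Lie] IntI[OF xm_G[OF 6(3)] xm_Lie]]
    unfolding L[OF 6] L[OF 6(2,3,1)] L[OF 6(3,1,2)]
    by (cases i; cases j; cases k; simp add: neg_eq_iff_add_eq_0 eq_neg_iff_add_eq_0 algebra_simps)
qed

lemma I3_map_plus: "I3_map scale G bar (\<lambda>b. \<beta> (xm b) (em 1))"
  using height_three.I3_map_E[OF height_three_Ew] by (simp add: Ew_sym)

lemma Ew_eq: "p \<in> G k \<Longrightarrow> bar p = p \<Longrightarrow> b \<in> G i \<Longrightarrow> \<beta> (xm b) (em p) = \<beta> (xm (b * p)) (em 1)"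
  using height_three.E_sym[OF height_three_Ew] by (simp add: Ew_sym)

end

text \<open>Subtracting a coboundary makes \<open>\<beta>(x u, y 1)\<close> vanish for all \<open>u\<close>.\<close>

locale normalized_cocycle = cocycle scale G bar sw \<beta>
  for scale :: "'k::comm_ring_1 \<Rightarrow> 'r::{ring, monoid_mult} \<Rightarrow> 'r" and G bar
    and sw :: "'k \<Rightarrow> 'w::ab_group_add \<Rightarrow> 'w" and \<beta> +
  assumes xy_one: "\<beta> (xm u) (ym 1) = 0"
begin

definition Tb :: "'r \<Rightarrow> 'r \<Rightarrow> 'w" where "Tb b c = \<beta> (xm b) (ym c)"

sublocale Tb: biadditive Tb
  using add_left[OF xm_Lie xm_Lie ym_Lie] add_right[OF ym_Lie ym_Lie xm_Lie]
  by unfold_locales (simp_all add: Tb_def omat_add)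

lemma yx: "b \<in> G i \<Longrightarrow> c \<in> G k \<Longrightarrow> \<beta> (ym c) (xm b) = - sg ((i + 1) * (k + 1)) (Tb b c)"
  unfolding Tb_def by (rule anti') simp_all

lemma xsg: "\<beta> (xm (sg p b)) (ym c) = sg p (Tb b c)" "\<beta> (xm b) (ym (sg p c)) = sg p (Tb b c)"
  using Tb.T_sg(1)[of p b c] Tb.T_sg(2)[of b p c] by (simp_all add: Tb_def)

text \<open>\<open>QT\<close> is the Leibniz expansion. The sign \<open>sg k\<close> on
  \<open>d\<close> is the one that occurs in \<open>hm_D\<close> and \<open>xy_hm\<close>.\<close>

lemma hm_xy:
  assumes h: "hm a (sg k d) \<in> Lie" "a \<in> G k" "bar a = - a" "d \<in> G k" and b: "b \<in> G i" and c: "c \<in> G j"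
  shows "\<beta> (hm a (sg k d)) (mat.br (xm b) (ym c)) = Tb.QT k a d i j b c"
proof -
  have d: "sg k d \<in> G k" using h by simp
  have hx: "mat.br (hm a (sg k d)) (xm b) = xm (a * b - sg (k * i) (b * d))"
    using br_hx[OF h(2,3) d b] by (simp add: sg_mult_right sg_sg distrib_left add.assoc)
  have hy: "mat.br (hm a (sg k d)) (ym c) = ym (sg k (d * c - sg (k * j) (c * a)))"
    using br_hy[OF h(2,3) d c] by (simp add: sg_mult_left sg_sg sg_diff distrib_left add.commute)
  show ?thesis
    using leib[OF hm_G[OF h(2) d] h(1) xm_G[OF b] xm_Lie ym_G[OF c] ym_Lie]
    unfolding hx hy xsg by (simp add: Tb.QT_def Tb_def[symmetric] sg_sg distrib_left add.assoc)
qed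

lemma xy_hm: "b \<in> G i \<Longrightarrow> c \<in> G j \<Longrightarrow> mat.br (xm b) (ym c) = hm (sk (b * c)) (sg (i + j) (sg (i * j) (c * b)))"
  using br_xy by (simp add: sg_sg add_ac)

lemma xy_xy:
  assumes b: "b \<in> G i" and c: "c \<in> G j" and b': "b' \<in> G k" and c': "c' \<in> G l"
  shows "\<beta> (mat.br (xm b') (ym c')) (mat.br (xm b) (ym c)) = Tb.QT (k + l) (sk (b' * c')) (sg (k * l) (c' * b')) i j b c"
  using hm_xy[OF _ sk_G[OF G_mult'[OF b' c']] bar_sk G_op_mult[OF b' c'] b c, of "k * l"] xy_Lie[of b' c']
  unfolding xy_hm[OF b' c'] by simp

text \<open>The bracket of \<open>ym 1\<close> with itself is \<open>- (fm 1 + fm 1)\<close>, and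
  the normalisation kills the Leibniz expansion of \<open>em p\<close> against it. So the cocycle
  vanishes on \<open>fm 1\<close> and \<open>em p\<close>. Expanding \<open>fm 1\<close> against the
  bracket of \<open>xm p\<close> and \<open>xm 1\<close>, a multiple of \<open>em p\<close>, leaves
  \<open>Tb 1 p\<close>.\<close>

lemma R0:
  assumes p: "p \<in> G m" "bar p = p"
  shows "Tb 1 p = 0"
proof -
  have 1: "mat.br (ym 1) (ym 1) = - (fm 1 + fm 1)"
    using br_yy[OF one_G one_G] by (simp add: omat_add omat_minus)
  have 2: "mat.br (xm p) (xm 1) = em (sg m p) + em (sg m p)"
    using br_xx[OF p(1) one_G] p(2) by (simp add: omat_add sg_add)
  have ep: "em (sg m p) \<in> Lie" and eep: "em p \<in> Lie" and f1: "fm 1 \<in> Lie"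
    using p by (auto intro!: em_Lie fm_Lie simp: bar_sg)
  have 3: "\<beta> (em p) (mat.br (ym 1) (ym 1)) = 0"
    using leib[OF em_G[OF p(1)] eep ym_G[OF one_G] ym_Lie ym_G[OF one_G] ym_Lie]
    unfolding br_ey[OF p one_G] xy_one using yx[OF G_closed(6)[OF p(1)] one_G, of m]
    by (simp add: Tb_def xy_one)
  have "\<beta> (em p) (fm 1) + \<beta> (em p) (fm 1) = 0"
    using 3[unfolded 1 minus_right[OF eep Lie_closed(2)[OF f1 f1]] add_right[OF f1 f1 eep]]
    by (simp only: neg_equal_0_iff_equal)
  then have "\<beta> (em p) (fm 1) = 0" by (rule torsion_free)
  then have ef: "\<beta> (fm 1) (em p) = 0"
    using anti'[OF em_G[OF p(1)] eep fm_G[OF one_G] f1] by simp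
  have "\<beta> (fm 1) (mat.br (xm p) (xm 1)) = 0"
    unfolding 2 using add_right[OF ep ep f1] sg_right[OF f1 eep, of m] ef by (simp add: omat_sg)
  moreover have "\<beta> (fm 1) (mat.br (xm p) (xm 1)) = Tb 1 p"
    using leib[OF fm_G[OF one_G] f1 xm_G[OF p(1)] xm_Lie xm_G[OF one_G] xm_Lie]
    unfolding br_fx[OF one_G bar_one p(1)] br_fx[OF one_G bar_one one_G]
    using yx[OF one_G G_closed(6)[OF p(1)], of m] p(2)
    by (cases m) (simp_all add: Tb.T_simps xy_one)
  ultimately show ?thesis by simp
qed

lemma e_yy:
  assumes p: "p \<in> G m" "bar p = p" and c: "c \<in> G k" and c': "c' \<in> G l"
  shows "\<beta> (em p) (mat.br (ym c) (ym c')) = sg (m * k + m + k) (Tb (bar c * p) c')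
     + sg (m * k + m + k + k * l + m * k + m * l) (Tb (bar c' * p) c)"
  using leib[OF em_G[OF p(1)] em_Lie[OF p(2)] ym_G[OF c] ym_Lie ym_G[OF c'] ym_Lie]
  unfolding br_ey[OF p c] br_ey[OF p c']
  using yx[OF G_closed(6)[OF G_mult'[OF bar_G[OF c'] p(1)]] c, of "m * l + m + l"]
  by (cases k; cases l; cases m; simp add: xsg Tb.T_simps Tb_def[symmetric])

text \<open>Up to sign, the bracket of \<open>ym c\<close> and \<open>ym c'\<close> does not change
  when \<open>(c, c')\<close> is replaced by \<open>(c * bar c', 1)\<close>. For the latter pair the
  normalisation kills one term of \<open>e_yy\<close>.\<close>

lemma R2:
  assumes p: "p \<in> G m" "bar p = p" and c: "c \<in> G k" and c': "c' \<in> G l"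
  shows "Tb (bar c * p) c' + sg (k * l + m * k + m * l) (Tb (bar c' * p) c) = sg (m * k) (Tb p (c * bar c'))"
proof -
  have w: "c * bar c' \<in> G (k + l)" using c c' by simp
  have "mat.br (ym c) (ym c') = sg l (mat.br (ym (c * bar c')) (ym 1))"
    unfolding br_yy[OF c c'] br_yy[OF w one_G]
    using bar_mult'[OF c bar_G[OF c']] by (simp add: omat_sg sg_minus sg_add sg_diff)
  moreover have "\<beta> (em p) (sg l (mat.br (ym (c * bar c')) (ym 1))) = sg l (\<beta> (em p) (mat.br (ym (c * bar c')) (ym 1)))"
    by (rule sg_right) (simp_all add: em_Lie p)
  ultimately have "\<beta> (em p) (mat.br (ym c) (ym c')) = sg l (\<beta> (em p) (mat.br (ym (c * bar c')) (ym 1)))"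
    by simp
  then show ?thesis
    unfolding e_yy[OF p c c'] e_yy[OF p w one_G] using xy_one[folded Tb_def]
    by (cases k; cases l; cases m; simp add: neg_eq_iff_add_eq_0 eq_neg_iff_add_eq_0 algebra_simps)
qed

sublocale Tb: lie_pairing scale G bar Tb
proof (unfold_locales, goal_cases)
  case 1 then show ?case by (rule torsion_free)
next
  case 2 show ?case by (simp add: Tb_def xy_one)
next
  case 3 then show ?case by (rule R0)
next
  case 4 then show ?case by (rule R2)
next
  \<comment> \<open>\<open>R3\<close> is antisymmetry on two brackets of \<open>xm\<close> with
    \<open>ym\<close>, where \<open>xy_xy\<close> evaluates both sides.\<close>
  case (5 b i c j b' k c' l)
  show ?case
    using anti'[OF mat.br_G[OF xm_G[OF 5(1)] ym_G[OF 5(2)]] xy_Lie mat.br_G[OF xm_G[OF 5(3)] ym_G[OF 5(4)]] xy_Lie]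
    unfolding xy_xy[OF 5(1,2,3,4)] xy_xy[OF 5(3,4,1,2)]
    by (cases i; cases j; cases k; cases l; simp)
qed

lemma hm_hm_skbr:
  assumes s: "s \<in> skbr k" and b: "b \<in> G i" and c: "c \<in> G j"
  shows "\<beta> (hm s 0) (hm (sk (br b c)) 0) = sg (k * j) (Jt Tb k i j s b c) + Tb s (br b c)"
proof -
  have *: "\<beta> (hm s 0) (mat.br (xm x) (ym y)) = Tb.QT k s 0 p q x y" if "x \<in> G p" "y \<in> G q" for x y p q
    using hm_xy[of s k 0, OF _ _ _ _ that] hm_skbr_Lie[OF s] skbr_D[OF s] by simp
  show ?thesis
    unfolding hm_skbr[OF b c] Tb.QT_skbr[OF conjunct1[OF skbr_D[OF s]] b c, symmetric]
    using diff_right[OF xy_Lie xy_Lie hm_skbr_Lie[OF s], of b c "sg (i * j) (c * b)" 1]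
      *[OF b c] *[OF G_op_mult[OF b c] one_G, of "i * j"] by simp
qed

sublocale Tb: lie_pairing_jacobi scale G bar Tb
proof (unfold_locales, goal_cases)
  case (1 a i b j c k)
  note a = skbr_D[OF 1(1)] and b = skbr_D[OF 1(2)] and c = skbr_D[OF 1(3)]
  have Lh: "hm a 0 \<in> Lie" "hm b 0 \<in> Lie" "hm c 0 \<in> Lie" using 1 hm_skbr_Lie by blast+
  have hh: "mat.br (hm x 0) (hm y 0) = hm (br x y) 0"
    if "x \<in> G p" "bar x = - x" "y \<in> G q" "bar y = - y" for x y p q
    using omat_br[of 0 p 0 0 0 x 0 0 q 0 0 0 y 0] that by (simp add: br_hom[OF that(1,3)])
  have X: "\<beta> (mat.br (hm x 0) (hm y 0)) (hm z 0) + \<beta> (mat.br (hm x 0) (hm y 0)) (hm z 0)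
      = - sg (n * (p + q)) (sg (n * q) (Jt Tb n p q z x y) + Tb z (br x y))"
    if "x \<in> skbr p" "y \<in> skbr q" "z \<in> skbr n" for x y z p q n
  proof -
    note x = skbr_D[OF that(1)] and y = skbr_D[OF that(2)] and z = skbr_D[OF that(3)]
    have "bar (br x y) = - br x y" using bar_br[of x p y q] x y by (simp add: br_minus)
    \<comment> \<open>On a skew commutator \<open>sk\<close> is doubling. \<open>hm_hm_skbr\<close>
      evaluates the doubled element, which is why twice the Jacobi sum is formed below.\<close>
    then have sk2: "hm (sk (br x y)) 0 = hm (br x y) 0 + hm (br x y) 0" by (simp add: sk_def omat_add)
    have h: "hm (br x y) 0 \<in> Lie" unfolding hh[symmetric, OF conjunct1[OF x] conjunct2[OF x] conjunct1[OF y] conjunct2[OF y]]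
      using that hm_skbr_Lie by simp
    have "\<beta> (hm (br x y) 0) (hm z 0) = - sg (n * (p + q)) (\<beta> (hm z 0) (hm (br x y) 0))"
      by (rule anti') (use x y z h hm_skbr_Lie[OF that(3)] in simp_all)
    then show ?thesis
      unfolding hm_hm_skbr[OF that(3) conjunct1[OF x] conjunct1[OF y], symmetric] sk2
        hh[OF conjunct1[OF x] conjunct2[OF x] conjunct1[OF y] conjunct2[OF y]]
      using add_right[OF h h hm_skbr_Lie[OF that(3)]] by (simp add: sg_add)
  qed
  have G: "hm a 0 \<in> mat_grading G i" "hm b 0 \<in> mat_grading G j" "hm c 0 \<in> mat_grading G k"
    using a b c by simp_all
  have "sg (i * k) (\<beta> (mat.br (hm a 0) (hm b 0)) (hm c 0)) + sg (j * i) (\<beta> (mat.br (hm b 0) (hm c 0)) (hm a 0))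
    + sg (k * j) (\<beta> (mat.br (hm c 0) (hm a 0)) (hm b 0)) = 0" (is "?s = 0")
    by (rule jac) (use G Lh in auto)
  then have "?s + ?s = 0" by simp
  then have "sg (i * k) (- sg (k * (i + j)) (sg (k * j) (Jt Tb k i j c a b) + Tb c (br a b)))
    + sg (j * i) (- sg (i * (j + k)) (sg (i * k) (Jt Tb i j k a b c) + Tb a (br b c)))
    + sg (k * j) (- sg (j * (k + i)) (sg (j * i) (Jt Tb j k i b c a) + Tb b (br c a))) = 0"
    unfolding X[OF 1(1,2,3), symmetric] X[OF 1(2,3,1), symmetric] X[OF 1(3,1,2), symmetric]
    by (simp add: sg_add algebra_simps)
  then show ?case
    by (cases i; cases j; cases k; simp add: algebra_simps neg_eq_iff_add_eq_0 eq_neg_iff_add_eq_0)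
qed

end

context osp_setting
begin

lemma coboundary:
  fixes sw :: "'k \<Rightarrow> 'w::ab_group_add \<Rightarrow> 'w"
  assumes "module sw" and add: "\<And>X Y. X \<in> Lie \<Longrightarrow> Y \<in> Lie \<Longrightarrow> g (X + Y) = g X + g Y"
    and scale: "\<And>c X. X \<in> Lie \<Longrightarrow> g (mat_scale scale c X) = sw c (g X)"
  shows "cocycle scale G bar sw (\<lambda>X Y. g (mat.br X Y))"
proof -
  interpret W: module sw by fact
  have minus: "g (- X) = - g X" if "X \<in> Lie" for X
    using add[OF that Lie_closed(4)[OF that]] add[OF Lie_closed(1) Lie_closed(1)]
    by (simp add: eq_neg_iff_add_eq_0 add.commute)
  have sg: "g (sg p X) = sg p (g X)" if "X \<in> Lie" for X p
    using minus[OF that] by (cases p) simp_all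
  have g0: "g 0 = 0" using add[OF Lie_closed(1) Lie_closed(1)] by simp
  show ?thesis
  proof (unfold_locales, goal_cases)
    case (5 X i Y j)
    then show ?case by (simp add: mat.br_anti[of X i Y j] minus sg sg_minus)
  next
    case (6 X i Y j Z k)
    have "sg (i * k) (mat.br (mat.br X Y) Z) + sg (j * i) (mat.br (mat.br Y Z) X) + sg (k * j) (mat.br (mat.br Z X) Y) = 0"
    proof -
      have 1: "mat.br (mat.br Y Z) X = - sg (i * (j + k)) (mat.br X (mat.br Y Z))"
        using mat.br_anti[of X i "mat.br Y Z" "j + k"] 6 by simp
      have 2: "mat.br (mat.br Z X) Y = sg (i * k + j * (i + k)) (mat.br Y (mat.br X Z))"
        using mat.br_anti[of X i Z k] mat.br_anti[of Y j "mat.br X Z" "i + k"] 6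
        by (simp add: mat.br_minus mat.br_sg sg_minus sg_sg)
      show ?thesis
        using mat.br_leibniz[of X i Y j Z k] 6 unfolding 1 2
        by (cases i; cases j; cases k; simp add: algebra_simps neg_eq_iff_add_eq_0 eq_neg_iff_add_eq_0)
    qed
    moreover have "mat.br (mat.br X Y) Z \<in> Lie" "mat.br (mat.br Y Z) X \<in> Lie" "mat.br (mat.br Z X) Y \<in> Lie"
      using 6 by simp_all
    ultimately show ?case
      using g0 by (simp add: sg[symmetric] add[symmetric])
  qed (simp_all add: mat.br_add_left mat.br_add_right mat.br_scale_left mat.br_scale_right add scale)
qed

lemma cocycle_diff:
  assumes "cocycle scale G bar sw \<beta>" "cocycle scale G bar sw \<gamma>"
  shows "cocycle scale G bar sw (\<lambda>X Y. \<beta> X Y - \<gamma> X Y)"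
proof -
  interpret b: cocycle scale G bar sw \<beta> by fact
  interpret c: cocycle scale G bar sw \<gamma> by fact
  show ?thesis
  proof (unfold_locales, goal_cases)
    case (5 X i Y j) show ?case using b.anti[OF 5] c.anti[OF 5]
      by (simp add: sg_diff) (metis (no_types, lifting) add_diff_add diff_zero)
  next
    case (6 X i Y j Z k)
    have "sg (i * k) (\<beta> (mat.br X Y) Z - \<gamma> (mat.br X Y) Z) + sg (j * i) (\<beta> (mat.br Y Z) X - \<gamma> (mat.br Y Z) X)
       + sg (k * j) (\<beta> (mat.br Z X) Y - \<gamma> (mat.br Z X) Y)
      = (sg (i * k) (\<beta> (mat.br X Y) Z) + sg (j * i) (\<beta> (mat.br Y Z) X) + sg (k * j) (\<beta> (mat.br Z X) Y))
       - (sg (i * k) (\<gamma> (mat.br X Y) Z) + sg (j * i) (\<gamma> (mat.br Y Z) X) + sg (k * j) (\<gamma> (mat.br Z X) Y))"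
      by (simp add: sg_diff algebra_simps)
    then show ?case unfolding b.jac[OF 6] c.jac[OF 6] by simp
  qed (simp_all add: b.add_left c.add_left b.add_right c.add_right b.scale_left c.scale_left b.scale_right c.scale_right
      b.W.scale_right_diff_distrib)
qed

text \<open>Reads \<open>u\<close> off the bracket up to the involution \<open>par\<close>. This
  lets \<open>nrm\<close> subtract a coboundary that agrees with the cocycle on every pair
  \<open>xm u\<close>, \<open>ym 1\<close>.\<close>

lemma br_xy_22: "mat.br (xm u) (ym 1) $ 2 $ 2 = par u"
proof (induction u rule: homogeneous_induct)
  case (1 i u)
  then show ?case using br_xy[OF 1 one_G] by (simp add: par_hom)
next
  case (2 x y)
  then show ?case using mat.br_add_left[of "xm x" "xm y" "ym 1"] by (simp add: omat_add par_add)
qed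

end

section \<open>Normalisation and the invariants of a cocycle\<close>

context cocycle
begin

definition nrm :: "'r^3^3 \<Rightarrow> 'r^3^3 \<Rightarrow> 'w" where
  "nrm X Y = \<beta> X Y - \<beta> (xm (par (mat.br X Y $ 2 $ 2))) (ym 1)"

lemma nrm_normalized: "normalized_cocycle scale G bar sw nrm"
proof -
  have "cocycle scale G bar sw (\<lambda>X Y. \<beta> (xm (par (mat.br X Y $ 2 $ 2))) (ym 1))"
    by (rule coboundary[where g="\<lambda>Z. \<beta> (xm (par (Z $ 2 $ 2))) (ym 1)"], unfold_locales)
       (use add_left[OF xm_Lie xm_Lie ym_Lie] scale_left[OF xm_Lie ym_Lie] in
        \<open>simp_all add: par_add par_scale omat_add omat_scale\<close>)
  from cocycle_diff[OF _ this] have "cocycle scale G bar sw nrm"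
    unfolding nrm_def[abs_def] by (simp add: cocycle_axioms)
  moreover have "nrm (xm u) (ym 1) = 0" for u by (simp add: nrm_def br_xy_22)
  ultimately show ?thesis by (simp add: normalized_cocycle_def normalized_cocycle_axioms_def)
qed

definition Tc :: "'r \<Rightarrow> 'r \<Rightarrow> 'w" where "Tc b c = nrm (xm b) (ym c)"

definition rplus :: "'r \<Rightarrow> 'w" where "rplus b = \<beta> (xm b) (em 1)"
definition rminus :: "'r \<Rightarrow> 'w" where "rminus b = \<beta> (theta (xm b)) (theta (em 1))"

lemma I3_rplus: "I3_map scale G bar rplus"
  using I3_map_plus by (simp add: rplus_def[abs_def])

lemma I3_rminus: "I3_map scale G bar rminus"
  using cocycle.I3_map_plus[OF cocycle_theta] by (simp add: rminus_def[abs_def])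

end

text \<open>Grading by the element \<open>hm 0 1\<close>, which acts on the root spaces by their weights: a normalised
  cocycle whose invariants vanish is recovered from its values on \<open>hm 0 1\<close>.\<close>

locale trivial_cocycle = normalized_cocycle scale G bar sw \<beta>
  for scale :: "'k::comm_ring_1 \<Rightarrow> 'r::{ring, monoid_mult} \<Rightarrow> 'r" and G bar
    and sw :: "'k \<Rightarrow> 'w::ab_group_add \<Rightarrow> 'w" and \<beta> +
  assumes xy0: "\<beta> (xm b) (ym c) = 0"
    and xe0: "\<beta> (xm b) (em 1) = 0"
    and yf0: "\<beta> (theta (xm b)) (theta (em 1)) = 0"
begin

text \<open>The inverse of the adjoint action of \<open>hm 0 1\<close> on the nonzero weights: the
  components of weight -1, 1, -2, 2 are divided by their weights, and the diagonal is dropped. Hence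
  \<open>gD\<close> is the primitive that \<open>wt_br\<close> suggests.\<close>

definition nw :: "'r^3^3 \<Rightarrow> 'r^3^3" where
  "nw Z = omat (- Z$1$2) (Z$2$1) (- scale hlf (Z$3$2)) (scale hlf (Z$2$3)) 0 0"

definition gD :: "'r^3^3 \<Rightarrow> 'w" where "gD Z = \<beta> (hm 0 1) (nw Z)"

lemma nw_Lie: "Z \<in> Lie \<Longrightarrow> nw Z \<in> Lie"
proof -
  assume "Z \<in> Lie"
  then have "osp_invol G bar Z = - Z" by (rule Lie_osp)
  then obtain b c p q a d where "Z = omat b c p q a d" "bar p = p" "bar q = q" unfolding osp_invol_iff by blast
  then have *: "bar (Z$3$2) = Z$3$2" "bar (Z$2$3) = Z$2$3" by simp_all
  have "em (- scale hlf (Z$3$2)) \<in> Lie" "fm (scale hlf (Z$2$3)) \<in> Lie"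
    by (rule em_Lie, simp add: bar_minus bar_scale *, rule fm_Lie, simp add: bar_scale *)
  moreover have "nw Z = xm (- Z$1$2) + ym (Z$2$1) + em (- scale hlf (Z$3$2)) + fm (scale hlf (Z$2$3)) + hm 0 0"
    unfolding nw_def by (rule omat_split)
  ultimately show ?thesis by simp
qed

lemma gD_add: "X \<in> Lie \<Longrightarrow> Y \<in> Lie \<Longrightarrow> gD (X + Y) = gD X + gD Y"
proof -
  assume *: "X \<in> Lie" "Y \<in> Lie"
  have "nw (X + Y) = nw X + nw Y" by (simp add: nw_def omat_add scale_right_distrib)
  then show ?thesis using * by (simp add: gD_def add_right nw_Lie)
qed

lemma gD_scale: "X \<in> Lie \<Longrightarrow> gD (mat_scale scale c X) = sw c (gD X)"
proof -
  assume *: "X \<in> Lie"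
  have "nw (mat_scale scale c X) = mat_scale scale c (nw X)" by (simp add: nw_def omat_scale mult.commute)
  then show ?thesis using * by (simp add: gD_def scale_right nw_Lie)
qed

lemma D1_G: "hm 0 1 \<in> mat_grading G 0" by simp

lemma leibD: "X \<in> mat_grading G i \<Longrightarrow> X \<in> Lie \<Longrightarrow> Y \<in> mat_grading G j \<Longrightarrow> Y \<in> Lie \<Longrightarrow>
    \<beta> (hm 0 1) (mat.br X Y) = \<beta> (mat.br (hm 0 1) X) Y + \<beta> X (mat.br (hm 0 1) Y)"
  using leib[OF D1_G D1_Lie, of X i Y j] by simp

lemma gD_x: "gD (xm b) = - \<beta> (hm 0 1) (xm b)" and gD_y: "gD (ym b) = \<beta> (hm 0 1) (ym b)"
  and gD_h: "gD (hm a d) = 0"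
  using minus_right[OF D1_Lie xm_Lie, of b] by (simp_all add: gD_def nw_def omat_minus)

lemma gD_e: "bar p = p \<Longrightarrow> gD (em p) + gD (em p) = - \<beta> (hm 0 1) (em p)"
  and gD_f: "bar p = p \<Longrightarrow> gD (fm p) + gD (fm p) = \<beta> (hm 0 1) (fm p)"
proof -
  assume p: "bar p = p"
  have 0: "- scale hlf p - scale hlf p = - p"
    using scale_hlf[of p] by (metis add.inverse_distrib_swap diff_conv_add_uminus)
  have 1: "nw (em p) + nw (em p) = - em p" "nw (fm p) + nw (fm p) = fm p"
    by (simp_all add: nw_def omat_add omat_minus scale_hlf 0)
  show "gD (em p) + gD (em p) = - \<beta> (hm 0 1) (em p)" "gD (fm p) + gD (fm p) = \<beta> (hm 0 1) (fm p)"
    unfolding gD_def using 1 add_right[OF nw_Lie[OF em_Lie[OF p]] nw_Lie[OF em_Lie[OF p]] D1_Lie]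
      add_right[OF nw_Lie[OF fm_Lie[OF p]] nw_Lie[OF fm_Lie[OF p]] D1_Lie]
      minus_right[OF D1_Lie em_Lie[OF p]] by simp_all
qed

definition ok :: "'r^3^3 \<Rightarrow> 'r^3^3 \<Rightarrow> bool" where "ok X Y \<longleftrightarrow> \<beta> X Y = gD (mat.br X Y)"

lemma gD_sg: "X \<in> Lie \<Longrightarrow> gD (sg p X) = sg p (gD X)"
  using gD_scale[of X "- 1"] by (cases p) simp_all

lemma ok_sym:
  assumes "ok X Y" "X \<in> mat_grading G i" "X \<in> Lie" "Y \<in> mat_grading G j" "Y \<in> Lie"
  shows "ok Y X"
  using assms mat.br_anti[of X i Y j] anti'[of X i Y j] gD_sg[OF Lie_closed(4), of "mat.br X Y"]
    gD_sg[of "mat.br X Y" 1]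
  by (simp add: ok_def) (metis Lie_closed(6) br_Lie gD_sg sg_1)

lemma eq_of_double: "x + x = y + y \<Longrightarrow> x = (y :: 'w)"
  using torsion_free[of "x - y"] by (simp add: algebra_simps)

definition wt :: "int \<Rightarrow> bit \<Rightarrow> 'r^3^3 \<Rightarrow> bool" where
  "wt n i X \<longleftrightarrow> X \<in> mat_grading G i \<and> X \<in> Lie \<and> mat.br (hm 0 1) X = mat_scale scale (of_int n) X"

lemma wt_br: "wt n i X \<Longrightarrow> wt m j Y \<Longrightarrow> \<beta> (hm 0 1) (mat.br X Y) = sw (of_int (n + m)) (\<beta> X Y)"
  unfolding wt_def using leibD[of X i Y j] by (simp add: scale_left scale_right W.scale_left_distrib)

lemma scale_two: "scale 2 x = x + x" "scale (- 2) x = - (x + x)"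
  by (metis one_add_one scale_left_distrib scale_one, metis one_add_one scale_left_distrib scale_one scale_minus_left)

lemma sw_two: "sw 2 x = x + x"
  by (metis one_add_one W.scale_left_distrib W.scale_one)

lemma wt_x: "b \<in> G i \<Longrightarrow> wt (- 1) (i + 1) (xm b)"
  and wt_y: "b \<in> G i \<Longrightarrow> wt 1 (i + 1) (ym b)"
  and wt_e: "p \<in> G i \<Longrightarrow> bar p = p \<Longrightarrow> wt (- 2) i (em p)"
  and wt_f: "p \<in> G i \<Longrightarrow> bar p = p \<Longrightarrow> wt 2 i (fm p)"
  and wt_h: "a \<in> G i \<Longrightarrow> bar a = - a \<Longrightarrow> d \<in> G i \<Longrightarrow> hm a d \<in> Lie \<Longrightarrow> wt 0 i (hm a d)"
  by (simp_all add: wt_def br_D1 br_D1_e br_D1_f br_D1_h em_Lie fm_Lie omat_scale scale_two omat_add omat_minus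
      scale_minus_left)

lemma ok_minus_one: "wt n i X \<Longrightarrow> wt m j Y \<Longrightarrow> n + m = - 1 \<Longrightarrow> mat.br X Y = xm z \<Longrightarrow> ok X Y"
  using wt_br[of n i X m j Y] gD_x[of z] by (simp add: ok_def)

lemma ok_one: "wt n i X \<Longrightarrow> wt m j Y \<Longrightarrow> n + m = 1 \<Longrightarrow> mat.br X Y = ym z \<Longrightarrow> ok X Y"
  using wt_br[of n i X m j Y] gD_y[of z] by (simp add: ok_def)

lemma ok_minus_two: "wt n i X \<Longrightarrow> wt m j Y \<Longrightarrow> n + m = - 2 \<Longrightarrow> mat.br X Y = em z \<Longrightarrow> bar z = z \<Longrightarrow> ok X Y"
  unfolding ok_def by (rule eq_of_double) (use wt_br[of n i X m j Y] gD_e[of z] in \<open>simp add: sw_two\<close>)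

lemma ok_two: "wt n i X \<Longrightarrow> wt m j Y \<Longrightarrow> n + m = 2 \<Longrightarrow> mat.br X Y = fm z \<Longrightarrow> bar z = z \<Longrightarrow> ok X Y"
  unfolding ok_def by (rule eq_of_double) (use wt_br[of n i X m j Y] gD_f[of z] in \<open>simp add: sw_two\<close>)

lemma sw_four: assumes "sw 4 x = 0" shows "x = 0"
proof -
  have "sw (2 * 2) x = (x + x) + (x + x)" unfolding W.scale_scale[symmetric] sw_two by simp
  then have "(x + x) + (x + x) = 0" using assms by simp
  then show ?thesis using torsion_free by blast
qed

text \<open>The total weights 4 and -4 act invertibly, so the cocycle vanishes together with the
  bracket. For the totals 3 and -3, which need not be invertible, \<open>ok_ex\<close> and
  \<open>ok_fy\<close> rely on \<open>xe0\<close> and \<open>yf0\<close>.\<close>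

lemma ok_four: "wt n i X \<Longrightarrow> wt m j Y \<Longrightarrow> n + m = 4 \<or> n + m = - 4 \<Longrightarrow> mat.br X Y = 0 \<Longrightarrow> ok X Y"
proof -
  assume *: "wt n i X" "wt m j Y" "n + m = 4 \<or> n + m = - 4" "mat.br X Y = 0"
  have "sw (of_int (n + m)) (\<beta> X Y) = 0" using wt_br[OF *(1,2)] *(4) by simp
  moreover have "of_int (n + m) = (4::'k) \<or> of_int (n + m) = (- 4 :: 'k)" using *(3) by (elim disjE) simp_all
  ultimately have "sw 4 (\<beta> X Y) = 0" by (elim disjE) (simp_all only: W.scale_minus_left neg_equal_0_iff_equal)
  then show ?thesis using sw_four gD_h[of 0 0] *(4) by (simp add: ok_def)
qed

lemma br_hf:
  assumes "a \<in> G k" "bar a = - a" "d \<in> G k" "p \<in> G m" "bar p = p"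
  shows "mat.br (hm a d) (fm p) = fm (d * p + sg (k * m) (p * bar d))"
  using omat_br[of 0 k 0 0 0 a d 0 m 0 0 p 0 0] assms by (simp add: sg_minus)

lemma yx0: "c \<in> G i \<Longrightarrow> b \<in> G j \<Longrightarrow> \<beta> (ym c) (xm b) = 0"
  using yx[of b j c i] by (simp add: Tb_def xy0)

definition gen :: "'r^3^3 \<Rightarrow> bool" where
  "gen X \<longleftrightarrow> (\<exists>i b. b \<in> G i \<and> X = xm b) \<or> (\<exists>i c. c \<in> G i \<and> X = ym c)
    \<or> (\<exists>i p. p \<in> G i \<and> bar p = p \<and> X = em p) \<or> (\<exists>i q. q \<in> G i \<and> bar q = q \<and> X = fm q)
    \<or> (\<exists>i j b c. b \<in> G i \<and> c \<in> G j \<and> X = mat.br (xm b) (ym c))"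

section \<open>The primitive on pairs of generators\<close>

context
  fixes b c p q b' c' p' q' i j k m i' j' k' m'
  assumes G: "b \<in> G i" "c \<in> G j" "p \<in> G k" "bar p = p" "q \<in> G m" "bar q = q"
    "b' \<in> G i'" "c' \<in> G j'" "p' \<in> G k'" "bar p' = p'" "q' \<in> G m'" "bar q' = q'"
begin

lemma ok_xx: "ok (xm b) (xm b')"
  by (rule ok_minus_two[OF wt_x[OF G(1)] wt_x[OF G(7)] _ br_xx[OF G(1,7)]])
    (use G bar_mult'[OF bar_G[OF G(1)] G(7)] bar_mult'[OF bar_G[OF G(7)] G(1)] in \<open>simp_all add: bar_sg bar_add mult.commute add.commute\<close>)

lemma ok_yy: "ok (ym c) (ym c')"
  by (rule ok_two[OF wt_y[OF G(2)] wt_y[OF G(8)] _ br_yy[OF G(2,8)]])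
    (use G bar_mult'[OF G(2) bar_G[OF G(8)]] bar_mult'[OF G(8) bar_G[OF G(2)]] in \<open>simp_all add: bar_sg bar_add bar_minus mult.commute add.commute\<close>)

lemma ok_xy: "ok (xm b) (ym c)"
  by (simp add: ok_def xy0 br_xy[OF G(1,2)] gD_h)

lemma ok_ex: "ok (em p) (xm b)"
proof -
  have "\<beta> (xm b) (em p) = 0" using Ew_eq[OF G(3,4,1)] xe0 by simp
  then have "\<beta> (em p) (xm b) = 0"
    using anti'[OF xm_G[OF G(1)] xm_Lie em_G[OF G(3)] em_Lie[OF G(4)]] by simp
  then show ?thesis using gD_h[of 0 0] by (simp add: ok_def br_ex[OF G(3,4,1)])
qed

lemma ok_fx: "ok (fm q) (xm b)"
  by (rule ok_one[OF wt_f[OF G(5,6)] wt_x[OF G(1)] _ br_fx[OF G(5,6,1)]]) simp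

lemma ok_ey: "ok (em p) (ym c)"
  by (rule ok_minus_one[OF wt_e[OF G(3,4)] wt_y[OF G(2)] _ br_ey[OF G(3,4,2)]]) simp

lemma ok_fy: "ok (fm q) (ym c)"
proof -
  \<comment> \<open>\<open>theta\<close> maps these two arguments to \<open>ym c\<close> and
    \<open>fm q\<close>, so this is the weight -3 argument for the cocycle composed with
    \<open>theta\<close>.\<close>
  have "\<beta> (theta (xm (bar (par c)))) (theta (em (- q))) = 0"
    using cocycle.Ew_eq[OF cocycle_theta, of "- q" m "bar (par c)" j] G yf0 by (simp add: bar_minus)
  then have "\<beta> (ym c) (fm q) = 0" by (simp add: theta_omat bar_par)
  then have "\<beta> (fm q) (ym c) = 0"
    using anti'[OF ym_G[OF G(2)] ym_Lie fm_G[OF G(5)] fm_Lie[OF G(6)]] by simp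
  then show ?thesis using gD_h[of 0 0] by (simp add: ok_def br_fy[OF G(5,6,2)])
qed

lemma ok_ee: "ok (em p) (em p')"
  by (rule ok_four[OF wt_e[OF G(3,4)] wt_e[OF G(9,10)] _ br_ee[OF G(3,4,9,10)]]) simp

lemma ok_ff: "ok (fm q) (fm q')"
  by (rule ok_four[OF wt_f[OF G(5,6)] wt_f[OF G(11,12)] _ br_ff[OF G(5,6,11,12)]]) simp

text \<open>The total weight is 0, so the weights say nothing. Instead \<open>fm q\<close> is
  written as a bracket of two vectors \<open>ym\<close>, and \<open>xy0\<close> kills the Leibniz
  expansion.\<close>

lemma ok_ef: "ok (em p) (fm q)"
proof -
  let ?q = "- scale hlf q"
  have q: "?q \<in> G m" using G by simp
  have "\<beta> (em p) (mat.br (ym ?q) (ym 1)) = 0"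
    using leib[OF em_G[OF G(3)] em_Lie[OF G(4)] ym_G[OF q] ym_Lie ym_G[OF one_G] ym_Lie]
    unfolding br_ey[OF G(3,4) q] br_ey[OF G(3,4) one_G]
    using yx0[OF q, of "sg (k * 0 + k + 0) (bar 1 * p)" k] G by (simp add: xy0)
  then show ?thesis unfolding ok_def br_ef[OF G(3-6)] gD_h using fm_br[OF G(5,6)] by simp
qed

context
  fixes a d l
  assumes h: "a \<in> G l" "bar a = - a" "d \<in> G l" "hm a d \<in> Lie"
begin

lemma ok_hx: "ok (hm a d) (xm b)"
  by (rule ok_minus_one[OF wt_h[OF h] wt_x[OF G(1)] _ br_hx[OF h(1-3) G(1)]]) simp

lemma ok_hy: "ok (hm a d) (ym c)"
  by (rule ok_one[OF wt_h[OF h] wt_y[OF G(2)] _ br_hy[OF h(1-3) G(2)]]) simp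

lemma ok_he: "ok (hm a d) (em p)"
  by (rule ok_minus_two[OF wt_h[OF h] wt_e[OF G(3,4)] _ br_he[OF h(1-3) G(3,4)]])
    (use bar_mult'[OF bar_G[OF h(3)] G(3)] bar_mult'[OF G(3) h(3)] G in
      \<open>simp_all add: bar_sg bar_diff bar_minus mult.commute algebra_simps\<close>)

lemma ok_hf: "ok (hm a d) (fm q)"
  by (rule ok_two[OF wt_h[OF h] wt_f[OF G(5,6)] _ br_hf[OF h(1-3) G(5,6)]])
    (use bar_mult'[OF h(3) G(5)] bar_mult'[OF G(5) bar_G[OF h(3)]] G in
      \<open>simp_all add: bar_sg bar_add mult.commute algebra_simps\<close>)

lemma ok_hh: "ok (hm a d) (mat.br (xm b) (ym c))"
proof -
  have "\<beta> (hm a d) (mat.br (xm b) (ym c)) = 0"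
    using leib[OF hm_G[OF h(1,3)] h(4) xm_G[OF G(1)] xm_Lie ym_G[OF G(2)] ym_Lie]
    unfolding br_hx[OF h(1-3) G(1)] br_hy[OF h(1-3) G(2)] by (simp add: xy0)
  moreover have "mat.br (hm a d) (mat.br (xm b) (ym c)) $ 1 $ 2 = 0 \<and> mat.br (hm a d) (mat.br (xm b) (ym c)) $ 2 $ 1 = 0
     \<and> mat.br (hm a d) (mat.br (xm b) (ym c)) $ 3 $ 2 = 0 \<and> mat.br (hm a d) (mat.br (xm b) (ym c)) $ 2 $ 3 = 0"
    using omat_br[of 0 l 0 0 0 a d 0 "i + j" 0 0 0 "sk (b * c)" "sg (i * j + i + j) (c * b)"] h G
    unfolding br_xy[OF G(1,2)] by (simp add: bar_sk)
  ultimately show ?thesis using zero_right[OF D1_Lie] by (simp add: ok_def gD_def nw_def)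
qed

end

end

text \<open>Each pair of types of generators is settled in one order by an \<open>ok\<close> lemma
  and in the other by \<open>ok_sym\<close>.\<close>

lemma gen_ok:
  assumes "gen X" "gen Y" shows "ok X Y"
proof -
  have s: "ok Y X \<Longrightarrow> wt n i Y \<Longrightarrow> wt m j X \<Longrightarrow> ok X Y" for X Y i j n m
    using ok_sym[of Y X i j] by (simp add: wt_def)
  \<comment> \<open>Zero fills the remaining slots of the parameter block that the \<open>ok\<close>
    lemmas share.\<close>
  have z: "(0::'r) \<in> G 0" "bar (0::'r) = 0" by simp_all
  have xy: "\<exists>a d l. a \<in> G l \<and> bar a = - a \<and> d \<in> G l \<and> hm a d \<in> Lie \<and> mat.br (xm b) (ym c) = hm a d"
    if "b \<in> G i" "c \<in> G j" for b c i j
    using xy_Lie[of b c] that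
    by (intro exI[of _ "sk (b * c)"] exI[of _ "sg (i * j + i + j) (c * b)"] exI[of _ "i + j"])
       (simp add: br_xy bar_sk)
  have h: "ok (mat.br (xm b) (ym c)) Y" if bcY: "b \<in> G i" "c \<in> G j" "gen Y" for b c i j Y
  proof -
    obtain a d l where 1: "a \<in> G l" "bar a = - a" "d \<in> G l" "hm a d \<in> Lie" "mat.br (xm b) (ym c) = hm a d"
      using xy[OF bcY(1,2)] by blast
    show ?thesis
      using bcY(3) ok_hx[OF _ z(1) z z z(1) z(1) z z 1(1-4)] ok_hy[OF z(1) _ z z z(1) z(1) z z 1(1-4)]
        ok_he[OF z(1) z(1) _ _ z z(1) z(1) z z 1(1-4)] ok_hf[OF z(1) z(1) z _ _ z(1) z(1) z z 1(1-4)]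
        ok_hh[OF _ _ z z z(1) z(1) z z 1(1-4)]
      unfolding 1(5) gen_def by blast
  qed
  have w: "\<exists>n i. wt n i X" if "gen X" for X
  proof -
    have "\<exists>n i. wt n i (mat.br (xm b) (ym c))" if "b \<in> G i" "c \<in> G j" for b c i j
    proof -
      obtain a d l where "a \<in> G l" "bar a = - a" "d \<in> G l" "hm a d \<in> Lie" "mat.br (xm b) (ym c) = hm a d"
        using xy[OF \<open>b \<in> G i\<close> \<open>c \<in> G j\<close>] by blast
      then show ?thesis using wt_h by metis
    qed
    then show ?thesis
      using that wt_x wt_y wt_e wt_f unfolding gen_def by (elim disjE exE conjE) blast+
  qed
  have sym: "ok Y X" if "ok X Y" "gen X" "gen Y" for X Y
    using w[OF that(2)] w[OF that(3)] s[OF that(1)] by blast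
  have ge: "gen (em p)" "gen (fm p)" if "p \<in> G i" "bar p = p" for p i using that unfolding gen_def by blast+
  have gx: "gen (xm b)" "gen (ym b)" if "b \<in> G i" for b i using that unfolding gen_def by blast+
  have gxy: "gen (mat.br (xm b) (ym c))" if "b \<in> G i" "c \<in> G j" for b c i j using that unfolding gen_def by blast
  have split: "P Y" if "gen Y" "\<And>i b. b \<in> G i \<Longrightarrow> P (xm b)" "\<And>i c. c \<in> G i \<Longrightarrow> P (ym c)"
    "\<And>i p. p \<in> G i \<Longrightarrow> bar p = p \<Longrightarrow> P (em p)" "\<And>i q. q \<in> G i \<Longrightarrow> bar q = q \<Longrightarrow> P (fm q)"
    "\<And>i j b c. b \<in> G i \<Longrightarrow> c \<in> G j \<Longrightarrow> P (mat.br (xm b) (ym c))" for P Y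
    using that unfolding gen_def by blast
  have h': "ok Y (mat.br (xm b) (ym c))" if "gen Y" "b \<in> G i" "c \<in> G j" for b c i j Y
    by (rule sym[OF h[OF that(2,3,1)] gxy[OF that(2,3)] that(1)])
  have e: "ok (em p) Y" if "p \<in> G i" "bar p = p" "gen Y" for p i Y
    using that(3)
    by (rule split) (fact ok_ex[OF _ z(1) that(1,2) z z(1) z(1) z z] ok_ey[OF z(1) _ that(1,2) z z(1) z(1) z z]
      ok_ee[OF z(1) z(1) that(1,2) z z(1) z(1) _ _ z] ok_ef[OF z(1) z(1) that(1,2) _ _ z(1) z(1) z z]
      h'[OF ge(1)[OF that(1,2)]])+
  have e': "ok Y (em p)" if "gen Y" "p \<in> G i" "bar p = p" for p i Y
    by (rule sym[OF e[OF that(2,3,1)] ge(1)[OF that(2,3)] that(1)])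
  have f: "ok (fm q) Y" if "q \<in> G i" "bar q = q" "gen Y" for q i Y
    using that(3)
    by (rule split) (fact ok_fx[OF _ z(1) z that(1,2) z(1) z(1) z z] ok_fy[OF z(1) _ z that(1,2) z(1) z(1) z z]
      e'[OF ge(2)[OF that(1,2)]] ok_ff[OF z(1) z(1) z that(1,2) z(1) z(1) z] h'[OF ge(2)[OF that(1,2)]])+
  have f': "ok Y (fm p)" if "gen Y" "p \<in> G i" "bar p = p" for p i Y
    by (rule sym[OF f[OF that(2,3,1)] ge(2)[OF that(2,3)] that(1)])
  have yx': "ok (ym c) (xm b)" if "c \<in> G j" "b \<in> G i" for b c i j
    by (rule sym[OF ok_xy[OF that(2,1) z z z(1) z(1) z z] gx(1)[OF that(2)] gx(2)[OF that(1)]])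
  have y: "ok (ym c) Y" if "c \<in> G i" "gen Y" for c i Y
    using that(2)
    by (rule split) (fact yx'[OF that(1)] ok_yy[OF z(1) that(1) z z z(1) _ z z]
      e'[OF gx(2)[OF that(1)]] f'[OF gx(2)[OF that(1)]] h'[OF gx(2)[OF that(1)]])+
  have x: "ok (xm b) Y" if "b \<in> G i" "gen Y" for b i Y
    using that(2)
    by (rule split) (fact ok_xx[OF that(1) z(1) z z _ z(1) z z] ok_xy[OF that(1) _ z z z(1) z(1) z z]
      e'[OF gx(1)[OF that(1)]] f'[OF gx(1)[OF that(1)]] h'[OF gx(1)[OF that(1)]])+
  show ?thesis using assms(1) x[OF _ assms(2)] y[OF _ assms(2)] e[OF _ _ assms(2)] f[OF _ _ assms(2)]
      h[OF _ _ assms(2)]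
    unfolding gen_def by blast
qed

lemma gen_induct [consumes 1, case_names gen add scale]:
  assumes "X \<in> Lie" and gen: "\<And>X. gen X \<Longrightarrow> X \<in> Lie \<Longrightarrow> P X"
    and "\<And>X Y. X \<in> Lie \<Longrightarrow> Y \<in> Lie \<Longrightarrow> P X \<Longrightarrow> P Y \<Longrightarrow> P (X + Y)"
    and "\<And>c X. X \<in> Lie \<Longrightarrow> P X \<Longrightarrow> P (mat_scale scale c X)"
  shows "P X"
  using assms(1)
proof (induction rule: Lie_induct)
  case (x i b) then show ?case by (intro gen) (auto simp: gen_def)
next
  case (y i b) then show ?case by (intro gen) (auto simp: gen_def)
next
  case (e i b) then show ?case by (intro gen) (auto simp: gen_def em_Lie)
next
  case (f i b) then show ?case by (intro gen) (auto simp: gen_def fm_Lie)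
next
  case (xy i j b c)
  then have "gen (mat.br (xm b) (ym c))" unfolding gen_def by blast
  then show ?case using gen xy_Lie by blast
qed (use assms in blast)+

theorem cobounds:
  assumes "X \<in> Lie" "Y \<in> Lie" shows "\<beta> X Y = gD (mat.br X Y)"
  using assms(1)
proof (induction X rule: gen_induct)
  case (gen X)
  show ?case using assms(2)
  proof (induction Y rule: gen_induct)
    case (gen Y) then show ?case using gen_ok[OF \<open>gen X\<close>] by (simp add: ok_def)
  qed (use gen in \<open>simp_all add: add_right scale_right mat.br_add_right mat.br_scale_right gD_add gD_scale\<close>)
qed (use assms in \<open>simp_all add: add_left scale_left mat.br_add_left mat.br_scale_left gD_add gD_scale\<close>)

end

context cocycle
begin

text \<open>Normalising does not change \<open>rplus\<close> and \<open>rminus\<close>, because the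
  brackets involved are 0. So \<open>cobounds\<close> applies to \<open>nrm\<close>; the primitive
  is \<open>gD\<close> plus the one that \<open>nrm\<close> subtracts.\<close>

theorem coboundary_if_invariants_vanish:
  assumes T: "\<And>b c. Tc b c = 0" and r: "\<And>b. rplus b = 0" "\<And>b. rminus b = 0"
  obtains g where "\<And>X Y. X \<in> Lie \<Longrightarrow> Y \<in> Lie \<Longrightarrow> \<beta> X Y = g (mat.br X Y)"
    and "\<And>X Y. X \<in> Lie \<Longrightarrow> Y \<in> Lie \<Longrightarrow> g (X + Y) = g X + g Y"
    and "\<And>c X. X \<in> Lie \<Longrightarrow> g (mat_scale scale c X) = sw c (g X)"
proof -
  have hom0: "rplus b = nrm (xm b) (em 1) \<and> rminus b = nrm (theta (xm b)) (theta (em 1))" if "b \<in> G i" for b i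
  proof -
    have "mat.br (xm b) (em 1) = 0"
      using mat.br_anti[OF em_G[OF one_G] xm_G[OF that]] br_ex[OF one_G bar_one that] by simp
    then show ?thesis
      by (simp add: rplus_def rminus_def nrm_def theta_br[symmetric])
  qed
  interpret n: normalized_cocycle scale G bar sw nrm by (rule nrm_normalized)
  have "nrm (xm b) (em 1) = 0 \<and> nrm (theta (xm b)) (theta (em 1)) = 0" for b
  proof (induction b rule: homogeneous_induct)
    case (1 i b) then show ?case using hom0[OF 1] r by simp
  next
    case (2 b b')
    have "xm (b + b') = xm b + xm b'" by (simp add: omat_add)
    then show ?case using 2 by (simp add: theta_add n.add_left em_Lie)
  qed
  moreover have "nrm (xm b) (ym c) = 0" for b c using T by (simp add: Tc_def)
  ultimately interpret t: trivial_cocycle scale G bar sw nrm by unfold_locales simp_all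
  let ?h = "\<lambda>Z. \<beta> (xm (par (Z $ 2 $ 2))) (ym 1)"
  show ?thesis
  proof (rule that[of "\<lambda>Z. t.gD Z + ?h Z"])
    show "\<beta> X Y = t.gD (mat.br X Y) + ?h (mat.br X Y)" if "X \<in> Lie" "Y \<in> Lie" for X Y
      using t.cobounds[OF that] by (simp add: nrm_def algebra_simps)
    show "t.gD (X + Y) + ?h (X + Y) = t.gD X + ?h X + (t.gD Y + ?h Y)" if "X \<in> Lie" "Y \<in> Lie" for X Y
      using add_left[OF xm_Lie xm_Lie ym_Lie, of "par (X$2$2)" "par (Y$2$2)" 1] t.gD_add[OF that]
      by (simp add: par_add omat_add)
    show "t.gD (mat_scale scale c X) + ?h (mat_scale scale c X) = sw c (t.gD X + ?h X)" if "X \<in> Lie" for c X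
      using scale_left[OF xm_Lie ym_Lie, of c "par (X$2$2)" 1] t.gD_scale[OF that]
      by (simp add: par_scale omat_scale W.scale_right_distrib)
  qed
qed

end

section \<open>Cocycles from maps on \<open>R\<close>\<close>

locale I3_linear = osp_setting scale G bar + I3_map scale G bar r + W: module sw
  for scale :: "'k::comm_ring_1 \<Rightarrow> 'r::{ring, monoid_mult} \<Rightarrow> 'r" and G bar
    and r :: "'r \<Rightarrow> 'w::ab_group_add" and sw :: "'k \<Rightarrow> 'w \<Rightarrow> 'w" +
  assumes r_scale: "r (scale c a) = sw c (r a)"
begin

text \<open>Pairs the weights -1 and -2 through \<open>r\<close>. The second term makes it
  antisymmetric; \<open>par\<close> and \<open>bar\<close> produce its sign without mention of
  degrees, see \<open>Phi_hom\<close>.\<close>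

definition Phi :: "'r^3^3 \<Rightarrow> 'r^3^3 \<Rightarrow> 'w" where
  "Phi X Y = r (X$1$2 * Y$3$2) - r (par (X$3$2) * bar (Y$1$2))"

lemma Phi_add: "Phi (X + Y) Z = Phi X Z + Phi Y Z" "Phi Z (X + Y) = Phi Z X + Phi Z Y"
  by (simp_all add: Phi_def par_add bar_add r_simps algebra_simps)

lemma Phi_scale: "Phi (mat_scale scale c X) Z = sw c (Phi X Z)" "Phi Z (mat_scale scale c X) = sw c (Phi Z X)"
  by (simp_all add: Phi_def par_scale bar_scale m_scale_left m_scale_right r_scale W.scale_right_diff_distrib)

lemma Lie_hom:
  assumes "X \<in> mat_grading G i" "X \<in> Lie"
  obtains b c p q a d where "X = omat b c p q a d" "b \<in> G (i + 1)" "c \<in> G (i + 1)" "p \<in> G i" "bar p = p"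
    "q \<in> G i" "bar q = q" "a \<in> G i" "bar a = - a" "d \<in> G i" "a - sk (par d) \<in> S"
proof -
  obtain b c p q a d where X: "X = omat b c p q a d" "bar p = p" "bar q = q" "bar a = - a" "a - sk (par d) \<in> S"
    using Lie_Lrep[OF assms(2)] unfolding Lrep_def by blast
  have "a \<in> G i" "b \<in> G (i + 1)" "c \<in> G (i + 1)" "d \<in> G i" "q \<in> G i" "p \<in> G i"
    using assms(1) unfolding X(1) by (simp_all add: mat_grading_def forall_3 add.commute)
  then show ?thesis using that X by blast
qed

lemma r_S: "s \<in> S \<Longrightarrow> z \<in> G l \<Longrightarrow> r (s * z) = 0"
  unfolding S_def
proof (induction rule: span_induct_alt)
  case base show ?case by (simp add: r.zero)
next
  case (step c x y)
  then show ?case using r_sk by (auto simp: distrib_right r.add m_scale_left r_scale)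
qed

lemma Phi_hom:
  assumes p: "p \<in> G i" "bar p = p" and b': "b' \<in> G (j + 1)"
  shows "Phi (omat b c p q a d) (omat b' c' p' q' a' d') = r (b * p') - sg (i * j) (r (b' * p))"
  using r_bar2[OF b' p(1)] p(2)
  by (cases i; cases j; simp add: Phi_def par_hom[OF p(1)] r_simps)

text \<open>Only triples of total weight -3 contribute to the Jacobi sum: three \<open>xm\<close>; a
  diagonal element with an \<open>xm\<close> and an \<open>em\<close>; or a \<open>ym\<close> with
  two \<open>em\<close>. These are the terms \<open>h1\<close>, \<open>h2\<close> and
  \<open>h4\<close>.\<close>

lemma Phi_cocycle: "cocycle scale G bar sw Phi"
proof (unfold_locales, goal_cases)
  case (5 X i Y j)
  then obtain b c p q a d b' c' p' q' a' d' where
    X: "X = omat b c p q a d" "b \<in> G (i + 1)" "p \<in> G i" "bar p = p" and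
    Y: "Y = omat b' c' p' q' a' d'" "b' \<in> G (j + 1)" "p' \<in> G j" "bar p' = p'"
    using Lie_hom[of X i] Lie_hom[of Y j] by (metis IntE)
  show ?case unfolding X(1) Y(1) Phi_hom[OF X(3,4) Y(2)] Phi_hom[OF Y(3,4) X(2)]
    by (cases i; cases j; simp)
next
  case (6 X i Y j Z k)
  obtain b1 c1 p1 q1 a1 d1 where X: "X = omat b1 c1 p1 q1 a1 d1" "b1 \<in> G (i + 1)" "c1 \<in> G (i + 1)" "p1 \<in> G i" "bar p1 = p1"
    "q1 \<in> G i" "bar q1 = q1" "a1 \<in> G i" "bar a1 = - a1" "d1 \<in> G i" "a1 - sk (par d1) \<in> S"
    using 6(1) by (elim IntE) (rule Lie_hom)
  obtain b2 c2 p2 q2 a2 d2 where Y: "Y = omat b2 c2 p2 q2 a2 d2" "b2 \<in> G (j + 1)" "c2 \<in> G (j + 1)" "p2 \<in> G j" "bar p2 = p2"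
    "q2 \<in> G j" "bar q2 = q2" "a2 \<in> G j" "bar a2 = - a2" "d2 \<in> G j" "a2 - sk (par d2) \<in> S"
    using 6(2) by (elim IntE) (rule Lie_hom)
  obtain b3 c3 p3 q3 a3 d3 where Z: "Z = omat b3 c3 p3 q3 a3 d3" "b3 \<in> G (k + 1)" "c3 \<in> G (k + 1)" "p3 \<in> G k" "bar p3 = p3"
    "q3 \<in> G k" "bar q3 = q3" "a3 \<in> G k" "bar a3 = - a3" "d3 \<in> G k" "a3 - sk (par d3) \<in> S"
    using 6(3) by (elim IntE) (rule Lie_hom)
  have P: "Phi (mat.br (omat b c p q a d) (omat b' c' p' q' a' d')) (omat b'' c'' p'' q'' a'' d'')
    = r ((a * b' + b * d' - bar (par c) * p' - sg (i * j) (a' * b + b' * d - bar (par c') * p)) * p'')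
      - sg ((i + j) * k) (r (b'' * (bar (par b) * b' + p * d' - bar d * p' - sg (i * j) (bar (par b') * b + p' * d - bar d' * p))))"
    if x: "b \<in> G (i + 1)" "c \<in> G (i + 1)" "p \<in> G i" "bar p = p" "q \<in> G i" "bar q = q" "a \<in> G i" "bar a = - a" "d \<in> G i"
    and y: "b' \<in> G (j + 1)" "c' \<in> G (j + 1)" "p' \<in> G j" "bar p' = p'" "q' \<in> G j" "bar q' = q'" "a' \<in> G j" "bar a' = - a'" "d' \<in> G j"
    and z: "b'' \<in> G (k + 1)" for b c p q a d b' c' p' q' a' d' b'' c'' p'' q'' a'' d'' i j k
  proof -
    note br = omat_br[OF x y]
    have pp: "bar (par b) * b' + p * d' - bar d * p' - sg (i * j) (bar (par b') * b + p' * d - bar d' * p) \<in> G (i + j)"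
    proof -
      have "omat b c p q a d \<in> mat_grading G i" "omat b' c' p' q' a' d' \<in> mat_grading G j"
        by (rule omat_G; use x y in simp)+
      from mat.br_G[OF this] have "mat.br (omat b c p q a d) (omat b' c' p' q' a' d') $ 3 $ 2 \<in> G (i + j)"
        by (auto simp: mat_grading_def forall_3)
      then show ?thesis unfolding br by simp
    qed
    have sym: "bar (bar (par b) * b' + p * d' - bar d * p' - sg (i * j) (bar (par b') * b + p' * d - bar d' * p))
      = bar (par b) * b' + p * d' - bar d * p' - sg (i * j) (bar (par b') * b + p' * d - bar d' * p)"
      using bar_mult'[OF bar_G[OF x(1)] y(1)] bar_mult'[OF bar_G[OF y(1)] x(1)] bar_mult'[OF x(3) y(9)] bar_mult'[OF y(3) x(9)]
        bar_mult'[OF bar_G[OF x(9)] y(3)] bar_mult'[OF bar_G[OF y(9)] x(3)]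
      by (cases i; cases j; simp add: par_hom[OF x(1)] par_hom[OF y(1)] bar_add bar_diff bar_minus x(4) y(4))
    show ?thesis unfolding br by (rule Phi_hom[OF pp sym z])
  qed
  define h2 where "h2 a d b p i j k = r (a * b * p) - sg (i * j) (r (b * d * p))
    - sg (i * j) (r (b * (bar d * p + sg (i * k) (p * d))))" for a d b p i j k
  have h2: "h2 a (par d) b p i j k = 0" if "a \<in> G i" "d \<in> G i" "b \<in> G j" "p \<in> G k" "bar p = p" "a - sk (par d) \<in> S"
    for a d b p i j k
    using r_height_two[OF that(1) par_mem[OF that(2)] that(3-5)] r_S[OF that(6)] by (simp add: h2_def)
  define h4 where "h4 c p q j k = r (c * p * q) - sg (j * k) (r (c * q * p))" for c p q j k
  have h4: "h4 (bar (par c)) p q j k = 0" if "c \<in> G i" "p \<in> G j" "bar p = p" "q \<in> G k" "bar q = q" for c p q i j k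
    unfolding h4_def by (rule r_height_four[OF bar_G[OF par_mem[OF that(1)]] that(2-5)])
  note h1 = r_height_one[OF X(2) Y(2) Z(2)]
  have "sg (i * k) (Phi (mat.br X Y) Z) + sg (j * i) (Phi (mat.br Y Z) X) + sg (k * j) (Phi (mat.br Z X) Y)
    = - (sg (i * k + (i + j) * k) (r (b3 * (bar (par b1) * b2 - sg (i * j) (bar (par b2) * b1))))
    + sg (j * i + (j + k) * i) (r (b1 * (bar (par b2) * b3 - sg (j * k) (bar (par b3) * b2))))
    + sg (k * j + (k + i) * j) (r (b2 * (bar (par b3) * b1 - sg (k * i) (bar (par b1) * b3)))))
    + sg (i * k) (h2 a1 (par d1) b2 p3 i (j + 1) k) - sg (k * j + k * i) (h2 a1 (par d1) b3 p2 i (k + 1) j)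
    + sg (j * i) (h2 a2 (par d2) b3 p1 j (k + 1) i) - sg (i * k + i * j) (h2 a2 (par d2) b1 p3 j (i + 1) k)
    + sg (k * j) (h2 a3 (par d3) b1 p2 k (i + 1) j) - sg (j * i + j * k) (h2 a3 (par d3) b2 p1 k (j + 1) i)
    - sg (i * k) (h4 (bar (par c1)) p2 p3 j k) - sg (j * i) (h4 (bar (par c2)) p3 p1 k i) - sg (k * j) (h4 (bar (par c3)) p1 p2 i j)"
    unfolding X(1) Y(1) Z(1) P[OF X(2-10) Y(2-10) Z(2)] P[OF Y(2-10) Z(2-10) X(2)] P[OF Z(2-10) X(2-10) Y(2)] h2_def h4_def
      par_hom[OF X(10)] par_hom[OF Y(10)] par_hom[OF Z(10)]
    by (cases i; cases j; cases k; simp add: r_simps bar_minus algebra_simps)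
  also have "\<dots> = 0"
    unfolding h1 h2[OF X(8,10) Y(2) Z(4,5) X(11)] h2[OF X(8,10) Z(2) Y(4,5) X(11)]
      h2[OF Y(8,10) Z(2) X(4,5) Y(11)] h2[OF Y(8,10) X(2) Z(4,5) Y(11)]
      h2[OF Z(8,10) X(2) Y(4,5) Z(11)] h2[OF Z(8,10) Y(2) X(4,5) Z(11)]
      h4[OF X(3) Y(4,5) Z(4,5)] h4[OF Y(3) Z(4,5) X(4,5)] h4[OF Z(3) X(4,5) Y(4,5)] by simp
  finally show ?case .
qed (simp_all add: Phi_add Phi_scale)

sublocale Phi: cocycle scale G bar sw Phi by (rule Phi_cocycle)

lemma Phi_invariants: "Phi.Tc b c = 0" "Phi.rplus b = r b" "Phi.rminus b = 0"
  by (simp_all add: Phi.Tc_def Phi.nrm_def Phi.rplus_def Phi.rminus_def Phi_def theta_omat r.zero)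

text \<open>\<open>theta\<close> has order four, so its cube is its inverse.\<close>

definition Phim :: "'r^3^3 \<Rightarrow> 'r^3^3 \<Rightarrow> 'w" where
  "Phim X Y = Phi (theta (theta (theta X))) (theta (theta (theta Y)))"

lemma Phim_cocycle: "cocycle scale G bar sw Phim"
  using cocycle.cocycle_theta[OF cocycle.cocycle_theta[OF Phi.cocycle_theta]] by (simp add: Phim_def[abs_def])

sublocale Phim: cocycle scale G bar sw Phim by (rule Phim_cocycle)

lemma Phim_invariants: "Phim.Tc b c = 0" "Phim.rplus b = 0" "Phim.rminus b = r b"
  by (simp_all add: Phim.Tc_def Phim.nrm_def Phim.rplus_def Phim.rminus_def Phim_def Phi_def theta_omat r.zero
      bar_minus par_minus bar_par)

end

section \<open>The cocycle with a prescribed pairing\<close>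

locale hd_linear = osp_setting scale G bar + hd_symbol scale G bar T + W: module sw
  for scale :: "'k::comm_ring_1 \<Rightarrow> 'r::{ring, monoid_mult} \<Rightarrow> 'r" and G bar
    and T :: "'r \<Rightarrow> 'r \<Rightarrow> 'w::ab_group_add" and sw :: "'k \<Rightarrow> 'w \<Rightarrow> 'w" +
  assumes T_scale_left: "T (scale c a) b = sw c (T a b)" and T_scale_right: "T a (scale c b) = sw c (T a b)"
begin

text \<open>The restriction of the cocycle to come to the odd part.\<close>

definition bV :: "'r^3^3 \<Rightarrow> 'r^3^3 \<Rightarrow> 'w" where
  "bV X Y = T (X$1$2) (Y$2$1) - T (par (X$2$1)) (par (Y$1$2))"

lemma bV_add: "bV (X + Y) Z = bV X Z + bV Y Z" "bV Z (X + Y) = bV Z X + bV Z Y"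
  by (simp_all add: bV_def par_add T_simps algebra_simps)

lemma bV_scale: "bV (mat_scale scale c X) Z = sw c (bV X Z)" "bV Z (mat_scale scale c X) = sw c (bV Z X)"
  by (simp_all add: bV_def par_scale T_scale_left T_scale_right W.scale_right_diff_distrib)

lemma bV_zero [simp]: "bV 0 Z = 0" "bV Z 0 = 0"
  by (simp_all add: bV_def)

lemma bV_minus: "bV (- X) Z = - bV X Z" "bV Z (- X) = - bV Z X"
  using bV_add(1)[of X "- X" Z] bV_add(2)[of Z X "- X"] by (simp_all add: eq_neg_iff_add_eq_0 add.commute)

lemma bV_diff: "bV (X - Y) Z = bV X Z - bV Y Z" "bV Z (X - Y) = bV Z X - bV Z Y"
  using bV_add(1)[of X "- Y" Z] bV_add(2)[of Z X "- Y"] by (simp_all add: bV_minus)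

lemma bV_sg: "bV (sg p X) Z = sg p (bV X Z)" "bV Z (sg p X) = sg p (bV Z X)"
  by (cases p; simp add: bV_minus)+

lemma bV_anti:
  assumes X: "X \<in> mat_grading G i" and Y: "Y \<in> mat_grading G j"
  shows "bV X Y = - sg (i * j) (bV Y X)"
proof -
  have m: "X $ 1 $ 2 \<in> G (i + 1)" "X $ 2 $ 1 \<in> G (i + 1)" "Y $ 1 $ 2 \<in> G (j + 1)" "Y $ 2 $ 1 \<in> G (j + 1)"
    using X Y by (auto simp: mat_grading_def forall_3 add.commute)
  show ?thesis
    using T_anti[OF m(1,4)] T_anti[OF m(2,3)]
    by (cases i; cases j; simp add: bV_def par_hom[OF m(1)] par_hom[OF m(2)] par_hom[OF m(3)] par_hom[OF m(4)] T_simps)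
qed

lemma bV_xx [simp]: "bV (xm b) (xm c) = 0" and bV_yy [simp]: "bV (ym b) (ym c) = 0"
  and bV_xy [simp]: "bV (xm b) (ym c) = T b c"
  by (simp_all add: bV_def)

lemma bV_yx: "c \<in> G k \<Longrightarrow> b \<in> G i \<Longrightarrow> bV (ym c) (xm b) = - sg ((k + 1) * (i + 1)) (T b c)"
  using bV_anti[OF ym_G xm_G, of c k b i] by simp

text \<open>The value forced on the pair \<open>(X, [v, w])\<close> by the Leibniz rule.\<close>

definition Q :: "'r^3^3 \<Rightarrow> bit \<Rightarrow> bit \<Rightarrow> 'r^3^3 \<Rightarrow> 'r^3^3 \<Rightarrow> 'w" where
  "Q X i j v w = bV (mat.br X v) w - sg (i * j) (bV (mat.br X w) v)"

lemma Q_add: "Q (X + Y) i j v w = Q X i j v w + Q Y i j v w"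
  by (simp add: Q_def mat.br_add_left bV_add sg_add algebra_simps)

lemma Q_add_v: "Q X i j (v + v') w = Q X i j v w + Q X i j v' w"
  "Q X i j v (w + w') = Q X i j v w + Q X i j v w'"
  by (simp_all add: Q_def mat.br_add_right bV_add sg_add algebra_simps)

lemma Q_scale: "Q (mat_scale scale c X) i j v w = sw c (Q X i j v w)"
  by (simp add: Q_def mat.br_scale_left bV_scale W.scale_sg W.scale_right_diff_distrib)

lemma Q_scale_v: "Q X i j (mat_scale scale c v) w = sw c (Q X i j v w)"
  by (simp add: Q_def mat.br_scale_right bV_scale W.scale_sg W.scale_right_diff_distrib)

lemma Q_zero [simp]: "Q 0 i j v w = 0" by (simp add: Q_def)

lemma Q_minus: "Q (- X) i j v w = - Q X i j v w" "Q X i j (- v) w = - Q X i j v w"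
  by (simp_all add: Q_def mat.br_minus bV_minus sg_minus)

lemma Q_sg: "Q (sg p X) i j v w = sg p (Q X i j v w)" "Q X i j (sg p v) w = sg p (Q X i j v w)"
  by (cases p; simp add: Q_minus)+

lemma Q_swap: "Q X j i w v = - sg (i * j) (Q X i j v w)"
  by (simp add: Q_def sg_diff sg_sg mult.commute)

lemma Q_hm:
  assumes h: "a \<in> G k" "bar a = - a" "d \<in> G k" and b: "b \<in> G i" and c: "c \<in> G j"
  shows "Q (hm a (sg k d)) (i + 1) (j + 1) (xm b) (ym c) = QT k a d i j b c"
    and "Q (hm a (sg k d)) (i + 1) (j + 1) (xm b) (xm c) = 0"
    and "Q (hm a (sg k d)) (i + 1) (j + 1) (ym b) (ym c) = 0"
proof -
  have d: "sg k d \<in> G k" using h by simp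
  have hx: "mat.br (hm a (sg k d)) (xm b) = xm (a * b - sg (k * i) (b * d))" if "b \<in> G i" for b i
    using br_hx[OF h(1,2) d that] by (simp add: sg_mult_right sg_sg distrib_left add.assoc)
  have hy: "mat.br (hm a (sg k d)) (ym c) = ym (sg k (d * c - sg (k * j) (c * a)))" if "c \<in> G j" for c j
    using br_hy[OF h(1,2) d that] by (simp add: sg_mult_left sg_sg sg_diff distrib_left add.commute)
  have y: "d * c - sg (k * j) (c * a) \<in> G (k + j)" using c h by simp
  show "Q (hm a (sg k d)) (i + 1) (j + 1) (xm b) (ym c) = QT k a d i j b c"
    unfolding Q_def hx[OF b] hy[OF c] QT_def bV_xy bV_yx[OF G_closed(6)[OF y] b]
    by (cases i; cases j; cases k; simp add: T_simps algebra_simps)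
  show "Q (hm a (sg k d)) (i + 1) (j + 1) (xm b) (xm c) = 0"
    unfolding Q_def hx[OF b] hx[OF c] by (simp add: bV_def)
  show "Q (hm a (sg k d)) (i + 1) (j + 1) (ym b) (ym c) = 0"
    unfolding Q_def hy[OF b] hy[OF c] by (simp add: bV_def)
qed

text \<open>By \<open>K2\<close> and \<open>J_sym\<close> the forced value on two vectors
  \<open>ym\<close> depends on \<open>b * bar c\<close> only, up to sign, as their bracket
  does.\<close>

lemma Q_em:
  assumes p: "p \<in> G m" "bar p = p" and b: "b \<in> G i" and c: "c \<in> G j"
  shows "Q (em p) (i + 1) (j + 1) (xm b) (ym c) = 0"
    and "Q (em p) (i + 1) (j + 1) (xm b) (xm c) = 0"
    and "Q (em p) (i + 1) (j + 1) (ym b) (ym c) = sg (m + i) (T p (b * bar c))"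
proof -
  show "Q (em p) (i + 1) (j + 1) (xm b) (ym c) = 0"
    unfolding Q_def br_ex[OF p b] br_ey[OF p c] by (simp add: bV_def)
  show "Q (em p) (i + 1) (j + 1) (xm b) (xm c) = 0"
    unfolding Q_def br_ex[OF p b] br_ex[OF p c] by simp
  show "Q (em p) (i + 1) (j + 1) (ym b) (ym c) = sg (m + i) (T p (b * bar c))"
    unfolding Q_def br_ey[OF p b] br_ey[OF p c]
    using K2[OF p b c] J_sym[OF p b bar_G[OF c]]
    by (cases i; cases j; cases m; simp add: bV_def T_simps algebra_simps neg_eq_iff_add_eq_0 eq_neg_iff_add_eq_0)
qed

lemma Q_fm:
  assumes p: "p \<in> G m" "bar p = p" and b: "b \<in> G i" and c: "c \<in> G j"
  shows "Q (fm p) (i + 1) (j + 1) (xm b) (ym c) = 0"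
    and "Q (fm p) (i + 1) (j + 1) (ym b) (ym c) = 0"
    and "Q (fm p) (i + 1) (j + 1) (xm b) (xm c) = sg (m + j + (i + j) * m) (T (bar b * c) p)"
proof -
  show "Q (fm p) (i + 1) (j + 1) (xm b) (ym c) = 0"
    unfolding Q_def br_fx[OF p b] br_fy[OF p c] by (simp add: bV_def)
  show "Q (fm p) (i + 1) (j + 1) (ym b) (ym c) = 0"
    unfolding Q_def br_fy[OF p b] br_fy[OF p c] by simp
  show "Q (fm p) (i + 1) (j + 1) (xm b) (xm c) = sg (m + j + (i + j) * m) (T (bar b * c) p)"
    unfolding Q_def br_fx[OF p b] br_fx[OF p c]
      bV_yx[OF G_closed(6)[OF G_mult'[OF p(1) bar_G[OF b]]] c] bV_yx[OF G_closed(6)[OF G_mult'[OF p(1) bar_G[OF c]]] b]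
    using K1[OF p b c] J_sym[OF p bar_G[OF b] c]
    by (cases i; cases j; cases m; simp add: T_simps algebra_simps neg_eq_iff_add_eq_0 eq_neg_iff_add_eq_0)
qed

lemma sg_swap_zero: "A + sg p B = 0 \<Longrightarrow> B + sg p A = 0" for A B :: "'w"
  by (cases p) (simp_all add: add.commute)

text \<open>The pairs of odd root vectors used to write elements of the even part as sums of brackets.\<close>

inductive pr :: "bit \<Rightarrow> bit \<Rightarrow> 'r^3^3 \<Rightarrow> 'r^3^3 \<Rightarrow> bool" where
  xx: "b \<in> G i \<Longrightarrow> c \<in> G j \<Longrightarrow> pr (i + 1) (j + 1) (xm b) (xm c)"
| yy: "b \<in> G i \<Longrightarrow> c \<in> G j \<Longrightarrow> pr (i + 1) (j + 1) (ym b) (ym c)"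
| xy: "b \<in> G i \<Longrightarrow> c \<in> G j \<Longrightarrow> pr (i + 1) (j + 1) (xm b) (ym c)"

lemma prD: "pr i j v w \<Longrightarrow> v \<in> mat_grading G i \<and> w \<in> mat_grading G j \<and> v \<in> Lie \<and> w \<in> Lie"
  by (induction rule: pr.induct) simp_all

lemma pr_scale: "pr i j v w \<Longrightarrow> pr i j (mat_scale scale k v) w"
  by (induction rule: pr.induct) (simp_all add: omat_scale pr.intros)

lemma pr_sg: "pr i j v w \<Longrightarrow> pr i j (sg p v) w"
  by (induction rule: pr.induct) (simp_all add: omat_sg pr.intros)

text \<open>Both terms vanish unless the two brackets have opposite weights. Here that is the case
  \<open>yy\<close>, where \<open>T_bar_left\<close> moves the bar across.\<close>

lemma Q_pr_xx:
  assumes b: "b \<in> G i" and c: "c \<in> G j" and vw: "pr k l v w"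
  shows "Q (mat.br v w) (i + 1) (j + 1) (xm b) (xm c) + sg ((k + l) * (i + j)) (Q (mat.br (xm b) (xm c)) k l v w) = 0"
  using vw
proof cases
  case (xx b' i' c' j')
  let ?u = "\<lambda>i j b c. sg i (bar b * c + sg (i * j) (bar c * b))"
  have u: "?u i j b c \<in> G (i + j)" "bar (?u i j b c) = ?u i j b c" if "b \<in> G i" "c \<in> G j" for i j b c
    using that bar_mult'[OF bar_G[OF that(1)] that(2)] bar_mult'[OF bar_G[OF that(2)] that(1)]
    by (simp_all add: bar_sg bar_add mult.commute add.commute)
  show ?thesis unfolding xx br_xx[OF b c] br_xx[OF xx(5,6)] Q_em(2)[OF u[OF b c] xx(5,6)] Q_em(2)[OF u[OF xx(5,6)] b c]
    by simp
next
  case (xy b' i' c' j')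
  let ?u = "sg i (bar b * c + sg (i * j) (bar c * b))"
  have u: "?u \<in> G (i + j)" "bar ?u = ?u"
    using b c bar_mult'[OF bar_G[OF b] c] bar_mult'[OF bar_G[OF c] b]
    by (simp_all add: bar_sg bar_add mult.commute add.commute)
  have h: "mat.br (xm b') (ym c') = hm (sk (b' * c')) (sg (i' + j') (sg (i' * j') (c' * b')))"
    using br_xy[OF xy(5,6)] by (simp add: sg_sg add_ac)
  show ?thesis
    unfolding xy h br_xx[OF b c] Q_hm(2)[OF sk_G[OF G_mult'[OF xy(5,6)]] bar_sk G_op_mult[OF xy(5,6)] b c] Q_em(1)[OF u xy(5,6)]
    by simp
next
  case (yy b' i' c' j')
  let ?u = "bar b * c" and ?w = "b' * bar c'"
  have u: "?u \<in> G (i + j)" "?w \<in> G (i' + j')" using b c yy by simp_all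
  have e: "mat.br (xm b) (xm c) = em (sg i (?u + bar ?u))" "mat.br (ym b') (ym c') = fm (- sg j' (?w + bar ?w))"
    unfolding br_xx[OF b c] br_yy[OF yy(5,6)] bar_mult'[OF bar_G[OF b] c] bar_mult'[OF yy(5) bar_G[OF yy(6)]]
    by (simp_all add: mult.commute)
  have E: "sg i (?u + bar ?u) \<in> G (i + j)" "bar (sg i (?u + bar ?u)) = sg i (?u + bar ?u)"
    and F: "- sg j' (?w + bar ?w) \<in> G (i' + j')" "bar (- sg j' (?w + bar ?w)) = - sg j' (?w + bar ?w)"
    using u by (simp_all add: bar_sg bar_add bar_minus add.commute)
  show ?thesis
    unfolding yy e Q_em(3)[OF E yy(5,6)] Q_fm(3)[OF F b c]
    using T_bar_left[of ?u ?w]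
    by (cases i; cases j; cases i'; cases j'; simp add: T_simps algebra_simps)
qed

lemma Q_pr_yy:
  assumes b: "b \<in> G i" and c: "c \<in> G j" and vw: "pr k l v w"
  shows "Q (mat.br v w) (i + 1) (j + 1) (ym b) (ym c) + sg ((k + l) * (i + j)) (Q (mat.br (ym b) (ym c)) k l v w) = 0"
  using vw
proof cases
  case (xx b' i' c' j')
  show ?thesis
    using Q_pr_xx[OF xx(5,6) yy[OF b c]] unfolding xx
    by - (rule sg_swap_zero, simp add: add_ac mult.commute[of "i' + j'"])
next
  case (yy b' i' c' j')
  let ?u = "\<lambda>i j b c. - sg j (b * bar c + sg (i * j) (c * bar b))"
  have u: "?u i j b c \<in> G (i + j)" "bar (?u i j b c) = ?u i j b c" if "b \<in> G i" "c \<in> G j" for i j b c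
    using that bar_mult'[OF that(1) bar_G[OF that(2)]] bar_mult'[OF that(2) bar_G[OF that(1)]]
    by (simp_all add: bar_sg bar_add bar_minus mult.commute add.commute)
  show ?thesis unfolding yy br_yy[OF b c] br_yy[OF yy(5,6)] Q_fm(2)[OF u[OF b c] yy(5,6)] Q_fm(2)[OF u[OF yy(5,6)] b c]
    by simp
next
  case (xy b' i' c' j')
  let ?u = "- sg j (b * bar c + sg (i * j) (c * bar b))"
  have u: "?u \<in> G (i + j)" "bar ?u = ?u"
    using b c bar_mult'[OF b bar_G[OF c]] bar_mult'[OF c bar_G[OF b]]
    by (simp_all add: bar_sg bar_add bar_minus mult.commute add.commute)
  have h: "mat.br (xm b') (ym c') = hm (sk (b' * c')) (sg (i' + j') (sg (i' * j') (c' * b')))"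
    using br_xy[OF xy(5,6)] by (simp add: sg_sg add_ac)
  show ?thesis
    unfolding xy h br_yy[OF b c] Q_hm(3)[OF sk_G[OF G_mult'[OF xy(5,6)]] bar_sk G_op_mult[OF xy(5,6)] b c] Q_fm(1)[OF u xy(5,6)]
    by simp
qed

lemma Q_pr_xy:
  assumes b: "b \<in> G i" and c: "c \<in> G j" and vw: "pr k l v w"
  shows "Q (mat.br v w) (i + 1) (j + 1) (xm b) (ym c) + sg ((k + l) * (i + j)) (Q (mat.br (xm b) (ym c)) k l v w) = 0"
  using vw
proof cases
  case (xx b' i' c' j')
  show ?thesis
    using Q_pr_xx[OF xx(5,6) xy[OF b c]] unfolding xx
    by - (rule sg_swap_zero, simp add: add_ac mult.commute[of "i' + j'"])
next
  case (yy b' i' c' j')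
  show ?thesis
    using Q_pr_yy[OF yy(5,6) xy[OF b c]] unfolding yy
    by - (rule sg_swap_zero, simp add: add_ac mult.commute[of "i' + j'"])
next
  case (xy b' i' c' j')
  have h: "mat.br (xm b) (ym c) = hm (sk (b * c)) (sg (i + j) (sg (i * j) (c * b)))" if "b \<in> G i" "c \<in> G j" for b c i j
    using br_xy[OF that] by (simp add: sg_sg add_ac)
  show ?thesis
    unfolding xy h[OF b c] h[OF xy(5,6)] Q_hm(1)[OF sk_G[OF G_mult'[OF xy(5,6)]] bar_sk G_op_mult[OF xy(5,6)] b c]
      Q_hm(1)[OF sk_G[OF G_mult'[OF b c]] bar_sk G_op_mult[OF b c] xy(5,6)]
    using xyxy[OF b c xy(5,6)] by (simp add: add_ac)
qed

text \<open>Reciprocity: the values forced on two brackets, computed from either side, agree up to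
  sign. The extension is well defined and antisymmetric because of it. The case of two brackets of
  weight 0 is \<open>xyxy\<close>.\<close>

lemma Q_pr:
  assumes "pr i j v w" "pr k l v' w'"
  shows "Q (mat.br v' w') i j v w + sg ((k + l) * (i + j)) (Q (mat.br v w) k l v' w') = 0"
  using assms(1)
proof cases
  case xx then show ?thesis using Q_pr_xx[OF xx(5,6) assms(2)] by (simp add: add_ac)
next
  case yy then show ?thesis using Q_pr_yy[OF yy(5,6) assms(2)] by (simp add: add_ac)
next
  case xy then show ?thesis using Q_pr_xy[OF xy(5,6) assms(2)] by (simp add: add_ac)
qed

section \<open>Extension to even weights through lists of pairs\<close>

definition prs :: "(bit \<times> bit \<times> ('r^3^3) \<times> ('r^3^3)) list \<Rightarrow> bool" where
  "prs ps \<longleftrightarrow> (\<forall>(i, j, v, w)\<in>set ps. pr i j v w)"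

definition sumbr :: "(bit \<times> bit \<times> ('r^3^3) \<times> ('r^3^3)) list \<Rightarrow> 'r^3^3" where
  "sumbr ps = (\<Sum>(i, j, v, w)\<leftarrow>ps. mat.br v w)"

definition sumQ :: "'r^3^3 \<Rightarrow> (bit \<times> bit \<times> ('r^3^3) \<times> ('r^3^3)) list \<Rightarrow> 'w" where
  "sumQ X ps = (\<Sum>(i, j, v, w)\<leftarrow>ps. Q X i j v w)"

text \<open>The part of even weight. Odd and even refer here to the weights, not to the
  degrees.\<close>

definition ep :: "'r^3^3 \<Rightarrow> 'r^3^3" where
  "ep X = X - omat (X$1$2) (X$2$1) 0 0 0 0"

lemma ep_add: "ep (X + Y) = ep X + ep Y" and ep_scale: "ep (mat_scale scale c X) = mat_scale scale c (ep X)"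
  by (simp_all add: ep_def mat.scale_right_diff_distrib omat_scale omat_add[of "X$1$2" "X$2$1" 0 0 0 0, simplified, symmetric])

lemma prs_simps [simp]: "prs []" "prs (p # ps) \<longleftrightarrow> (case p of (i, j, v, w) \<Rightarrow> pr i j v w) \<and> prs ps"
  "prs (ps @ qs) \<longleftrightarrow> prs ps \<and> prs qs"
  by (simp_all add: prs_def ball_Un)

lemma sumbr_simps [simp]: "sumbr [] = 0" "sumbr ((i, j, v, w) # ps) = mat.br v w + sumbr ps"
  "sumbr (ps @ qs) = sumbr ps + sumbr qs"
  by (simp_all add: sumbr_def)

lemma sumQ_simps [simp]: "sumQ X [] = 0" "sumQ X ((i, j, v, w) # ps) = Q X i j v w + sumQ X ps"
  "sumQ X (ps @ qs) = sumQ X ps + sumQ X qs"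
  by (simp_all add: sumQ_def)

lemma ep_x [simp]: "ep (xm b) = 0" "ep (ym b) = 0" "ep (em p) = em p" "ep (fm p) = fm p" "ep (hm a d) = hm a d"
  by (simp_all add: ep_def)

definition scl :: "'k \<Rightarrow> (bit \<times> bit \<times> ('r^3^3) \<times> ('r^3^3)) list \<Rightarrow> (bit \<times> bit \<times> ('r^3^3) \<times> ('r^3^3)) list" where
  "scl c = map (\<lambda>(i, j, v, w). (i, j, mat_scale scale c v, w))"

lemma scl_simps: "prs ps \<Longrightarrow> prs (scl c ps)" "sumbr (scl c ps) = mat_scale scale c (sumbr ps)"
  "sumQ X (scl c ps) = sw c (sumQ X ps)"
  by (induction ps) (auto simp: scl_def pr_scale mat.br_scale_left mat.scale_right_distrib Q_scale_v W.scale_right_distrib)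

lemma lift_ex: "X \<in> Lie \<Longrightarrow> \<exists>ps. prs ps \<and> sumbr ps = ep X"
proof (induction rule: Lie_induct)
  case (x i b) show ?case by (intro exI[of _ "[]"]) simp
next
  case (y i c) show ?case by (intro exI[of _ "[]"]) simp
next
  case (e i p)
  have "pr (i + 1) (0 + 1) (xm (sg i (scale hlf p))) (xm 1)" by (rule pr.xx) (use e in simp_all)
  then show ?case
    by (intro exI[of _ "[(i + 1, 0 + 1, xm (sg i (scale hlf p)), xm 1)]"]) (simp add: em_br[OF e, symmetric])
next
  case (f i p)
  have "pr (i + 1) (0 + 1) (ym (- scale hlf p)) (ym 1)" by (rule pr.yy) (use f in simp_all)
  then show ?case
    by (intro exI[of _ "[(i + 1, 0 + 1, ym (- scale hlf p), ym 1)]"]) (simp add: fm_br[OF f, symmetric])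
next
  case (xy i j b c)
  have "pr (i + 1) (j + 1) (xm b) (ym c)" by (rule pr.xy) (use xy in simp_all)
  then show ?case
    by (intro exI[of _ "[(i + 1, j + 1, xm b, ym c)]"]) (simp add: br_xy[OF xy])
next
  case (add X Y)
  then obtain ps qs where "prs ps" "prs qs" "sumbr ps = ep X" "sumbr qs = ep Y" by blast
  then show ?case by (intro exI[of _ "ps @ qs"]) (simp add: ep_add)
next
  case (scale c X)
  then obtain ps where "prs ps" "sumbr ps = ep X" by blast
  then show ?case by (intro exI[of _ "scl c ps"]) (simp add: ep_scale scl_simps)
qed

definition z12 :: "'r^3^3 \<Rightarrow> bool" where "z12 X \<longleftrightarrow> X$1$2 = 0 \<and> X$2$1 = 0"

lemma z12_bV: "z12 X \<Longrightarrow> bV X Y = 0" "z12 X \<Longrightarrow> bV Y X = 0"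
  by (simp_all add: z12_def bV_def)

lemma z12_br:
  assumes "v = xm b \<or> v = ym b" "b \<in> G i" "w = xm c \<or> w = ym c"
  shows "z12 (mat.br v w)"
proof -
  have hom: "z12 (mat.br v w)" if "w = xm c \<or> w = ym c" "c \<in> G j" for w c j
    using assms(1) that(1) br_xx[OF assms(2) that(2)] br_xy[OF assms(2) that(2)] br_yy[OF assms(2) that(2)]
      br_xy[OF that(2) assms(2)] mat.br_anti[OF xm_G[OF that(2)] ym_G[OF assms(2)]]
    by (elim disjE) (simp_all add: z12_def)
  have "z12 (mat.br v (xm c)) \<and> z12 (mat.br v (ym c))"
  proof (induction c rule: homogeneous_induct)
    case (1 i c) then show ?case using hom by blast
  next
    case (2 c c')
    then show ?case
      using mat.br_add_right[of v "xm c" "xm c'"] mat.br_add_right[of v "ym c" "ym c'"]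
      by (simp add: omat_add z12_def)
  qed
  then show ?thesis using assms(3) by blast
qed

lemma z12_br': 
  assumes "v = xm b \<or> v = ym b" "b \<in> G i" "w = xm c \<or> w = ym c"
  shows "z12 (mat.br w v)"
proof -
  have "z12 (mat.br (xm c) v) \<and> z12 (mat.br (ym c) v)"
  proof (induction c rule: homogeneous_induct)
    case (1 j c) then show ?case using z12_br[OF _ 1 assms(1)] by blast
  next
    case (2 c c')
    then show ?case
      using mat.br_add_left[of "xm c" "xm c'" v] mat.br_add_left[of "ym c" "ym c'" v]
      by (simp add: omat_add z12_def)
  qed
  then show ?thesis using assms(3) by blast
qed

text \<open>A vector of odd weight bracketed with \<open>v\<close> or \<open>w\<close> has even
  weight, where \<open>bV\<close> vanishes.\<close>

lemma Q_ep: assumes "pr i j v w" shows "Q (ep X) i j v w = Q X i j v w"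
proof -
  have V: "omat (X$1$2) (X$2$1) 0 0 0 0 = xm (X$1$2) + ym (X$2$1)" by (simp add: omat_add)
  obtain b c k l where "v = xm b \<or> v = ym b" "b \<in> G k" "w = xm c \<or> w = ym c" "c \<in> G l"
    using assms by (cases rule: pr.cases) blast+
  then have z: "z12 (mat.br (xm u) v)" "z12 (mat.br (ym u) v)" "z12 (mat.br (xm u) w)" "z12 (mat.br (ym u) w)" for u
    using z12_br' by blast+
  have "Q (omat (X$1$2) (X$2$1) 0 0 0 0) i j v w = 0"
    unfolding V Q_add by (simp add: Q_def z12_bV z)
  moreover have "X = ep X + omat (X$1$2) (X$2$1) 0 0 0 0" by (simp add: ep_def)
  ultimately show ?thesis using Q_add[of "ep X" "omat (X$1$2) (X$2$1) 0 0 0 0" i j v w] by simp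
qed

lemma sumQ_ep: "prs ps \<Longrightarrow> sumQ (ep X) ps = sumQ X ps"
  by (induction ps) (auto simp: Q_ep)

lemma sumQ_add: "sumQ (X + Y) ps = sumQ X ps + sumQ Y ps"
  by (induction ps) (auto simp: Q_add)

lemma sumQ_scale: "sumQ (mat_scale scale c X) ps = sw c (sumQ X ps)"
  by (induction ps) (auto simp: Q_scale W.scale_right_distrib)

lemma sumQ_zero [simp]: "sumQ 0 ps = 0"
  by (induction ps) auto

text \<open>In a sum of brackets of various degrees the sign in \<open>Q_pr\<close> changes with the
  summand. \<open>parp\<close> attaches it to the element, and so commutes with summation.\<close>

definition parp :: "bit \<Rightarrow> 'r^3^3 \<Rightarrow> 'r^3^3" where "parp p X = (if p = 0 then X else mat.par X)"

lemma parp_zero [simp]: "parp p 0 = 0" and parp_add: "parp p (X + Y) = parp p X + parp p Y"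
  by (simp_all add: parp_def mat.par_add)

lemma parp_hom: "X \<in> mat_grading G i \<Longrightarrow> parp p X = sg (p * i) X"
  by (cases p) (simp_all add: parp_def mat.par_hom)

text \<open>\<open>Q_pr\<close>, summed: the left side depends on the list only through
  \<open>sumbr ps\<close>.\<close>

lemma sumQ_exchange:
  assumes "pr k l v' w'" "prs ps"
  shows "sumQ (mat.br v' w') ps = - Q (parp (k + l) (sumbr ps)) k l v' w'"
  using assms(2)
proof (induction ps)
  case (Cons p ps)
  obtain i j v w where p: "p = (i, j, v, w)" by (cases p)
  have v: "pr i j v w" using Cons(2) p by simp
  have "parp (k + l) (mat.br v w) = sg ((k + l) * (i + j)) (mat.br v w)"
    using prD[OF v] by (intro parp_hom mat.br_G) auto
  moreover have "Q (mat.br v' w') i j v w = - sg ((k + l) * (i + j)) (Q (mat.br v w) k l v' w')"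
    using Q_pr[OF v assms(1)] by (simp add: eq_neg_iff_add_eq_0)
  ultimately show ?case using Cons by (simp add: p parp_add Q_add Q_sg)
qed simp

lemma sumQ_sumbr_zero: "prs rs \<Longrightarrow> prs ps \<Longrightarrow> sumbr ps = 0 \<Longrightarrow> sumQ (sumbr rs) ps = 0"
  by (induction rs) (auto simp: sumQ_add sumQ_exchange)

text \<open>Against a single bracket of a pair this is \<open>sumQ_exchange\<close>, and by
  \<open>lift_ex\<close> such brackets span the part of even weight.\<close>

lemma sumQ_wd:
  assumes "prs ps" "sumbr ps = 0" "X \<in> Lie" shows "sumQ X ps = 0"
proof -
  obtain rs where "prs rs" "sumbr rs = ep X" using lift_ex[OF assms(3)] by blast
  then show ?thesis using sumQ_sumbr_zero[OF _ assms(1,2)] sumQ_ep[OF assms(1)] by metis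
qed

definition lft :: "'r^3^3 \<Rightarrow> (bit \<times> bit \<times> ('r^3^3) \<times> ('r^3^3)) list" where
  "lft Y = (SOME ps. prs ps \<and> sumbr ps = ep Y)"

lemma lft: "Y \<in> Lie \<Longrightarrow> prs (lft Y) \<and> sumbr (lft Y) = ep Y"
  unfolding lft_def by (rule someI_ex) (rule lift_ex)

lemma sumQ_lft:
  assumes "prs ps" "sumbr ps = ep Y" "X \<in> Lie" "Y \<in> Lie" shows "sumQ X (lft Y) = sumQ X ps"
proof -
  have "sumQ X (lft Y @ scl (- 1) ps) = 0"
    by (rule sumQ_wd) (use assms lft[of Y] in \<open>simp_all add: scl_simps\<close>)
  then show ?thesis using assms by (simp add: scl_simps)
qed

text \<open>On two vectors of odd weight this is \<open>bV\<close>, on two of even weight the value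
  forced by the Leibniz rule, and on mixed pairs 0. By \<open>sumQ_lft\<close> the choice in
  \<open>lft\<close> does not matter.\<close>

definition Phi :: "'r^3^3 \<Rightarrow> 'r^3^3 \<Rightarrow> 'w" where
  "Phi X Y = bV X Y + sumQ X (lft Y)"

lemma Phi_add_left: "Phi (X + Y) Z = Phi X Z + Phi Y Z"
  by (simp add: Phi_def bV_add sumQ_add add_ac)

lemma Phi_scale_left: "Phi (mat_scale scale c X) Z = sw c (Phi X Z)"
  by (simp add: Phi_def bV_scale sumQ_scale W.scale_right_distrib)

lemma Phi_add_right: "X \<in> Lie \<Longrightarrow> Y \<in> Lie \<Longrightarrow> Z \<in> Lie \<Longrightarrow> Phi Z (X + Y) = Phi Z X + Phi Z Y"
  using sumQ_lft[of "lft X @ lft Y" "X + Y" Z] lft[of X] lft[of Y]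
  by (simp add: Phi_def bV_add ep_add)

lemma Phi_scale_right: "X \<in> Lie \<Longrightarrow> Z \<in> Lie \<Longrightarrow> Phi Z (mat_scale scale c X) = sw c (Phi Z X)"
  using sumQ_lft[of "scl c (lft X)" "mat_scale scale c X" Z] lft[of X]
  by (simp add: Phi_def bV_scale ep_scale scl_simps W.scale_right_distrib)

lemma ep_G: "X \<in> mat_grading G i \<Longrightarrow> ep X \<in> mat_grading G i"
  unfolding ep_def by (intro mat.G_closed(3) omat_G) (auto simp: mat_grading_def forall_3 add.commute)

lemma sumQ_anti:
  assumes X: "X \<in> mat_grading G i" "X \<in> Lie" and Y: "Y \<in> mat_grading G j" "Y \<in> Lie"
  shows "sumQ X (lft Y) = - sg (i * j) (sumQ Y (lft X))"
proof -
  \<comment> \<open>\<open>tw\<close> gives each pair the sign that \<open>sumQ_exchange\<close>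
    asks for when the other argument has degree \<open>j\<close>.\<close>
  define tw where "tw = map (\<lambda>(k, l, v :: 'r^3^3, w :: 'r^3^3). (k, l, sg ((k + l) * j) v, w))"
  have 1: "prs (tw rs) \<and> sumbr (tw rs) = parp j (sumbr rs) \<and> sumQ (sumbr rs) (lft Y) = - sumQ (ep Y) (tw rs)" if "prs rs" for rs
    using that
  proof (induction rs)
    case (Cons p rs)
    obtain k l v w where p: "p = (k, l, v, w)" by (cases p)
    have v: "pr k l v w" using Cons(2) p by simp
    have "parp j (mat.br v w) = sg (j * (k + l)) (mat.br v w)"
      using prD[OF v] by (intro parp_hom mat.br_G) auto
    moreover have "parp (k + l) (ep Y) = sg ((k + l) * j) (ep Y)" by (rule parp_hom[OF ep_G[OF Y(1)]])
    ultimately show ?case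
      using Cons v lft[OF Y(2)] sumQ_exchange[OF v, of "lft Y"]
      by (simp add: p tw_def parp_add mat.br_sg mult.commute pr_sg sumQ_add Q_sg)
  qed (simp_all add: tw_def)
  note l = lft[OF X(2)]
  have sgi: "sg p Z = mat_scale scale (ksign p) Z" for p Z by (simp add: mat.scale_ksign)
  have "sumbr (tw (lft X)) = sg (j * i) (ep X)" using 1[of "lft X"] l parp_hom[OF ep_G[OF X(1)]] by simp
  then have "sumQ Y (lft (sg (j * i) X)) = sumQ Y (tw (lft X))"
    using 1[of "lft X"] l X Y by (intro sumQ_lft) (simp_all add: sgi ep_scale)
  moreover have "sumQ Y (lft (sg (j * i) X)) = sg (j * i) (sumQ Y (lft X))"
    using sumQ_lft[of "scl (ksign (j * i)) (lft X)" "sg (j * i) X" Y] l X Y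
    by (simp add: sgi ep_scale scl_simps W.scale_ksign)
  ultimately show ?thesis
    using 1[of "lft X"] l sumQ_ep[OF conjunct1[OF lft[OF Y(2)]], of X] sumQ_ep[of "tw (lft X)" Y] by (simp add: mult.commute)
qed

lemma ep_zero_bV: "prs ps \<Longrightarrow> ep X = 0 \<Longrightarrow> sumQ X ps = 0"
  using sumQ_ep[of ps X] by simp

lemma Phi_odd: "X \<in> Lie \<Longrightarrow> Y \<in> Lie \<Longrightarrow> ep X = 0 \<or> ep Y = 0 \<Longrightarrow> Phi X Y = bV X Y"
  using sumQ_lft[of "[]" Y X] ep_zero_bV[of "lft Y" X] lft[of Y] by (auto simp: Phi_def)

lemma Phi_even: "z12 X \<or> z12 Y \<Longrightarrow> Phi X Y = sumQ X (lft Y)"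
  by (auto simp: Phi_def z12_bV)

lemma Phi_mixed: "X \<in> Lie \<Longrightarrow> Y \<in> Lie \<Longrightarrow> ep X = 0 \<Longrightarrow> z12 Y \<Longrightarrow> Phi X Y = 0 \<and> Phi Y X = 0"
  by (simp add: Phi_odd z12_bV)

lemma omat_ep: "ep (omat b c p q a d) = omat 0 0 p q a d"
  by (simp add: ep_def omat_diff)

lemma omat_eq_0: "omat b c p q a d = 0 \<longleftrightarrow> b = 0 \<and> c = 0 \<and> p = 0 \<and> q = 0 \<and> a = 0 \<and> d = 0"
  by (auto simp: vec3_eq_iff)

lemma Lie_hom:
  assumes "X \<in> mat_grading G i" "X \<in> Lie"
  obtains b c p q a d where "X = omat b c p q a d" "b \<in> G (i + 1)" "c \<in> G (i + 1)" "p \<in> G i" "bar p = p"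
    "q \<in> G i" "bar q = q" "a \<in> G i" "bar a = - a" "d \<in> G i"
proof -
  obtain b c p q a d where X: "X = omat b c p q a d" "bar p = p" "bar q = q" "bar a = - a"
    using Lie_Lrep[OF assms(2)] unfolding Lrep_def by blast
  have "a \<in> G i" "b \<in> G (i + 1)" "c \<in> G (i + 1)" "d \<in> G i" "q \<in> G i" "p \<in> G i"
    using assms(1) unfolding X(1) by (simp_all add: mat_grading_def forall_3 add.commute)
  then show ?thesis using that X by blast
qed

lemma br_parity:
  assumes X: "X \<in> mat_grading G i" "X \<in> Lie" and Y: "Y \<in> mat_grading G j" "Y \<in> Lie"
  shows "z12 X \<Longrightarrow> z12 Y \<Longrightarrow> z12 (mat.br X Y)" "ep X = 0 \<Longrightarrow> ep Y = 0 \<Longrightarrow> z12 (mat.br X Y)"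
    "z12 X \<Longrightarrow> ep Y = 0 \<Longrightarrow> ep (mat.br X Y) = 0" "ep X = 0 \<Longrightarrow> z12 Y \<Longrightarrow> ep (mat.br X Y) = 0"
proof -
  obtain b c p q a d where x: "X = omat b c p q a d" "b \<in> G (i + 1)" "c \<in> G (i + 1)" "p \<in> G i" "bar p = p"
    "q \<in> G i" "bar q = q" "a \<in> G i" "bar a = - a" "d \<in> G i"
    using X by (rule Lie_hom)
  obtain b' c' p' q' a' d' where y: "Y = omat b' c' p' q' a' d'" "b' \<in> G (j + 1)" "c' \<in> G (j + 1)" "p' \<in> G j" "bar p' = p'"
    "q' \<in> G j" "bar q' = q'" "a' \<in> G j" "bar a' = - a'" "d' \<in> G j"
    using Y by (rule Lie_hom)
  note e = omat_br[OF x(2-10) y(2-10)]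
  show "z12 X \<Longrightarrow> z12 Y \<Longrightarrow> z12 (mat.br X Y)" "ep X = 0 \<Longrightarrow> ep Y = 0 \<Longrightarrow> z12 (mat.br X Y)"
    "z12 X \<Longrightarrow> ep Y = 0 \<Longrightarrow> ep (mat.br X Y) = 0" "ep X = 0 \<Longrightarrow> z12 Y \<Longrightarrow> ep (mat.br X Y) = 0"
    unfolding x(1) y(1) e omat_ep omat_eq_0 z12_def by simp_all
qed

lemma odd_cases:
  assumes "X \<in> mat_grading G i" "X \<in> Lie" "ep X = 0"
  obtains b c where "X = xm b + ym c" "b \<in> G (i + 1)" "c \<in> G (i + 1)"
proof -
  obtain b c p q a d where x: "X = omat b c p q a d" "b \<in> G (i + 1)" "c \<in> G (i + 1)"
    using Lie_hom[OF assms(1,2)] by metis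
  then have "X = xm b + ym c" using assms(3) by (simp add: omat_ep omat_eq_0 omat_add)
  then show ?thesis using that x by blast
qed

lemma even_ep: "z12 X \<Longrightarrow> ep X = X"
  by (simp add: z12_def ep_def)

lemma Phi_br:
  assumes v: "v \<in> mat_grading G i" "v \<in> Lie" "ep v = 0" and w: "w \<in> mat_grading G j" "w \<in> Lie" "ep w = 0"
    and X: "X \<in> Lie"
  shows "Phi X (mat.br v w) = Q X i j v w"
proof -
  obtain b c where vv: "v = xm b + ym c" "b \<in> G (i + 1)" "c \<in> G (i + 1)" using v by (rule odd_cases)
  obtain b' c' where ww: "w = xm b' + ym c'" "b' \<in> G (j + 1)" "c' \<in> G (j + 1)" using w by (rule odd_cases)
  have ii: "i + 1 + 1 = i" "j + 1 + 1 = j" by (simp_all add: add.assoc)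
  note pr = pr.xx[OF vv(2) ww(2), unfolded ii] pr.xy[OF vv(2) ww(3), unfolded ii]
    pr.xy[OF ww(2) vv(3), unfolded ii] pr.yy[OF vv(3) ww(3), unfolded ii]
  \<comment> \<open>\<open>pr\<close> admits mixed pairs with \<open>xm\<close> first, so the
    bracket of \<open>ym c\<close> with \<open>xm b'\<close> enters reversed, with its sign.\<close>
  let ?ps = "[(i, j, xm b, xm b'), (i, j, xm b, ym c'), (j, i, - sg (i * j) (xm b'), ym c), (i, j, ym c, ym c')]"
  have e: "mat.br (ym c) (xm b') = mat.br (- sg (i * j) (xm b')) (ym c)"
    using mat.br_anti[of "xm b'" j "ym c" i] xm_G[OF ww(2), unfolded ii] ym_G[OF vv(3), unfolded ii]
    by (simp add: mat.br_minus mat.br_sg mult.commute)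
  have z: "z12 (mat.br v w)" using br_parity(2)[OF v(1,2) w(1,2) v(3) w(3)] .
  have sb: "sumbr ?ps = mat.br v w"
    unfolding vv(1) ww(1) mat.br_add_left mat.br_add_right e by (simp add: add_ac)
  have "pr j i (- sg (i * j) (xm b')) (ym c)"
    using pr_scale[OF pr_sg[OF pr(3)], of "- 1" "i * j"] by simp
  then have "prs ?ps" using pr by simp
  then have "Phi X (mat.br v w) = sumQ X ?ps"
    unfolding Phi_even[OF disjI2[OF z]] using sb X v w even_ep[OF z] by (intro sumQ_lft) simp_all
  also have "\<dots> = Q X i j v w"
    unfolding vv(1) ww(1) Q_add_v using Q_swap[of X j i "xm b'" "ym c"]
    by (simp add: Q_minus Q_sg sg_sg sg_minus add_ac mult.commute)
  finally show ?thesis .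
qed

lemma Phi_anti:
  assumes X: "X \<in> mat_grading G i" "X \<in> Lie" and Y: "Y \<in> mat_grading G j" "Y \<in> Lie"
  shows "Phi X Y = - sg (i * j) (Phi Y X)"
  using bV_anti[OF X(1) Y(1)] sumQ_anti[OF X Y] by (simp add: Phi_def sg_add)

lemma Phi_zero [simp]: "X \<in> Lie \<Longrightarrow> Phi 0 X = 0" "X \<in> Lie \<Longrightarrow> Phi X 0 = 0"
  using Phi_add_left[of 0 0 X] Phi_add_right[of 0 0 X] by simp_all

lemma Phi_minus_left: "X \<in> Lie \<Longrightarrow> Y \<in> Lie \<Longrightarrow> Phi (- X) Y = - Phi X Y"
  and Phi_minus_right: "X \<in> Lie \<Longrightarrow> Y \<in> Lie \<Longrightarrow> Phi X (- Y) = - Phi X Y"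
  using Phi_add_left[of X "- X" Y] Phi_add_right[of Y "- Y" X] by (simp_all add: eq_neg_iff_add_eq_0 add.commute)

lemma Phi_sg_left: "X \<in> Lie \<Longrightarrow> Y \<in> Lie \<Longrightarrow> Phi (sg p X) Y = sg p (Phi X Y)"
  and Phi_sg_right: "X \<in> Lie \<Longrightarrow> Y \<in> Lie \<Longrightarrow> Phi X (sg p Y) = sg p (Phi X Y)"
  by (cases p; simp add: Phi_minus_left Phi_minus_right)+

text \<open>Brackets of vectors of odd weight span the even part, so \<open>Z\<close> may be one of
  them. Then \<open>Phi_br\<close> reduces everything to \<open>bV\<close>, and the terms in which
  \<open>X\<close> and \<open>Y\<close> act on different vectors cancel by
  \<open>bV_anti\<close>.\<close>

lemma Phi_leib_even:
  assumes X: "X \<in> mat_grading G i" "X \<in> Lie" "z12 X" and Y: "Y \<in> mat_grading G j" "Y \<in> Lie" "z12 Y"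
    and Z: "Z \<in> Lie" "z12 Z"
  shows "Phi (mat.br X Y) Z = Phi X (mat.br Y Z) - sg (i * j) (Phi Y (mat.br X Z))"
proof -
  have base: "Phi (mat.br X Y) (mat.br v w) = Phi X (mat.br Y (mat.br v w)) - sg (i * j) (Phi Y (mat.br X (mat.br v w)))"
    if "pr a b v w" for a b v w
  proof -
    have v: "v \<in> mat_grading G a" "v \<in> Lie" "ep v = 0" and w: "w \<in> mat_grading G b" "w \<in> Lie" "ep w = 0"
      using prD[OF that] that by (auto elim!: pr.cases)
    have Xv: "mat.br X v \<in> mat_grading G (i + a)" "mat.br X v \<in> Lie" "ep (mat.br X v) = 0"
      and Xw: "mat.br X w \<in> mat_grading G (i + b)" "mat.br X w \<in> Lie" "ep (mat.br X w) = 0"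
      and Yv: "mat.br Y v \<in> mat_grading G (j + a)" "mat.br Y v \<in> Lie" "ep (mat.br Y v) = 0"
      and Yw: "mat.br Y w \<in> mat_grading G (j + b)" "mat.br Y w \<in> Lie" "ep (mat.br Y w) = 0"
      using X Y v w br_parity(3)[OF X(1,2) v(1,2) X(3) v(3)] br_parity(3)[OF X(1,2) w(1,2) X(3) w(3)]
        br_parity(3)[OF Y(1,2) v(1,2) Y(3) v(3)] br_parity(3)[OF Y(1,2) w(1,2) Y(3) w(3)] by auto
    have lX: "mat.br X (mat.br v w) = mat.br (mat.br X v) w + sg (i * a) (mat.br v (mat.br X w))"
      by (rule mat.br_leibniz[OF X(1) v(1) w(1)])
    have lY: "mat.br Y (mat.br v w) = mat.br (mat.br Y v) w + sg (j * a) (mat.br v (mat.br Y w))"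
      by (rule mat.br_leibniz[OF Y(1) v(1) w(1)])
    have PX: "Phi X (mat.br Y (mat.br v w)) = Q X (j + a) b (mat.br Y v) w + sg (j * a) (Q X a (j + b) v (mat.br Y w))"
      unfolding lY using Phi_br[OF Yv w X(2)] Phi_br[OF v Yw X(2)] X Yv Yw v w
      by (simp add: Phi_add_right Phi_sg_right)
    have PY: "Phi Y (mat.br X (mat.br v w)) = Q Y (i + a) b (mat.br X v) w + sg (i * a) (Q Y a (i + b) v (mat.br X w))"
      unfolding lX using Phi_br[OF Xv w Y(2)] Phi_br[OF v Xw Y(2)] Y Xv Xw v w
      by (simp add: Phi_add_right Phi_sg_right)
    have PXY: "Phi (mat.br X Y) (mat.br v w) = Q (mat.br X Y) a b v w"
      by (rule Phi_br[OF v w]) (use X Y in simp)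
    have e: "mat.br (mat.br X Y) u = mat.br X (mat.br Y u) - sg (i * j) (mat.br Y (mat.br X u))"
      if "u \<in> mat_grading G c" for u c
      using mat.br_leibniz[OF X(1) Y(1) that] by simp
    have an: "bV (mat.br X w) (mat.br Y v) = - sg ((i + b) * (j + a)) (bV (mat.br Y v) (mat.br X w))"
      "bV (mat.br Y w) (mat.br X v) = - sg ((j + b) * (i + a)) (bV (mat.br X v) (mat.br Y w))"
      by (rule bV_anti[OF Xw(1) Yv(1)], rule bV_anti[OF Yw(1) Xv(1)])
    show ?thesis
      unfolding PXY PX PY Q_def e[OF v(1)] e[OF w(1)] bV_diff bV_sg an
      by (cases i; cases j; cases a; cases b; simp add: algebra_simps)
  qed
  have "Phi (mat.br X Y) (sumbr ps) = Phi X (mat.br Y (sumbr ps)) - sg (i * j) (Phi Y (mat.br X (sumbr ps))) \<and> sumbr ps \<in> Lie"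
    if "prs ps" for ps
    using that
  proof (induction ps)
    case (Cons p ps)
    obtain a b v w where p: "p = (a, b, v, w)" by (cases p)
    have v: "pr a b v w" using Cons(2) p by simp
    have "mat.br v w \<in> Lie" using prD[OF v] by simp
    then show ?case using Cons base[OF v] X Y
      by (simp add: p mat.br_add_right Phi_add_right sg_add)
  qed (use X Y in simp)
  from this[of "lft Z"] show ?thesis using lft[OF Z(1)] even_ep[OF Z(2)] by simp
qed

definition Jac :: "bit \<Rightarrow> bit \<Rightarrow> bit \<Rightarrow> 'r^3^3 \<Rightarrow> 'r^3^3 \<Rightarrow> 'r^3^3 \<Rightarrow> 'w" where
  "Jac i j k X Y Z = sg (i * k) (Phi (mat.br X Y) Z) + sg (j * i) (Phi (mat.br Y Z) X) + sg (k * j) (Phi (mat.br Z X) Y)"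

lemma Jac_cyc: "Jac i j k X Y Z = Jac j k i Y Z X"
  by (simp add: Jac_def)

lemma Jac_add: "X \<in> Lie \<Longrightarrow> X' \<in> Lie \<Longrightarrow> Y \<in> Lie \<Longrightarrow> Z \<in> Lie \<Longrightarrow>
    Jac i j k (X + X') Y Z = Jac i j k X Y Z + Jac i j k X' Y Z"
  by (simp add: Jac_def mat.br_add_left mat.br_add_right Phi_add_left Phi_add_right sg_add)

lemma Jac_zero:
  assumes X: "X \<in> mat_grading G i" "X \<in> Lie" and Y: "Y \<in> mat_grading G j" "Y \<in> Lie"
    and Z: "Z \<in> mat_grading G k" "Z \<in> Lie"
    and leib: "Phi X (mat.br Y Z) = Phi (mat.br X Y) Z + sg (i * j) (Phi Y (mat.br X Z))"
  shows "Jac i j k X Y Z = 0"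
proof -
  have 1: "Phi (mat.br Y Z) X = - sg ((j + k) * i) (Phi X (mat.br Y Z))"
    by (rule Phi_anti) (use X Y Z in simp_all)
  have 2: "Phi (mat.br Z X) Y = sg (i * k + (i + k) * j) (Phi Y (mat.br X Z))"
    unfolding mat.br_anti[OF X(1) Z(1)] using Phi_anti[OF mat.br_G[OF X(1) Z(1)] br_Lie[OF X(2) Z(2)] Y] X Y Z
    by (simp add: Phi_minus_left Phi_sg_left sg_minus sg_sg)
  show ?thesis
    using leib unfolding Jac_def 1 2
    by (cases i; cases j; cases k; simp add: algebra_simps neg_eq_iff_add_eq_0 eq_neg_iff_add_eq_0)
qed

context
  fixes X Y Z i j k
  assumes X: "X \<in> mat_grading G i" "X \<in> Lie" and Y: "Y \<in> mat_grading G j" "Y \<in> Lie"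
    and Z: "Z \<in> mat_grading G k" "Z \<in> Lie"
begin

lemma Jac_VVV: assumes "ep X = 0" "ep Y = 0" "ep Z = 0" shows "Jac i j k X Y Z = 0"
  using br_parity(2)[OF X Y] br_parity(2)[OF X Z] br_parity(2)[OF Y Z] assms X Y Z Phi_mixed[of X "mat.br Y Z"]
    Phi_mixed[of Z "mat.br X Y"] Phi_mixed[of Y "mat.br X Z"]
  by (intro Jac_zero X Y Z) simp

lemma Jac_VEE: assumes "ep X = 0" "z12 Y" "z12 Z" shows "Jac i j k X Y Z = 0"
  using br_parity(4)[OF X Y] br_parity(4)[OF X Z] br_parity(1)[OF Y Z] assms X Y Z Phi_mixed[of X "mat.br Y Z"]
    Phi_mixed[of "mat.br X Y" Z] Phi_mixed[of "mat.br X Z" Y]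
  by (intro Jac_zero X Y Z) simp

lemma Jac_EVV: assumes "z12 X" "ep Y = 0" "ep Z = 0" shows "Jac i j k X Y Z = 0"
proof (intro Jac_zero X Y Z)
  have *: "bV Y (mat.br X Z) = - sg (j * (i + k)) (bV (mat.br X Z) Y)"
    by (rule bV_anti[OF Y(1) mat.br_G[OF X(1) Z(1)]])
  show "Phi X (mat.br Y Z) = Phi (mat.br X Y) Z + sg (i * j) (Phi Y (mat.br X Z))"
    using Phi_br[OF Y assms(2) Z assms(3) X(2)] Phi_odd[of "mat.br X Y" Z] Phi_odd[of Y "mat.br X Z"] assms X Y Z
    by (simp add: Q_def * sg_minus sg_sg distrib_left mult.commute)
qed

lemma Jac_EEE: assumes "z12 X" "z12 Y" "z12 Z" shows "Jac i j k X Y Z = 0"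
  using Phi_leib_even[OF X assms(1) Y assms(2) Z(2) assms(3)] by (intro Jac_zero X Y Z) simp

end

text \<open>By trilinearity each argument has purely odd or purely even weight. With one or three
  odd arguments every term vanishes, two odd ones are the definition of \<open>Q\<close>, and three
  even ones are \<open>Phi_leib_even\<close>. Cyclic rotation reduces eight cases to these
  four.\<close>

lemma Jac_all:
  assumes X: "X \<in> mat_grading G i" "X \<in> Lie" and Y: "Y \<in> mat_grading G j" "Y \<in> Lie"
    and Z: "Z \<in> mat_grading G k" "Z \<in> Lie"
  shows "Jac i j k X Y Z = 0"
proof -
  define vp where "vp X = omat (X$1$2) (X$2$1) 0 0 0 0" for X :: "'r^3^3"
  have vp: "X = vp X + ep X" "vp X \<in> Lie" "ep (vp X) = 0" "z12 (ep X)" "X \<in> Lie \<Longrightarrow> ep X \<in> Lie" for X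
  proof -
    have *: "vp X = xm (X$1$2) + ym (X$2$1)" by (simp add: vp_def omat_add)
    show 1: "X = vp X + ep X" by (simp add: vp_def ep_def)
    show 2: "vp X \<in> Lie" unfolding * by (intro Lie_closed(2) xm_Lie ym_Lie)
    show "ep (vp X) = 0" "z12 (ep X)" by (simp_all add: vp_def ep_def z12_def)
    show "X \<in> Lie \<Longrightarrow> ep X \<in> Lie" using 2 Lie_closed(3)[of X "vp X"] by (simp add: vp_def ep_def)
  qed
  have vG: "vp X \<in> mat_grading G i" if "X \<in> mat_grading G i" for X i
    unfolding vp_def using that by (intro omat_G) (auto simp: mat_grading_def forall_3 add.commute)
  note V = vG[OF X(1)] vp(2)[of X] and E = ep_G[OF X(1)] vp(5)[OF X(2)]
  note V' = vG[OF Y(1)] vp(2)[of Y] and E' = ep_G[OF Y(1)] vp(5)[OF Y(2)]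
  note V'' = vG[OF Z(1)] vp(2)[of Z] and E'' = ep_G[OF Z(1)] vp(5)[OF Z(2)]
  have split: "Jac i j k X Y Z = Jac i j k (vp X) Y Z + Jac i j k (ep X) Y Z"
    if "X \<in> Lie" "Y \<in> Lie" "Z \<in> Lie" for X Y Z i j k
    using Jac_add[OF vp(2)[of X] vp(5)[OF that(1)] that(2,3), of i j k] vp(1)[of X] by simp
  have split2: "Jac i j k X Y Z = Jac i j k X (vp Y) Z + Jac i j k X (ep Y) Z"
    if "X \<in> Lie" "Y \<in> Lie" "Z \<in> Lie" for X Y Z i j k
    using split[OF that(2,3,1), of j k i] by (simp add: Jac_cyc[of i j k])
  have split3: "Jac i j k X Y Z = Jac i j k X Y (vp Z) + Jac i j k X Y (ep Z)"
    if "X \<in> Lie" "Y \<in> Lie" "Z \<in> Lie" for X Y Z i j k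
    using split2[OF that(2,3,1), of j k i] by (simp add: Jac_cyc[of i j k])
  have "Jac i j k (vp X) (vp Y) (vp Z) = 0" by (rule Jac_VVV[OF V V' V'' vp(3) vp(3) vp(3)])
  moreover have "Jac i j k (vp X) (ep Y) (ep Z) = 0" by (rule Jac_VEE[OF V E' E'' vp(3) vp(4) vp(4)])
  moreover have "Jac i j k (ep X) (vp Y) (vp Z) = 0" by (rule Jac_EVV[OF E V' V'' vp(4) vp(3) vp(3)])
  moreover have "Jac i j k (ep X) (ep Y) (ep Z) = 0" by (rule Jac_EEE[OF E E' E'' vp(4) vp(4) vp(4)])
  moreover have "Jac i j k (vp X) (vp Y) (ep Z) = 0"
    using Jac_EVV[OF E'' V V' vp(4) vp(3) vp(3)] by (simp add: Jac_cyc[of k i j])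
  moreover have "Jac i j k (vp X) (ep Y) (vp Z) = 0"
    using Jac_EVV[OF E' V'' V vp(4) vp(3) vp(3)] by (simp add: Jac_cyc[of i j k])
  moreover have "Jac i j k (ep X) (vp Y) (ep Z) = 0"
    using Jac_VEE[OF V' E'' E vp(3) vp(4) vp(4)] by (simp add: Jac_cyc[of i j k])
  moreover have "Jac i j k (ep X) (ep Y) (vp Z) = 0"
    using Jac_VEE[OF V'' E E' vp(3) vp(4) vp(4)] by (simp add: Jac_cyc[of k i j])
  ultimately show ?thesis
    using split[OF X(2) Y(2) Z(2), of i j k] split2[OF V(2) Y(2) Z(2), of i j k] split2[OF E(2) Y(2) Z(2), of i j k]
      split3[OF V(2) V'(2) Z(2), of i j k] split3[OF V(2) E'(2) Z(2), of i j k]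
      split3[OF E(2) V'(2) Z(2), of i j k] split3[OF E(2) E'(2) Z(2), of i j k] by simp
qed

sublocale Phi: cocycle scale G bar sw Phi
proof (unfold_locales, goal_cases)
  case (5 X i Y j) then show ?case using Phi_anti[of X i Y j] by (simp add: sg_minus)
next
  case (6 X i Y j Z k) then show ?case using Jac_all[of X i Y j Z k] by (simp add: Jac_def)
qed (simp_all add: Phi_add_left Phi_scale_left Phi_add_right Phi_scale_right)

lemma Phi_xy: "Phi (xm b) (ym c) = T b c"
  by (simp add: Phi_odd)

lemma Phi_invariants: "Phi.Tc b c = T b c" "Phi.rplus b = 0" "Phi.rminus b = 0"
proof -
  show "Phi.Tc b c = T b c" by (simp add: Phi.Tc_def Phi.nrm_def Phi_xy)
  have "z12 (em 1)" "z12 (theta (em 1))" "fm (- 1) \<in> Lie" by (simp_all add: z12_def fm_Lie bar_minus)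
  then show "Phi.rplus b = 0" "Phi.rminus b = 0"
    by (simp_all add: Phi.rplus_def Phi.rminus_def Phi_odd z12_bV em_Lie theta_omat)
qed

end

section \<open>Quotients and tensor products of modules with carrier\<close>

locale kmodule =
  fixes M :: "('k::comm_ring_1, 'm) kmod"
  assumes zero_closed [simp]: "mzero M \<in> carr M"
    and add_closed [simp]: "x \<in> carr M \<Longrightarrow> y \<in> carr M \<Longrightarrow> madd M x y \<in> carr M"
    and smult_closed [simp]: "x \<in> carr M \<Longrightarrow> msmult M c x \<in> carr M"
    and add_assoc: "x \<in> carr M \<Longrightarrow> y \<in> carr M \<Longrightarrow> z \<in> carr M \<Longrightarrow> madd M (madd M x y) z = madd M x (madd M y z)"
    and add_comm: "x \<in> carr M \<Longrightarrow> y \<in> carr M \<Longrightarrow> madd M x y = madd M y x"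
    and zero_left [simp]: "x \<in> carr M \<Longrightarrow> madd M (mzero M) x = x"
    and smult_add: "x \<in> carr M \<Longrightarrow> y \<in> carr M \<Longrightarrow> msmult M c (madd M x y) = madd M (msmult M c x) (msmult M c y)"
    and add_smult: "x \<in> carr M \<Longrightarrow> msmult M (c + d) x = madd M (msmult M c x) (msmult M d x)"
    and smult_smult: "x \<in> carr M \<Longrightarrow> msmult M c (msmult M d x) = msmult M (c * d) x"
    and smult_one [simp]: "x \<in> carr M \<Longrightarrow> msmult M 1 x = x"
    and smult_zero [simp]: "x \<in> carr M \<Longrightarrow> msmult M 0 x = mzero M"
begin

lemma zero_right [simp]: "x \<in> carr M \<Longrightarrow> madd M x (mzero M) = x"
  by (simp add: add_comm[of x])

lemma add_left_comm: "x \<in> carr M \<Longrightarrow> y \<in> carr M \<Longrightarrow> z \<in> carr M \<Longrightarrow> madd M x (madd M y z) = madd M y (madd M x z)"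
  by (metis add_assoc add_comm)

lemma neg_right [simp]: "x \<in> carr M \<Longrightarrow> madd M x (msmult M (- 1) x) = mzero M"
  using add_smult[of x 1 "- 1"] by simp

lemma smult_mzero [simp]: "msmult M c (mzero M) = mzero M"
  using smult_smult[OF zero_closed, of c 0] by simp

lemma neg_add: "x \<in> carr M \<Longrightarrow> y \<in> carr M \<Longrightarrow> madd M (madd M x (msmult M (- 1) y)) y = x"
  by (simp add: add_assoc add_comm[of "msmult M (- 1) y" y])

lemma eq_iff_diff: "x \<in> carr M \<Longrightarrow> y \<in> carr M \<Longrightarrow> x = y \<longleftrightarrow> madd M x (msmult M (- 1) y) = mzero M"
  using neg_add[of x y] by auto

lemma submod_carr: "submod M (carr M)"
  by (simp add: submod_def)

lemma submod_mspan: assumes "X \<subseteq> carr M" shows "submod M (mspan M X)"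
proof -
  have "mspan M X \<subseteq> carr M" unfolding mspan_def using assms submod_carr by blast
  then show ?thesis unfolding submod_def mspan_def by (auto 0 3)
qed

lemma mspan_base: "X \<subseteq> mspan M X"
  unfolding mspan_def by blast

lemma mspan_least: "submod M N \<Longrightarrow> X \<subseteq> N \<Longrightarrow> mspan M X \<subseteq> N"
  unfolding mspan_def by blast

end

section \<open>Quotients by submodules\<close>

locale ksubmod = kmodule M for M :: "('k::comm_ring_1, 'm) kmod" +
  fixes N assumes sub: "submod M N"
begin

lemma N_closed: "x \<in> N \<Longrightarrow> x \<in> carr M" "mzero M \<in> N" "x \<in> N \<Longrightarrow> y \<in> N \<Longrightarrow> madd M x y \<in> N" "x \<in> N \<Longrightarrow> msmult M c x \<in> N"
  using sub unfolding submod_def by auto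

lemma coset_self: assumes "x \<in> carr M" shows "x \<in> mcoset M N x"
  unfolding mcoset_def using N_closed(2) zero_right[OF assms] by (intro CollectI exI[of _ "mzero M"]) simp

lemma coset_eq_iff: "x \<in> carr M \<Longrightarrow> y \<in> carr M \<Longrightarrow>
   mcoset M N x = mcoset M N y \<longleftrightarrow> madd M x (msmult M (- 1) y) \<in> N"
proof
  assume x: "x \<in> carr M" and y: "y \<in> carr M" and e: "mcoset M N x = mcoset M N y"
  have "x \<in> mcoset M N y" using coset_self[OF x] e by simp
  then obtain n where n: "n \<in> N" "x = madd M y n" unfolding mcoset_def by blast
  have nc: "n \<in> carr M" using N_closed(1)[OF n(1)] .
  have "madd M x (msmult M (- 1) y) = n"
    unfolding n(2) using y nc by (simp add: add_comm[of y n] add_assoc)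
  then show "madd M x (msmult M (- 1) y) \<in> N" using n by simp
next
  have *: "mcoset M N x \<subseteq> mcoset M N y" if x: "x \<in> carr M" and y: "y \<in> carr M" and d: "madd M x (msmult M (- 1) y) \<in> N" for x y
  proof
    fix z assume "z \<in> mcoset M N x"
    then obtain n where n: "n \<in> N" "z = madd M x n" unfolding mcoset_def by blast
    let ?d = "madd M x (msmult M (- 1) y)"
    have "z = madd M y (madd M ?d n)"
    proof -
      have "z = madd M (madd M ?d y) n" unfolding n(2) neg_add[OF x y] ..
      also have "\<dots> = madd M y (madd M ?d n)"
        using add_assoc[OF N_closed(1)[OF d] y N_closed(1)[OF n(1)]] add_left_comm[OF N_closed(1)[OF d] y N_closed(1)[OF n(1)]]
        by simp
      finally show ?thesis .
    qed
    then show "z \<in> mcoset M N y" unfolding mcoset_def using N_closed(3)[OF d n(1)] by blast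
  qed
  assume x: "x \<in> carr M" and y: "y \<in> carr M" and d: "madd M x (msmult M (- 1) y) \<in> N"
  have "msmult M (- 1) (madd M x (msmult M (- 1) y)) = madd M y (msmult M (- 1) x)"
    using x y by (simp add: smult_add smult_smult add_comm)
  then have "madd M y (msmult M (- 1) x) \<in> N" using N_closed(4)[OF d] by metis
  then show "mcoset M N x = mcoset M N y" using *[OF x y d] *[OF y x] by blast
qed

lemma coset_rep: "a \<in> mcoset M N x \<Longrightarrow> x \<in> carr M \<Longrightarrow> a \<in> carr M \<and> mcoset M N a = mcoset M N x"
proof -
  assume "a \<in> mcoset M N x" and x: "x \<in> carr M"
  then obtain n where n: "n \<in> N" "a = madd M x n" unfolding mcoset_def by blast
  have nc: "n \<in> carr M" using N_closed n by blast
  have "madd M a (msmult M (- 1) x) = n" unfolding n(2) using x nc by (simp add: add_comm[of x n] add_assoc)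
  then show ?thesis using coset_eq_iff[of a x] n x nc by simp
qed

lemma coset_zero: "mcoset M N (mzero M) = N"
  unfolding mcoset_def using N_closed(1) by (auto intro: zero_left[symmetric] simp: image_def)

lemma quot_add: "x \<in> carr M \<Longrightarrow> y \<in> carr M \<Longrightarrow> madd (quot M N) (mcoset M N x) (mcoset M N y) = mcoset M N (madd M x y)"
proof -
  assume x: "x \<in> carr M" and y: "y \<in> carr M"
  have "{madd M a b |a b. a \<in> mcoset M N x \<and> b \<in> mcoset M N y} = mcoset M N (madd M x y)"
  proof (intro subset_antisym subsetI)
    fix z assume "z \<in> {madd M a b |a b. a \<in> mcoset M N x \<and> b \<in> mcoset M N y}"
    then obtain n m where z: "z = madd M (madd M x n) (madd M y m)" "n \<in> N" "m \<in> N" unfolding mcoset_def by blast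
    have "z = madd M (madd M x y) (madd M n m)"
      using z x y N_closed(1) by (simp add: add_assoc add_left_comm[of n y m])
    then show "z \<in> mcoset M N (madd M x y)" unfolding mcoset_def using N_closed(3) z by blast
  next
    fix z assume "z \<in> mcoset M N (madd M x y)"
    then obtain n where z: "z = madd M (madd M x y) n" "n \<in> N" unfolding mcoset_def by blast
    then have "z = madd M x (madd M y n)" using x y N_closed(1) by (simp add: add_assoc)
    then show "z \<in> {madd M a b |a b. a \<in> mcoset M N x \<and> b \<in> mcoset M N y}"
      using coset_self[OF x] z(2) unfolding mcoset_def by blast
  qed
  then show ?thesis by (simp add: quot_def)
qed

lemma quot_smult: "x \<in> carr M \<Longrightarrow> msmult (quot M N) c (mcoset M N x) = mcoset M N (msmult M c x)"
proof -
  assume x: "x \<in> carr M"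
  have "{madd M (msmult M c a) n |a n. a \<in> mcoset M N x \<and> n \<in> N} = mcoset M N (msmult M c x)"
  proof (intro subset_antisym subsetI)
    fix z assume "z \<in> {madd M (msmult M c a) n |a n. a \<in> mcoset M N x \<and> n \<in> N}"
    then obtain n m where z: "z = madd M (msmult M c (madd M x m)) n" "n \<in> N" "m \<in> N" unfolding mcoset_def by blast
    have "z = madd M (msmult M c x) (madd M (msmult M c m) n)"
      using z x N_closed(1) by (simp add: add_assoc smult_add)
    then show "z \<in> mcoset M N (msmult M c x)" unfolding mcoset_def using N_closed(3)[OF N_closed(4)] z by blast
  next
    fix z assume "z \<in> mcoset M N (msmult M c x)"
    then show "z \<in> {madd M (msmult M c a) n |a n. a \<in> mcoset M N x \<and> n \<in> N}"
      using coset_self[OF x] unfolding mcoset_def by blast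
  qed
  then show ?thesis by (simp add: quot_def)
qed

lemma quot_carr: "carr (quot M N) = mcoset M N ` carr M" and quot_zero: "mzero (quot M N) = mcoset M N (mzero M)"
  by (simp_all add: quot_def coset_zero)

lemma quot_kmodule: "kmodule (quot M N)"
  by unfold_locales
    (auto simp: quot_carr quot_zero quot_add quot_smult add_assoc smult_add add_smult smult_smult add_comm add_left_comm)

lemma quot_linear: "mlinear M (quot M N) (mcoset M N)"
  by (simp add: mlinear_def quot_carr quot_add quot_smult)

lemma quot_lift:
  assumes Q: "kmodule Q" and g: "mlinear M Q g" and z: "\<And>n. n \<in> N \<Longrightarrow> g n = mzero Q"
  shows "\<exists>h. mlinear (quot M N) Q h \<and> (\<forall>x\<in>carr M. h (mcoset M N x) = g x)"
proof -
  interpret Q: kmodule Q by fact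
  have gc: "x \<in> carr M \<Longrightarrow> g x \<in> carr Q" "x \<in> carr M \<Longrightarrow> y \<in> carr M \<Longrightarrow> g (madd M x y) = madd Q (g x) (g y)"
    "x \<in> carr M \<Longrightarrow> g (msmult M c x) = msmult Q c (g x)" for x y c
    using g unfolding mlinear_def by auto
  define h where "h A = g (SOME a. a \<in> A)" for A
  have h: "h (mcoset M N x) = g x" if x: "x \<in> carr M" for x
  proof -
    let ?a = "SOME a. a \<in> mcoset M N x"
    have "?a \<in> mcoset M N x" using coset_self[OF x] by (rule someI)
    then have a: "?a \<in> carr M" "mcoset M N ?a = mcoset M N x" using coset_rep x by blast+
    then have "madd M ?a (msmult M (- 1) x) \<in> N" using coset_eq_iff x by blast
    then have "madd Q (g ?a) (msmult Q (- 1) (g x)) = mzero Q" using z a x gc by (metis smult_closed)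
    then show ?thesis unfolding h_def using Q.eq_iff_diff a x gc by blast
  qed
  have "mlinear (quot M N) Q h"
    unfolding mlinear_def by (auto simp: quot_carr quot_add quot_smult h gc)
  then show ?thesis using h by blast
qed

end

lemma kernel_submod:
  assumes "kmodule M" "kmodule Q" "mlinear M Q g"
  shows "submod M {x \<in> carr M. g x = mzero Q}"
proof -
  interpret M: kmodule M by fact
  interpret Q: kmodule Q by fact
  have gc: "x \<in> carr M \<Longrightarrow> g x \<in> carr Q" "x \<in> carr M \<Longrightarrow> y \<in> carr M \<Longrightarrow> g (madd M x y) = madd Q (g x) (g y)"
    "x \<in> carr M \<Longrightarrow> g (msmult M c x) = msmult Q c (g x)" for x y c
    using assms(3) unfolding mlinear_def by auto
  have "g (mzero M) = mzero Q"
    using gc(3)[OF M.zero_closed, of 0] gc(1)[OF M.zero_closed] by simp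
  then show ?thesis unfolding submod_def by (auto simp: gc)
qed

lemma quot_mspan_lift:
  assumes M: "kmodule M" and X: "X \<subseteq> carr M" and Q: "kmodule Q" and g: "mlinear M Q g"
    and z: "\<And>x. x \<in> X \<Longrightarrow> g x = mzero Q"
  shows "\<exists>h. mlinear (quot M (mspan M X)) Q h \<and> (\<forall>x\<in>carr M. h (mcoset M (mspan M X) x) = g x)"
proof -
  interpret M: kmodule M by fact
  interpret s: ksubmod M "mspan M X" by unfold_locales (rule M.submod_mspan[OF X])
  have "mspan M X \<subseteq> {x \<in> carr M. g x = mzero Q}"
    by (rule M.mspan_least[OF kernel_submod[OF M Q g]]) (use X z in auto)
  then show ?thesis by (intro s.quot_lift[OF Q g]) auto
qed

lemma kmod_of_simps [simp]: "carr (kmod_of s A) = A" "madd (kmod_of s A) = (+)" "mzero (kmod_of s A) = 0" "msmult (kmod_of s A) = s"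
  by (simp_all add: kmod_of_def)

lemma (in module) kmodule_kmod_of: "subspace A \<Longrightarrow> kmodule (kmod_of scale A)"
  by unfold_locales (auto simp: subspace_0 subspace_add subspace_scale scale_right_distrib scale_left_distrib add_ac)

subsection \<open>Free modules\<close>

abbreviation psm :: "'k::comm_ring_1 \<Rightarrow> ('x \<Rightarrow>\<^sub>0 'k) \<Rightarrow> ('x \<Rightarrow>\<^sub>0 'k)" where
  "psm c \<equiv> Poly_Mapping.map ((*) c)"

lemma lookup_psm [simp]: "Poly_Mapping.lookup (psm c v) x = c * Poly_Mapping.lookup v x"
  by (simp add: Poly_Mapping.map.rep_eq when_def)

interpretation psm: module psm
  by unfold_locales (auto intro!: poly_mapping_eqI simp: lookup_add algebra_simps)

lemma psm_single [simp]: "psm c (Poly_Mapping.single x d) = Poly_Mapping.single x (c * d)"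
  by (rule poly_mapping_eqI) (simp add: lookup_single when_def)

lemma keys_subspace: "psm.subspace {f. Poly_Mapping.keys f \<subseteq> X}"
proof (rule psm.subspaceI)
  show "0 \<in> {f. Poly_Mapping.keys f \<subseteq> X}" by simp
  show "\<And>x y. x \<in> {f. Poly_Mapping.keys f \<subseteq> X} \<Longrightarrow> y \<in> {f. Poly_Mapping.keys f \<subseteq> X} \<Longrightarrow> x + y \<in> {f. Poly_Mapping.keys f \<subseteq> X}"
    using Poly_Mapping.keys_add by force
  show "\<And>c x. x \<in> {f. Poly_Mapping.keys f \<subseteq> X} \<Longrightarrow> psm c x \<in> {f. Poly_Mapping.keys f \<subseteq> X}"
    by (auto simp: subset_iff in_keys_iff) (metis mult_zero_right)
qed

lemma free_mod_simps [simp]: "carr (free_mod X) = {f. Poly_Mapping.keys f \<subseteq> X}" "madd (free_mod X) = (+)" "mzero (free_mod X) = 0"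
  "msmult (free_mod X) = psm"
  by (simp_all add: free_mod_def)

lemma free_kmodule: "kmodule (free_mod X)"
  unfolding free_mod_def by (rule psm.kmodule_kmod_of[OF keys_subspace])

text \<open>The linear extension of \<open>f\<close> from the generators to the free module.\<close>

definition pext :: "('k::comm_ring_1 \<Rightarrow> 'w::ab_group_add \<Rightarrow> 'w) \<Rightarrow> ('x \<Rightarrow> 'w) \<Rightarrow> ('x \<Rightarrow>\<^sub>0 'k) \<Rightarrow> 'w" where
  "pext s f v = (\<Sum>x\<in>Poly_Mapping.keys v. s (Poly_Mapping.lookup v x) (f x))"

context module
begin

lemma pext_superset: "finite A \<Longrightarrow> Poly_Mapping.keys v \<subseteq> A \<Longrightarrow> pext scale f v = (\<Sum>x\<in>A. scale (Poly_Mapping.lookup v x) (f x))"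
  unfolding pext_def by (rule sum.mono_neutral_left) (auto simp: in_keys_iff)

lemma pext_add: "pext scale f (v + w) = pext scale f v + pext scale f w"
proof -
  have "Poly_Mapping.keys (v + w) \<subseteq> Poly_Mapping.keys v \<union> Poly_Mapping.keys w" by (rule Poly_Mapping.keys_add)
  then show ?thesis
    by (simp add: pext_superset[of "Poly_Mapping.keys v \<union> Poly_Mapping.keys w"] lookup_add scale_left_distrib sum.distrib)
qed

lemma pext_scale: "pext scale f (psm c v) = scale c (pext scale f v)"
proof -
  have "Poly_Mapping.keys (psm c v) \<subseteq> Poly_Mapping.keys v" by (auto simp: in_keys_iff)
  then show ?thesis
    by (simp add: pext_superset[of "Poly_Mapping.keys v"] scale_sum_right)
qed

lemma pext_single [simp]: "pext scale f (Poly_Mapping.single x c) = scale c (f x)"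
  by (cases "c = 0") (simp_all add: pext_def)

lemma pext_zero [simp]: "pext scale f 0 = 0" by (simp add: pext_def)

lemma pext_diff: "pext scale f (v - w) = pext scale f v - pext scale f w"
  using pext_add[of f "v - w" w] by simp

lemma pext_linear: "mlinear (free_mod X) (kmod_of scale UNIV) (pext scale f)"
  by (simp add: mlinear_def pext_add pext_scale)

end

subsection \<open>A universal module\<close>

text \<open>The product of all quotients of the free module on \<open>'x\<close>. Every module with carrier that is a
  quotient of a submodule of it embeds into this type, where one can calculate with the operations of
  class \<open>ab_group_add\<close>.\<close>

definition urel :: "(('x \<Rightarrow>\<^sub>0 'k::comm_ring_1) set \<Rightarrow> ('x \<Rightarrow>\<^sub>0 'k)) \<Rightarrow> (('x \<Rightarrow>\<^sub>0 'k) set \<Rightarrow> ('x \<Rightarrow>\<^sub>0 'k)) \<Rightarrow> bool" where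
  "urel g h \<longleftrightarrow> (\<forall>N. psm.subspace N \<longrightarrow> g N - h N \<in> N)"

lemma urel_refl [simp]: "urel g g"
  by (simp add: urel_def psm.subspace_0)

lemma urel_add: "urel g g' \<Longrightarrow> urel h h' \<Longrightarrow> urel (\<lambda>N. g N + h N) (\<lambda>N. g' N + h' N)"
  unfolding urel_def using psm.subspace_add by (metis add_diff_add)

lemma urel_scale: "urel g g' \<Longrightarrow> urel (\<lambda>N. psm c (g N)) (\<lambda>N. psm c (g' N))"
  unfolding urel_def using psm.subspace_scale by (metis psm.scale_right_diff_distrib)

lemma urel_minus: "urel g g' \<Longrightarrow> urel (\<lambda>N. - g N) (\<lambda>N. - g' N)"
  using urel_scale[of g g' "- 1"] by (simp add: psm.scale_minus_left)

lemma equivp_urel: "equivp (urel :: (('x \<Rightarrow>\<^sub>0 'k::comm_ring_1) set \<Rightarrow> ('x \<Rightarrow>\<^sub>0 'k)) \<Rightarrow> _)" (is "equivp ?R")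
proof (rule equivpI)
  show "reflp ?R" by (simp add: reflp_def)
  show "symp ?R"
    unfolding symp_def urel_def using psm.subspace_neg by (metis minus_diff_eq)
  show "transp ?R"
  proof (rule transpI)
    fix f g h :: "('x \<Rightarrow>\<^sub>0 'k) set \<Rightarrow> ('x \<Rightarrow>\<^sub>0 'k)"
    assume *: "urel f g" "urel g h"
    have "f N - h N = (f N - g N) + (g N - h N)" for N by simp
    then show "urel f h" using * unfolding urel_def by (metis psm.subspace_add)
  qed
qed

quotient_type (overloaded) ('x, 'k) univ = "('x \<Rightarrow>\<^sub>0 'k::comm_ring_1) set \<Rightarrow> ('x \<Rightarrow>\<^sub>0 'k)" / urel
  by (rule equivp_urel)

instantiation univ :: (type, comm_ring_1) ab_group_add
begin

lift_definition zero_univ :: "('a, 'b) univ" is "\<lambda>N. 0" .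

lift_definition plus_univ :: "('a, 'b) univ \<Rightarrow> ('a, 'b) univ \<Rightarrow> ('a, 'b) univ" is "\<lambda>g h N. g N + h N"
  by (rule urel_add)

lift_definition uminus_univ :: "('a, 'b) univ \<Rightarrow> ('a, 'b) univ" is "\<lambda>g N. - g N"
  by (rule urel_minus)

definition minus_univ :: "('a, 'b) univ \<Rightarrow> ('a, 'b) univ \<Rightarrow> ('a, 'b) univ" where "minus_univ g h = g + - h"

instance
  by standard (simp add: minus_univ_def | transfer, simp add: algebra_simps)+

end

lift_definition usm :: "'k::comm_ring_1 \<Rightarrow> ('x, 'k) univ \<Rightarrow> ('x, 'k) univ" is "\<lambda>c g N. psm c (g N)"
  by (rule urel_scale)

interpretation usm: module usm
proof
  fix a b :: 'a and x y :: "('b, 'a) univ"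
  show "usm a (x + y) = usm a x + usm a y" by transfer (simp add: psm.scale_right_distrib)
  show "usm (a + b) x = usm a x + usm b x" by transfer (simp add: psm.scale_left_distrib)
  show "usm a (usm b x) = usm (a * b) x" by transfer simp
  show "usm 1 x = x" by transfer simp
qed

text \<open>The inclusion of the factor for \<open>N\<close> into the product.\<close>

definition ucls :: "('x \<Rightarrow>\<^sub>0 'k::comm_ring_1) set \<Rightarrow> ('x \<Rightarrow>\<^sub>0 'k) \<Rightarrow> ('x, 'k) univ" where
  "ucls N v = abs_univ (\<lambda>M. if M = N then v else 0)"

lemma ucls_add: "ucls N (v + w) = ucls N v + ucls N w"
  by (auto simp: ucls_def plus_univ.abs_eq univ.abs_eq_iff urel_def psm.subspace_0)

lemma ucls_scale: "ucls N (psm c v) = usm c (ucls N v)"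
  by (auto simp: ucls_def usm.abs_eq univ.abs_eq_iff urel_def psm.subspace_0)

lemma ucls_eq_iff: "psm.subspace N \<Longrightarrow> ucls N v = ucls N w \<longleftrightarrow> v - w \<in> N"
  by (auto simp: ucls_def univ.abs_eq_iff urel_def psm.subspace_0)

text \<open>\<open>Q\<close> is the free module on \<open>X\<close> modulo the kernel
  \<open>N\<close> of \<kappa>, and so sits in the factor for \<open>N\<close>.\<close>

lemma univ_embedding:
  fixes Q :: "('k::comm_ring_1, 'm) kmod" and \<kappa> :: "('x \<Rightarrow>\<^sub>0 'k) \<Rightarrow> 'm"
  assumes Q: "kmodule Q" and k: "mlinear (free_mod X) Q \<kappa>" and surj: "\<kappa> ` carr (free_mod X) = carr Q"
  obtains \<iota> :: "'m \<Rightarrow> ('x, 'k) univ" where "mlinear Q (kmod_of usm UNIV) \<iota>" "inj_on \<iota> (carr Q)"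
proof -
  interpret Q: kmodule Q by fact
  interpret F: kmodule "free_mod X :: ('k, 'x \<Rightarrow>\<^sub>0 'k) kmod" by (rule free_kmodule)
  let ?F = "carr (free_mod X) :: ('x \<Rightarrow>\<^sub>0 'k) set"
  define N where "N = {v \<in> ?F. \<kappa> v = mzero Q}"
  have kc: "v \<in> ?F \<Longrightarrow> \<kappa> v \<in> carr Q" "v \<in> ?F \<Longrightarrow> w \<in> ?F \<Longrightarrow> \<kappa> (v + w) = madd Q (\<kappa> v) (\<kappa> w)"
    "v \<in> ?F \<Longrightarrow> \<kappa> (psm c v) = msmult Q c (\<kappa> v)" for v w c
    using k unfolding mlinear_def by auto
  have sub: "psm.subspace N"
    using kernel_submod[OF free_kmodule Q k] unfolding N_def submod_def psm.subspace_def by auto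
  have eq: "ucls N v = ucls N w \<longleftrightarrow> \<kappa> v = \<kappa> w" if v: "v \<in> ?F" and w: "w \<in> ?F" for v w
  proof -
    have vw: "v - w = v + psm (- 1) w" by (simp add: psm.scale_minus_left)
    have mw: "psm (- 1) w \<in> ?F" using F.smult_closed[OF w, of "- 1"] by simp
    have "v + psm (- 1) w \<in> ?F" using F.add_closed[OF v mw] by simp
    then have "v - w \<in> N \<longleftrightarrow> madd Q (\<kappa> v) (msmult Q (- 1) (\<kappa> w)) = mzero Q"
      unfolding N_def vw mem_Collect_eq kc(2)[OF v mw] kc(3)[OF w] by blast
    then show ?thesis using ucls_eq_iff[OF sub] Q.eq_iff_diff[of "\<kappa> v" "\<kappa> w"] kc(1) v w by blast
  qed
  define \<iota> where "\<iota> x = ucls N (SOME v. v \<in> ?F \<and> \<kappa> v = x)" for x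
  have i: "\<iota> (\<kappa> v) = ucls N v" if v: "v \<in> ?F" for v
  proof -
    have "(SOME w. w \<in> ?F \<and> \<kappa> w = \<kappa> v) \<in> ?F \<and> \<kappa> (SOME w. w \<in> ?F \<and> \<kappa> w = \<kappa> v) = \<kappa> v"
      by (rule someI_ex) (use v in blast)
    then show ?thesis unfolding \<iota>_def using eq v by blast
  qed
  show ?thesis
  proof (rule that)
    show "mlinear Q (kmod_of usm UNIV) \<iota>"
      unfolding mlinear_def
    proof (intro conjI ballI allI)
      fix x y assume "x \<in> carr Q" "y \<in> carr Q"
      then obtain v w where vw: "v \<in> ?F" "w \<in> ?F" "x = \<kappa> v" "y = \<kappa> w" unfolding surj[symmetric] by blast
      have "v + w \<in> ?F" using F.add_closed[OF vw(1,2)] by simp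
      then have "\<iota> (\<kappa> (v + w)) = \<iota> x + \<iota> y" using i vw by (simp add: ucls_add)
      then show "\<iota> (madd Q x y) = madd (kmod_of usm UNIV) (\<iota> x) (\<iota> y)" using kc(2) vw by simp
    next
      fix c x assume "x \<in> carr Q"
      then obtain v where v: "v \<in> ?F" "x = \<kappa> v" unfolding surj[symmetric] by blast
      have "psm c v \<in> ?F" using F.smult_closed[OF v(1), of c] by simp
      then have "\<iota> (\<kappa> (psm c v)) = usm c (\<iota> x)" using i v by (simp add: ucls_scale)
      then show "\<iota> (msmult Q c x) = msmult (kmod_of usm UNIV) c (\<iota> x)" using kc(3) v by simp
    qed simp
    show "inj_on \<iota> (carr Q)"
      unfolding surj[symmetric] by (intro inj_onI) (use i eq in auto)
  qed
qed

lemma mlinearD: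
  assumes "mlinear M N f"
  shows "x \<in> carr M \<Longrightarrow> f x \<in> carr N" "x \<in> carr M \<Longrightarrow> y \<in> carr M \<Longrightarrow> f (madd M x y) = madd N (f x) (f y)"
    "x \<in> carr M \<Longrightarrow> f (msmult M c x) = msmult N c (f x)"
  using assms unfolding mlinear_def by auto

lemma mlinear_comp: "mlinear M N f \<Longrightarrow> mlinear N P g \<Longrightarrow> mlinear M P (\<lambda>x. g (f x))"
  unfolding mlinear_def by (auto simp: image_subset_iff)

lemma mlinear_zero: "kmodule M \<Longrightarrow> kmodule N \<Longrightarrow> mlinear M N f \<Longrightarrow> f (mzero M) = mzero N"
  using kernel_submod[of M N f] by (simp add: submod_def)

text \<open>The way back to carriers: a map into the ambient type lands in \<open>P\<close> once its
  values lie in the image of the embedding.\<close>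

lemma mlinear_factor:
  assumes P: "kmodule P" and i: "mlinear P W \<iota>" "inj_on \<iota> (carr P)" and g: "mlinear Q W g" and Q: "kmodule Q"
    and im: "\<And>x. x \<in> carr Q \<Longrightarrow> g x \<in> \<iota> ` carr P"
  obtains h where "mlinear Q P h" "\<And>x. x \<in> carr Q \<Longrightarrow> \<iota> (h x) = g x"
proof -
  interpret P: kmodule P by fact
  interpret Q: kmodule Q by fact
  define h where "h x = inv_into (carr P) \<iota> (g x)" for x
  have h: "h x \<in> carr P" "\<iota> (h x) = g x" if "x \<in> carr Q" for x
    using im[OF that] by (simp_all add: h_def inv_into_into f_inv_into_f)
  note id = mlinearD[OF i(1)] and gd = mlinearD[OF g]
  have "mlinear Q P h"
    unfolding mlinear_def
  proof (intro conjI ballI allI)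
    show "h ` carr Q \<subseteq> carr P" using h by blast
    fix x assume x: "x \<in> carr Q"
    show "h (madd Q x y) = madd P (h x) (h y)" if y: "y \<in> carr Q" for y
      by (rule inj_onD[OF i(2)]) (use h x y id gd in simp_all)
    show "h (msmult Q c x) = msmult P c (h x)" for c
      by (rule inj_onD[OF i(2)]) (use h x id gd in simp_all)
  qed
  then show ?thesis using that h by blast
qed

lemma free_single: "x \<in> X \<Longrightarrow> Poly_Mapping.single x c \<in> carr (free_mod X)"
  by simp

lemma free_diff: "v \<in> carr (free_mod X) \<Longrightarrow> w \<in> carr (free_mod X) \<Longrightarrow> v - w \<in> carr (free_mod X)"
  using psm.subspace_diff[OF keys_subspace, of v X w] by simp

lemma free_induct [consumes 1, case_names zero single add]:
  assumes "Poly_Mapping.keys v \<subseteq> X" and z: "P 0" and s: "\<And>x c. x \<in> X \<Longrightarrow> P (Poly_Mapping.single x c)"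
    and a: "\<And>v w. Poly_Mapping.keys v \<subseteq> X \<Longrightarrow> Poly_Mapping.keys w \<subseteq> X \<Longrightarrow> P v \<Longrightarrow> P w \<Longrightarrow> P (v + w)"
  shows "P (v :: 'x \<Rightarrow>\<^sub>0 'k::comm_ring_1)"
proof -
  have "P v" if "finite A" "Poly_Mapping.keys v \<subseteq> A" "A \<subseteq> X" for A and v :: "'x \<Rightarrow>\<^sub>0 'k"
    using that
  proof (induction A arbitrary: v rule: finite_induct)
    case empty then show ?case using z by simp
  next
    case (insert x A)
    let ?s = "Poly_Mapping.single x (Poly_Mapping.lookup v x)"
    have k: "Poly_Mapping.keys (v - ?s) \<subseteq> A"
    proof
      fix y assume "y \<in> Poly_Mapping.keys (v - ?s)"
      then have "y \<noteq> x" "y \<in> Poly_Mapping.keys v"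
        by (auto simp: in_keys_iff lookup_minus lookup_single when_def split: if_splits)
      then show "y \<in> A" using insert.prems(1) by blast
    qed
    have AX: "A \<subseteq> X" "x \<in> X" using insert.prems(2) by simp_all
    have "Poly_Mapping.keys ?s \<subseteq> X" using AX(2) by simp
    from a[OF subset_trans[OF k AX(1)] this insert.IH[OF k AX(1)] s[OF AX(2)]]
    have "P (v - ?s + ?s)" .
    then show ?case by simp
  qed
  from this[OF finite_keys subset_refl assms(1)] show ?thesis .
qed

section \<open>Tensor products and bilinear maps\<close>

locale two_kmodules = M: kmodule M + N: kmodule N
  for M :: "('k::comm_ring_1, 'm) kmod" and N :: "('k, 'n) kmod"
begin

abbreviation "F \<equiv> free_mod (carr M \<times> carr N) :: ('k, 'm \<times> 'n \<Rightarrow>\<^sub>0 'k) kmod"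

sublocale F: kmodule F by (rule free_kmodule)

lemma bilinear_gens_closed:
  "{Poly_Mapping.single (madd M x x', y) 1 - Poly_Mapping.single (x, y) 1 - Poly_Mapping.single (x', y) 1
      | x x' y. x \<in> carr M \<and> x' \<in> carr M \<and> y \<in> carr N} \<union>
   {Poly_Mapping.single (x, madd N y y') 1 - Poly_Mapping.single (x, y) 1 - Poly_Mapping.single (x, y') 1
      | x y y'. x \<in> carr M \<and> y \<in> carr N \<and> y' \<in> carr N} \<union>
   {Poly_Mapping.single (msmult M c x, y) 1 - Poly_Mapping.single (x, y) c | c x y. x \<in> carr M \<and> y \<in> carr N} \<union>
   {Poly_Mapping.single (x, msmult N c y) 1 - Poly_Mapping.single (x, y) c | c x y. x \<in> carr M \<and> y \<in> carr N} \<subseteq> carr F"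
  by (intro Un_least subsetI; clarify; intro free_diff free_single SigmaI; simp)

sublocale B: ksubmod F "bilinear_rels M N"
  by unfold_locales (unfold bilinear_rels_def, rule F.submod_mspan[OF bilinear_gens_closed])

abbreviation "TT \<equiv> tensor M N"

sublocale T: kmodule "tensor M N"
  unfolding tensor_def by (rule B.quot_kmodule)

lemma tens_closed [simp]: "x \<in> carr M \<Longrightarrow> y \<in> carr N \<Longrightarrow> tens M N x y \<in> carr (tensor M N)"
  unfolding tensor_def tens_def B.quot_carr by (intro imageI) simp

lemma rels_base:
  "x \<in> carr M \<Longrightarrow> x' \<in> carr M \<Longrightarrow> y \<in> carr N \<Longrightarrow> Poly_Mapping.single (madd M x x', y) 1 - Poly_Mapping.single (x, y) 1 - Poly_Mapping.single (x', y) 1 \<in> bilinear_rels M N"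
  "x \<in> carr M \<Longrightarrow> y \<in> carr N \<Longrightarrow> y' \<in> carr N \<Longrightarrow> Poly_Mapping.single (x, madd N y y') 1 - Poly_Mapping.single (x, y) 1 - Poly_Mapping.single (x, y') 1 \<in> bilinear_rels M N"
  "x \<in> carr M \<Longrightarrow> y \<in> carr N \<Longrightarrow> Poly_Mapping.single (msmult M c x, y) 1 - Poly_Mapping.single (x, y) c \<in> bilinear_rels M N"
  "x \<in> carr M \<Longrightarrow> y \<in> carr N \<Longrightarrow> Poly_Mapping.single (x, msmult N c y) 1 - Poly_Mapping.single (x, y) c \<in> bilinear_rels M N"
  unfolding bilinear_rels_def by (rule subsetD[OF F.mspan_base], blast)+

lemma F_cong: "Poly_Mapping.keys v \<subseteq> carr M \<times> carr N \<Longrightarrow> Poly_Mapping.keys w \<subseteq> carr M \<times> carr N \<Longrightarrow> v - w \<in> bilinear_rels M N \<Longrightarrow>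
   mcoset F (bilinear_rels M N) v = mcoset F (bilinear_rels M N) w"
  using B.coset_eq_iff[of v w] by (simp add: psm.scale_minus_left)

lemma tens_add_left: "x \<in> carr M \<Longrightarrow> x' \<in> carr M \<Longrightarrow> y \<in> carr N \<Longrightarrow> tens M N (madd M x x') y = madd TT (tens M N x y) (tens M N x' y)"
proof -
  assume x: "x \<in> carr M" "x' \<in> carr M" "y \<in> carr N"
  have k: "Poly_Mapping.keys (Poly_Mapping.single (x, y) 1 + Poly_Mapping.single (x', y) (1::'k)) \<subseteq> carr M \<times> carr N"
    using F.add_closed[of "Poly_Mapping.single (x, y) 1" "Poly_Mapping.single (x', y) 1"] x by simp
  have "mcoset F (bilinear_rels M N) (Poly_Mapping.single (madd M x x', y) 1)
      = mcoset F (bilinear_rels M N) (Poly_Mapping.single (x, y) 1 + Poly_Mapping.single (x', y) 1)"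
    using x k rels_base(1)[OF x] by (intro F_cong) (simp_all add: diff_diff_add)
  then show ?thesis unfolding tens_def tensor_def
    using B.quot_add[of "Poly_Mapping.single (x, y) 1" "Poly_Mapping.single (x', y) 1"] x by simp
qed

lemma tens_add_right: "x \<in> carr M \<Longrightarrow> y \<in> carr N \<Longrightarrow> y' \<in> carr N \<Longrightarrow> tens M N x (madd N y y') = madd TT (tens M N x y) (tens M N x y')"
proof -
  assume x: "x \<in> carr M" "y \<in> carr N" "y' \<in> carr N"
  have k: "Poly_Mapping.keys (Poly_Mapping.single (x, y) 1 + Poly_Mapping.single (x, y') (1::'k)) \<subseteq> carr M \<times> carr N"
    using F.add_closed[of "Poly_Mapping.single (x, y) 1" "Poly_Mapping.single (x, y') 1"] x by simp
  have "mcoset F (bilinear_rels M N) (Poly_Mapping.single (x, madd N y y') 1)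
      = mcoset F (bilinear_rels M N) (Poly_Mapping.single (x, y) 1 + Poly_Mapping.single (x, y') 1)"
    using x k rels_base(2)[OF x] by (intro F_cong) (simp_all add: diff_diff_add)
  then show ?thesis unfolding tens_def tensor_def
    using B.quot_add[of "Poly_Mapping.single (x, y) 1" "Poly_Mapping.single (x, y') 1"] x by simp
qed

lemma tens_scale: "x \<in> carr M \<Longrightarrow> y \<in> carr N \<Longrightarrow> tens M N (msmult M c x) y = msmult TT c (tens M N x y)"
  "x \<in> carr M \<Longrightarrow> y \<in> carr N \<Longrightarrow> tens M N x (msmult N c y) = msmult TT c (tens M N x y)"
proof -
  assume x: "x \<in> carr M" and y: "y \<in> carr N"
  have "mcoset F (bilinear_rels M N) (Poly_Mapping.single (msmult M c x, y) 1) = mcoset F (bilinear_rels M N) (Poly_Mapping.single (x, y) c)"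
    "mcoset F (bilinear_rels M N) (Poly_Mapping.single (x, msmult N c y) 1) = mcoset F (bilinear_rels M N) (Poly_Mapping.single (x, y) c)"
    using x y rels_base(3,4)[OF x y, of c] by (intro F_cong; simp)+
  then show "tens M N (msmult M c x) y = msmult TT c (tens M N x y)" "tens M N x (msmult N c y) = msmult TT c (tens M N x y)"
    unfolding tens_def tensor_def using B.quot_smult[of "Poly_Mapping.single (x, y) 1" c] x y by simp_all
qed

lemma tensor_lift:
  assumes "module sw" and add: "\<And>x x' y. x \<in> carr M \<Longrightarrow> x' \<in> carr M \<Longrightarrow> y \<in> carr N \<Longrightarrow> f (madd M x x') y = f x y + f x' y"
    "\<And>x y y'. x \<in> carr M \<Longrightarrow> y \<in> carr N \<Longrightarrow> y' \<in> carr N \<Longrightarrow> f x (madd N y y') = f x y + f x y'"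
    and scale: "\<And>c x y. x \<in> carr M \<Longrightarrow> y \<in> carr N \<Longrightarrow> f (msmult M c x) y = sw c (f x y)"
    "\<And>c x y. x \<in> carr M \<Longrightarrow> y \<in> carr N \<Longrightarrow> f x (msmult N c y) = sw c (f x y)"
  shows "\<exists>h. mlinear (tensor M N) (kmod_of sw UNIV) h \<and> (\<forall>x\<in>carr M. \<forall>y\<in>carr N. h (tens M N x y) = f x y)"
proof -
  interpret W: module sw by fact
  have "\<exists>h. mlinear (quot F (bilinear_rels M N)) (kmod_of sw UNIV) h \<and>
     (\<forall>v\<in>carr F. h (mcoset F (bilinear_rels M N) v) = pext sw (\<lambda>(x, y). f x y) v)"
    unfolding bilinear_rels_def
    by (rule quot_mspan_lift[OF F.kmodule_axioms bilinear_gens_closed W.kmodule_kmod_of[OF W.subspace_UNIV] W.pext_linear])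
      (auto simp: W.pext_diff add scale)
  then show ?thesis unfolding tensor_def tens_def by fastforce
qed

lemma tens_image: "(\<lambda>v. mcoset F (bilinear_rels M N) v) ` carr F = carr (tensor M N)"
  "mlinear F (tensor M N) (mcoset F (bilinear_rels M N))"
  unfolding tensor_def by (simp_all only: B.quot_carr B.quot_linear)

end

section \<open>Quotients of tensor products by given relations\<close>

locale tensor_quotient = two_kmodules M N
  for M :: "('k::comm_ring_1, 'm) kmod" and N :: "('k, 'n) kmod" +
  fixes R assumes R: "R \<subseteq> carr (tensor M N)"
begin

abbreviation "rels \<equiv> mspan (tensor M N) R"

sublocale R: ksubmod "tensor M N" rels
  by unfold_locales (rule T.submod_mspan[OF R])

definition Qm where "Qm = quot (tensor M N) rels"
definition cls where "cls x y = mcoset (tensor M N) rels (tens M N x y)"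

sublocale Q: kmodule Qm unfolding Qm_def by (rule R.quot_kmodule)

lemma coset_linear: "mlinear (tensor M N) Qm (mcoset (tensor M N) rels)"
  unfolding Qm_def by (rule R.quot_linear)

lemma cls_closed [simp]: "x \<in> carr M \<Longrightarrow> y \<in> carr N \<Longrightarrow> cls x y \<in> carr Qm"
  unfolding cls_def using mlinearD(1)[OF coset_linear] by simp

lemma cls_add_left: "x \<in> carr M \<Longrightarrow> x' \<in> carr M \<Longrightarrow> y \<in> carr N \<Longrightarrow> cls (madd M x x') y = madd Qm (cls x y) (cls x' y)"
  and cls_add_right: "x \<in> carr M \<Longrightarrow> y \<in> carr N \<Longrightarrow> y' \<in> carr N \<Longrightarrow> cls x (madd N y y') = madd Qm (cls x y) (cls x y')"
  and cls_scale: "x \<in> carr M \<Longrightarrow> y \<in> carr N \<Longrightarrow> cls (msmult M c x) y = msmult Qm c (cls x y)"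
    "x \<in> carr M \<Longrightarrow> y \<in> carr N \<Longrightarrow> cls x (msmult N c y) = msmult Qm c (cls x y)"
  unfolding cls_def using mlinearD(2,3)[OF coset_linear]
  by (simp_all add: tens_add_left tens_add_right tens_scale)

lemma rel_zero: "s \<in> R \<Longrightarrow> mcoset (tensor M N) rels s = mzero Qm"
  unfolding Qm_def R.quot_zero using R.coset_eq_iff[of s "mzero (tensor M N)"] T.mspan_base R
  by (auto simp: subset_iff)

text \<open>Scalars can be absorbed into an argument of \<open>cls\<close>, so closure under sums is
  enough.\<close>

lemma Q_induct [consumes 1, case_names cls add]:
  assumes "q \<in> carr Qm" and c: "\<And>x y. x \<in> carr M \<Longrightarrow> y \<in> carr N \<Longrightarrow> P (cls x y)"
    and a: "\<And>p q. p \<in> carr Qm \<Longrightarrow> q \<in> carr Qm \<Longrightarrow> P p \<Longrightarrow> P q \<Longrightarrow> P (madd Qm p q)"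
  shows "P q"
proof -
  let ?k = "\<lambda>v. mcoset (tensor M N) rels (mcoset F (bilinear_rels M N) v)"
  have k: "mlinear F Qm ?k" by (rule mlinear_comp[OF tens_image(2) coset_linear])
  have "carr Qm = ?k ` carr F"
    unfolding Qm_def R.quot_carr tens_image(1)[symmetric] image_image ..
  then obtain v where v: "v \<in> carr F" "q = ?k v" using assms(1) by blast
  have P0: "P (mzero Qm)"
    using c[OF M.zero_closed N.zero_closed] cls_scale(1)[OF M.zero_closed N.zero_closed, of 0] by simp
  have "P (?k v)"
    using v(1) unfolding free_mod_simps mem_Collect_eq
  proof (induction rule: free_induct)
    case zero
    show ?case using P0 mlinear_zero[OF F.kmodule_axioms Q.kmodule_axioms k] by simp
  next
    case (single p d)
    obtain x y where p: "p = (x, y)" "x \<in> carr M" "y \<in> carr N" using single by blast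
    have "?k (Poly_Mapping.single p d) = msmult Qm d (cls x y)"
      using mlinearD(3)[OF k, of "Poly_Mapping.single (x, y) 1" d] p by (simp add: cls_def tens_def)
    then show ?case using c[of "msmult M d x" y] p by (simp add: cls_scale)
  next
    case (add v w)
    then show ?case using mlinearD(2)[OF k, of v w] a[of "?k v" "?k w"] mlinearD(1)[OF k] by simp
  qed
  then show ?thesis using v by simp
qed

lemma lift:
  assumes W: "module sw" and add: "\<And>x x' y. x \<in> carr M \<Longrightarrow> x' \<in> carr M \<Longrightarrow> y \<in> carr N \<Longrightarrow> f (madd M x x') y = f x y + f x' y"
    "\<And>x y y'. x \<in> carr M \<Longrightarrow> y \<in> carr N \<Longrightarrow> y' \<in> carr N \<Longrightarrow> f x (madd N y y') = f x y + f x y'"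
    and scale: "\<And>c x y. x \<in> carr M \<Longrightarrow> y \<in> carr N \<Longrightarrow> f (msmult M c x) y = sw c (f x y)"
    "\<And>c x y. x \<in> carr M \<Longrightarrow> y \<in> carr N \<Longrightarrow> f x (msmult N c y) = sw c (f x y)"
    and rel: "\<And>h s. mlinear (tensor M N) (kmod_of sw UNIV) h \<Longrightarrow> (\<And>x y. x \<in> carr M \<Longrightarrow> y \<in> carr N \<Longrightarrow> h (tens M N x y) = f x y) \<Longrightarrow> s \<in> R \<Longrightarrow> h s = 0"
  obtains g where "mlinear Qm (kmod_of sw UNIV) g" "\<And>x y. x \<in> carr M \<Longrightarrow> y \<in> carr N \<Longrightarrow> g (cls x y) = f x y"
proof -
  interpret W: module sw by fact
  obtain h where h: "mlinear (tensor M N) (kmod_of sw UNIV) h" "\<forall>x\<in>carr M. \<forall>y\<in>carr N. h (tens M N x y) = f x y"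
    using tensor_lift[OF W add scale] by blast
  have "\<exists>g. mlinear Qm (kmod_of sw UNIV) g \<and> (\<forall>t\<in>carr (tensor M N). g (mcoset (tensor M N) rels t) = h t)"
    unfolding Qm_def
    by (rule quot_mspan_lift[OF T.kmodule_axioms R W.kmodule_kmod_of[OF W.subspace_UNIV] h(1)]) (use rel h in auto)
  then show ?thesis using that h(2) unfolding cls_def by (metis tens_closed)
qed

lemma embedding:
  obtains \<iota> :: "_ \<Rightarrow> ('m \<times> 'n, 'k) univ" where "mlinear Qm (kmod_of usm UNIV) \<iota>" "inj_on \<iota> (carr Qm)"
proof (rule univ_embedding[OF Q.kmodule_axioms mlinear_comp[OF tens_image(2) coset_linear]])
  show "(\<lambda>v. mcoset (tensor M N) rels (mcoset F (bilinear_rels M N) v)) ` carr F = carr Qm"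
    unfolding Qm_def R.quot_carr tens_image(1)[symmetric] image_image ..
qed (rule that)

end

context tensor_quotient
begin

lemma factor:
  assumes P: "kmodule P" and i: "mlinear P (kmod_of sw UNIV) \<iota>" "inj_on \<iota> (carr P)"
    and g: "mlinear Qm (kmod_of sw UNIV) g" "\<And>x y. x \<in> carr M \<Longrightarrow> y \<in> carr N \<Longrightarrow> g (cls x y) \<in> \<iota> ` carr P"
  obtains h where "mlinear Qm P h" "\<And>x. x \<in> carr Qm \<Longrightarrow> \<iota> (h x) = g x"
proof (rule mlinear_factor[OF P i g(1) Q.kmodule_axioms])
  interpret P: kmodule P by fact
  fix x assume "x \<in> carr Qm"
  then show "g x \<in> \<iota> ` carr P"
  proof (induction rule: Q_induct)
    case (cls x y) then show ?case by (rule g(2))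
  next
    case (add p q)
    then obtain u v where "u \<in> carr P" "v \<in> carr P" "g p = \<iota> u" "g q = \<iota> v" by blast
    then have "g (madd Qm p q) = \<iota> (madd P u v)" "madd P u v \<in> carr P"
      using mlinearD(2)[OF g(1) add(1,2)] mlinearD(2)[OF i(1), of u v] by simp_all
    then show ?case by blast
  qed
qed (rule that)

lemma pull:
  assumes "mlinear Qm W h" "kmodule W"
  obtains k where "mlinear (tensor M N) W k" "\<And>x y. k (tens M N x y) = h (cls x y)" "\<And>s. s \<in> R \<Longrightarrow> k s = mzero W"
proof (rule that)
  show "mlinear (tensor M N) W (\<lambda>v. h (mcoset (tensor M N) rels v))" by (rule mlinear_comp[OF coset_linear assms(1)])
  show "h (mcoset (tensor M N) rels (tens M N x y)) = h (cls x y)" for x y by (simp add: cls_def)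
  show "h (mcoset (tensor M N) rels s) = mzero W" if "s \<in> R" for s
    using rel_zero[OF that] mlinear_zero[OF Q.kmodule_axioms assms(2,1)] by simp
qed

end

section \<open>The universal cocycle\<close>

context osp_setting
begin

abbreviation "L \<equiv> osp scale G bar"

lemma osp_simps [simp]: "carr L = Lie" "madd L = (+)" "mzero L = 0" "msmult L = mat_scale scale"
  by (simp_all add: osp_eq)

lemma kmodule_osp: "kmodule L"
  unfolding osp_eq Lie_def by (rule mat.kmodule_kmod_of[OF mat.subspace_span])

sublocale LL: two_kmodules L L
  by (simp add: two_kmodules_def kmodule_osp)

definition H2_gens :: "(('r^3^3) \<times> ('r^3^3) \<Rightarrow>\<^sub>0 'k) set set" where
  "H2_gens =
    {madd (tensor L L) (tens L L x y) (msmult (tensor L L) (ksign (i * j)) (tens L L y x))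
          | i j x y. x \<in> mat_grading G i \<inter> carr L \<and> y \<in> mat_grading G j \<inter> carr L} \<union>
    {madd (tensor L L) (madd (tensor L L)
        (msmult (tensor L L) (ksign (i * k)) (tens L L (mat.br x y) z))
        (msmult (tensor L L) (ksign (j * i)) (tens L L (mat.br y z) x)))
        (msmult (tensor L L) (ksign (k * j)) (tens L L (mat.br z x) y))
          | i j k x y z. x \<in> mat_grading G i \<inter> carr L \<and> y \<in> mat_grading G j \<inter> carr L \<and> z \<in> mat_grading G k \<inter> carr L}"

lemma H2_gens_closed: "H2_gens \<subseteq> carr (tensor L L)"
  unfolding H2_gens_def by (auto intro!: LL.T.add_closed LL.T.smult_closed LL.tens_closed)

sublocale H: tensor_quotient L L H2_gens
  by unfold_locales (rule H2_gens_closed)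

lemma H2_rels_eq: "H2_rels L (mat_grading G) mat.br = mspan (tensor L L) H2_gens"
  unfolding H2_rels_def Let_def H2_gens_def ..

lemma H2_quot_eq: "H2_quot L (mat_grading G) mat.br = H.Qm"
  unfolding H2_quot_def H2_rels_eq H.Qm_def ..

text \<open>A linear map on the tensor product descends to the quotient exactly when it is a
  cocycle. One direction gives \<open>H2_lift\<close>, the other \<open>H2_cocycle\<close>.\<close>

lemma H2_gens_zero:
  fixes sw :: "'k \<Rightarrow> 'w::ab_group_add \<Rightarrow> 'w"
  assumes "module sw" and k: "mlinear (tensor L L) (kmod_of sw UNIV) k"
    and kt: "\<And>X Y. X \<in> Lie \<Longrightarrow> Y \<in> Lie \<Longrightarrow> k (tens L L X Y) = \<beta> X Y"
  shows "(\<forall>s\<in>H2_gens. k s = 0) \<longleftrightarrow>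
    (\<forall>i j X Y. X \<in> mat_grading G i \<inter> Lie \<longrightarrow> Y \<in> mat_grading G j \<inter> Lie \<longrightarrow> \<beta> X Y + sg (i * j) (\<beta> Y X) = 0) \<and>
    (\<forall>i j k X Y Z. X \<in> mat_grading G i \<inter> Lie \<longrightarrow> Y \<in> mat_grading G j \<inter> Lie \<longrightarrow> Z \<in> mat_grading G k \<inter> Lie \<longrightarrow>
      sg (i * k) (\<beta> (mat.br X Y) Z) + sg (j * i) (\<beta> (mat.br Y Z) X) + sg (k * j) (\<beta> (mat.br Z X) Y) = 0)"
    (is "_ \<longleftrightarrow> ?A \<and> ?B")
proof -
  interpret W: module sw by fact
  note kd = mlinearD[OF k]
  have 1: "k (madd (tensor L L) (tens L L X Y) (msmult (tensor L L) (ksign p) (tens L L Y X))) = \<beta> X Y + sg p (\<beta> Y X)"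
    if "X \<in> Lie" "Y \<in> Lie" for p X Y
    using that by (simp add: kd kt W.scale_ksign)
  have 2: "k (madd (tensor L L) (madd (tensor L L)
        (msmult (tensor L L) (ksign p) (tens L L (mat.br x y) z))
        (msmult (tensor L L) (ksign q) (tens L L (mat.br y z) x)))
        (msmult (tensor L L) (ksign r) (tens L L (mat.br z x) y)))
      = sg p (\<beta> (mat.br x y) z) + sg q (\<beta> (mat.br y z) x) + sg r (\<beta> (mat.br z x) y)"
    if "x \<in> Lie" "y \<in> Lie" "z \<in> Lie" for p q r x y z
    using that by (simp add: kd kt W.scale_ksign)
  show ?thesis
  proof
    assume *: "\<forall>s\<in>H2_gens. k s = 0"
    show "?A \<and> ?B"
    proof (intro conjI allI impI)
      fix i j X Y assume m: "X \<in> mat_grading G i \<inter> Lie" "Y \<in> mat_grading G j \<inter> Lie"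
      have "madd (tensor L L) (tens L L X Y) (msmult (tensor L L) (ksign (i * j)) (tens L L Y X)) \<in> H2_gens"
        unfolding H2_gens_def osp_simps(1) using m by blast
      from *[rule_format, OF this] show "\<beta> X Y + sg (i * j) (\<beta> Y X) = 0" using 1[of X Y] m by simp
    next
      fix i j n x y z assume m: "x \<in> mat_grading G i \<inter> Lie" "y \<in> mat_grading G j \<inter> Lie" "z \<in> mat_grading G n \<inter> Lie"
      have "madd (tensor L L) (madd (tensor L L)
        (msmult (tensor L L) (ksign (i * n)) (tens L L (mat.br x y) z))
        (msmult (tensor L L) (ksign (j * i)) (tens L L (mat.br y z) x)))
        (msmult (tensor L L) (ksign (n * j)) (tens L L (mat.br z x) y)) \<in> H2_gens"
        unfolding H2_gens_def osp_simps(1) using m by blast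
      from *[rule_format, OF this]
      show "sg (i * n) (\<beta> (mat.br x y) z) + sg (j * i) (\<beta> (mat.br y z) x) + sg (n * j) (\<beta> (mat.br z x) y) = 0"
        using 2[of x y z] m by simp
    qed
  next
    assume *: "?A \<and> ?B"
    show "\<forall>s\<in>H2_gens. k s = 0"
    proof
      fix s assume "s \<in> H2_gens"
      then show "k s = 0" unfolding H2_gens_def osp_simps(1)
      proof (elim UnE CollectE exE conjE)
        fix i j x y assume s: "s = madd (tensor L L) (tens L L x y) (msmult (tensor L L) (ksign (i * j)) (tens L L y x))"
          and m: "x \<in> mat_grading G i \<inter> Lie" "y \<in> mat_grading G j \<inter> Lie"
        show "k s = 0" unfolding s using 1[of x y] m conjunct1[OF *, rule_format, OF m] by simp
      next
        fix i j n x y z assume s: "s = madd (tensor L L) (madd (tensor L L)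
            (msmult (tensor L L) (ksign (i * n)) (tens L L (mat.br x y) z))
            (msmult (tensor L L) (ksign (j * i)) (tens L L (mat.br y z) x)))
            (msmult (tensor L L) (ksign (n * j)) (tens L L (mat.br z x) y))"
          and m: "x \<in> mat_grading G i \<inter> Lie" "y \<in> mat_grading G j \<inter> Lie" "z \<in> mat_grading G n \<inter> Lie"
        show "k s = 0" unfolding s using 2[of x y z] m conjunct2[OF *, rule_format, OF m] by simp
      qed
    qed
  qed
qed

lemma H2_lift:
  fixes sw :: "'k \<Rightarrow> 'w::ab_group_add \<Rightarrow> 'w"
  assumes "cocycle scale G bar sw \<beta>"
  obtains g where "mlinear H.Qm (kmod_of sw UNIV) g" "\<And>X Y. X \<in> Lie \<Longrightarrow> Y \<in> Lie \<Longrightarrow> g (H.cls X Y) = \<beta> X Y"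
proof -
  interpret b: cocycle scale G bar sw \<beta> by fact
  show ?thesis
  proof (rule H.lift[OF b.W.module_axioms, of \<beta>])
    fix h s assume h: "mlinear (tensor L L) (kmod_of sw UNIV) h" "\<And>x y. x \<in> carr L \<Longrightarrow> y \<in> carr L \<Longrightarrow> h (tens L L x y) = \<beta> x y" and s: "s \<in> H2_gens"
    have "\<forall>s\<in>H2_gens. h s = 0"
      by (subst H2_gens_zero[OF b.W.module_axioms h(1), of \<beta>]) (use h(2) b.anti b.jac in auto)
    then show "h s = 0" using s by blast
  qed (use that in \<open>simp_all add: b.add_left b.add_right b.scale_left b.scale_right\<close>)
qed

lemma H2_cocycle:
  fixes sw :: "'k \<Rightarrow> 'w::ab_group_add \<Rightarrow> 'w"
  assumes W: "module sw" and h: "mlinear H.Qm (kmod_of sw UNIV) h"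
  shows "cocycle scale G bar sw (\<lambda>X Y. h (H.cls X Y))"
proof -
  interpret W: module sw by fact
  obtain k where k: "mlinear (tensor L L) (kmod_of sw UNIV) k" "\<And>x y. k (tens L L x y) = h (H.cls x y)" "\<And>s. s \<in> H2_gens \<Longrightarrow> k s = 0"
    by (rule H.pull[OF h W.kmodule_kmod_of[OF W.subspace_UNIV]]) auto
  have "(\<forall>s\<in>H2_gens. k s = 0)" using k(3) by blast
  then have z: "(\<forall>i j X Y. X \<in> mat_grading G i \<inter> Lie \<longrightarrow> Y \<in> mat_grading G j \<inter> Lie \<longrightarrow> h (H.cls X Y) + sg (i * j) (h (H.cls Y X)) = 0) \<and>
    (\<forall>i j k X Y Z. X \<in> mat_grading G i \<inter> Lie \<longrightarrow> Y \<in> mat_grading G j \<inter> Lie \<longrightarrow> Z \<in> mat_grading G k \<inter> Lie \<longrightarrow>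
      sg (i * k) (h (H.cls (mat.br X Y) Z)) + sg (j * i) (h (H.cls (mat.br Y Z) X)) + sg (k * j) (h (H.cls (mat.br Z X) Y)) = 0)"
    by (subst (asm) H2_gens_zero[OF W k(1), of "\<lambda>X Y. h (H.cls X Y)"]) (simp_all add: k(2))
  note hd = mlinearD[OF h]
  show ?thesis
  proof (unfold_locales, goal_cases)
    case (1 X Y Z)
    then show ?case using H.cls_add_left[of X Y Z] H.cls_closed[of X Z] H.cls_closed[of Y Z] by (simp add: hd)
  next
    case (2 X Y Z)
    then show ?case using H.cls_add_right[of Z X Y] H.cls_closed[of Z X] H.cls_closed[of Z Y] by (simp add: hd)
  next
    case (3 X Y r)
    then show ?case using H.cls_scale(1)[of X Y r] H.cls_closed[of X Y] by (simp add: hd)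
  next
    case (4 X Y r)
    then show ?case using H.cls_scale(2)[of X Y r] H.cls_closed[of X Y] by (simp add: hd)
  next
    case (5 X i Y j) then show ?case using z by blast
  next
    case (6 X i Y j Z k) then show ?case using z by blast
  qed
qed

lemma H2_map:
  shows "mlinear H.Qm L (H2_map L (mat_grading G) mat.br)"
    and "\<And>X Y. X \<in> Lie \<Longrightarrow> Y \<in> Lie \<Longrightarrow> H2_map L (mat_grading G) mat.br (H.cls X Y) = mat.br X Y"
proof -
  \<comment> \<open>The bracket is the coboundary of the identity and thus a cocycle with values in
    matrices. It provides the map that the \<open>SOME\<close> in \<open>H2_map\<close> asks
    for.\<close>
  have "cocycle scale G bar (mat_scale scale) (\<lambda>X Y. id (mat.br X Y))"
    by (rule coboundary) (simp_all add: mat.module_axioms)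
  then obtain g where g: "mlinear H.Qm (kmod_of (mat_scale scale) UNIV) g" "\<And>X Y. X \<in> Lie \<Longrightarrow> Y \<in> Lie \<Longrightarrow> g (H.cls X Y) = mat.br X Y"
    by (rule H2_lift) auto
  have i: "mlinear L (kmod_of (mat_scale scale) UNIV) id" "inj_on id (carr L)"
    by (simp_all add: mlinear_def)
  obtain h where h: "mlinear H.Qm L h" "\<And>x. x \<in> carr H.Qm \<Longrightarrow> id (h x) = g x"
    by (rule H.factor[OF kmodule_osp i g(1)]) (use g(2) in auto)
  have "\<forall>x\<in>carr L. \<forall>y\<in>carr L. h (H.cls x y) = mat.br x y"
  proof (intro ballI)
    fix x y assume m: "x \<in> carr L" "y \<in> carr L"
    have "id (h (H.cls x y)) = g (H.cls x y)" by (rule h(2)[OF H.cls_closed[OF m]])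
    then show "h (H.cls x y) = mat.br x y" using g(2)[of x y] m by simp
  qed
  then have "mlinear H.Qm L h \<and> (\<forall>x\<in>carr L. \<forall>y\<in>carr L. h (H.cls x y) = mat.br x y)"
    by (rule conjI[OF h(1)])
  from someI[where P="\<lambda>h. mlinear H.Qm L h \<and> (\<forall>x\<in>carr L. \<forall>y\<in>carr L. h (H.cls x y) = mat.br x y)", OF this]
  have *: "mlinear H.Qm L (H2_map L (mat_grading G) mat.br) \<and>
     (\<forall>x\<in>carr L. \<forall>y\<in>carr L. H2_map L (mat_grading G) mat.br (H.cls x y) = mat.br x y)"
    unfolding H2_map_def H2_quot_eq H2_rels_eq H.cls_def .
  show "mlinear H.Qm L (H2_map L (mat_grading G) mat.br)" by (rule conjunct1[OF *])
  show "\<And>X Y. X \<in> Lie \<Longrightarrow> Y \<in> Lie \<Longrightarrow> H2_map L (mat_grading G) mat.br (H.cls X Y) = mat.br X Y"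
    using conjunct2[OF *] unfolding osp_simps(1) by - (drule (1) bspec, drule (1) bspec, assumption)
qed

end

lemma ball_setcompr:
  "(\<forall>s\<in>{f a b | a b. P a b}. Q s) \<longleftrightarrow> (\<forall>a b. P a b \<longrightarrow> Q (f a b))"
  "(\<forall>s\<in>{f2 a b c d | a b c d. P2 a b c d}. Q s) \<longleftrightarrow> (\<forall>a b c d. P2 a b c d \<longrightarrow> Q (f2 a b c d))"
  "(\<forall>s\<in>{f3 a b c d e g | a b c d e g. P3 a b c d e g}. Q s) \<longleftrightarrow> (\<forall>a b c d e g. P3 a b c d e g \<longrightarrow> Q (f3 a b c d e g))"
  "(\<forall>s\<in>{f4 a b c d e g h i | a b c d e g h i. P4 a b c d e g h i}. Q s) \<longleftrightarrow> (\<forall>a b c d e g h i. P4 a b c d e g h i \<longrightarrow> Q (f4 a b c d e g h i))"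
  "(\<forall>s\<in>{f5 a b c d e g h i j k l m | a b c d e g h i j k l m. P5 a b c d e g h i j k l m}. Q s)
    \<longleftrightarrow> (\<forall>a b c d e g h i j k l m. P5 a b c d e g h i j k l m \<longrightarrow> Q (f5 a b c d e g h i j k l m))"
  by blast+

section \<open>The module of symbols\<close>

context osp_setting
begin

abbreviation "Rk \<equiv> R_kmod scale"

lemma R_kmod_simps [simp]: "carr Rk = UNIV" "madd Rk = (+)" "mzero Rk = 0" "msmult Rk = scale"
  by (simp_all add: R_kmod_def)

lemma kmodule_R: "kmodule Rk"
  unfolding R_kmod_def by (rule kmodule_kmod_of[OF subspace_UNIV])

sublocale Rk: two_kmodules Rk Rk
  by (simp add: two_kmodules_def kmodule_R)

definition hd_rules :: "('r \<Rightarrow> 'r \<Rightarrow> 'w::ab_group_add) \<Rightarrow> bool" where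
  "hd_rules T \<longleftrightarrow>
    (\<forall>i a. a \<in> G i \<longrightarrow> T a 1 = 0) \<and>
    (\<forall>i j a b. a \<in> G i \<and> b \<in> G j \<longrightarrow> T a b + sg (i * j) (T b a) = 0) \<and>
    (\<forall>i j a b. a \<in> G i \<and> b \<in> G j \<longrightarrow> T a b - T (bar a) (bar b) = 0) \<and>
    (\<forall>i j k a b c. a \<in> G i \<and> b \<in> G j \<and> c \<in> G k \<longrightarrow>
      Jt T j i k b a c - sg (i * j + j * k + k * i) (Jt T i j k a b (sk c)) = 0) \<and>
    (\<forall>i j k l a b c d. a \<in> G i \<and> b \<in> G j \<and> c \<in> G k \<and> d \<in> G l \<longrightarrow>
      Jt T i j (k + l) a b (br c d) + sg (i * k + j * l) (Jt T k l (i + j) c d (br a b)) = 0) \<and>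
    (\<forall>i1 i2 j1 j2 k1 k2 a1 a2 b1 b2 c1 c2.
      a1 \<in> G i1 \<and> a2 \<in> G i2 \<and> b1 \<in> G j1 \<and> b2 \<in> G j2 \<and> c1 \<in> G k1 \<and> c2 \<in> G k2 \<longrightarrow>
      Jt T (i1 + i2) (j1 + j2) (k1 + k2) (br a1 a2) (br b1 b2) (br c1 c2) = 0)"

definition HD_gens :: "('r \<times> 'r \<Rightarrow>\<^sub>0 'k) set set" where
  "HD_gens =
    {rtens scale a 1 | i a. a \<in> G i} \<union>
     {madd (RR scale) (rtens scale a b) (msmult (RR scale) (ksign (i * j)) (rtens scale b a)) | i j a b. a \<in> G i \<and> b \<in> G j} \<union>
     {madd (RR scale) (rtens scale a b) (msmult (RR scale) (- 1) (rtens scale (bar a) (bar b))) | i j a b. a \<in> G i \<and> b \<in> G j} \<union>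
     {madd (RR scale) (J scale j i k b a c) (msmult (RR scale) (- ksign (i * j + j * k + k * i)) (J scale i j k a b (c - bar c)))
        | i j k a b c. a \<in> G i \<and> b \<in> G j \<and> c \<in> G k} \<union>
     {madd (RR scale) (J scale i j (k + l) a b (rcom scale G c d))
        (msmult (RR scale) (ksign (i * k + j * l)) (J scale k l (i + j) c d (rcom scale G a b)))
        | i j k l a b c d. a \<in> G i \<and> b \<in> G j \<and> c \<in> G k \<and> d \<in> G l} \<union>
     {J scale (i1 + i2) (j1 + j2) (k1 + k2) (rcom scale G a1 a2) (rcom scale G b1 b2) (rcom scale G c1 c2)
        | i1 i2 j1 j2 k1 k2 a1 a2 b1 b2 c1 c2.
          a1 \<in> G i1 \<and> a2 \<in> G i2 \<and> b1 \<in> G j1 \<and> b2 \<in> G j2 \<and> c1 \<in> G k1 \<and> c2 \<in> G k2}"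

lemma rtens_closed: "rtens scale a b \<in> carr (tensor Rk Rk)"
  by (simp add: rtens_def)

lemma J_closed: "J scale i j k a b c \<in> carr (tensor Rk Rk)"
  by (simp add: J_def RR_def rtens_closed)

lemma HD_gens_closed: "HD_gens \<subseteq> carr (tensor Rk Rk)"
  unfolding HD_gens_def RR_def
  by (intro Un_least subsetI; elim CollectE exE conjE; hypsubst; intro Rk.T.add_closed Rk.T.smult_closed rtens_closed J_closed)

sublocale D: tensor_quotient Rk Rk HD_gens
  by unfold_locales (rule HD_gens_closed)

lemma HD_rels_eq: "HD_rels scale G bar = mspan (tensor Rk Rk) HD_gens"
  unfolding HD_rels_def HD_gens_def RR_def ..

lemma HD_quot_eq: "HD_quot scale G bar = D.Qm"
  unfolding HD_quot_def HD_rels_eq D.Qm_def RR_def ..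

lemma HD_class_eq: "HD_class scale G bar = D.cls"
  by (intro ext) (simp add: HD_class_def HD_rels_eq D.cls_def RR_def rtens_def)

lemma HD_gens_zero:
  fixes sw :: "'k \<Rightarrow> 'w::ab_group_add \<Rightarrow> 'w"
  assumes "module sw" and k: "mlinear (tensor Rk Rk) (kmod_of sw UNIV) k" and kt: "\<And>a b. k (tens Rk Rk a b) = T a b"
  shows "(\<forall>s\<in>HD_gens. k s = 0) \<longleftrightarrow> hd_rules T"
proof -
  interpret W: module sw by fact
  note kd = mlinearD[OF k]
  have r: "k (rtens scale a b) = T a b" for a b by (simp add: rtens_def kt)
  have add: "k (madd (RR scale) x y) = k x + k y" if "x \<in> carr (tensor Rk Rk)" "y \<in> carr (tensor Rk Rk)" for x y
    using that by (simp add: RR_def kd)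
  have scl: "k (msmult (RR scale) c x) = sw c (k x)" if "x \<in> carr (tensor Rk Rk)" for c x
    using that by (simp add: RR_def kd)
  have cl: "msmult (RR scale) c x \<in> carr (tensor Rk Rk)" "madd (RR scale) x y \<in> carr (tensor Rk Rk)"
    if "x \<in> carr (tensor Rk Rk)" "y \<in> carr (tensor Rk Rk)" for c x y
    using that by (simp_all add: RR_def)
  have kJ: "k (J scale i j l a b c) = Jt T i j l a b c" for i j l a b c
    unfolding J_def Jt_def
    by (simp add: add scl cl(1)[OF _ rtens_closed[of 0 0]] cl(2) rtens_closed r W.scale_ksign)
  have m: "sw (- ksign p) x = - sg p x" for p x by (simp add: W.scale_minus_left W.scale_ksign)
  note cl' = cl(1)[OF _ rtens_closed[of 0 0]]
  have e2: "k (madd (RR scale) (rtens scale a b) (msmult (RR scale) (ksign p) (rtens scale b a))) = T a b + sg p (T b a)" for a b p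
    by (simp add: add scl cl' rtens_closed r W.scale_ksign)
  have e3: "k (madd (RR scale) (rtens scale a b) (msmult (RR scale) (- 1) (rtens scale (bar a) (bar b)))) = T a b - T (bar a) (bar b)" for a b
    by (simp add: add scl cl' rtens_closed r W.scale_minus_left)
  have e4: "k (madd (RR scale) (J scale j i n b a c) (msmult (RR scale) (- ksign p) (J scale i j n a b (c - bar c))))
     = Jt T j i n b a c - sg p (Jt T i j n a b (sk c))" for i j n p a b c
    by (simp add: add scl cl' J_closed kJ m sk_def W.scale_ksign)
  have e5: "k (madd (RR scale) (J scale i j n a b u) (msmult (RR scale) (ksign p) (J scale i' j' n' a' b' v)))
     = Jt T i j n a b u + sg p (Jt T i' j' n' a' b' v)" for i j n p a b u i' j' n' a' b' v
    by (simp add: add scl cl' J_closed kJ W.scale_ksign)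
  show ?thesis
    unfolding HD_gens_def ball_Un ball_setcompr r e2 e3 e4 e5 kJ rcom_eq hd_rules_def conj_assoc ..
qed

lemma hd_linearI:
  fixes sw :: "'k \<Rightarrow> 'w::ab_group_add \<Rightarrow> 'w"
  assumes "module sw" and add: "\<And>a b c. T (a + b) c = T a c + T b c" "\<And>a b c. T a (b + c) = T a b + T a c"
    and scale: "\<And>c a b. T (scale c a) b = sw c (T a b)" "\<And>c a b. T a (scale c b) = sw c (T a b)"
    and r: "hd_rules T"
  shows "hd_linear scale G bar T sw"
proof -
  interpret W: module sw by fact
  note r' = r[unfolded hd_rules_def]
  note r1 = r'[THEN conjunct1, rule_format]
    and r2 = r'[THEN conjunct2, THEN conjunct1, rule_format]
    and r3 = r'[THEN conjunct2, THEN conjunct2, THEN conjunct1, rule_format]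
    and r4 = r'[THEN conjunct2, THEN conjunct2, THEN conjunct2, THEN conjunct1, rule_format]
    and r5 = r'[THEN conjunct2, THEN conjunct2, THEN conjunct2, THEN conjunct2, THEN conjunct1, rule_format]
  have one: "T a 1 = 0" for a
    by (induction a rule: homogeneous_induct) (simp_all add: r1 add)
  have T_bar: "T (bar a) (bar b) = T a b" for a b
  proof (induction a rule: homogeneous_induct)
    case (1 i a)
    show ?case
    proof (induction b rule: homogeneous_induct)
      case (1 j b)
      have "T a b - T (bar a) (bar b) = 0" by (rule r3) (use 1 \<open>a \<in> G i\<close> in blast)
      then show ?case by simp
    qed (simp add: add bar_add)
  qed (simp add: add bar_add)
  show ?thesis
  proof (unfold_locales, goal_cases)
    case (4 a i b j)
    have "T a b + sg (i * j) (T b a) = 0" by (rule r2) (use 4 in blast)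
    then show ?case by (simp add: eq_neg_iff_add_eq_0)
  next
    case (6 a i b j c k)
    have "Jt T j i k b a c - sg (i * j + j * k + k * i) (Jt T i j k a b (sk c)) = 0" by (rule r4) (use 6 in blast)
    then show ?case by simp
  next
    case (7 a i b j c k d l)
    show ?case by (rule r5) (use 7 in blast)
  qed (simp_all add: add scale one T_bar)
qed

lemma D_lift:
  fixes sw :: "'k \<Rightarrow> 'w::ab_group_add \<Rightarrow> 'w"
  assumes "module sw" and add: "\<And>a b c. T (a + b) c = T a c + T b c" "\<And>a b c. T a (b + c) = T a b + T a c"
    and scale: "\<And>c a b. T (scale c a) b = sw c (T a b)" "\<And>c a b. T a (scale c b) = sw c (T a b)"
    and r: "hd_rules T"
  obtains g where "mlinear D.Qm (kmod_of sw UNIV) g" "\<And>a b. g (D.cls a b) = T a b"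
proof (rule D.lift[OF assms(1), of T])
  fix h s assume h: "mlinear (tensor Rk Rk) (kmod_of sw UNIV) h" "\<And>x y. x \<in> carr Rk \<Longrightarrow> y \<in> carr Rk \<Longrightarrow> h (tens Rk Rk x y) = T x y"
    and s: "s \<in> HD_gens"
  have h2: "h (tens Rk Rk x y) = T x y" for x y by (rule h(2)) simp_all
  show "h s = 0" using HD_gens_zero[OF assms(1) h(1) h2] r s by blast
qed (use that in \<open>simp_all add: add scale\<close>)

lemma D_hd_linear:
  fixes sw :: "'k \<Rightarrow> 'w::ab_group_add \<Rightarrow> 'w"
  assumes W: "module sw" and h: "mlinear D.Qm (kmod_of sw UNIV) h"
  shows "hd_linear scale G bar (\<lambda>a b. h (D.cls a b)) sw"
proof -
  interpret W: module sw by fact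
  obtain k where k: "mlinear (tensor Rk Rk) (kmod_of sw UNIV) k" "\<And>x y. k (tens Rk Rk x y) = h (D.cls x y)" "\<And>s. s \<in> HD_gens \<Longrightarrow> k s = 0"
    by (rule D.pull[OF h W.kmodule_kmod_of[OF W.subspace_UNIV]]) auto
  have r: "hd_rules (\<lambda>a b. h (D.cls a b))"
    using HD_gens_zero[OF W k(1), of "\<lambda>a b. h (D.cls a b)", OF k(2)] k(3) by blast
  note hd = mlinearD[OF h]
  show ?thesis
  proof (rule hd_linearI[OF W _ _ _ _ r])
    show "h (D.cls (a + b) c) = h (D.cls a c) + h (D.cls b c)" for a b c
      using D.cls_add_left[of a b c] D.cls_closed[of a c] D.cls_closed[of b c] by (simp add: hd)
    show "h (D.cls a (b + c)) = h (D.cls a b) + h (D.cls a c)" for a b c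
      using D.cls_add_right[of a b c] D.cls_closed[of a b] D.cls_closed[of a c] by (simp add: hd)
    show "h (D.cls (scale c a) b) = sw c (h (D.cls a b))" for a b c
      using D.cls_scale(1)[of a b c] D.cls_closed[of a b] by (simp add: hd)
    show "h (D.cls a (scale c b)) = sw c (h (D.cls a b))" for a b c
      using D.cls_scale(2)[of a b c] D.cls_closed[of a b] by (simp add: hd)
  qed
qed

section \<open>The quotient by \<open>I3\<close>\<close>

definition I3_gens :: "'r set" where
  "I3_gens =
    {scale 3 a | i a. a \<in> G i} \<union>
     {a - bar a | i a. a \<in> G i} \<union>
     {(rcom scale G a b - bar (rcom scale G a b)) * c | i j k a b c. a \<in> G i \<and> b \<in> G j \<and> c \<in> G k} \<union>
     {(a + bar a) * (b + bar b) * c - scale (ksign (i * j)) ((b + bar b) * (a + bar a) * c)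
        | i j k a b c. a \<in> G i \<and> b \<in> G j \<and> c \<in> G k} \<union>
     {scale (ksign (i * k)) (a * bar b * c + bar a * b * bar c)
        + scale (ksign (j * i)) (b * bar c * a + bar b * c * bar a)
        + scale (ksign (k * j)) (c * bar a * b + bar c * a * bar b)
        | i j k a b c. a \<in> G i \<and> b \<in> G j \<and> c \<in> G k}"

abbreviation "Iq \<equiv> R_quot_I3 scale G bar"

lemma I3_eq: "I3 scale G bar = mspan Rk I3_gens"
  by (simp add: I3_def I3_gens_def mspan_def submod_def span_def hull_def subspace_def)

sublocale I: ksubmod Rk "I3 scale G bar"
  by unfold_locales (simp add: I3_eq Rk.M.submod_mspan)

lemma kmodule_Iq: "kmodule Iq"
  unfolding R_quot_I3_def by (rule I.quot_kmodule)

definition Icls :: "'r \<Rightarrow> 'r set" where "Icls = mcoset Rk (I3 scale G bar)"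

lemma Icls_linear: "mlinear Rk Iq Icls"
  unfolding R_quot_I3_def Icls_def by (rule I.quot_linear)

lemma carr_Iq: "carr Iq = range Icls"
  unfolding R_quot_I3_def Icls_def using I.quot_carr by simp

lemma I3_gens_zero:
  fixes sw :: "'k \<Rightarrow> 'w::ab_group_add \<Rightarrow> 'w"
  assumes "module sw" and r: "\<And>a b. r (a + b) = r a + r b" "\<And>c a. r (scale c a) = sw c (r a)"
  shows "(\<forall>s\<in>I3_gens. r s = 0) \<longleftrightarrow> I3_linear scale G bar r sw"
proof -
  interpret W: module sw by fact
  interpret r: additive r by unfold_locales (rule r)
  have rs: "r (scale (ksign p) a) = sg p (r a)" for p a by (simp add: r W.scale_ksign)
  have r3: "r (scale 3 a) = r a + r a + r a" for a
  proof -
    have "(3::'k) = 1 + 1 + 1" by simp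
    then show ?thesis by (simp only: r(2) W.scale_left_distrib W.scale_one)
  qed
  have rsg: "r (sg p a) = sg p (r a)" for p a using rs[of p a] by (simp add: scale_ksign)
  have "(\<forall>s\<in>I3_gens. r s = 0) \<longleftrightarrow>
    (\<forall>i a. a \<in> G i \<longrightarrow> r a + r a + r a = 0) \<and> (\<forall>i a. a \<in> G i \<longrightarrow> r (sk a) = 0) \<and>
    (\<forall>i j k a b c. a \<in> G i \<and> b \<in> G j \<and> c \<in> G k \<longrightarrow> r (sk (br a b) * c) = 0) \<and>
    (\<forall>i j k a b c. a \<in> G i \<and> b \<in> G j \<and> c \<in> G k \<longrightarrow>
      r ((a + bar a) * (b + bar b) * c) - sg (i * j) (r ((b + bar b) * (a + bar a) * c)) = 0) \<and>
    (\<forall>i j k a b c. a \<in> G i \<and> b \<in> G j \<and> c \<in> G k \<longrightarrow>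
      sg (i * k) (r (a * bar b * c + bar a * b * bar c))
      + sg (j * i) (r (b * bar c * a + bar b * c * bar a))
      + sg (k * j) (r (c * bar a * b + bar c * a * bar b)) = 0)" (is "_ \<longleftrightarrow> ?A \<and> ?B \<and> ?C \<and> ?E \<and> ?F")
    unfolding I3_gens_def ball_Un ball_setcompr r3 r.diff rs rcom_eq conj_assoc sk_def[symmetric] r(1)[of "scale (ksign _) _ + _"]
      r(1)[of "scale (ksign _) _"] ..
  also have "\<dots> \<longleftrightarrow> I3_linear scale G bar r sw"
  proof
    assume *: "?A \<and> ?B \<and> ?C \<and> ?E \<and> ?F"
    note r1 = *[THEN conjunct1, rule_format]
      and r2 = *[THEN conjunct2, THEN conjunct1, rule_format]
      and r3 = *[THEN conjunct2, THEN conjunct2, THEN conjunct1, rule_format]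
      and r4 = *[THEN conjunct2, THEN conjunct2, THEN conjunct2, THEN conjunct1, rule_format]
      and r5 = *[THEN conjunct2, THEN conjunct2, THEN conjunct2, THEN conjunct2, rule_format]
    show "I3_linear scale G bar r sw"
    proof (unfold_locales, goal_cases)
      case (1 a i) then show ?case by (rule r1)
    next
      case (2 a i)
      then have "r (sk a) = 0" by (rule r2)
      then show ?case by (simp add: sk_def r.diff)
    next
      case (3 a i b j c k) show ?case by (rule r3) (use 3 in blast)
    next
      case (4 p i q j c k)
      \<comment> \<open>Symmetric elements are of the form \<open>a + bar a\<close>, with
        \<open>a\<close> their half.\<close>
      let ?h = "scale hlf"
      have pm: "?h p + bar (?h p) = p" "?h q + bar (?h q) = q"
        using scale_hlf[of p] scale_hlf[of q] 4 by (simp_all add: bar_scale)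
      have hG: "?h p \<in> G i" "?h q \<in> G j" using 4 by simp_all
      have "r ((?h p + bar (?h p)) * (?h q + bar (?h q)) * c) - sg (i * j) (r ((?h q + bar (?h q)) * (?h p + bar (?h p)) * c)) = 0"
        by (rule r4) (use hG 4(3) in blast)
      then show ?case unfolding pm by simp
    next
      case (5 a i b j c k) show ?case by (rule r5) (use 5 in blast)
    next
      case (6 c a) show ?case by (rule r)
    qed
  next
    assume "I3_linear scale G bar r sw"
    then interpret rr: I3_linear scale G bar r sw .
    have e: "r ((a + bar a) * (b + bar b) * c) - sg (i * j) (r ((b + bar b) * (a + bar a) * c)) = 0"
      if "a \<in> G i" "b \<in> G j" "c \<in> G k" for a b c i j k
      using rr.r_sym[of "a + bar a" i "b + bar b" j c k] that by (simp add: bar_add add.commute)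
    have b: "r (sk a) = 0" if "a \<in> G i" for a i
      using rr.r_bar[OF that] by (simp add: sk_def r.diff)
    show "?A \<and> ?B \<and> ?C \<and> ?E \<and> ?F"
      by (intro conjI allI impI; (elim conjE)?)
        (erule rr.r_three, erule b, (erule (2) rr.r_sk), (erule (2) e), (erule (2) rr.r_cyc))
  qed
  finally show ?thesis .
qed

lemma I_lift:
  fixes sw :: "'k \<Rightarrow> 'w::ab_group_add \<Rightarrow> 'w"
  assumes "I3_linear scale G bar r sw"
  obtains g where "mlinear Iq (kmod_of sw UNIV) g" "\<And>a. g (Icls a) = r a"
proof -
  interpret r: I3_linear scale G bar r sw by fact
  have l: "mlinear Rk (kmod_of sw UNIV) r" by (simp add: mlinear_def r.r.add r.r_scale)
  have z: "\<forall>s\<in>I3_gens. r s = 0"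
    using I3_gens_zero[OF r.W.module_axioms r.r.add r.r_scale] assms by blast
  have "\<exists>h. mlinear (quot Rk (mspan Rk I3_gens)) (kmod_of sw UNIV) h \<and> (\<forall>x\<in>carr Rk. h (mcoset Rk (mspan Rk I3_gens) x) = r x)"
    by (rule quot_mspan_lift[OF kmodule_R _ r.W.kmodule_kmod_of[OF r.W.subspace_UNIV] l]) (use z in auto)
  then obtain h where h: "mlinear (quot Rk (mspan Rk I3_gens)) (kmod_of sw UNIV) h" "\<forall>x\<in>carr Rk. h (mcoset Rk (mspan Rk I3_gens) x) = r x"
    by (elim exE conjE)
  show ?thesis
  proof (rule that)
    show "mlinear Iq (kmod_of sw UNIV) h" unfolding R_quot_I3_def I3_eq by (rule h(1))
    show "h (Icls a) = r a" for a
      unfolding Icls_def I3_eq by (rule h(2)[rule_format]) simp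
  qed
qed

lemma I_linear:
  fixes sw :: "'k \<Rightarrow> 'w::ab_group_add \<Rightarrow> 'w"
  assumes W: "module sw" and h: "mlinear Iq (kmod_of sw UNIV) h"
  shows "I3_linear scale G bar (\<lambda>a. h (Icls a)) sw"
proof -
  interpret W: module sw by fact
  note l = mlinearD[OF mlinear_comp[OF Icls_linear h]]
  have a: "h (Icls (a + b)) = h (Icls a) + h (Icls b)" "h (Icls (scale c a)) = sw c (h (Icls a))" for a b c
    using l by simp_all
  have z: "h (Icls s) = 0" if "s \<in> I3_gens" for s
  proof -
    have "s \<in> I3 scale G bar" unfolding I3_eq using that Rk.M.mspan_base by blast
    then have "Icls s = Icls 0" unfolding Icls_def using I.coset_eq_iff[of s 0] by simp
    then show ?thesis using a(1)[of 0 0] by simp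
  qed
  show ?thesis
    using I3_gens_zero[OF W, of "\<lambda>a. h (Icls a)", OF a] z by blast
qed

lemma I_embedding:
  obtains \<iota> :: "_ \<Rightarrow> ('r, 'k) univ" where "mlinear Iq (kmod_of usm UNIV) \<iota>" "inj_on \<iota> (carr Iq)"
proof (rule univ_embedding[of Iq UNIV "\<lambda>v. Icls (pext scale id v)"])
  show "kmodule Iq" by (rule kmodule_Iq)
  show "mlinear (free_mod UNIV) Iq (\<lambda>v. Icls (pext scale id v))"
    by (rule mlinear_comp[OF pext_linear[folded R_kmod_def] Icls_linear])
  have "a = pext scale id (Poly_Mapping.single a 1)" for a by simp
  then show "(\<lambda>v. Icls (pext scale id v)) ` carr (free_mod UNIV) = carr Iq"
    unfolding carr_Iq by (auto simp del: pext_single) (metis rangeI)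
qed (rule that)

end

lemma image_subspace:
  assumes "module sw" "kmodule P" "mlinear P (kmod_of sw UNIV) \<iota>"
  shows "module.subspace sw (\<iota> ` carr P)"
proof -
  interpret W: module sw by fact
  interpret P: kmodule P by fact
  note i = mlinearD[OF assms(3)]
  have z: "\<iota> (mzero P) = 0" using mlinear_zero[OF assms(2) W.kmodule_kmod_of[OF W.subspace_UNIV] assms(3)] by simp
  show ?thesis
  proof (rule W.subspaceI)
    show "0 \<in> \<iota> ` carr P" using z P.zero_closed by (rule image_eqI[OF sym])
    fix x y c assume "x \<in> \<iota> ` carr P"
    then obtain u where u: "u \<in> carr P" "x = \<iota> u" by blast
    have "sw c x = \<iota> (msmult P c u)" using i(3)[OF u(1), of c] u(2) by simp
    then show "sw c x \<in> \<iota> ` carr P" using P.smult_closed[OF u(1), of c] by (rule image_eqI)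
    assume "y \<in> \<iota> ` carr P"
    then obtain v where v: "v \<in> carr P" "y = \<iota> v" by blast
    have "x + y = \<iota> (madd P u v)" using i(2)[OF u(1) v(1)] u(2) v(2) by simp
    then show "x + y \<in> \<iota> ` carr P" using P.add_closed[OF u(1) v(1)] by (rule image_eqI)
  qed
qed

lemma (in module) subspace_sg: "subspace A \<Longrightarrow> x \<in> A \<Longrightarrow> sg p x \<in> A"
  using subspace_scale[of A x "ksign p"] by (simp add: scale_ksign)

text \<open>\<open>Phi\<close> is computed in \<open>univ\<close>; its values must be seen to lie in
  the image of the embedded symbols before the induced map can be brought back to their
  carrier.\<close>

lemma (in hd_linear) Phi_mem:
  assumes A: "W.subspace A" and T: "\<And>a b. T a b \<in> A"
  shows "Phi X Y \<in> A"
proof -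
  have bV: "bV X Y \<in> A" for X Y
    unfolding bV_def by (rule W.subspace_diff[OF A T T])
  have Q: "Q X i j v w \<in> A" for X i j v w
    unfolding Q_def by (intro W.subspace_diff[OF A] W.subspace_sg[OF A] bV)
  have "sumQ X ps \<in> A" for ps
    by (induction ps) (use W.subspace_0[OF A] W.subspace_add[OF A] Q in auto)
  then show ?thesis unfolding Phi_def using W.subspace_add[OF A bV] by blast
qed

section \<open>Maps between the second homology and the direct sum\<close>

context osp_setting
begin

abbreviation "H2m \<equiv> H2_map L (mat_grading G) mat.br"

text \<open>A linear functional takes on these classes the values \<open>Tc\<close>, \<open>rplus\<close> and \<open>rminus\<close> of the
  cocycle that it induces.\<close>

definition tau :: "'r \<Rightarrow> 'r \<Rightarrow> (('r^3^3) \<times> ('r^3^3) \<Rightarrow>\<^sub>0 'k) set set" where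
  "tau b c = madd H.Qm (H.cls (xm b) (ym c)) (msmult H.Qm (- 1) (H.cls (xm (par (mat.br (xm b) (ym c) $ 2 $ 2))) (ym 1)))"
definition pip :: "'r \<Rightarrow> (('r^3^3) \<times> ('r^3^3) \<Rightarrow>\<^sub>0 'k) set set" where
  "pip b = H.cls (xm b) (em 1)"
definition pim :: "'r \<Rightarrow> (('r^3^3) \<times> ('r^3^3) \<Rightarrow>\<^sub>0 'k) set set" where
  "pim b = H.cls (theta (xm b)) (theta (em 1))"

lemma em_one_Lie [simp]: "em 1 \<in> Lie" by (rule em_Lie) simp

lemma H_closed: "tau b c \<in> carr H.Qm" "pip b \<in> carr H.Qm" "pim b \<in> carr H.Qm"
  by (simp_all add: tau_def pip_def pim_def)

lemma tau_linear:
  fixes sw :: "'k \<Rightarrow> 'w::ab_group_add \<Rightarrow> 'w"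
  assumes W: "module sw" and h: "mlinear H.Qm (kmod_of sw UNIV) h"
  shows "h (tau b c) = h (H.cls (xm b) (ym c)) - h (H.cls (xm (par (mat.br (xm b) (ym c) $ 2 $ 2))) (ym 1))"
proof -
  interpret W: module sw by fact
  show ?thesis by (simp add: tau_def mlinearD[OF h] W.scale_minus_left)
qed

text \<open>With vanishing invariants the induced cocycle is a function of the bracket, so it
  vanishes where the bracket map does. \<open>H2_iso\<close> uses this for differences of composite
  maps.\<close>

lemma H2_vanish:
  fixes sw :: "'k \<Rightarrow> 'w::ab_group_add \<Rightarrow> 'w"
  assumes W: "module sw" and h: "mlinear H.Qm (kmod_of sw UNIV) h"
    and z: "\<And>b c. h (tau b c) = 0" "\<And>b. h (pip b) = 0" "\<And>b. h (pim b) = 0"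
    and x: "x \<in> carr H.Qm" "H2m x = 0"
  shows "h x = 0"
proof -
  interpret c: cocycle scale G bar sw "\<lambda>X Y. h (H.cls X Y)" by (rule H2_cocycle[OF W h])
  have 1: "c.Tc b c = 0" for b c using z(1)[of b c] by (simp add: tau_linear[OF W h] c.Tc_def c.nrm_def)
  have 2: "c.rplus b = 0" "c.rminus b = 0" for b
    using z(2,3)[of b] by (simp_all add: c.rplus_def c.rminus_def pip_def pim_def)
  obtain g where g: "\<And>X Y. X \<in> Lie \<Longrightarrow> Y \<in> Lie \<Longrightarrow> h (H.cls X Y) = g (mat.br X Y)"
    "\<And>X Y. X \<in> Lie \<Longrightarrow> Y \<in> Lie \<Longrightarrow> g (X + Y) = g X + g Y"
    by (rule c.coboundary_if_invariants_vanish[OF 1 2]) blast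
  have "h x = g (H2m x)" using x(1)
  proof (induction rule: H.Q_induct)
    case (cls X Y) then show ?case by (simp add: g H2_map(2))
  next
    case (add p q)
    note m = mlinearD[OF H2_map(1)]
    have "H2m p \<in> Lie" "H2m q \<in> Lie" using m(1)[OF add(1)] m(1)[OF add(2)] by simp_all
    then show ?case using m(2)[OF add(1,2)] mlinearD(2)[OF h add(1,2)] add(3,4) by (simp add: g(2))
  qed
  moreover have "g 0 = 0" using g(2)[of 0 0] by simp
  ultimately show ?thesis using x(2) by simp
qed

text \<open>That \<open>E0\<close> exists means that the classes \<open>tau b c\<close> satisfy the
  relations of the symbols. This is read off from the universal cocycle after embedding its values
  into \<open>univ\<close>, where the results on cocycles apply.\<close>

lemma E0_exists: obtains E0 where "mlinear D.Qm H.Qm E0" "\<And>b c. E0 (D.cls b c) = tau b c"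
proof -
  obtain \<iota> :: "_ \<Rightarrow> (('r^3^3) \<times> ('r^3^3), 'k) univ" where i: "mlinear H.Qm (kmod_of usm UNIV) \<iota>" "inj_on \<iota> (carr H.Qm)"
    by (rule H.embedding)
  interpret u: cocycle scale G bar usm "\<lambda>X Y. \<iota> (H.cls X Y)" by (rule H2_cocycle[OF usm.module_axioms i(1)])
  interpret n: normalized_cocycle scale G bar usm u.nrm by (rule u.nrm_normalized)
  have Tb: "n.Tb b c = \<iota> (tau b c)" for b c
    by (simp add: n.Tb_def u.nrm_def tau_linear[OF usm.module_axioms i(1)])
  have r: "hd_rules n.Tb"
    unfolding hd_rules_def
  proof ((intro conjI allI impI; (elim conjE)?), goal_cases)
    case 1 show ?case by (rule n.Tb.T_one)
  next
    case (2 i j a b) then show ?case by (simp add: n.Tb.T_anti[OF 2])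
  next
    case (3 i j a b) show ?case by (simp add: n.Tb.T_bar)
  next
    case (4 i j k a b c) show ?case using n.Tb.J_skew[OF 4] by simp
  next
    case (5 i j k l a b c d) show ?case by (rule n.Tb.J_br[OF 5])
  next
    case (6 i1 i2 j1 j2 k1 k2 a1 a2 b1 b2 c1 c2) show ?case by (rule n.Tb.J_comm[OF 6])
  qed
  obtain g where g: "mlinear D.Qm (kmod_of usm UNIV) g" "\<And>a b. g (D.cls a b) = n.Tb a b"
  proof (rule D_lift[OF usm.module_axioms n.Tb.T_add_left n.Tb.T_add_right _ _ r])
    show "n.Tb (scale k a) b = usm k (n.Tb a b)" for k a b
      using n.scale_left[OF xm_Lie ym_Lie, where r=k] by (simp add: n.Tb_def omat_scale)
    show "n.Tb a (scale k b) = usm k (n.Tb a b)" for k a b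
      using n.scale_right[OF xm_Lie ym_Lie, where r=k] by (simp add: n.Tb_def omat_scale)
  qed blast
  obtain E0 where E0: "mlinear D.Qm H.Qm E0" "\<And>x. x \<in> carr D.Qm \<Longrightarrow> \<iota> (E0 x) = g x"
    by (rule D.factor[OF H.Q.kmodule_axioms i g(1)]) (use g(2) Tb H_closed(1) in auto)
  have "E0 (D.cls b c) = tau b c" for b c
  proof (rule inj_onD[OF i(2)])
    have "D.cls b c \<in> carr D.Qm" by (rule D.cls_closed) simp_all
    then show "E0 (D.cls b c) \<in> carr H.Qm" "\<iota> (E0 (D.cls b c)) = \<iota> (tau b c)"
      using mlinearD(1)[OF E0(1)] E0(2) g(2) Tb by simp_all
  qed (rule H_closed)
  then show ?thesis using that E0(1) by blast
qed

lemma E_exists: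
  fixes p :: "'r \<Rightarrow> _"
  assumes c: "\<And>b. p b \<in> carr H.Qm"
    and I: "\<And>\<iota> :: _ \<Rightarrow> (('r^3^3) \<times> ('r^3^3), 'k) univ. mlinear H.Qm (kmod_of usm UNIV) \<iota> \<Longrightarrow> I3_linear scale G bar (\<lambda>b. \<iota> (p b)) usm"
  obtains E where "mlinear Iq H.Qm E" "\<And>b. E (Icls b) = p b"
proof -
  obtain \<iota> :: "_ \<Rightarrow> (('r^3^3) \<times> ('r^3^3), 'k) univ" where i: "mlinear H.Qm (kmod_of usm UNIV) \<iota>" "inj_on \<iota> (carr H.Qm)"
    by (rule H.embedding)
  obtain g where g: "mlinear Iq (kmod_of usm UNIV) g" "\<And>a. g (Icls a) = \<iota> (p a)"
    by (rule I_lift[OF I[OF i(1)]]) blast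
  obtain E where E: "mlinear Iq H.Qm E" "\<And>x. x \<in> carr Iq \<Longrightarrow> \<iota> (E x) = g x"
    by (rule mlinear_factor[OF H.Q.kmodule_axioms i g(1) kmodule_Iq]) (use g(2) c in \<open>auto simp: carr_Iq\<close>)
  have "E (Icls b) = p b" for b
  proof (rule inj_onD[OF i(2)])
    have "Icls b \<in> carr Iq" by (simp add: carr_Iq)
    then show "E (Icls b) \<in> carr H.Qm" "\<iota> (E (Icls b)) = \<iota> (p b)"
      using mlinearD(1)[OF E(1)] E(2) g(2) by simp_all
  qed (rule c)
  then show ?thesis using that E(1) by blast
qed

lemma I3_linear_cocycle:
  fixes sw :: "'k \<Rightarrow> 'w::ab_group_add \<Rightarrow> 'w"
  assumes "module sw" "I3_map scale G bar r" "\<And>c a. r (scale c a) = sw c (r a)"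
  shows "I3_linear scale G bar r sw"
  using assms by (simp add: I3_linear_def I3_linear_axioms_def osp_setting_axioms)

lemma Ep_exists: obtains E where "mlinear Iq H.Qm E" "\<And>b. E (Icls b) = pip b"
proof (rule E_exists[of pip])
  fix \<iota> :: "_ \<Rightarrow> (('r^3^3) \<times> ('r^3^3), 'k) univ" assume i: "mlinear H.Qm (kmod_of usm UNIV) \<iota>"
  interpret u: cocycle scale G bar usm "\<lambda>X Y. \<iota> (H.cls X Y)" by (rule H2_cocycle[OF usm.module_axioms i])
  have "I3_linear scale G bar u.rplus usm"
    by (rule I3_linear_cocycle[OF usm.module_axioms u.I3_rplus])
      (use u.scale_left[OF xm_Lie em_one_Lie] in \<open>simp add: u.rplus_def omat_scale\<close>)
  then show "I3_linear scale G bar (\<lambda>b. \<iota> (pip b)) usm" by (simp add: pip_def u.rplus_def[abs_def])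
qed (use H_closed that in auto)

lemma Em_exists: obtains E where "mlinear Iq H.Qm E" "\<And>b. E (Icls b) = pim b"
proof (rule E_exists[of pim])
  fix \<iota> :: "_ \<Rightarrow> (('r^3^3) \<times> ('r^3^3), 'k) univ" assume i: "mlinear H.Qm (kmod_of usm UNIV) \<iota>"
  interpret u: cocycle scale G bar usm "\<lambda>X Y. \<iota> (H.cls X Y)" by (rule H2_cocycle[OF usm.module_axioms i])
  have "I3_linear scale G bar u.rminus usm"
  proof (rule I3_linear_cocycle[OF usm.module_axioms u.I3_rminus])
    show "u.rminus (scale c a) = usm c (u.rminus a)" for c a
      using u.scale_left[OF theta_Lie[OF xm_Lie] theta_Lie[OF em_one_Lie], where r=c]
      by (simp add: u.rminus_def theta_scale[symmetric] omat_scale)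
  qed
  then show "I3_linear scale G bar (\<lambda>b. \<iota> (pim b)) usm" by (simp add: pim_def u.rminus_def[abs_def])
qed (use H_closed that in auto)

text \<open>The cocycle \<open>Phi\<close> for the universal symbol, embedded into
  \<open>univ\<close>; \<open>Phi_mem\<close> brings its values back.\<close>

lemma D0_exists:
  obtains D0 where "mlinear H.Qm D.Qm D0" "\<And>b c. D0 (tau b c) = D.cls b c"
    "\<And>b. D0 (pip b) = mzero D.Qm" "\<And>b. D0 (pim b) = mzero D.Qm"
proof -
  obtain \<iota> :: "_ \<Rightarrow> ('r \<times> 'r, 'k) univ" where i: "mlinear D.Qm (kmod_of usm UNIV) \<iota>" "inj_on \<iota> (carr D.Qm)"
    by (rule D.embedding)
  interpret t: hd_linear scale G bar "\<lambda>a b. \<iota> (D.cls a b)" usm by (rule D_hd_linear[OF usm.module_axioms i(1)])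
  have cl: "D.cls a b \<in> carr D.Qm" for a b by (rule D.cls_closed) simp_all
  have z: "\<iota> (mzero D.Qm) = 0"
    using mlinear_zero[OF D.Q.kmodule_axioms usm.kmodule_kmod_of[OF usm.subspace_UNIV] i(1)] by simp
  obtain g where g: "mlinear H.Qm (kmod_of usm UNIV) g" "\<And>X Y. X \<in> Lie \<Longrightarrow> Y \<in> Lie \<Longrightarrow> g (H.cls X Y) = t.Phi X Y"
    by (rule H2_lift[OF t.Phi.cocycle_axioms]) blast
  have inv: "g (tau b c) = \<iota> (D.cls b c)" "g (pip b) = 0" "g (pim b) = 0" for b c
    using t.Phi_invariants
    by (simp_all add: tau_linear[OF usm.module_axioms g(1)] g(2) t.Phi.Tc_def t.Phi.nrm_def t.Phi.rplus_def t.Phi.rminus_def pip_def pim_def)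
  have mem: "t.Phi X Y \<in> \<iota> ` carr D.Qm" for X Y
    by (rule t.Phi_mem[OF image_subspace[OF usm.module_axioms D.Q.kmodule_axioms i(1)]]) (rule imageI[OF cl])
  obtain D0 where D0: "mlinear H.Qm D.Qm D0" "\<And>x. x \<in> carr H.Qm \<Longrightarrow> \<iota> (D0 x) = g x"
    by (rule H.factor[OF D.Q.kmodule_axioms i g(1)]) (use g(2) mem in auto)
  have "D0 x = y" if "x \<in> carr H.Qm" "y \<in> carr D.Qm" "g x = \<iota> y" for x y
    by (rule inj_onD[OF i(2)]) (use that mlinearD(1)[OF D0(1)] D0(2) in auto)
  then show ?thesis using that[OF D0(1)] H_closed inv cl z D.Q.zero_closed by metis
qed

lemma Dpm_exists:
  obtains Dp Dm where "mlinear H.Qm Iq Dp" "\<And>b c. Dp (tau b c) = mzero Iq" "\<And>b. Dp (pip b) = Icls b" "\<And>b. Dp (pim b) = mzero Iq"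
    "mlinear H.Qm Iq Dm" "\<And>b c. Dm (tau b c) = mzero Iq" "\<And>b. Dm (pip b) = mzero Iq" "\<And>b. Dm (pim b) = Icls b"
proof -
  obtain \<iota> :: "_ \<Rightarrow> ('r, 'k) univ" where i: "mlinear Iq (kmod_of usm UNIV) \<iota>" "inj_on \<iota> (carr Iq)"
    by (rule I_embedding)
  interpret r: I3_linear scale G bar "\<lambda>a. \<iota> (Icls a)" usm by (rule I_linear[OF usm.module_axioms i(1)])
  interpret Iq: kmodule Iq by (rule kmodule_Iq)
  have cl: "Icls a \<in> carr Iq" for a by (simp add: carr_Iq)
  have z: "\<iota> (mzero Iq) = 0"
    using mlinear_zero[OF kmodule_Iq usm.kmodule_kmod_of[OF usm.subspace_UNIV] i(1)] by simp
  obtain g where g: "mlinear H.Qm (kmod_of usm UNIV) g" "\<And>X Y. X \<in> Lie \<Longrightarrow> Y \<in> Lie \<Longrightarrow> g (H.cls X Y) = r.Phi X Y"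
    by (rule H2_lift[OF r.Phi.cocycle_axioms]) blast
  obtain g' where g': "mlinear H.Qm (kmod_of usm UNIV) g'" "\<And>X Y. X \<in> Lie \<Longrightarrow> Y \<in> Lie \<Longrightarrow> g' (H.cls X Y) = r.Phim X Y"
    by (rule H2_lift[OF r.Phim.cocycle_axioms]) blast
  have inv: "g (tau b c) = 0" "g (pip b) = \<iota> (Icls b)" "g (pim b) = 0" for b c
    using r.Phi_invariants
    by (simp_all add: tau_linear[OF usm.module_axioms g(1)] g(2) r.Phi.Tc_def r.Phi.nrm_def r.Phi.rplus_def r.Phi.rminus_def pip_def pim_def)
  have inv': "g' (tau b c) = 0" "g' (pip b) = 0" "g' (pim b) = \<iota> (Icls b)" for b c
    using r.Phim_invariants
    by (simp_all add: tau_linear[OF usm.module_axioms g'(1)] g'(2) r.Phim.Tc_def r.Phim.nrm_def r.Phim.rplus_def r.Phim.rminus_def pip_def pim_def)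
  have mem: "r.Phi X Y \<in> \<iota> ` carr Iq" for X Y
    unfolding r.Phi_def r.r.diff[symmetric] by (rule imageI[OF cl])
  have mem': "r.Phim X Y \<in> \<iota> ` carr Iq" for X Y
    unfolding r.Phim_def by (rule mem)
  obtain Dp where D: "mlinear H.Qm Iq Dp" "\<And>x. x \<in> carr H.Qm \<Longrightarrow> \<iota> (Dp x) = g x"
    by (rule H.factor[OF kmodule_Iq i g(1)]) (use g(2) mem in auto)
  obtain Dm where D': "mlinear H.Qm Iq Dm" "\<And>x. x \<in> carr H.Qm \<Longrightarrow> \<iota> (Dm x) = g' x"
    by (rule H.factor[OF kmodule_Iq i g'(1)]) (use g'(2) mem' in auto)
  have e: "Dp x = y" if "x \<in> carr H.Qm" "y \<in> carr Iq" "g x = \<iota> y" for x y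
    by (rule inj_onD[OF i(2)]) (use that mlinearD(1)[OF D(1)] D(2) in auto)
  have e': "Dm x = y" if "x \<in> carr H.Qm" "y \<in> carr Iq" "g' x = \<iota> y" for x y
    by (rule inj_onD[OF i(2)]) (use that mlinearD(1)[OF D'(1)] D'(2) in auto)
  show ?thesis
    by (rule that[OF D(1) e e e D'(1) e' e' e']) (simp_all add: H_closed cl inv inv' z)
qed

end

section \<open>The kernel of the bracket and the isomorphism\<close>

context osp_setting
begin

text \<open>In an associative superalgebra the signed cyclic sum of the commutators of ab and c is
  0, so J vanishes for the commutator pairing. Hence \<open>sk (br a b)\<close> is a function of the
  symbol.\<close>

lemma skbr_Jt: assumes "a \<in> G i" "b \<in> G j" "c \<in> G k" shows "Jt (\<lambda>a b. sk (br a b)) i j k a b c = 0"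
proof -
  have "sg (i * k) (br (a * b) c) + sg (j * i) (br (b * c) a) + sg (k * j) (br (c * a) b) = 0"
    unfolding br_hom[OF G_mult[OF assms(1,2)] assms(3)] br_hom[OF G_mult[OF assms(2,3)] assms(1)] br_hom[OF G_mult[OF assms(3,1)] assms(2)]
    by (cases i; cases j; cases k; simp add: mult.assoc algebra_simps)
  then have "sk (sg (i * k) (br (a * b) c) + sg (j * i) (br (b * c) a) + sg (k * j) (br (c * a) b)) = 0"
    by (simp add: sk_def bar_zero)
  then show ?thesis by (simp add: Jt_def sk_add sk_sg)
qed

lemma hd_rules_skbr: "hd_rules (\<lambda>a b. sk (br a b))"
  unfolding hd_rules_def
proof ((intro conjI allI impI; (elim conjE)?), goal_cases)
  case (1 i a) show ?case by (simp add: sk_def)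
next
  case (2 i j a b)
  show ?case using br_anti[OF 2(2,1)] by (simp add: sk_sg sk_minus mult.commute)
next
  case (3 i j a b)
  have "br (bar a) (bar b) = - bar (br a b)" using bar_br[OF 3] by simp
  then show ?case by (simp add: sk_def bar_minus)
next
  case (4 i j k a b c)
  show ?case using skbr_Jt[OF 4(2,1,3)] skbr_Jt[OF 4(1,2) sk_G[OF 4(3)]] by simp
next
  case (5 i j k l a b c d)
  show ?case using skbr_Jt[OF 5(1,2) br_G[OF 5(3,4)]] skbr_Jt[OF 5(3,4) br_G[OF 5(1,2)]] by simp
next
  case (6 i1 i2 j1 j2 k1 k2 a1 a2 b1 b2 c1 c2)
  show ?case by (rule skbr_Jt[OF br_G[OF 6(1,2)] br_G[OF 6(3,4)] br_G[OF 6(5,6)]])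
qed

lemma delta_exists: obtains \<delta> where "mlinear D.Qm Rk \<delta>" "\<And>a b. \<delta> (D.cls a b) = sk (br a b)"
  by (rule D_lift[OF module_axioms, of "\<lambda>a b. sk (br a b)", folded R_kmod_def])
    (simp_all add: br_add_left br_add_right br_scale_left br_scale_right sk_add sk_scale hd_rules_skbr)

lemma H2m_add: "x \<in> carr H.Qm \<Longrightarrow> y \<in> carr H.Qm \<Longrightarrow> H2m (madd H.Qm x y) = H2m x + H2m y"
  and H2m_scale: "x \<in> carr H.Qm \<Longrightarrow> H2m (msmult H.Qm c x) = mat_scale scale c (H2m x)"
  using mlinearD[OF H2_map(1)] by simp_all

text \<open>The normalising term in \<open>tau\<close> removes the (2,2) entry, as in
  \<open>hm_skbr\<close>. On sums of classes \<open>tau b c\<close> the bracket thus vanishes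
  exactly when the sum of the \<open>sk (br b c)\<close> does, which is the condition that defines
  \<open>HD\<close>.\<close>

lemma H2m_tau: "H2m (tau b c) = hm (sk (br b c)) 0"
proof -
  define f where "f b c = mat.br (xm b) (ym c) - mat.br (xm (par (mat.br (xm b) (ym c) $ 2 $ 2))) (ym 1)" for b c
  have "H2m (tau b c) = f b c"
    by (simp add: tau_def H2m_add H2m_scale H2_map(2) f_def mat.scale_minus_left)
  also have "f b c = hm (sk (br b c)) 0"
  proof (induction b rule: homogeneous_induct)
    case b: (1 i b)
    show ?case
    proof (induction c rule: homogeneous_induct)
      case (1 j c)
      have "par (mat.br (xm b) (ym c) $ 2 $ 2) = sg (i * j) (c * b)"
        using par_hom[OF G_mult[OF 1 b]] br_xy[OF b 1] by (cases i; cases j; simp add: par_minus)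
      then show ?case using hm_skbr[OF b 1] by (simp add: f_def)
    next
      case (2 c c')
      have "f b (c + c') = f b c + f b c'"
        using omat_add[of 0 c 0 0 0 0 0 c' 0 0 0 0] omat_add[of "par (mat.br (xm b) (ym c) $ 2 $ 2)" 0 0 0 0 0 "par (mat.br (xm b) (ym c') $ 2 $ 2)" 0 0 0 0 0]
        by (simp add: f_def mat.br_add_left mat.br_add_right par_add flip: omat_add[of 0 c 0 0 0 0 0 c' 0 0 0 0, simplified] omat_add[of "par (mat.br (xm b) (ym c) $ 2 $ 2)" 0 0 0 0 0 "par (mat.br (xm b) (ym c') $ 2 $ 2)" 0 0 0 0 0, simplified])
      then show ?case using 2 by (simp add: br_add_right sk_add omat_add)
    qed
  next
    case (2 b b')
    have "f (b + b') c = f b c + f b' c"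
      by (simp add: f_def mat.br_add_left mat.br_add_right par_add flip: omat_add[of b 0 0 0 0 0 b' 0 0 0 0 0, simplified] omat_add[of "par (mat.br (xm b) (ym c) $ 2 $ 2)" 0 0 0 0 0 "par (mat.br (xm b') (ym c) $ 2 $ 2)" 0 0 0 0 0, simplified])
    then show ?case using 2 by (simp add: br_add_left sk_add omat_add)
  qed
  finally show ?thesis .
qed

lemma br_xe: "mat.br (xm b) (em 1) = 0"
proof (induction b rule: homogeneous_induct)
  case (1 i b)
  show ?case using mat.br_anti[OF em_G[OF one_G] xm_G[OF 1]] br_ex[OF one_G bar_one 1] by simp
next
  case (2 b b')
  then show ?case using mat.br_add_left[of "xm b" "xm b'" "em 1"] by (simp add: omat_add)
qed

lemma H2m_pi: "H2m (pip b) = 0" "H2m (pim b) = 0"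
proof -
  have "mat.br (theta (xm b)) (theta (em 1)) = 0"
    using theta_br[of "xm b" "em 1"] br_xe[of b] theta_omat[of 0 0 0 0 0 0] by simp
  then show "H2m (pip b) = 0" "H2m (pim b) = 0" by (simp_all add: pip_def pim_def H2_map(2) br_xe)
qed

text \<open>The condition on a finite sum of symbols says that \<delta> vanishes on its class, and
  so depends on the class only.\<close>

lemma HD_carr:
  assumes \<delta>: "mlinear D.Qm Rk \<delta>" "\<And>a b. \<delta> (D.cls a b) = sk (br a b)"
  shows "carr (HD scale G bar) = {q \<in> carr D.Qm. \<delta> q = 0}"
proof -
  define F where "F ps = foldr (madd D.Qm) (map (\<lambda>(a, b). D.cls a b) ps) (mzero D.Qm)" for ps
  note d = mlinearD[OF \<delta>(1)]
  have cl: "D.cls a b \<in> carr D.Qm" for a b by (rule D.cls_closed) simp_all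
  have F: "F ps \<in> carr D.Qm \<and> \<delta> (F ps) = (\<Sum>(a, b)\<leftarrow>ps. br a b) - (\<Sum>(a, b)\<leftarrow>ps. bar (br a b))" for ps
  proof (induction ps)
    case Nil
    have "\<delta> (mzero D.Qm) = 0" using mlinear_zero[OF D.Q.kmodule_axioms kmodule_R \<delta>(1)] by simp
    then show ?case by (simp add: F_def)
  next
    case (Cons p ps)
    obtain a b where p: "p = (a, b)" by (cases p)
    have "F (p # ps) = madd D.Qm (D.cls a b) (F ps)" by (simp add: F_def p)
    then show ?case using Cons d(2)[OF cl[of a b], of "F ps"] cl[of a b] by (simp add: p \<delta>(2) sk_def)
  qed
  have app: "F (ps @ qs) = madd D.Qm (F ps) (F qs)" for ps qs
  proof (induction ps)
    case Nil then show ?case using F[of qs] by (simp add: F_def[of "[]"])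
  next
    case (Cons p ps)
    obtain a b where p: "p = (a, b)" by (cases p)
    have "F (p # rs) = madd D.Qm (D.cls a b) (F rs)" for rs by (simp add: F_def p)
    then show ?case using Cons F[of ps] F[of qs] cl[of a b] by (simp add: D.Q.add_assoc)
  qed
  have ex: "\<exists>ps. q = F ps" if "q \<in> carr D.Qm" for q
    using that
  proof (induction rule: D.Q_induct)
    case (cls a b)
    have "D.cls a b = F [(a, b)]" using cl[of a b] by (simp add: F_def)
    then show ?case by blast
  next
    case (add p q)
    then obtain ps qs where "p = F ps" "q = F qs" by blast
    then have "madd D.Qm p q = F (ps @ qs)" by (simp add: app)
    then show ?case by blast
  qed
  have HD: "carr (HD scale G bar) = {F ps | ps. (\<Sum>(a, b)\<leftarrow>ps. br a b) = (\<Sum>(a, b)\<leftarrow>ps. bar (br a b))}"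
    by (simp add: HD_def HD_quot_eq HD_class_eq rcom_eq F_def)
  show ?thesis
  proof (intro subset_antisym subsetI)
    fix q assume "q \<in> carr (HD scale G bar)"
    then obtain ps where "q = F ps" "(\<Sum>(a, b)\<leftarrow>ps. br a b) = (\<Sum>(a, b)\<leftarrow>ps. bar (br a b))"
      unfolding HD by blast
    then show "q \<in> {q \<in> carr D.Qm. \<delta> q = 0}" using F[of ps] by simp
  next
    fix q assume q: "q \<in> {q \<in> carr D.Qm. \<delta> q = 0}"
    then obtain ps where ps: "q = F ps" using ex by blast
    then have "(\<Sum>(a, b)\<leftarrow>ps. br a b) = (\<Sum>(a, b)\<leftarrow>ps. bar (br a b))" using q F[of ps] by simp
    then show "q \<in> carr (HD scale G bar)" unfolding HD ps by blast
  qed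
qed

lemma H2_iso: "miso (osp_H2 scale G bar)
    (direct_sum (HD scale G bar) (direct_sum (R_quot_I3 scale G bar) (R_quot_I3 scale G bar)))"
proof -
  obtain E0 where E0: "mlinear D.Qm H.Qm E0" "\<And>b c. E0 (D.cls b c) = tau b c" by (rule E0_exists) blast
  obtain Ep where Ep: "mlinear Iq H.Qm Ep" "\<And>b. Ep (Icls b) = pip b" by (rule Ep_exists) blast
  obtain Em where Em: "mlinear Iq H.Qm Em" "\<And>b. Em (Icls b) = pim b" by (rule Em_exists) blast
  obtain D0 where D0: "mlinear H.Qm D.Qm D0" "\<And>b c. D0 (tau b c) = D.cls b c"
    "\<And>b. D0 (pip b) = mzero D.Qm" "\<And>b. D0 (pim b) = mzero D.Qm" by (rule D0_exists) blast
  obtain Dp Dm where Dp: "mlinear H.Qm Iq Dp" "\<And>b c. Dp (tau b c) = mzero Iq" "\<And>b. Dp (pip b) = Icls b" "\<And>b. Dp (pim b) = mzero Iq"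
    and Dm: "mlinear H.Qm Iq Dm" "\<And>b c. Dm (tau b c) = mzero Iq" "\<And>b. Dm (pip b) = mzero Iq" "\<And>b. Dm (pim b) = Icls b"
    by (rule Dpm_exists) blast
  obtain \<delta> where \<delta>: "mlinear D.Qm Rk \<delta>" "\<And>a b. \<delta> (D.cls a b) = sk (br a b)" by (rule delta_exists) blast
  interpret Iq: kmodule Iq by (rule kmodule_Iq)
  note e0 = mlinearD[OF E0(1)] and ep = mlinearD[OF Ep(1)] and em = mlinearD[OF Em(1)]
    and d0 = mlinearD[OF D0(1)] and dp = mlinearD[OF Dp(1)] and dm = mlinearD[OF Dm(1)] and dl = mlinearD[OF \<delta>(1)]
  note E0z = mlinear_zero[OF D.Q.kmodule_axioms H.Q.kmodule_axioms E0(1)]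
    and Epz = mlinear_zero[OF kmodule_Iq H.Q.kmodule_axioms Ep(1)]
    and Emz = mlinear_zero[OF kmodule_Iq H.Q.kmodule_axioms Em(1)]
    and dlz = mlinear_zero[OF D.Q.kmodule_axioms kmodule_R \<delta>(1), unfolded R_kmod_simps]
  have Icl: "Icls b \<in> carr Iq" for b by (simp add: carr_Iq)

  have D0E0: "D0 (E0 q) = q \<and> Dp (E0 q) = mzero Iq \<and> Dm (E0 q) = mzero Iq \<and> H2m (E0 q) = hm (\<delta> q) 0" if "q \<in> carr D.Qm" for q
    using that
  proof (induction rule: D.Q_induct)
    case (cls b c) then show ?case by (simp add: E0(2) D0(2) Dp(2) Dm(2) H2m_tau \<delta>(2))
  next
    case (add p q)
    then show ?case
      by (simp add: e0 d0 dp dm dl H2m_add omat_add)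
  qed
  have DEp: "D0 (Ep s) = mzero D.Qm" "Dp (Ep s) = s" "Dm (Ep s) = mzero Iq" "H2m (Ep s) = 0" if "s \<in> carr Iq" for s
    using that by (auto simp: carr_Iq Ep(2) D0 Dp Dm H2m_pi)
  have DEm: "D0 (Em s) = mzero D.Qm" "Dp (Em s) = mzero Iq" "Dm (Em s) = s" "H2m (Em s) = 0" if "s \<in> carr Iq" for s
    using that by (auto simp: carr_Iq Em(2) D0 Dp Dm H2m_pi)

  have \<delta>D0: "\<delta> (D0 x) = 0" if x: "x \<in> carr H.Qm" "H2m x = 0" for x
  proof -
    \<comment> \<open>\<open>s\<close> measures the deviation of \<open>a\<close> from
      \<open>sk (par d)\<close>. It is linear and sends the bracket of \<open>tau b c\<close> to
      \<open>sk (br b c)\<close>, the value of \<delta> on the symbol, so that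
      \<open>\<delta> (D0 x)\<close> and \<open>s (H2m x)\<close> have the same invariants.\<close>
    define s where "s Z = Z $ 1 $ 1 - sk (par (Z $ 2 $ 2))" for Z :: "'r^3^3"
    have "\<delta> (D0 x) - s (H2m x) = 0"
    proof (rule H2_vanish[where sw=scale and h="\<lambda>x. \<delta> (D0 x) - s (H2m x)", OF module_axioms _ _ _ _ x])
      show "mlinear H.Qm (kmod_of scale UNIV) (\<lambda>x. \<delta> (D0 x) - s (H2m x))"
        by (auto simp: mlinear_def d0 dl H2m_add H2m_scale s_def par_add par_scale sk_add sk_scale mat_scale_def scale_right_diff_distrib)
    qed (simp_all add: D0 \<delta>(2) H2m_tau H2m_pi dlz s_def sk_def)
    then show ?thesis using x by (simp add: s_def sk_def)
  qed

  obtain \<iota> :: "_ \<Rightarrow> (('r^3^3) \<times> ('r^3^3), 'k) univ" where i: "mlinear H.Qm (kmod_of usm UNIV) \<iota>" "inj_on \<iota> (carr H.Qm)"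
    by (rule H.embedding)
  note il = mlinearD[OF i(1)]
  have iz: "\<iota> (mzero H.Qm) = 0"
    using mlinear_zero[OF H.Q.kmodule_axioms usm.kmodule_kmod_of[OF usm.subspace_UNIV] i(1)] by simp
  have split: "\<iota> x = \<iota> (E0 (D0 x)) + \<iota> (Ep (Dp x)) + \<iota> (Em (Dm x))" if x: "x \<in> carr H.Qm" "H2m x = 0" for x
  proof -
    have "\<iota> x - (\<iota> (E0 (D0 x)) + \<iota> (Ep (Dp x)) + \<iota> (Em (Dm x))) = 0"
    proof (rule H2_vanish[where sw=usm and h="\<lambda>x. \<iota> x - (\<iota> (E0 (D0 x)) + \<iota> (Ep (Dp x)) + \<iota> (Em (Dm x)))", OF usm.module_axioms _ _ _ _ x])
      show "mlinear H.Qm (kmod_of usm UNIV) (\<lambda>x. \<iota> x - (\<iota> (E0 (D0 x)) + \<iota> (Ep (Dp x)) + \<iota> (Em (Dm x))))"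
        by (auto simp: mlinear_def il e0 ep em d0 dp dm usm.scale_right_diff_distrib usm.scale_right_distrib)
    qed (simp_all add: E0 Ep Em D0 Dp Dm E0z Epz Emz iz)
    then show ?thesis by simp
  qed

  let ?K = "{x \<in> carr H.Qm. H2m x = 0}"
  have K: "osp_H2 scale G bar = H.Qm\<lparr>carr := ?K\<rparr>"
    by (simp add: osp_H2_def H2_def mker_def mat_com_def H2_quot_eq)
  note HDc = HD_carr[OF \<delta>]
  have HDo: "madd (HD scale G bar) = madd D.Qm" "msmult (HD scale G bar) = msmult D.Qm"
    by (simp_all add: HD_def HD_quot_eq)
  define f where "f x = (D0 x, Dp x, Dm x)" for x
  have "mlinear (osp_H2 scale G bar) (direct_sum (HD scale G bar) (direct_sum Iq Iq)) f"
    unfolding mlinear_def K by (auto simp: f_def direct_sum_def HDo HDc d0 dp dm \<delta>D0)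
  moreover have "bij_betw f (carr (osp_H2 scale G bar)) (carr (direct_sum (HD scale G bar) (direct_sum Iq Iq)))"
  proof (rule bij_betw_imageI)
    show "inj_on f (carr (osp_H2 scale G bar))"
    proof (rule inj_onI)
      fix x y assume xy: "x \<in> carr (osp_H2 scale G bar)" "y \<in> carr (osp_H2 scale G bar)" "f x = f y"
      then have m: "x \<in> carr H.Qm" "H2m x = 0" "y \<in> carr H.Qm" "H2m y = 0" by (simp_all add: K)
      have "\<iota> x = \<iota> y" using split[OF m(1,2)] split[OF m(3,4)] xy(3) by (simp add: f_def)
      then show "x = y" using inj_onD[OF i(2)] m by blast
    qed
    show "f ` carr (osp_H2 scale G bar) = carr (direct_sum (HD scale G bar) (direct_sum Iq Iq))"
    proof (intro subset_antisym subsetI)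
      fix z assume "z \<in> f ` carr (osp_H2 scale G bar)"
      then show "z \<in> carr (direct_sum (HD scale G bar) (direct_sum Iq Iq))"
        by (auto simp: K f_def direct_sum_def HDc d0 dp dm \<delta>D0)
    next
      fix z assume "z \<in> carr (direct_sum (HD scale G bar) (direct_sum Iq Iq))"
      then obtain q s t where z: "z = (q, s, t)" "q \<in> carr D.Qm" "\<delta> q = 0" "s \<in> carr Iq" "t \<in> carr Iq"
        by (auto simp: direct_sum_def HDc)
      let ?x = "madd H.Qm (madd H.Qm (E0 q) (Ep s)) (Em t)"
      have c: "E0 q \<in> carr H.Qm" "Ep s \<in> carr H.Qm" "Em t \<in> carr H.Qm" using z e0 ep em by simp_all
      have "?x \<in> ?K" using c z D0E0[OF z(2)] DEp[OF z(4)] DEm[OF z(5)] by (simp add: H2m_add)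
      moreover have "f ?x = z"
        using c z D0E0[OF z(2)] DEp[OF z(4)] DEm[OF z(5)] by (simp add: f_def d0 dp dm)
      ultimately show "z \<in> f ` carr (osp_H2 scale G bar)" unfolding K by (intro image_eqI[of _ _ ?x]) simp_all
    qed
  qed
  ultimately show ?thesis unfolding miso_def by blast
qed

end

theorem corollary7p13:
  fixes scale :: "'k::comm_ring_1 \<Rightarrow> 'r::{ring, monoid_mult} \<Rightarrow> 'r"
    and G :: "bit \<Rightarrow> 'r set"
    and bar :: "'r \<Rightarrow> 'r"
  assumes "(2::'k) dvd 1"
    and "superalgebra_with_superinvolution scale G bar"
  shows "miso (osp_H2 scale G bar)
    (direct_sum (HD scale G bar) (direct_sum (R_quot_I3 scale G bar) (R_quot_I3 scale G bar)))"
proof -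
  interpret osp_setting scale G bar
    using assms by (simp add: osp_setting_def osp_setting_axioms_def)
  show ?thesis by (rule H2_iso)
qed

end
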